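(* There exists an $L_2$-continuous, stationary, real-valued stochastic process $\mathbf{Y}=\{Y_t\}_{t\in\mathbb{R}}$ such that for every $\delta>0$ the random sequence $X^{(\delta)}_n=Y_{n\delta}$, $n\in\mathbb{Z}$, is a regular 1TSP. Moreover, for every such process $\mathbf{Y}$ there exist two numbers $q\in(-1,1]$ and $\alpha>0$ such that $\mathbf{Y}$ is a Markov process whose marginal distributions have density $f_N(x|q)$ and whose transition distributions have density $f_{CN}(x|y,e^{-\alpha|s-t|},q)$, i.e. for $s>t$ the conditional distribution of $Y_s$ given $Y_t=y$ has density $x\mapsto f_{CN}(x|y,e^{-\alpha|s-t|},q)$.
   Context: **1TSP.** A 1TSP is a square integrable random sequence $\mathbf{X}=\{X_n\}_{n\in\mathbb{Z}}$ with all covariance matrices non-singular and constant first two moments, normalized so that $\mathbb{E}X_n=0$, $\mathbb{E}X_n^2=1$, such that $\rho:=\operatorname{corr}(X_0,X_1)\neq 0$ and such that, with $\mathcal{F}_{\neq n}=\sigma(X_k:k\neq n)$, there exist real constants $a,A,B,C,D$ with, for all $n\in\mathbb{Z}$, almost surely, $$\mathbb{E}(X_n|\mathcal{F}_{\neq n})=a(X_{n-1}+X_{n+1}),$$ $$\mathbb{E}(X_n^2|\mathcal{F}_{\neq n})=A(X_{n-1}^2+X_{n+1}^2)+BX_{n-1}X_{n+1}+D(X_{n-1}+X_{n+1})+C.$$ Necessarily $0<|\rho|<1$. The second parameter of the 1TSP is $$q=\frac{\rho^4+B(\rho+1/\rho)^2-1}{1+\rho^4\left(B(\rho+1/\rho)^2-1\right)}.$$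 The 1TSP is called *regular* if $0<|\rho|<1$ and $q\in(-1,1]$. **$L_2$-continuous** means mean-square continuous. **Densities.** Write $(a)_\infty=(a;q)_\infty=\prod_{i\ge 0}(1-aq^i)$, $(a,b)_\infty=(a)_\infty(b)_\infty$, and $I_A$ for the indicator function of $A$. Let $S(q)=[-2/\sqrt{1-q},2/\sqrt{1-q}]$ for $q\in(-1,1)$, $S(1)=\mathbb{R}$. For $|q|<1$, $|\rho|<1$, $y\in S(q)$ (with the convention $0^0=1$): $$f_N(x|q)=\frac{\sqrt{1-q}\,(q)_\infty}{2\pi\sqrt{4-(1-q)x^2}}\prod_{k=0}^\infty\left((1+q^k)^2-(1-q)x^2q^k\right)I_{S(q)}(x),$$ $$f_{CN}(x|y,\rho,q)=\frac{\sqrt{1-q}\,(\rho^2,q)_\infty}{2\pi\sqrt{4-(1-q)x^2}}\prod_{k=0}^\infty\frac{(1+q^k)^2-(1-q)x^2q^k}{(1-\rho^2q^{2k})^2-(1-q)\rho q^k(1+\rho^2q^{2k})xy+(1-q)\rho^2(x^2+y^2)q^{2k}}\,I_{S(q)}(x).$$ For $q=1$, $f_N(x|1)=\frac{1}{\sqrt{2\pi}}e^{-x^2/2}$ and $f_{CN}(x|y,\rho,1)=\frac{1}{\sqrt{2\pi(1-\rho^2)}}\exp\left(-\frac{(x-\rho y)^2}{2(1-\rho^2)}\right)$. *)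

theory Defs
  imports "HOL-Probability.Probability" "Jordan_Normal_Form.Matrix"
begin

definition covariance :: "'a measure \<Rightarrow> ('a \<Rightarrow> real) \<Rightarrow> ('a \<Rightarrow> real) \<Rightarrow> real" where
  "covariance M U V =
     (\<integral>\<omega>. (U \<omega> - (\<integral>\<eta>. U \<eta> \<partial>M)) * (V \<omega> - (\<integral>\<eta>. V \<eta> \<partial>M)) \<partial>M)"

definition correlation :: "'a measure \<Rightarrow> ('a \<Rightarrow> real) \<Rightarrow> ('a \<Rightarrow> real) \<Rightarrow> real" where
  "correlation M U V = covariance M U V / sqrt (covariance M U U * covariance M V V)"

definition covariance_matrix :: "'a measure \<Rightarrow> ('i \<Rightarrow> 'a \<Rightarrow> real) \<Rightarrow> 'i list \<Rightarrow> real mat" where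
  "covariance_matrix M X is =
     mat (length is) (length is) (\<lambda>(j, k). covariance M (X (is ! j)) (X (is ! k)))"

definition generated_algebra :: "'a measure \<Rightarrow> 'i set \<Rightarrow> ('i \<Rightarrow> 'a \<Rightarrow> real) \<Rightarrow> 'a measure" where
  "generated_algebra M I X =
     sigma (space M) {X i -` S \<inter> space M | i S. i \<in> I \<and> S \<in> sets borel}"

definition square_integrable :: "'a measure \<Rightarrow> ('a \<Rightarrow> real) \<Rightarrow> bool" where
  "square_integrable M U \<longleftrightarrow> U \<in> borel_measurable M \<and> integrable M (\<lambda>\<omega>. (U \<omega>)\<^sup>2)"

definition one_TSP_with ::
  "'a measure \<Rightarrow> (int \<Rightarrow> 'a \<Rightarrow> real) \<Rightarrow> real \<Rightarrow> real \<Rightarrow> real \<Rightarrow> real \<Rightarrow> real \<Rightarrow> bool" where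
  "one_TSP_with M X a A B C D \<longleftrightarrow>
     prob_space M \<and>
     (\<forall>n. square_integrable M (X n)) \<and>
     (\<forall>ns. distinct ns \<longrightarrow> invertible_mat (covariance_matrix M X ns)) \<and>
     (\<forall>n. (\<integral>\<omega>. X n \<omega> \<partial>M) = 0) \<and>
     (\<forall>n. (\<integral>\<omega>. (X n \<omega>)\<^sup>2 \<partial>M) = 1) \<and>
     correlation M (X 0) (X 1) \<noteq> 0 \<and>
     (\<forall>n. AE \<omega> in M. real_cond_exp M (generated_algebra M (- {n}) X) (X n) \<omega>
            = a * (X (n - 1) \<omega> + X (n + 1) \<omega>)) \<and>
     (\<forall>n. AE \<omega> in M. real_cond_exp M (generated_algebra M (- {n}) X) (\<lambda>\<eta>. (X n \<eta>)\<^sup>2) \<omega>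
            = A * ((X (n - 1) \<omega>)\<^sup>2 + (X (n + 1) \<omega>)\<^sup>2) + B * X (n - 1) \<omega> * X (n + 1) \<omega>
              + D * (X (n - 1) \<omega> + X (n + 1) \<omega>) + C)"

definition second_parameter_denom :: "real \<Rightarrow> real \<Rightarrow> real" where
  "second_parameter_denom \<rho> B = 1 + \<rho> ^ 4 * (B * (\<rho> + 1 / \<rho>)\<^sup>2 - 1)"

definition second_parameter :: "real \<Rightarrow> real \<Rightarrow> real" where
  "second_parameter \<rho> B =
     (\<rho> ^ 4 + B * (\<rho> + 1 / \<rho>)\<^sup>2 - 1) / second_parameter_denom \<rho> B"

text \<open>The condition on the denominator says that the second parameter is defined; without it,
  division by zero would yield the value 0, which lies in the admissible range.\<close>

definition regular_one_TSP :: "'a measure \<Rightarrow> (int \<Rightarrow> 'a \<Rightarrow> real) \<Rightarrow> bool" where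
  "regular_one_TSP M X \<longleftrightarrow>
     (\<exists>a A B C D. one_TSP_with M X a A B C D \<and>
        (let \<rho> = correlation M (X 0) (X 1) in
           0 < \<bar>\<rho>\<bar> \<and> \<bar>\<rho>\<bar> < 1 \<and>
           second_parameter_denom \<rho> B \<noteq> 0 \<and>
           second_parameter \<rho> B \<in> {-1<..1}))"

definition stochastic_process :: "'a measure \<Rightarrow> (real \<Rightarrow> 'a \<Rightarrow> real) \<Rightarrow> bool" where
  "stochastic_process M Y \<longleftrightarrow> prob_space M \<and> (\<forall>t. Y t \<in> borel_measurable M)"

definition L2_continuous :: "'a measure \<Rightarrow> (real \<Rightarrow> 'a \<Rightarrow> real) \<Rightarrow> bool" where
  "L2_continuous M Y \<longleftrightarrow>
     (\<forall>t. square_integrable M (Y t)) \<and>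
     (\<forall>t. ((\<lambda>s. \<integral>\<omega>. (Y s \<omega> - Y t \<omega>)\<^sup>2 \<partial>M) \<longlongrightarrow> 0) (at t))"

definition stationary :: "'a measure \<Rightarrow> (real \<Rightarrow> 'a \<Rightarrow> real) \<Rightarrow> bool" where
  "stationary M Y \<longleftrightarrow>
     (\<forall>J h. finite J \<longrightarrow>
        distr M (PiM J (\<lambda>_. borel)) (\<lambda>\<omega>. \<lambda>t\<in>J. Y (t + h) \<omega>)
        = distr M (PiM J (\<lambda>_. borel)) (\<lambda>\<omega>. \<lambda>t\<in>J. Y t \<omega>))"

definition cond_prob_given :: "'a measure \<Rightarrow> 'a measure \<Rightarrow> 'a set \<Rightarrow> 'a \<Rightarrow> real" where
  "cond_prob_given M F E = real_cond_exp M F (indicator E)"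

definition markov_process :: "'a measure \<Rightarrow> (real \<Rightarrow> 'a \<Rightarrow> real) \<Rightarrow> bool" where
  "markov_process M Y \<longleftrightarrow>
     (\<forall>t s S. t < s \<longrightarrow> S \<in> sets borel \<longrightarrow>
        (AE \<omega> in M. cond_prob_given M (generated_algebra M {..t} Y) (Y s -` S \<inter> space M) \<omega>
                  = cond_prob_given M (generated_algebra M {t} Y) (Y s -` S \<inter> space M) \<omega>))"

definition probability_density :: "(real \<Rightarrow> real) \<Rightarrow> bool" where
  "probability_density g \<longleftrightarrow>
     g \<in> borel_measurable borel \<and> (\<forall>x. 0 \<le> g x) \<and> (\<integral>\<^sup>+x. ennreal (g x) \<partial>lborel) = 1"

text \<open>\<open>g x y\<close> is a density in \<open>x\<close> of the regular conditional distribution of \<open>U\<close> given \<open>V = y\<close>.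
  As such a distribution is determined only up to null sets of the law of \<open>V\<close>, all conditions
  on \<open>g\<close> are required for almost all \<open>y\<close> with respect to this law.\<close>

definition has_conditional_density ::
  "'a measure \<Rightarrow> ('a \<Rightarrow> real) \<Rightarrow> ('a \<Rightarrow> real) \<Rightarrow> (real \<Rightarrow> real \<Rightarrow> real) \<Rightarrow> bool" where
  "has_conditional_density M U V g \<longleftrightarrow>
     (AE \<omega> in M. probability_density (\<lambda>x. g x (V \<omega>))) \<and>
     (\<forall>S \<in> sets borel.
        (AE \<omega> in M. cond_prob_given M (generated_algebra M {()} (\<lambda>_. V)) (U -` S \<inter> space M) \<omega>
                  = measure (density lborel (\<lambda>x. ennreal (g x (V \<omega>)))) S))"

definition qpoch_inf :: "real \<Rightarrow> real \<Rightarrow> real" where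
  "qpoch_inf a q = (\<Prod>i. 1 - a * q ^ i)"

definition q_support :: "real \<Rightarrow> real set" where
  "q_support q = (if q = 1 then UNIV else {- 2 / sqrt (1 - q) .. 2 / sqrt (1 - q)})"

definition f_N :: "real \<Rightarrow> real \<Rightarrow> real" where
  "f_N x q =
     (if q = 1 then 1 / sqrt (2 * pi) * exp (- x\<^sup>2 / 2)
      else sqrt (1 - q) * qpoch_inf q q / (2 * pi * sqrt (4 - (1 - q) * x\<^sup>2))
           * (\<Prod>k. (1 + q ^ k)\<^sup>2 - (1 - q) * x\<^sup>2 * q ^ k)
           * indicator (q_support q) x)"

definition f_CN :: "real \<Rightarrow> real \<Rightarrow> real \<Rightarrow> real \<Rightarrow> real" where
  "f_CN x y \<rho> q =
     (if q = 1 then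
        1 / sqrt (2 * pi * (1 - \<rho>\<^sup>2)) * exp (- (x - \<rho> * y)\<^sup>2 / (2 * (1 - \<rho>\<^sup>2)))
      else sqrt (1 - q) * (qpoch_inf (\<rho>\<^sup>2) q * qpoch_inf q q)
             / (2 * pi * sqrt (4 - (1 - q) * x\<^sup>2))
           * (\<Prod>k. ((1 + q ^ k)\<^sup>2 - (1 - q) * x\<^sup>2 * q ^ k)
                / ((1 - \<rho>\<^sup>2 * q ^ (2 * k))\<^sup>2
                   - (1 - q) * \<rho> * q ^ k * (1 + \<rho>\<^sup>2 * q ^ (2 * k)) * x * y
                   + (1 - q) * \<rho>\<^sup>2 * (x\<^sup>2 + y\<^sup>2) * q ^ (2 * k)))
           * indicator (q_support q) x)"

definition continuous_time_regular_TSP :: "'a measure \<Rightarrow> (real \<Rightarrow> 'a \<Rightarrow> real) \<Rightarrow> bool" where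
  "continuous_time_regular_TSP M Y \<longleftrightarrow>
     stochastic_process M Y \<and> L2_continuous M Y \<and> stationary M Y \<and>
     (\<forall>\<delta>>0. regular_one_TSP M (\<lambda>n. Y (of_int n * \<delta>)))"

end

theory Submission
  imports Defs "Jordan_Normal_Form.Determinant"
begin

text \<open>Existence: the stationary Ornstein--Uhlenbeck process, built by Kolmogorov's theorem from the Mehler
  kernels, is a regular 1TSP with \<open>q = 1\<close> on every grid, since conditionally on the neighbours \<open>X\<^sub>n\<close> is a
  Gaussian bridge.

  Characterization: the linear regression forces the grid correlations \<open>\<rho>^|n|\<close>, hence
  \<open>corr (Y\<^sub>s, Y\<^sub>t) = exp (-\<alpha> |s - t|)\<close>. For \<open>F\<close> in the past, \<open>E[X\<^sub>n; F]\<close> is a bounded solution in \<open>n\<close> of a second-order recurrence,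
  so the regression on the past is \<open>\<rho> X\<^sub>0\<close>; the same argument applies to squares, all moments exist, and
  by induction the \<open>q\<close>-Hermite polynomials satisfy \<open>E[H\<^sub>m(X\<^sub>1) | past] = \<rho>^m H\<^sub>m(X\<^sub>0)\<close>. The fourth moment is
  \<open>q + 2\<close>, so \<open>q\<close> does not depend on the mesh, and \<open>L\<^sub>2\<close>-continuity extends the regressions to the full past.
  For \<open>q < 1\<close>, summing them against the Poisson--Mehler kernel gives the transition law, and letting the
  correlation in the kernel tend to \<open>1\<close> identifies the marginal law; for \<open>q = 1\<close> the Hermite generating
  function gives characteristic functions.\<close>

section \<open>Rescaled \<open>q\<close>-Hermite polynomials and the Poisson--Mehler kernel\<close>

text \<open>The hypotheses are two-sided and concern first and second conditional moments; the
  conclusion is one-sided and concerns whole laws. Three obstacles lie between. The recurrence from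
  the quadratic regression also admits the case that the squares form a martingale; stationarity and
  \<open>B > 0\<close>, a consequence of the regularity condition on the second parameter, rule it
  out. Only second moments are given; bounding |X| by its forward and backward residuals raises the
  order by two at a time. Finally, polynomial regressions have to determine laws. For -1 < q < 1 the
  diagonal of the kernel series shows that the law lives on a compact interval, where polynomials
  are dense; for q = 1 the norms sqrt (n!) are small enough for the generating function to converge.
  The kernel is treated as a power series, on which orthogonality acts termwise; the infinite
  products of the densities enter through a functional equation relating r to q r. The
  Ornstein--Uhlenbeck process serves as the example because its bridges are explicit.\<close>

fun opoly :: "(nat \<Rightarrow> real) \<Rightarrow> nat \<Rightarrow> real \<Rightarrow> real" where
  "opoly b 0 x = 1"
| "opoly b (Suc 0) x = x"
| "opoly b (Suc (Suc n)) x = x * opoly b (Suc n) x - b (Suc n) * opoly b n x"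

lemma opoly_scale: "opoly (\<lambda>n. c\<^sup>2 * b n) n (c * x) = c ^ n * opoly b n x"
  by (induction n rule: induct_nat_012) (auto simp: algebra_simps power2_eq_square)

text \<open>Read backwards, the recurrence expands multiplication by \<open>x\<close>. Because
  \<open>b 0 = 0\<close>, it also covers \<open>n = 0\<close>, where the truncated index
  \<open>n - 1\<close> would otherwise contribute a spurious term.\<close>

lemma opoly_mult_x:
  assumes "b 0 = 0"
  shows "x * opoly b n x = opoly b (Suc n) x + b n * opoly b (n - 1) x"
  using assms by (cases n) auto

text \<open>Favard: a linear functional that kills all \<open>opoly b n\<close>, \<open>n \<ge> 1\<close>, makes them orthogonal.\<close>

lemma opoly_orthogonal:
  fixes G :: "nat \<Rightarrow> nat \<Rightarrow> real"
  assumes b0: "b 0 = 0" and G0: "\<And>n. G n 0 = (if n = 0 then 1 else 0)"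
    and sym: "\<And>n m. G (Suc n) m + b n * G (n - 1) m = G n (Suc m) + b m * G n (m - 1)"
  shows "G n m = (if n = m then \<Prod>k\<in>{1..n}. b k else 0)"
proof (induction m arbitrary: n rule: less_induct)
  case (less m)
  show ?case
  proof (cases m)
    case 0
    then show ?thesis using G0 by simp
  next
    case (Suc k)
    \<comment> \<open>\<open>sym\<close> solved for the entry in column \<open>Suc k\<close>; all
      entries on the right lie in columns \<open>k\<close> and \<open>k - 1\<close>, where the
      induction hypothesis applies.\<close>
    have 1: "G n (Suc k) = G (Suc n) k + b n * G (n - 1) k - b k * G n (k - 1)"
      using sym[of n k] by simp
    have 2: "G i k = (if i = k then \<Prod>k\<in>{1..i}. b k else 0)" for i using less Suc by simp
    have 3: "b k * G n (k - 1) = (if Suc n = k then \<Prod>k\<in>{1..Suc n}. b k else 0)"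
      using less[of "k - 1" n] Suc b0 by (cases k) auto
    have 4: "b n * G (n - 1) k = (if n = Suc k then \<Prod>k\<in>{1..n}. b k else 0)"
      unfolding 2 using b0 by (cases n) auto
    show ?thesis unfolding Suc 1 3 4 unfolding 2 by auto
  qed
qed

text \<open>The kernels are studied in the rescaled variable \<open>u = sqrt (1 - q) * x\<close>, which ranges over \<open>{-2..2}\<close> for all \<open>q\<close>. There the monic orthogonal
  polynomials of \<open>f_N\<close> have recurrence coefficients \<open>1 - q ^ n\<close> instead of \<open>[n]\<^sub>q\<close>, and \<open>qfac q n\<close> is \<open>(q;q)\<^sub>n\<close>.\<close>

abbreviation qh :: "real \<Rightarrow> nat \<Rightarrow> real \<Rightarrow> real" where
  "qh q \<equiv> opoly (\<lambda>n. 1 - q ^ n)"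

definition qfac :: "real \<Rightarrow> nat \<Rightarrow> real" where
  "qfac q n = (\<Prod>k\<in>{1..n}. 1 - q ^ k)"

lemma qfac_simps [simp]: "qfac q 0 = 1" "qfac q (Suc n) = qfac q n * (1 - q ^ Suc n)"
  by (simp_all add: qfac_def)

lemma one_minus_power_pos:
  fixes q :: real
  assumes "\<bar>q\<bar> < 1" shows "0 < 1 - q ^ Suc n"
proof -
  have "\<bar>q\<bar> ^ Suc n < 1" using assms by (intro power_less_one_iff[THEN iffD2]) auto
  then show ?thesis using abs_ge_self[of "q ^ Suc n"] by (simp only: power_abs)
qed

lemma qfac_pos: "\<bar>q\<bar> < 1 \<Longrightarrow> 0 < qfac q n"
proof (induction n)
  case (Suc n) then show ?case using one_minus_power_pos[of q n] by (simp only: qfac_simps) simp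
qed simp

definition qc :: "real \<Rightarrow> real \<Rightarrow> real \<Rightarrow> nat \<Rightarrow> real" where
  "qc q u v n = qh q n u * qh q n v / qfac q n"

text \<open>The denominator of \<open>f_CN\<close> is \<open>\<Prod>k. pmd (\<rho> * q ^ k) u v\<close>.\<close>

definition pmd :: "real \<Rightarrow> real \<Rightarrow> real \<Rightarrow> real" where
  "pmd r u v = (1 - r\<^sup>2)\<^sup>2 - r * (1 + r\<^sup>2) * u * v + r\<^sup>2 * (u\<^sup>2 + v\<^sup>2)"

text \<open>A product of solutions of two three-term recurrences satisfies a linear recurrence of
  order four. For the generating series \<open>qK\<close> the left side is the coefficient of
  \<open>r ^ (n + 4)\<close> in \<open>pmd r u v * qK q r u v\<close>, and the right side is the one
  in \<open>(1 - r\<^sup>2) * (1 - q * r\<^sup>2) * qK q (q * r) u v\<close>.\<close>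

lemma qc_recurrence:
  assumes q: "\<bar>q\<bar> < 1"
  shows "qc q u v (n + 4) - u * v * qc q u v (n + 3) + (u\<^sup>2 + v\<^sup>2 - 2) * qc q u v (n + 2)
      - u * v * qc q u v (n + 1) + qc q u v n
     = q ^ (n + 4) * qc q u v (n + 4) - (1 + q) * q ^ (n + 2) * qc q u v (n + 2) + q ^ (n + 1) * qc q u v n"
proof -
  define Q where "Q = q ^ n"
  define a where "a = qh q n u"
  define a' where "a' = qh q n v"
  define b where "b = qh q (Suc n) u"
  define b' where "b' = qh q (Suc n) v"
  define f where "f = qfac q n"
  note defs = a_def a'_def b_def b'_def f_def
  have ne: "1 - Q * q \<noteq> 0" "1 - Q * q^2 \<noteq> 0" "1 - Q * q^3 \<noteq> 0" "1 - Q * q^4 \<noteq> 0" "f \<noteq> 0"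
    using one_minus_power_pos[OF q, of n] one_minus_power_pos[OF q, of "Suc n"]
      one_minus_power_pos[OF q, of "Suc (Suc n)"] one_minus_power_pos[OF q, of "Suc (Suc (Suc n))"] qfac_pos[OF q, of n]
    by (auto simp: Q_def f_def algebra_simps power2_eq_square power3_eq_cube power4_eq_xxxx)
  have F: "qfac q (n+1) = f * (1 - Q * q)" "qfac q (n+2) = f * (1 - Q * q) * (1 - Q * q^2)"
    "qfac q (n+3) = f * (1 - Q * q) * (1 - Q * q^2)* (1 - Q * q^3)"
    "qfac q (n+4) = f * (1 - Q * q) * (1 - Q * q^2)* (1 - Q * q^3) * (1 - Q * q^4)"
    by (simp_all add: Q_def f_def algebra_simps numeral_eq_Suc power_add)
  define a2 where "a2 = (\<lambda>u (b::real) a. u * b - (1 - Q * q) * a :: real)"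
  define a3 where "a3 = (\<lambda>u b a. u * a2 u b a - (1 - Q * q^2) * b :: real)"
  define a4 where "a4 = (\<lambda>u b a. u * a3 u b a - (1 - Q * q^3) * a2 u b a)"
  have H: "qh q (n+1) u = b" "qh q (n+2) u = a2 u b a" "qh q (n+3) u = a3 u b a" "qh q (n+4) u = a4 u b a"
     "qh q (n+1) v = b'" "qh q (n+2) v = a2 v b' a'" "qh q (n+3) v = a3 v b' a'" "qh q (n+4) v = a4 v b' a'"
    by (simp_all add: a2_def a3_def a4_def numeral_eq_Suc Q_def algebra_simps defs)
  define A2 where "A2 = a2 u b a"
  define A3 where "A3 = a3 u b a"
  define A4 where "A4 = a4 u b a"
  define A2' where "A2' = a2 v b' a'"
  define A3' where "A3' = a3 v b' a'"
  define A4' where "A4' = a4 v b' a'"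
  note AA = A2_def A3_def A4_def A2'_def A3'_def A4'_def
  \<comment> \<open>After clearing the factorials, everything is expressed through two consecutive
    values for \<open>u\<close> and two for \<open>v\<close>, and \<open>q ^ n\<close> is the free
    variable \<open>Q\<close>. What remains is a polynomial identity.\<close>
  have "A4 * A4' - u * v * (A3 * A3') * 1 + (u\<^sup>2 + v\<^sup>2 - 2) * (A2 * A2') * (1 - Q * q^3) 
      - u * v * (b * b') * (1 - Q * q^2) * (1 - Q * q^3) + a * a' * (1 - Q * q) * (1 - Q * q^2) * (1 - Q * q^3) 
      = - (1 + q) * (Q * q^2) * (A2 * A2') * (1 - Q * q^3) 
       + Q * q * (a * a') * (1 - Q * q) * (1 - Q * q^2) * (1 - Q * q^3)"
    unfolding AA a2_def a3_def a4_def by Groebner_Basis.algebra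
  note main = this
  define W where "W = f * (1 - Q * q) * (1 - Q * q^2)* (1 - Q * q^3)"
  have W: "W \<noteq> 0" using ne by (simp add: W_def)
  have c: "qc q u v (n + 4) * (1 - Q * q^4) * W = A4 * A4'"
    "qc q u v (n + 3) * W = A3 * A3'"
    "qc q u v (n + 2) * W = A2 * A2' * (1 - Q * q^3)"
    "qc q u v (n + 1) * W = b * b' * (1 - Q * q^2) * (1 - Q * q^3)"
    "qc q u v n * W = a * a' * (1 - Q * q) * (1 - Q * q^2) * (1 - Q * q^3)"
    unfolding qc_def H F AA W_def using ne by (simp_all add: divide_simps defs)
  have p: "q ^ (n + 4) = Q * q^4" "q ^ (n + 2) = Q * q^2" "q ^ (n+1) = Q * q"
    by (simp_all only: Q_def power_add power_one_right)
  have *: "C4 - u * v * C3 + (u\<^sup>2 + v\<^sup>2 - 2) * C2 - u * v * C1 + C0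
      = Q * q^4 * C4 - (1 + q) * (Q * q^2) * C2 + Q * q * C0"
    if "C4 * (1 - Q * q^4) * W = A4 * A4'" "C3 * W = A3 * A3'" "C2 * W = A2 * A2' * (1 - Q * q^3)"
    "C1 * W = b * b' * (1 - Q * q^2) * (1 - Q * q^3)"
    "C0 * W = a * a' * (1 - Q * q) * (1 - Q * q^2) * (1 - Q * q^3)" for C0 C1 C2 C3 C4
  proof -
    have "(C4 - u * v * C3 + (u\<^sup>2 + v\<^sup>2 - 2) * C2 - u * v * C1 + C0
      - (Q * q^4 * C4 - (1 + q) * (Q * q^2) * C2 + Q * q * C0)) * W
     = C4 * (1 - Q * q^4) * W - u * v * (C3 * W) + (u\<^sup>2 + v\<^sup>2 - 2) * (C2 * W) - u * v * (C1 * W) + C0 * W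
       + (1 + q) * (Q * q^2) * (C2 * W) - Q * q * (C0 * W)"
      by (simp add: algebra_simps)
    also have "\<dots> = 0" unfolding that using main by (simp add: algebra_simps)
    finally show ?thesis using W by simp
  qed
  show ?thesis unfolding p by (rule *[OF c])
qed

text \<open>The Poisson--Mehler kernel of the \<open>q\<close>-Hermite polynomials: the transition
  density relative to the marginal law, as a function of the rescaled variables. It is defined by
  its expansion, not by its product, so that orthogonality can be applied term by term.\<close>

definition qK :: "real \<Rightarrow> real \<Rightarrow> real \<Rightarrow> real \<Rightarrow> real" where
  "qK q r u v = (\<Sum>n. qc q u v n * r ^ n)"

text \<open>Comparison of coefficients: \<open>qc_recurrence\<close> treats the orders from four on,
  and the lower ones are checked directly. Convergence is assumed at the given point instead of
  \<open>u\<close> and \<open>v\<close> being bounded, since \<open>qh_support\<close> applies the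
  equation to points outside the interval from -2 to 2.\<close>

lemma qK_functional_equation:
  assumes q: "\<bar>q\<bar> < 1" and s: "summable (\<lambda>n. norm (qc q u v n * r ^ n))"
  shows "pmd r u v * qK q r u v = (1 - r\<^sup>2) * (1 - q * r\<^sup>2) * qK q (q * r) u v"
proof -
  \<comment> \<open>The coefficients preceded by four zeros: every product of the series with
    \<open>r ^ j\<close>, \<open>j \<le> 4\<close>, then becomes an index shift of one sequence, and
    all coefficients are compared by a single equation.\<close>
  define C where "C n = (if n < 4 then 0 else qc q u v (n - 4))" for n
  have *: "(\<lambda>n. C (n + 4 - j) * p ^ (n - j) * r ^ n) sums (r ^ j * qK q (p * r) u v)" if p: "\<bar>p\<bar> \<le> 1" and j: "j \<le> 4" for p j
  proof -
    have "summable (\<lambda>n. norm (qc q u v n * (p * r) ^ n))"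
    proof (rule summable_comparison_test'[OF s, of 0])
      fix n
      have "\<bar>p\<bar> ^ n \<le> 1" using p by (simp add: power_le_one)
      then show "norm (norm (qc q u v n * (p * r) ^ n)) \<le> norm (qc q u v n * r ^ n)"
        by (auto simp: abs_mult power_mult_distrib power_abs intro!: mult_left_mono mult_left_le_one_le)
    qed
    then have "summable (\<lambda>n. qc q u v n * (p * r) ^ n)" by (rule summable_norm_cancel)
    then have "(\<lambda>n. qc q u v n * (p * r) ^ n) sums qK q (p * r) u v"
      unfolding qK_def by (rule summable_sums)
    then have "(\<lambda>n. r ^ j * (qc q u v n * (p * r) ^ n)) sums (r ^ j * qK q (p * r) u v)" by (rule sums_mult)
    also have "(\<lambda>n. r ^ j * (qc q u v n * (p * r) ^ n)) = (\<lambda>n. C (n + j + 4 - j) * p ^ (n + j - j) * r ^ (n + j))"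
      by (auto simp: C_def power_add power_mult_distrib algebra_simps)
    finally show ?thesis
      by (subst (asm) sums_zero_iff_shift) (use j in \<open>auto simp: C_def\<close>)
  qed
  have 1: "(\<lambda>n. C (n + 4 - 0) * 1 ^ (n - 0) * r ^ n - u * v * (C (n + 4 - 1) * 1 ^ (n - 1) * r ^ n)
      + (u\<^sup>2 + v\<^sup>2 - 2) * (C (n + 4 - 2) * 1 ^ (n - 2) * r ^ n)
      - u * v * (C (n + 4 - 3) * 1 ^ (n - 3) * r ^ n) + C (n + 4 - 4) * 1 ^ (n - 4) * r ^ n) sums
      (r ^ 0 * qK q (1 * r) u v - u * v * (r ^ 1 * qK q (1 * r) u v) + (u\<^sup>2 + v\<^sup>2 - 2) * (r ^ 2 * qK q (1 * r) u v)
       - u * v * (r ^ 3 * qK q (1 * r) u v) + r ^ 4 * qK q (1 * r) u v)"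
    by (intro sums_add sums_diff sums_mult *) auto
  have 2: "(\<lambda>n. C (n + 4 - 0) * q ^ (n - 0) * r ^ n - (1 + q) * (C (n + 4 - 2) * q ^ (n - 2) * r ^ n)
      + q * (C (n + 4 - 4) * q ^ (n - 4) * r ^ n)) sums
      (r ^ 0 * qK q (q * r) u v - (1 + q) * (r ^ 2 * qK q (q * r) u v) + q * (r ^ 4 * qK q (q * r) u v))"
    using q by (intro sums_add sums_diff sums_mult *) auto
  have eq: "C (n + 4) - u * v * C (n + 3) + (u\<^sup>2 + v\<^sup>2 - 2) * C (n + 2) - u * v * C (n + 1) + C n
    = q ^ n * C (n + 4) - (1 + q) * q ^ (n - 2) * C (n + 2) + q * q ^ (n - 4) * C n" for n
  proof -
    have ne: "1 - q \<noteq> 0" "1 - q^2 \<noteq> 0" "1 - q^3 \<noteq> 0"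
      using one_minus_power_pos[OF q, of 0] one_minus_power_pos[OF q, of 1] one_minus_power_pos[OF q, of 2] 
      by (auto simp: numeral_eq_Suc)
    have c: "qc q u v 0 = 1" "(1 - q) * qc q u v 1 = u * v"
         "(1 - q) * (1 - q^2) * qc q u v 2 = (u * u - (1 - q)) * (v * v - (1 - q))"
         "(1 - q) * (1 - q^2) * (1 - q^3) * qc q u v 3 = (u * (u * u - (1 - q)) - (1 - q^2) * u) * (v * (v * v - (1 - q)) - (1 - q^2) * v)"
      using ne by (simp_all add: qc_def numeral_eq_Suc)
    consider "n = 0" | "n = 1" | "n = 2" | "n = 3" | m where "n = m + 4"
      by (metis One_nat_def Suc_1 add.commute less_Suc_eq_le less_one numeral_3_eq_3 add_2_eq_Suc' eval_nat_numeral(2) le_Suc_ex not_less_eq numeral_Bit0 Suc_eq_plus1 less_Suc_eq)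
    then show ?thesis
    proof cases
      case 1 then show ?thesis by (simp add: C_def)
    next
      case 2 then show ?thesis using c(1,2) by (simp add: C_def algebra_simps)
    next
      case 3
      have "(1 - q) * (qc q u v 2 - u * v * qc q u v 1 + (u\<^sup>2 + v\<^sup>2 - 2) * qc q u v 0 - (q^2 * qc q u v 2 - (1+q) * qc q u v 0)) = 0"
        using c by Groebner_Basis.algebra
      then show ?thesis using 3 ne by (simp add: C_def)
    next
      case 4
      have "(1 - q) * (1 - q^2) * (qc q u v 3 - u * v * qc q u v 2 + (u\<^sup>2 + v\<^sup>2 - 2) * qc q u v 1 - u * v * qc q u v 0 - (q^3 * qc q u v 3 - (1+q) * q * qc q u v 1)) = 0"
        using c by Groebner_Basis.algebra
      then show ?thesis using 4 ne by (simp add: C_def)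
    next
      case 5
      then show ?thesis using qc_recurrence[OF q, of u v m]
        by (simp add: C_def add.commute add.left_commute)
    qed
  qed
  have "(C (n + 4 - 0) * 1 ^ (n - 0) * r ^ n - u * v * (C (n + 4 - 1) * 1 ^ (n - 1) * r ^ n)
      + (u\<^sup>2 + v\<^sup>2 - 2) * (C (n + 4 - 2) * 1 ^ (n - 2) * r ^ n)
      - u * v * (C (n + 4 - 3) * 1 ^ (n - 3) * r ^ n) + C (n + 4 - 4) * 1 ^ (n - 4) * r ^ n) =
     (C (n + 4 - 0) * q ^ (n - 0) * r ^ n - (1 + q) * (C (n + 4 - 2) * q ^ (n - 2) * r ^ n)
      + q * (C (n + 4 - 4) * q ^ (n - 4) * r ^ n))" for n
  proof -
    have "n + 4 - 3 = n + 1" "n + 4 - 2 = n + 2" "n + 4 - 1 = n + 3" by auto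
    then show ?thesis using arg_cong[OF eq[of n], of "\<lambda>x. x * r ^ n"] by (simp add: algebra_simps)
  qed
  then have "r ^ 0 * qK q (1 * r) u v - u * v * (r ^ 1 * qK q (1 * r) u v) + (u\<^sup>2 + v\<^sup>2 - 2) * (r ^ 2 * qK q (1 * r) u v)
       - u * v * (r ^ 3 * qK q (1 * r) u v) + r ^ 4 * qK q (1 * r) u v =
       r ^ 0 * qK q (q * r) u v - (1 + q) * (r ^ 2 * qK q (q * r) u v) + q * (r ^ 4 * qK q (q * r) u v)"
    using 1 2 by (metis (no_types, lifting) sums_unique2 ext)
  then show ?thesis by (simp add: pmd_def) Groebner_Basis.algebra
qed

section \<open>Positivity, growth bounds and the product formula\<close>

lemma pmd_pos:
  assumes "\<bar>r\<bar> < 1" "\<bar>u\<bar> \<le> 2" "\<bar>v\<bar> \<le> 2"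
  shows "0 < pmd r u v"
proof -
  have *: "0 < pmd r u v" if "0 \<le> r" "r < 1" "\<bar>u\<bar> \<le> 2" "\<bar>v\<bar> \<le> 2" for r u v :: real
  proof -
    have uv: "u * v \<le> 4" using mult_mono[of "\<bar>u\<bar>" 2 "\<bar>v\<bar>" 2] that abs_ge_self[of "u * v"] by (simp add: abs_mult)
    have "pmd r u v = (1 - r\<^sup>2)\<^sup>2 - r * (1 - r)\<^sup>2 * (u * v) + r\<^sup>2 * (u - v)\<^sup>2" unfolding pmd_def by Groebner_Basis.algebra
    moreover have "\<dots> \<ge> (1 - r\<^sup>2)\<^sup>2 - r * (1 - r)\<^sup>2 * 4 + 0"
      using uv that by (intro add_mono diff_mono mult_left_mono) auto
    moreover have "(1 - r\<^sup>2)\<^sup>2 - r * (1 - r)\<^sup>2 * 4 + 0 = (1 - r) ^ 4" by Groebner_Basis.algebra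
    moreover have "0 < (1 - r) ^ 4" using that by simp
    ultimately show ?thesis by linarith
  qed
  show ?thesis
  proof (cases "r \<ge> 0")
    case False
    have "pmd r u v = pmd (- r) u (- v)" by (simp add: pmd_def)
    then show ?thesis using *[of "- r" u "- v"] assms False by simp
  qed (use * assms in auto)
qed

text \<open>Dominates all partial products of \<open>1 + k * \<bar>q\<bar> ^ k\<close>, the factor
  by which one step of the recurrence can enlarge the estimate in \<open>qh_bound\<close>.\<close>

definition qbound :: "real \<Rightarrow> real" where
  "qbound q = exp (\<Sum>k. real k * \<bar>q\<bar> ^ k)"

lemma summable_square_power:
  fixes r :: real
  assumes "\<bar>r\<bar> < 1" shows "summable (\<lambda>n. (real n + 1)\<^sup>2 * \<bar>r\<bar> ^ n)"
proof -
  have 1: "summable (\<lambda>n. diffs (\<lambda>_. 1) n * x ^ n)" if "norm x < 1" for x :: real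
    by (rule termdiff_converges[OF that]) (simp add: summable_geometric)
  have "summable (\<lambda>n. diffs (diffs (\<lambda>_. 1)) n * \<bar>r\<bar> ^ n)"
    by (rule termdiff_converges[of _ 1, OF _ 1]) (use assms in auto)
  then show ?thesis
    by (rule summable_comparison_test') (auto simp: diffs_def power2_eq_square intro!: mult_right_mono mult_mono)
qed

lemma summable_n_power:
  fixes q :: real
  assumes "\<bar>q\<bar> < 1" shows "summable (\<lambda>k. real k * \<bar>q\<bar> ^ k)"
proof (rule summable_comparison_test'[OF summable_square_power[OF assms], of 0])
  fix n :: nat
  have "real n \<le> (real n + 1)\<^sup>2" by (simp add: power2_eq_square algebra_simps)
  then show "norm (real n * \<bar>q\<bar> ^ n) \<le> (real n + 1)\<^sup>2 * \<bar>q\<bar> ^ n" by (auto intro: mult_right_mono)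
qed

text \<open>Write \<open>u = z + cnj z\<close> with \<open>z\<close> on the unit circle. The
  recurrence for \<open>q = 0\<close> then factors into two first-order recurrences with multipliers
  \<open>z\<close> and \<open>cnj z\<close> of modulus one, and \<open>b\<close> is the intermediate
  sequence. The growth \<open>n + 1\<close> is that of the Chebyshev polynomials; the term with
  \<open>q ^ n\<close> is a summable perturbation, absorbed in \<open>P\<close>.\<close>

lemma qh_bound:
  assumes q: "\<bar>q\<bar> < 1" and u: "\<bar>u\<bar> \<le> 2"
  shows "\<bar>qh q n u\<bar> \<le> (real n + 1) * qbound q"
proof -
  define z where "z = Complex (u / 2) (sqrt (1 - (u / 2)\<^sup>2))"
  have u2: "(u / 2)\<^sup>2 \<le> 1" using u by (simp add: abs_square_le_1)
  then have nz: "norm z = 1" by (simp add: z_def cmod_def)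
  then have zz: "cnj z * z = 1" by (simp add: complex_norm_square[symmetric] mult.commute)
  have zu: "of_real u = z + cnj z" by (simp add: z_def complex_eq_iff)
  define P where "P n = (\<Prod>k<n. 1 + real k * \<bar>q\<bar> ^ k)" for n
  have P1: "1 \<le> P n" for n unfolding P_def by (rule prod_ge_1) auto
  have Pm: "P n \<le> P (Suc n)" for n using P1[of n] by (simp add: P_def)
  define b where "b n = complex_of_real (qh q (Suc n) u) - z * of_real (qh q n u)" for n
  have b: "b (Suc n) = cnj z * b n + of_real (q ^ Suc n * qh q n u)" for n
  proof -
    have "b (Suc n) = of_real u * of_real (qh q (Suc n) u) - of_real (qh q n u) + of_real (q ^ Suc n * qh q n u) - z * of_real (qh q (Suc n) u)"
      by (simp add: b_def algebra_simps)
    also have "\<dots> = cnj z * b n + of_real (q ^ Suc n * qh q n u) + (cnj z * z - 1) * of_real (qh q n u)"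
      unfolding zu b_def by (simp add: algebra_simps)
    finally show ?thesis using zz by simp
  qed
  have "norm (b n) \<le> P (Suc n) \<and> \<bar>qh q n u\<bar> \<le> (real n + 1) * P n"
  proof (induction n)
    case 0
    have "b 0 = cnj z" by (simp add: b_def zu)
    then show ?case using nz by (simp add: P_def)
  next
    case (Suc n)
    have "norm (b (Suc n)) \<le> norm (b n) + \<bar>q\<bar> ^ Suc n * \<bar>qh q n u\<bar>"
      unfolding b by (rule order_trans[OF norm_triangle_ineq]) (simp add: norm_mult nz abs_mult power_abs flip: of_real_mult of_real_power)
    also have "\<dots> \<le> P (Suc n) + \<bar>q\<bar> ^ Suc n * ((real n + 1) * P (Suc n))"
      using Suc Pm[of n] by (intro add_mono mult_left_mono) (auto intro: order_trans mult_left_mono)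
    also have "\<dots> = P (Suc (Suc n))" by (simp add: P_def algebra_simps)
    finally have 1: "norm (b (Suc n)) \<le> P (Suc (Suc n))" .
    have "\<bar>qh q (Suc n) u\<bar> = norm (b n + z * of_real (qh q n u))" by (simp add: b_def)
    also have "\<dots> \<le> norm (b n) + \<bar>qh q n u\<bar>" by (rule order_trans[OF norm_triangle_ineq]) (simp add: norm_mult nz)
    also have "\<dots> \<le> P (Suc n) + (real n + 1) * P (Suc n)"
      using Suc Pm[of n] by (intro add_mono) (auto intro: order_trans mult_left_mono)
    finally show ?case using 1 by (simp add: algebra_simps)
  qed
  moreover have "P n \<le> qbound q"
  proof -
    have "P n \<le> (\<Prod>k<n. exp (real k * \<bar>q\<bar> ^ k))" unfolding P_def by (rule prod_mono) (auto intro: exp_ge_add_one_self)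
    also have "\<dots> = exp (\<Sum>k<n. real k * \<bar>q\<bar> ^ k)" by (simp add: exp_sum)
    also have "\<dots> \<le> qbound q" unfolding qbound_def using sum_le_suminf[OF summable_n_power[OF q], of "{..<n}"] by auto
    finally show ?thesis .
  qed
  ultimately show ?thesis by (auto intro: order_trans mult_left_mono)
qed

text \<open>A factor \<open>1 / (1 - y)\<close> with \<open>0 \<le> y \<le> \<bar>q\<bar>\<close> is
  at most \<open>exp (y / (1 - \<bar>q\<bar>))\<close>, so the product of inverses is bounded by the
  exponential of a geometric series.\<close>

lemma inverse_qfac_bound:
  assumes q: "\<bar>q\<bar> < 1"
  shows "1 / qfac q n \<le> exp (1 / (1 - \<bar>q\<bar>)\<^sup>2)"
proof -
  have le: "1 / qfac q n \<le> exp (\<Sum>k<n. \<bar>q\<bar> ^ Suc k / (1 - \<bar>q\<bar>))"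
  proof (induction n)
    case (Suc n)
    define y where "y = \<bar>q\<bar> ^ Suc n"
    have y: "0 \<le> y" "y \<le> \<bar>q\<bar>" "y < 1" using q power_decreasing[of 1 "Suc n" "\<bar>q\<bar>"] by (auto simp: y_def)
    have "q ^ Suc n \<le> y" unfolding y_def by (metis abs_ge_self power_abs)
    then have "1 / (1 - q ^ Suc n) \<le> 1 / (1 - y)" using y by (intro divide_left_mono) auto
    also have "\<dots> = 1 + y / (1 - y)" using y by (simp add: field_simps)
    also have "\<dots> \<le> 1 + y / (1 - \<bar>q\<bar>)" using y q by (intro add_left_mono divide_left_mono) auto
    also have "\<dots> \<le> exp (y / (1 - \<bar>q\<bar>))" by (rule exp_ge_add_one_self)
    finally have 1: "1 / (1 - q ^ Suc n) \<le> exp (y / (1 - \<bar>q\<bar>))" .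
    have "1 / qfac q (Suc n) = 1 / qfac q n * (1 / (1 - q ^ Suc n))" by (simp del: power_Suc)
    also have "\<dots> \<le> exp (\<Sum>k<n. \<bar>q\<bar> ^ Suc k / (1 - \<bar>q\<bar>)) * exp (y / (1 - \<bar>q\<bar>))"
      using Suc 1 one_minus_power_pos[OF q, of n] by (intro mult_mono) (auto simp del: power_Suc)
    finally show ?case by (simp add: y_def exp_add)
  qed simp
  have sg: "summable (\<lambda>k. \<bar>q\<bar> ^ k)" using q by (simp add: summable_geometric)
  have "(\<Sum>k<n. \<bar>q\<bar> ^ Suc k / (1 - \<bar>q\<bar>)) \<le> (\<Sum>k<n. \<bar>q\<bar> ^ k / (1 - \<bar>q\<bar>))"
    using q by (intro sum_mono divide_right_mono) (auto simp: mult_left_le_one_le)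
  also have "\<dots> = (\<Sum>k<n. \<bar>q\<bar> ^ k) / (1 - \<bar>q\<bar>)" by (simp add: sum_divide_distrib)
  also have "\<dots> \<le> (\<Sum>k. \<bar>q\<bar> ^ k) / (1 - \<bar>q\<bar>)"
    using q sg by (intro divide_right_mono sum_le_suminf) auto
  also have "\<dots> = 1 / (1 - \<bar>q\<bar>)\<^sup>2" using q by (simp add: suminf_geometric power2_eq_square)
  finally show ?thesis using le by (meson exp_le_cancel_iff order_trans)
qed


definition qcbound :: "real \<Rightarrow> real" where
  "qcbound q = (qbound q)\<^sup>2 * exp (1 / (1 - \<bar>q\<bar>)\<^sup>2)"

lemma qc_bound:
  assumes q: "\<bar>q\<bar> < 1" and u: "\<bar>u\<bar> \<le> 2" and v: "\<bar>v\<bar> \<le> 2"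
  shows "\<bar>qc q u v n\<bar> \<le> qcbound q * (real n + 1)\<^sup>2"
proof -
  have "\<bar>qc q u v n\<bar> = \<bar>qh q n u\<bar> * \<bar>qh q n v\<bar> * (1 / qfac q n)"
    using qfac_pos[OF q, of n] by (simp add: qc_def abs_mult)
  also have "\<dots> \<le> ((real n + 1) * qbound q) * ((real n + 1) * qbound q) * exp (1 / (1 - \<bar>q\<bar>)\<^sup>2)"
    using qh_bound[OF q u, of n] qh_bound[OF q v, of n] inverse_qfac_bound[OF q, of n] qfac_pos[OF q, of n]
    by (intro mult_mono) (auto intro: order_trans[OF abs_ge_zero])
  finally show ?thesis by (simp add: qcbound_def power2_eq_square algebra_simps)
qed

lemma qc_summable:
  assumes q: "\<bar>q\<bar> < 1" and u: "\<bar>u\<bar> \<le> 2" and v: "\<bar>v\<bar> \<le> 2" and r: "\<bar>r\<bar> < 1"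
  shows "summable (\<lambda>n. norm (qc q u v n * r ^ n))"
proof (rule summable_comparison_test'[OF summable_mult[OF summable_square_power[OF r], of "qcbound q"], of 0])
  fix n
  show "norm (norm (qc q u v n * r ^ n)) \<le> qcbound q * ((real n + 1)\<^sup>2 * \<bar>r\<bar> ^ n)"
    using mult_right_mono[OF qc_bound[OF q u v, of n], of "\<bar>r\<bar> ^ n"] by (simp add: abs_mult power_abs algebra_simps)
qed

lemma qK_0 [simp]: "qK q 0 u v = 1"
proof -
  have "qK q 0 u v = qc q u v 0" unfolding qK_def by (rule powser_zero)
  then show ?thesis by (simp add: qc_def)
qed

lemma isCont_qK:
  assumes q: "\<bar>q\<bar> < 1" and u: "\<bar>u\<bar> \<le> 2" and v: "\<bar>v\<bar> \<le> 2" and r: "\<bar>r\<bar> < 1"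
  shows "isCont (\<lambda>r. qK q r u v) r"
proof -
  obtain K where K: "\<bar>r\<bar> < K" "K < 1" using dense r by blast
  have "summable (\<lambda>n. qc q u v n * K ^ n)"
    using summable_norm_cancel[OF qc_summable[OF q u v, of K]] K by auto
  then show ?thesis unfolding qK_def by (rule isCont_powser) (use K in auto)
qed

lemma convergent_prod_geometric:
  fixes f :: "nat \<Rightarrow> real"
  assumes q: "\<bar>q\<bar> < 1" and f: "\<And>k. \<bar>f k - 1\<bar> \<le> c * \<bar>q\<bar> ^ k"
  shows "convergent_prod f"
proof -
  have "summable (\<lambda>k. norm (f k - 1))"
    by (rule summable_comparison_test'[where g = "\<lambda>k. c * \<bar>q\<bar> ^ k" and N = 0])
      (use f q in \<open>auto intro!: summable_mult summable_geometric\<close>)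
  then show ?thesis by (intro abs_convergent_prod_imp_convergent_prod) (simp add: abs_convergent_prod_conv_summable)
qed

lemma prodinf_ge_0:
  fixes f :: "nat \<Rightarrow> real"
  assumes "convergent_prod f" "\<And>k. 0 \<le> f k"
  shows "0 \<le> prodinf f"
  by (rule LIMSEQ_le_const[OF convergent_prod_LIMSEQ[OF assms(1)]]) (use assms(2) in \<open>auto intro!: prod_nonneg\<close>)

lemma prodinf_gt_0:
  fixes f :: "nat \<Rightarrow> real"
  assumes "convergent_prod f" "\<And>k. 0 < f k"
  shows "0 < prodinf f"
  using prodinf_ge_0[OF assms(1)] prodinf_nonzero[OF assms(1)] assms(2) by (metis less_eq_real_def less_irrefl)

lemma qpoch_convergent:
  fixes a q :: real
  shows "\<bar>q\<bar> < 1 \<Longrightarrow> convergent_prod (\<lambda>k. 1 - a * q ^ k)"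
  by (rule convergent_prod_geometric[where c = "\<bar>a\<bar>"]) (auto simp: abs_mult power_abs)

lemma pmd_convergent:
  assumes q: "\<bar>q\<bar> < 1" and u: "\<bar>u\<bar> \<le> 2" and v: "\<bar>v\<bar> \<le> 2" and r: "\<bar>r\<bar> < 1"
  shows "convergent_prod (\<lambda>k. pmd (r * q ^ k) u v)"
proof (rule convergent_prod_geometric[where c = 20, OF q])
  fix k
  define s where "s = r * q ^ k"
  have "\<bar>q\<bar> ^ k \<le> 1" using q by (simp add: power_le_one)
  then have s: "\<bar>s\<bar> \<le> \<bar>q\<bar> ^ k" "\<bar>s\<bar> \<le> 1" using r mult_left_le_one_le[of "\<bar>q\<bar> ^ k" "\<bar>r\<bar>"]
    by (auto simp: s_def abs_mult power_abs mult_le_one)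
  have u2: "u\<^sup>2 \<le> 4" "v\<^sup>2 \<le> 4" using u v by (auto simp: abs_le_square_iff[of _ 2, simplified])
  have uv: "\<bar>u * v\<bar> \<le> 4" using mult_mono[of "\<bar>u\<bar>" 2 "\<bar>v\<bar>" 2] u v by (simp add: abs_mult)
  have s2: "s\<^sup>2 \<le> 1" using s by (simp add: abs_square_le_1)
  have "pmd s u v - 1 = s * (s * (s\<^sup>2 - 2) - (1 + s\<^sup>2) * (u * v) + s * (u\<^sup>2 + v\<^sup>2))" unfolding pmd_def by Groebner_Basis.algebra
  also have "\<bar>\<dots>\<bar> \<le> \<bar>s\<bar> * 20"
    unfolding abs_mult[of s]
  proof (rule mult_left_mono)
    have "\<bar>s * (s\<^sup>2 - 2)\<bar> \<le> 1 * 2" unfolding abs_mult using s s2 by (intro mult_mono) auto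
    moreover have "\<bar>(1 + s\<^sup>2) * (u * v)\<bar> \<le> 2 * 4" unfolding abs_mult[of "1 + s\<^sup>2"] using uv s2 by (intro mult_mono) auto
    moreover have "\<bar>s * (u\<^sup>2 + v\<^sup>2)\<bar> \<le> 1 * 8" unfolding abs_mult using s u2 by (intro mult_mono) auto
    ultimately show "\<bar>s * (s\<^sup>2 - 2) - (1 + s\<^sup>2) * (u * v) + s * (u\<^sup>2 + v\<^sup>2)\<bar> \<le> 20" by linarith
  qed auto
  finally show "\<bar>pmd (r * q ^ k) u v - 1\<bar> \<le> 20 * \<bar>q\<bar> ^ k" using s by (simp add: s_def)
qed

lemma qpoch_pos:
  fixes a q :: real
  assumes q: "\<bar>q\<bar> < 1" and a: "\<bar>a\<bar> < 1"
  shows "0 < (\<Prod>k. 1 - a * q ^ k)"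
proof (rule prodinf_gt_0[OF qpoch_convergent[OF q]])
  fix k
  have "\<bar>q\<bar> ^ k \<le> 1" using q by (simp add: power_le_one)
  then have "\<bar>a * q ^ k\<bar> < 1" using a mult_left_le_one_le[of "\<bar>a\<bar>" "\<bar>q\<bar> ^ k"] by (simp add: abs_mult power_abs mult.commute)
  then show "0 < 1 - a * q ^ k" by linarith
qed

text \<open>Iterating the functional equation turns the series into a product (Poisson--Mehler).\<close>

lemma qK_product:
  assumes q: "\<bar>q\<bar> < 1" and u: "\<bar>u\<bar> \<le> 2" and v: "\<bar>v\<bar> \<le> 2" and r: "\<bar>r\<bar> < 1"
  shows "qK q r u v * (\<Prod>k. pmd (r * q ^ k) u v) = (\<Prod>k. 1 - r\<^sup>2 * q ^ k)"
proof -
  have rk: "\<bar>r * q ^ k\<bar> < 1" for k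
    using r q mult_left_le_one_le[of "\<bar>r\<bar>" "\<bar>q\<bar> ^ k"] by (simp add: abs_mult power_abs power_le_one mult.commute)
  \<comment> \<open>One application of the functional equation at \<open>r * q ^ N\<close> releases
    the factors with exponents \<open>2 * N\<close> and \<open>2 * N + 1\<close>, hence the upper
    limit \<open>2 * N\<close> on the right against \<open>N\<close> on the left.\<close>
  have it: "qK q r u v * (\<Prod>k<N. pmd (r * q ^ k) u v) = (\<Prod>k<2 * N. 1 - r\<^sup>2 * q ^ k) * qK q (r * q ^ N) u v" for N
  proof (induction N)
    case (Suc N)
    have "qK q r u v * (\<Prod>k<Suc N. pmd (r * q ^ k) u v)
        = (\<Prod>k<2 * N. 1 - r\<^sup>2 * q ^ k) * (pmd (r * q ^ N) u v * qK q (r * q ^ N) u v)"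
      using Suc by simp
    also have "\<dots> = (\<Prod>k<2 * N. 1 - r\<^sup>2 * q ^ k) * ((1 - (r * q ^ N)\<^sup>2) * (1 - q * (r * q ^ N)\<^sup>2) * qK q (q * (r * q ^ N)) u v)"
      by (subst qK_functional_equation[OF q qc_summable[OF q u v rk]]) simp
    also have "\<dots> = (\<Prod>k<2 * Suc N. 1 - r\<^sup>2 * q ^ k) * qK q (r * q ^ Suc N) u v"
      by (simp add: power_mult_distrib power_mult[symmetric] mult_ac)
    finally show ?case .
  qed simp
  have 1: "(\<lambda>N. qK q r u v * (\<Prod>k<N. pmd (r * q ^ k) u v)) \<longlonglongrightarrow> qK q r u v * (\<Prod>k. pmd (r * q ^ k) u v)"
    using convergent_prod_LIMSEQ[OF pmd_convergent[OF q u v r]]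
    by (intro tendsto_mult tendsto_const) (metis LIMSEQ_lessThan_iff_atMost)
  have qp: "(\<lambda>N. (\<Prod>k<N. 1 - r\<^sup>2 * q ^ k)) \<longlonglongrightarrow> (\<Prod>k. 1 - r\<^sup>2 * q ^ k)"
    using convergent_prod_LIMSEQ[OF qpoch_convergent[OF q]] by (metis LIMSEQ_lessThan_iff_atMost)
  have "(\<lambda>N. \<Prod>k<2 * N. 1 - r\<^sup>2 * q ^ k) \<longlonglongrightarrow> (\<Prod>k. 1 - r\<^sup>2 * q ^ k)"
    using LIMSEQ_subseq_LIMSEQ[OF qp, of "\<lambda>N. 2 * N"] by (auto simp: strict_mono_def o_def)
  moreover have "(\<lambda>N. r * q ^ N) \<longlonglongrightarrow> r * 0" using q by (intro tendsto_intros LIMSEQ_power_zero) auto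
  then have "(\<lambda>N. qK q (r * q ^ N) u v) \<longlonglongrightarrow> qK q 0 u v"
    using isCont_tendsto_compose[OF isCont_qK[OF q u v, of 0]] by simp
  ultimately have "(\<lambda>N. (\<Prod>k<2 * N. 1 - r\<^sup>2 * q ^ k) * qK q (r * q ^ N) u v) \<longlonglongrightarrow> (\<Prod>k. 1 - r\<^sup>2 * q ^ k) * qK q 0 u v"
    by (intro tendsto_mult)
  then show ?thesis using 1 LIMSEQ_unique unfolding it by fastforce
qed

lemma qK_pos:
  assumes q: "\<bar>q\<bar> < 1" and u: "\<bar>u\<bar> \<le> 2" and v: "\<bar>v\<bar> \<le> 2" and r: "\<bar>r\<bar> < 1"
  shows "0 < qK q r u v"
proof -
  have rk: "\<bar>r * q ^ k\<bar> < 1" for k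
    using r q mult_left_le_one_le[of "\<bar>r\<bar>" "\<bar>q\<bar> ^ k"] by (simp add: abs_mult power_abs power_le_one mult.commute)
  have "0 < (\<Prod>k. pmd (r * q ^ k) u v)"
    using pmd_pos[OF rk u v] by (intro prodinf_gt_0 pmd_convergent q u v r)
  moreover have "0 < (\<Prod>k. 1 - r\<^sup>2 * q ^ k)" using r by (intro qpoch_pos q) (simp add: abs_square_less_1)
  ultimately show ?thesis using qK_product[OF q u v r] by (metis zero_less_mult_pos2)
qed

definition qnum :: "real \<Rightarrow> real \<Rightarrow> nat \<Rightarrow> real" where
  "qnum q u k = (1 + q ^ k)\<^sup>2 - u\<^sup>2 * q ^ k"

lemma qnum_convergent:
  assumes q: "\<bar>q\<bar> < 1" and u: "\<bar>u\<bar> \<le> 2"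
  shows "convergent_prod (qnum q u)" "convergent_prod (\<lambda>k. qnum q u (Suc k))"
proof -
  show "convergent_prod (qnum q u)"
  proof (rule convergent_prod_geometric[where c = 10, OF q])
    fix k
    have u2: "u\<^sup>2 \<le> 4" using u by (auto simp: abs_le_square_iff[of _ 2, simplified])
    have s: "\<bar>q ^ k\<bar> \<le> 1" using q by (simp add: power_abs power_le_one)
    have "qnum q u k - 1 = q ^ k * (2 + q ^ k - u\<^sup>2)" unfolding qnum_def by Groebner_Basis.algebra
    also have "\<bar>\<dots>\<bar> \<le> \<bar>q ^ k\<bar> * 10" unfolding abs_mult using s u2 zero_le_power2[of u] by (intro mult_left_mono) linarith+
    finally show "\<bar>qnum q u k - 1\<bar> \<le> 10 * \<bar>q\<bar> ^ k" by (simp add: power_abs)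
  qed
  then show "convergent_prod (\<lambda>k. qnum q u (Suc k))" using convergent_prod_ignore_initial_segment[of "qnum q u" 1] by simp
qed

text \<open>On the diagonal the denominator of the kernel contains the factors \<open>qnum\<close>
  that make up the numerator of \<open>f_N\<close>. This is why the marginal density can be read off
  from the kernel.\<close>

lemma pmd_diagonal: "pmd s u u = (1 - s) * (1 - s) * ((1 + s)\<^sup>2 - u\<^sup>2 * s)"
  unfolding pmd_def by Groebner_Basis.algebra

text \<open>The density of \<open>f_N\<close> relative to the semicircle law is \<open>1 / psi\<close>.\<close>

definition psi :: "real \<Rightarrow> real \<Rightarrow> real" where
  "psi q u = (1 - q) * qK q q u u"

text \<open>At \<open>r = q\<close> and \<open>u = v\<close> the Poisson--Mehler product has
  denominator (q;q) squared times the product of the \<open>qnum\<close> from index 1, by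
  \<open>pmd_diagonal\<close>. Its numerator is the symbol with first entry q squared, that is (q;q)
  / (1 - q); the factor \<open>1 - q\<close> in \<open>psi\<close> compensates this.\<close>

lemma psi_product:
  assumes q: "\<bar>q\<bar> < 1" and u: "\<bar>u\<bar> \<le> 2"
  shows "psi q u * (qpoch_inf q q * (\<Prod>k. qnum q u (Suc k))) = 1"
proof -
  define P where "P = (\<Prod>k. 1 - q * q ^ k)"
  define N where "N = (\<Prod>k. qnum q u (Suc k))"
  have P: "0 < P" unfolding P_def by (rule qpoch_pos[OF q q])
  have c: "convergent_prod (\<lambda>k. 1 - q * q ^ k)" using qpoch_convergent[OF q] .
  have "(\<Prod>k. pmd (q * q ^ k) u u) = (\<Prod>k. ((1 - q * q ^ k) * (1 - q * q ^ k)) * qnum q u (Suc k))"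
    by (simp add: pmd_diagonal qnum_def)
  also have "\<dots> = (P * P) * N" unfolding P_def N_def
    by (simp add: prodinf_mult[symmetric] convergent_prod_mult c qnum_convergent[OF q u])
  finally have 1: "qK q q u u * (P * P * N) = (\<Prod>k. 1 - q\<^sup>2 * q ^ k)" using qK_product[OF q u u q] by simp
  have "(\<Prod>k. 1 - q * q ^ Suc k) = P / (1 - q * q ^ 0)" unfolding P_def
    using q by (intro prodinf_split_head c) auto
  then have "(1 - q) * (\<Prod>k. 1 - q\<^sup>2 * q ^ k) = P" using q by (simp add: power2_eq_square mult.assoc)
  then have "psi q u * (P * P * N) = P" using 1 by (simp add: psi_def mult.assoc)
  then have "psi q u * (P * N) * P = 1 * P" by (simp add: algebra_simps)
  then have "psi q u * (P * N) = 1" using P by (metis less_irrefl mult_cancel_right)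
  then show ?thesis by (simp add: P_def N_def qpoch_inf_def)
qed

lemma psi_pos: "\<bar>q\<bar> < 1 \<Longrightarrow> \<bar>u\<bar> \<le> 2 \<Longrightarrow> 0 < psi q u"
  unfolding psi_def by (auto intro!: mult_pos_pos qK_pos)

section \<open>The densities in the rescaled variable\<close>

lemma q_support_iff:
  assumes q: "\<bar>q\<bar> < 1"
  shows "x \<in> q_support q \<longleftrightarrow> \<bar>sqrt (1 - q) * x\<bar> \<le> 2"
proof -
  have s: "0 < sqrt (1 - q)" using q by simp
  have "\<bar>sqrt (1 - q) * x\<bar> \<le> 2 \<longleftrightarrow> - 2 \<le> sqrt (1 - q) * x \<and> sqrt (1 - q) * x \<le> 2" by linarith
  then show ?thesis using s q by (simp add: q_support_def field_simps)
qed

lemma f_N_eq: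
  assumes q: "\<bar>q\<bar> < 1"
  shows "f_N x q = (if \<bar>sqrt (1 - q) * x\<bar> \<le> 2
     then sqrt (1 - q) * (sqrt (4 - (sqrt (1 - q) * x)\<^sup>2) / (2 * pi * psi q (sqrt (1 - q) * x))) else 0)"
proof (cases "\<bar>sqrt (1 - q) * x\<bar> \<le> 2")
  case True
  define u where "u = sqrt (1 - q) * x"
  have u: "\<bar>u\<bar> \<le> 2" using True by (simp add: u_def)
  have u2: "u\<^sup>2 = (1 - q) * x\<^sup>2" using q by (simp add: u_def power_mult_distrib)
  have u4: "u\<^sup>2 \<le> 4" using u by (auto simp: abs_le_square_iff[of _ 2, simplified])
  define N where "N = (\<Prod>k. qnum q u (Suc k))"
  have "f_N x q = sqrt (1 - q) * qpoch_inf q q / (2 * pi * sqrt (4 - u\<^sup>2)) * prodinf (qnum q u)"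
    using q True q_support_iff[OF q, of x] unfolding f_N_def qnum_def u2 by simp
  also have "\<dots> = sqrt (1 - q) * (sqrt (4 - u\<^sup>2) / (2 * pi * psi q u))"
  \<comment> \<open>The factor of index 0 in the product is \<open>4 - u\<^sup>2\<close>; against
    the root in the denominator it leaves the root in the numerator. At the end points this
    cancellation is impossible, but there both sides are 0, the left one because division by zero
    yields 0.\<close>
  proof (cases "u\<^sup>2 = 4")
    case False
    then have pos: "0 < 4 - u\<^sup>2" using u4 by simp
    have "prodinf (qnum q u) = (4 - u\<^sup>2) * N"
      using prodinf_split_head[OF qnum_convergent(1)[OF q u]] pos by (simp add: qnum_def N_def field_simps)
    moreover have "4 - u\<^sup>2 = sqrt (4 - u\<^sup>2) * sqrt (4 - u\<^sup>2)" using pos by simp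
    moreover have "qpoch_inf q q * N = 1 / psi q u" using psi_product[OF q u] psi_pos[OF q u] by (simp add: N_def field_simps)
    moreover have "S * P / (2 * pi * w) * (w * w * N) = S * (w / (2 * pi * p))" if "P * N = 1 / p" "0 < w" for S P w p :: real
    proof -
      have "S * P / (2 * pi * w) * (w * w * N) = S * w / (2 * pi) * (P * N)" using that(2) by simp
      then show ?thesis unfolding that by simp
    qed
    ultimately show ?thesis using pos by (metis real_sqrt_gt_0_iff)
  qed simp
  finally show ?thesis using True by (simp add: u_def)
next
  case False
  then show ?thesis using q q_support_iff[OF q, of x] by (auto simp: f_N_def)
qed

text \<open>Inside the support all factors \<open>pmd\<close> are positive, so the infinite product
  of quotients splits into the numerator of \<open>f_N\<close> and one denominator, which
  \<open>qK_product\<close> converts into the series.\<close>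

lemma f_CN_eq:
  assumes q: "\<bar>q\<bar> < 1" and y: "\<bar>sqrt (1 - q) * y\<bar> \<le> 2" and r: "\<bar>r\<bar> < 1"
  shows "f_CN x y r q = f_N x q * qK q r (sqrt (1 - q) * x) (sqrt (1 - q) * y)"
proof (cases "\<bar>sqrt (1 - q) * x\<bar> \<le> 2")
  case True
  define u where "u = sqrt (1 - q) * x"
  define v where "v = sqrt (1 - q) * y"
  have u: "\<bar>u\<bar> \<le> 2" and v: "\<bar>v\<bar> \<le> 2" using True y by (auto simp: u_def v_def)
  have u2: "u\<^sup>2 = (1 - q) * x\<^sup>2" "v\<^sup>2 = (1 - q) * y\<^sup>2" "u * v = (1 - q) * (x * y)"
    using q by (simp_all add: u_def v_def power_mult_distrib)
  have rk: "\<bar>r * q ^ k\<bar> < 1" for k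
    using r q mult_left_le_one_le[of "\<bar>r\<bar>" "\<bar>q\<bar> ^ k"] by (simp add: abs_mult power_abs power_le_one mult.commute)
  have qk: "q ^ (2 * k) = q ^ k * q ^ k" for k by (simp add: mult_2 power_add)
  have D: "(1 - r\<^sup>2 * q ^ (2 * k))\<^sup>2 - (1 - q) * r * q ^ k * (1 + r\<^sup>2 * q ^ (2 * k)) * x * y
                   + (1 - q) * r\<^sup>2 * (x\<^sup>2 + y\<^sup>2) * q ^ (2 * k) = pmd (r * q ^ k) u v" for k
  proof -
    have "pmd (r * q ^ k) u v = (1 - (r * q ^ k)\<^sup>2)\<^sup>2 - r * q ^ k * (1 + (r * q ^ k)\<^sup>2) * (u * v) + (r * q ^ k)\<^sup>2 * (u\<^sup>2 + v\<^sup>2)"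
      by (simp add: pmd_def)
    then show ?thesis 
      unfolding u2 qk[of k] by (simp add: power2_eq_square algebra_simps)
  qed
  have pos: "0 < (\<Prod>k. pmd (r * q ^ k) u v)"
    using pmd_pos[OF rk u v] by (intro prodinf_gt_0 pmd_convergent q u v r)
  have "(\<Prod>k. qnum q u k / pmd (r * q ^ k) u v) = prodinf (qnum q u) / (\<Prod>k. pmd (r * q ^ k) u v)"
    using pmd_pos[OF rk u v] by (intro prodinf_divide[symmetric] qnum_convergent pmd_convergent q u v r)
  moreover have "qpoch_inf (r\<^sup>2) q = qK q r u v * (\<Prod>k. pmd (r * q ^ k) u v)"
    unfolding qpoch_inf_def using qK_product[OF q u v r] by simp
  ultimately have "qpoch_inf (r\<^sup>2) q * (\<Prod>k. qnum q u k / pmd (r * q ^ k) u v) = qK q r u v * prodinf (qnum q u)"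
    using pos by (simp add: field_simps)
  moreover have "f_CN x y r q = sqrt (1 - q) * qpoch_inf q q / (2 * pi * sqrt (4 - u\<^sup>2)) * 
      (qpoch_inf (r\<^sup>2) q * (\<Prod>k. qnum q u k / pmd (r * q ^ k) u v))"
    using q True q_support_iff[OF q, of x] unfolding f_CN_def D qnum_def u2 by simp
  moreover have "f_N x q = sqrt (1 - q) * qpoch_inf q q / (2 * pi * sqrt (4 - u\<^sup>2)) * prodinf (qnum q u)"
    using q True q_support_iff[OF q, of x] unfolding f_N_def qnum_def u2 by simp
  ultimately show ?thesis unfolding u_def[symmetric] v_def[symmetric] by (simp add: mult_ac)
next
  case False
  then show ?thesis using q q_support_iff[OF q, of x] by (auto simp: f_CN_def f_N_def)
qed

section \<open>The semicircle law\<close>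

lemma continuous_on_opoly [continuous_intros]: "continuous_on A f \<Longrightarrow> continuous_on A (\<lambda>x. opoly b n (f x))"
  by (induction n rule: induct_nat_012) (auto intro!: continuous_intros)

lemma borel_measurable_opoly [measurable (raw)]:
  assumes "f \<in> borel_measurable M" shows "(\<lambda>x. opoly b n (f x)) \<in> borel_measurable M"
  using measurable_compose[OF assms borel_measurable_continuous_onI[OF continuous_on_opoly[OF continuous_on_id]]] by simp

lemma borel_measurable_qK [measurable (raw)]:
  assumes [measurable]: "f \<in> borel_measurable M" "g \<in> borel_measurable M" "h \<in> borel_measurable M"
  shows "(\<lambda>x. qK q (h x) (f x) (g x)) \<in> borel_measurable M"
  unfolding qK_def qc_def by measurable

text \<open>The algebraic lemma for the functional given by integration; its symmetry hypothesis
  says that the factor \<open>U\<close> may be absorbed into either of the two polynomials.\<close>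

lemma opoly_orthogonal_integral:
  assumes b0: "b 0 = 0" and int: "\<And>n m. integrable M (\<lambda>\<omega>. opoly b n (U \<omega>) * opoly b m (U \<omega>))"
    and mean: "\<And>n. (\<integral>\<omega>. opoly b n (U \<omega>) \<partial>M) = (if n = 0 then 1 else 0)"
  shows "(\<integral>\<omega>. opoly b n (U \<omega>) * opoly b m (U \<omega>) \<partial>M) = (if n = m then \<Prod>k\<in>{1..n}. b k else 0)"
proof (rule opoly_orthogonal[where b = b and G = "\<lambda>n m. \<integral>\<omega>. opoly b n (U \<omega>) * opoly b m (U \<omega>) \<partial>M"])
  show "b 0 = 0" by fact
next
  show "(\<integral>\<omega>. opoly b n (U \<omega>) * opoly b 0 (U \<omega>) \<partial>M) = (if n = 0 then 1 else 0)" for n using mean by simp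
next
  fix n m
  note mx = opoly_mult_x[of b, OF b0]
  have "(\<integral>\<omega>. opoly b (Suc n) (U \<omega>) * opoly b m (U \<omega>) \<partial>M) + b n * (\<integral>\<omega>. opoly b (n - 1) (U \<omega>) * opoly b m (U \<omega>) \<partial>M)
    = (\<integral>\<omega>. (U \<omega> * opoly b n (U \<omega>)) * opoly b m (U \<omega>) \<partial>M)"
    unfolding mx distrib_right mult.assoc
    by (subst Bochner_Integration.integral_add) (auto simp: int intro!: integrable_mult_right)
  also have "\<dots> = (\<integral>\<omega>. opoly b n (U \<omega>) * (U \<omega> * opoly b m (U \<omega>)) \<partial>M)" by (simp add: mult_ac)
  also have "\<dots> = (\<integral>\<omega>. opoly b n (U \<omega>) * opoly b (Suc m) (U \<omega>) \<partial>M) + b m * (\<integral>\<omega>. opoly b n (U \<omega>) * opoly b (m - 1) (U \<omega>) \<partial>M)"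
    unfolding mx distrib_left mult.left_commute[of _ "b m"]
    by (subst Bochner_Integration.integral_add) (auto simp: int intro!: integrable_mult_right)
  finally show "(\<integral>\<omega>. opoly b (Suc n) (U \<omega>) * opoly b m (U \<omega>) \<partial>M) + b n * (\<integral>\<omega>. opoly b (n - 1) (U \<omega>) * opoly b m (U \<omega>) \<partial>M)
    = (\<integral>\<omega>. opoly b n (U \<omega>) * opoly b (Suc m) (U \<omega>) \<partial>M) + b m * (\<integral>\<omega>. opoly b n (U \<omega>) * opoly b (m - 1) (U \<omega>) \<partial>M)" .
qed

lemma (in prob_space) integrable_continuous_bounded:
  fixes f :: "real \<Rightarrow> real"
  assumes "U \<in> borel_measurable M" "AE \<omega> in M. \<bar>U \<omega>\<bar> \<le> R" "continuous_on {-R..R} f" "f \<in> borel_measurable borel"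
  shows "integrable M (\<lambda>\<omega>. f (U \<omega>))"
proof -
  have "bounded (f ` {-R..R})" using assms(3) by (intro compact_imp_bounded compact_continuous_image) auto
  then obtain C where C: "\<forall>x\<in>{-R..R}. \<bar>f x\<bar> \<le> C" by (auto simp: bounded_iff)
  have "AE \<omega> in M. norm (f (U \<omega>)) \<le> C" using assms(2)
    by eventually_elim (use C in \<open>auto simp: abs_le_iff\<close>)
  then show ?thesis by (rule integrable_const_bound) (use assms in measurable)
qed

text \<open>Reproducing property: the bounds on \<open>qc\<close> justify termwise integration, and
  orthogonality keeps only the term of index \<open>j\<close>. The law of \<open>V\<close> enters
  through its polynomial means alone, so the lemma serves both the semicircle law and the unknown
  marginal law of the process.\<close>

lemma (in prob_space) integral_qK:
  assumes q: "\<bar>q\<bar> < 1" and r: "\<bar>r\<bar> < 1" and u: "\<bar>u\<bar> \<le> 2"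
    and [measurable]: "V \<in> borel_measurable M" and V: "AE \<omega> in M. \<bar>V \<omega>\<bar> \<le> 2"
    and mean: "\<And>n. expectation (\<lambda>\<omega>. qh q n (V \<omega>)) = (if n = 0 then 1 else 0)"
  shows "expectation (\<lambda>\<omega>. qK q r u (V \<omega>) * qh q j (V \<omega>)) = r ^ j * qh q j u"
proof -
  have int: "integrable M (\<lambda>\<omega>. qh q n (V \<omega>) * qh q m (V \<omega>))" for n m
    by (rule integrable_continuous_bounded[where f = "\<lambda>x. qh q n x * qh q m x"]) (auto intro!: continuous_intros V)
  have orth: "expectation (\<lambda>\<omega>. qh q n (V \<omega>) * qh q m (V \<omega>)) = (if n = m then qfac q n else 0)" for n m
    unfolding qfac_def by (rule opoly_orthogonal_integral) (use int mean in auto)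
  define B where "B = (real j + 1) * qbound q"
  have B: "AE \<omega> in M. \<bar>qh q j (V \<omega>)\<bar> \<le> B" using V by eventually_elim (auto simp: B_def intro: qh_bound[OF q])
  define f where "f n \<omega> = qc q u (V \<omega>) n * r ^ n * qh q j (V \<omega>)" for n \<omega>
  have [measurable]: "f n \<in> borel_measurable M" for n unfolding f_def qc_def by measurable
  have bd: "AE \<omega> in M. \<bar>f n \<omega>\<bar> \<le> qcbound q * B * ((real n + 1)\<^sup>2 * \<bar>r\<bar> ^ n)" for n
    using V B
  proof eventually_elim
    case (elim \<omega>)
    have "\<bar>f n \<omega>\<bar> = \<bar>qc q u (V \<omega>) n\<bar> * \<bar>r\<bar> ^ n * \<bar>qh q j (V \<omega>)\<bar>" by (simp add: f_def abs_mult power_abs)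
    also have "\<dots> \<le> (qcbound q * (real n + 1)\<^sup>2) * \<bar>r\<bar> ^ n * B"
      using qc_bound[OF q u elim(1), of n] elim(2)
      by (intro mult_mono) (auto intro: order_trans[OF abs_ge_zero])
    finally show ?case by (simp add: mult_ac)
  qed
  have fi: "integrable M (f n)" for n
    using bd[of n] by (intro integrable_const_bound) auto
  have sm: "summable (\<lambda>n. qcbound q * B * ((real n + 1)\<^sup>2 * \<bar>r\<bar> ^ n))" by (intro summable_mult summable_square_power r)
  have sum: "expectation (\<lambda>\<omega>. \<Sum>n. f n \<omega>) = (\<Sum>n. expectation (f n))"
  proof (rule integral_suminf[OF fi])
    have "AE \<omega> in M. \<forall>n. \<bar>f n \<omega>\<bar> \<le> qcbound q * B * ((real n + 1)\<^sup>2 * \<bar>r\<bar> ^ n)" using bd by (simp add: AE_all_countable)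
    then show "AE \<omega> in M. summable (\<lambda>i. norm (f i \<omega>))"
      by eventually_elim (rule summable_comparison_test'[OF sm, of 0], auto)
    show "summable (\<lambda>i. expectation (\<lambda>\<omega>. norm (f i \<omega>)))"
    proof (rule summable_comparison_test'[OF sm, of 0])
      fix n
      have "expectation (\<lambda>\<omega>. \<bar>f n \<omega>\<bar>) \<le> qcbound q * B * ((real n + 1)\<^sup>2 * \<bar>r\<bar> ^ n)"
        using bd[of n] fi by (intro integral_le_const) auto
      then show "norm (expectation (\<lambda>\<omega>. norm (f n \<omega>))) \<le> qcbound q * B * ((real n + 1)\<^sup>2 * \<bar>r\<bar> ^ n)" by simp
    qed
  qed
  have f_int: "expectation (f n) = (if n = j then r ^ j * qh q j u else 0)" for n
  proof -
    have "expectation (f n) = qh q n u / qfac q n * r ^ n * expectation (\<lambda>\<omega>. qh q n (V \<omega>) * qh q j (V \<omega>))"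
      unfolding f_def qc_def by (subst integral_mult_right_zero[symmetric]) (simp add: mult_ac)
    then show ?thesis using orth[of n j] qfac_pos[OF q, of j] by (cases "n = j") auto
  qed
  note sum
  also have "(\<Sum>n. expectation (f n)) = (\<Sum>n. if n = j then r ^ j * qh q j u else 0)" by (simp only: f_int)
  also have "\<dots> = r ^ j * qh q j u" 
    using sums_single[of j "\<lambda>_. r ^ j * qh q j u"] by (rule sums_unique[symmetric])
  also have "expectation (\<lambda>\<omega>. \<Sum>n. f n \<omega>) = expectation (\<lambda>\<omega>. qK q r u (V \<omega>) * qh q j (V \<omega>))"
  proof (rule integral_cong_AE)
    show "AE \<omega> in M. (\<Sum>n. f n \<omega>) = qK q r u (V \<omega>) * qh q j (V \<omega>)" using V
    proof eventually_elim
      case (elim \<omega>)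
      show ?case unfolding f_def qK_def
        by (rule suminf_mult2[symmetric]) (rule summable_norm_cancel[OF qc_summable[OF q u elim r]])
    qed
  qed (auto simp: f_def qc_def)
  finally show ?thesis .
qed


definition scw :: "real \<Rightarrow> real" where
  "scw v = indicator {-2..2} v * sqrt (4 - v\<^sup>2) / (2 * pi)"

definition semicircle :: "real measure" where
  "semicircle = density lborel (\<lambda>v. ennreal (scw v))"

lemma scw_measurable [measurable]: "scw \<in> borel_measurable borel"
  unfolding scw_def by measurable

lemma scw_nonneg: "0 \<le> scw v" for v :: real
  using abs_square_le_1[of "v / 2"] by (auto simp: scw_def indicator_def power_divide abs_le_iff)

text \<open>For \<open>q = 0\<close> the coefficients are 0 at index 0 (as \<open>0 ^ 0 = 1\<close>)
  and 1 afterwards, so these are Chebyshev polynomials of the second kind. The argument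
  \<open>- 2 * cos t\<close> runs upwards from -2 to 2 as \<open>t\<close> goes from 0 to pi, which
  gives the substitution in \<open>semicircle_opoly\<close> the right orientation.\<close>

lemma opoly_chebyshev:
  "qh 0 n (- 2 * cos t) * sin t = (-1) ^ n * sin (real (Suc n) * t)"
proof (induction n rule: induct_nat_012)
  case 1 then show ?case by (simp add: sin_double)
next
  case (ge2 n)
  have "sin (real (Suc (Suc (Suc n))) * t) = 2 * cos t * sin (real (Suc (Suc n)) * t) - sin (real (Suc n) * t)"
  proof -
    have "sin (real (Suc (Suc n)) * t + t) + sin (real (Suc (Suc n)) * t - t) = 2 * cos t * sin (real (Suc (Suc n)) * t)"
      by (simp only: sin_add sin_diff) simp
    then show ?thesis by (simp add: algebra_simps)
  qed
  then have "(-1) ^ Suc (Suc n) * sin (real (Suc (Suc (Suc n))) * t) =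
     - 2 * cos t * ((-1) ^ Suc n * sin (real (Suc (Suc n)) * t)) - (-1) ^ n * sin (real (Suc n) * t)"
    by (simp only: power_Suc) (simp only: algebra_simps minus_one_mult_self)
  also have "\<dots> = qh 0 (Suc (Suc n)) (- 2 * cos t) * sin t"
    unfolding ge2[symmetric] by (simp add: algebra_simps)
  finally show ?case by simp
qed simp

lemma semicircle_opoly: "(\<integral>v. qh 0 n v * scw v \<partial>lborel) = (if n = 0 then 1 else 0)"
proof -
  \<comment> \<open>Antiderivative of half the integrand that results from
    \<open>v = - 2 * cos t\<close> and the product formula for sines. For \<open>n = 0\<close> the
    first cosine is the constant 1, hence the separate case.\<close>
  define F where "F t = (-1) ^ n * ((if n = 0 then t else sin (real n * t) / real n) - sin (real (n + 2) * t) / real (n + 2))" for t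
  have dF: "(F has_vector_derivative ((-1) ^ n * (cos (real n * t) - cos (real (n + 2) * t)))) (at t within A)" for t A
    unfolding F_def has_real_derivative_iff_has_vector_derivative[symmetric]
    by (cases "n = 0") (auto intro!: derivative_eq_intros)
  have "(LBINT t=ereal 0..ereal pi. (2 * sin t) *\<^sub>R (qh 0 n (- 2 * cos t) * sqrt (4 - (- 2 * cos t)\<^sup>2)))
      = (LBINT v=ereal (- 2 * cos 0)..ereal (- 2 * cos pi). qh 0 n v * sqrt (4 - v\<^sup>2))"
    by (rule interval_integral_substitution_finite[where g = "\<lambda>t. - 2 * cos t"])
       (auto intro!: derivative_eq_intros continuous_intros)
  also have "\<dots> = (LBINT v:{-2..2}. qh 0 n v * sqrt (4 - v\<^sup>2))" by (simp add: interval_integral_Icc)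
  finally have 1: "(LBINT v:{-2..2}. qh 0 n v * sqrt (4 - v\<^sup>2)) =
     (LBINT t=ereal 0..ereal pi. (2 * sin t) *\<^sub>R (qh 0 n (- 2 * cos t) * sqrt (4 - (- 2 * cos t)\<^sup>2)))" ..
  also have "\<dots> = (LBINT t=ereal 0..ereal pi. 2 * ((-1) ^ n * (cos (real n * t) - cos (real (n + 2) * t))))"
  proof (rule interval_integral_cong)
    fix t assume "t \<in> einterval (min (ereal 0) (ereal pi)) (max (ereal 0) (ereal pi))"
    then have t: "0 < t" "t < pi" by (auto simp: einterval_def)
    have "4 - (- 2 * cos t)\<^sup>2 = (2 * sin t)\<^sup>2" by (simp add: power_mult_distrib cos_squared_eq)
    then have "sqrt (4 - (- 2 * cos t)\<^sup>2) = 2 * sin t" using sin_gt_zero[OF t] by (simp only: real_sqrt_abs)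
    then have "(2 * sin t) *\<^sub>R (qh 0 n (- 2 * cos t) * sqrt (4 - (- 2 * cos t)\<^sup>2)) = 4 * (sin t * (qh 0 n (- 2 * cos t) * sin t))" by simp
    also have "\<dots> = (-1) ^ n * (4 * (sin t * sin (real (Suc n) * t)))" unfolding opoly_chebyshev by simp
    also have "4 * (sin t * sin (real (Suc n) * t)) = 2 * (cos (real (Suc n) * t - t) - cos (real (Suc n) * t + t))"
      by (simp only: cos_diff cos_add) simp
    also have "real (Suc n) * t - t = real n * t" by (simp add: algebra_simps)
    also have "real (Suc n) * t + t = real (n + 2) * t" by (simp add: algebra_simps)
    finally show "(2 * sin t) *\<^sub>R (qh 0 n (- 2 * cos t) * sqrt (4 - (- 2 * cos t)\<^sup>2)) = 2 * ((-1) ^ n * (cos (real n * t) - cos (real (n + 2) * t)))"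
      by simp
  qed
  also have "\<dots> = 2 * (LBINT t=ereal 0..ereal pi. (-1) ^ n * (cos (real n * t) - cos (real (n + 2) * t)))"
    by (rule interval_lebesgue_integral_mult_right)
  also have "(LBINT t=ereal 0..ereal pi. (-1) ^ n * (cos (real n * t) - cos (real (n + 2) * t))) = F pi - F 0"
    by (rule interval_integral_FTC_finite[OF _ dF]) (auto intro!: continuous_intros)
  also have "F pi - F 0 = (if n = 0 then pi else 0)"
    using sin_npi[of n] sin_npi[of "n + 2"] by (auto simp: F_def simp del: sin_npi of_nat_add)
  finally have "(LBINT v:{-2..2}. qh 0 n v * sqrt (4 - v\<^sup>2)) / (2 * pi) = (if n = 0 then 1 else 0)" by simp
  moreover have "(LBINT v:{-2..2}. qh 0 n v * sqrt (4 - v\<^sup>2)) / (2 * pi) = (\<integral>v. qh 0 n v * scw v \<partial>lborel)"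
    unfolding set_lebesgue_integral_def scw_def
    by (subst Bochner_Integration.integral_divide_zero[symmetric]) (simp add: mult_ac)
  ultimately show ?thesis by simp
qed

lemma integral_semicircle:
  "f \<in> borel_measurable borel \<Longrightarrow> (\<integral>v. f v \<partial>semicircle) = (\<integral>v. f v * scw v \<partial>lborel)" for f :: "real \<Rightarrow> real"
  unfolding semicircle_def using scw_nonneg
  by (subst integral_density) (auto simp: mult_ac)

lemma AE_semicircle: "AE v in semicircle. \<bar>v\<bar> \<le> 2"
  unfolding semicircle_def by (subst AE_density) (auto intro!: AE_I2 simp: scw_def indicator_def split: if_splits)

lemma prob_space_semicircle: "prob_space semicircle"
proof -
  have 1: "(\<integral>v. scw v \<partial>lborel) = 1" using semicircle_opoly[of 0] by simp
  then have "integrable lborel scw" using not_integrable_integral_eq by fastforce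
  then have "(\<integral>\<^sup>+v. scw v \<partial>lborel) = 1" using scw_nonneg 1 by (subst nn_integral_eq_integral) auto
  then show ?thesis unfolding semicircle_def by (intro prob_spaceI) (simp add: emeasure_density cong: nn_integral_cong)
qed

lemma semicircle_mean: "(\<integral>v. qh 0 n v \<partial>semicircle) = (if n = 0 then 1 else 0)"
  by (subst integral_semicircle) (auto simp: semicircle_opoly)

section \<open>Uniform bounds, continuity and concentration of the kernel\<close>

definition qKbound :: "real \<Rightarrow> real \<Rightarrow> real" where
  "qKbound q r = (\<Sum>n. qcbound q * ((real n + 1)\<^sup>2 * \<bar>r\<bar> ^ n))"

lemma qK_bound:
  assumes q: "\<bar>q\<bar> < 1" and u: "\<bar>u\<bar> \<le> 2" and v: "\<bar>v\<bar> \<le> 2" and r: "\<bar>r\<bar> \<le> s" "s < 1"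
  shows "\<bar>qK q r u v\<bar> \<le> qKbound q s"
proof -
  have r1: "\<bar>r\<bar> < 1" and s: "\<bar>s\<bar> < 1" "\<bar>r\<bar> \<le> \<bar>s\<bar>" using r by auto
  have "\<bar>qK q r u v\<bar> \<le> (\<Sum>n. norm (qc q u v n * r ^ n))" unfolding qK_def real_norm_def[symmetric]
    by (rule summable_norm[OF qc_summable[OF q u v r1]])
  also have "\<dots> \<le> qKbound q s" unfolding qKbound_def
  proof (intro suminf_le qc_summable q u v r1 summable_mult summable_square_power s)
    fix n
    have "\<bar>qc q u v n\<bar> * \<bar>r\<bar> ^ n \<le> (qcbound q * (real n + 1)\<^sup>2) * \<bar>s\<bar> ^ n"
      using qc_bound[OF q u v, of n] s by (intro mult_mono power_mono) (auto intro: order_trans[OF abs_ge_zero])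
    then show "norm (qc q u v n * r ^ n) \<le> qcbound q * ((real n + 1)\<^sup>2 * \<bar>s\<bar> ^ n)"
      by (simp add: abs_mult power_abs mult.assoc)
  qed
  finally show ?thesis .
qed

lemma continuous_on_qK:
  assumes q: "\<bar>q\<bar> < 1" and f: "continuous_on A f" "\<And>x. x \<in> A \<Longrightarrow> \<bar>f x\<bar> \<le> 2"
    and g: "continuous_on A g" "\<And>x. x \<in> A \<Longrightarrow> \<bar>g x\<bar> \<le> 2"
    and h: "continuous_on A h" "\<And>x. x \<in> A \<Longrightarrow> \<bar>h x\<bar> \<le> s" "s < 1"
  shows "continuous_on A (\<lambda>x. qK q (h x) (f x) (g x))"
proof (cases "A = {}")
  case False
  then have s: "0 \<le> s" using h(2) abs_ge_zero order_trans by blast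
  have "uniform_limit A (\<lambda>n x. \<Sum>i<n. qc q (f x) (g x) i * h x ^ i) (\<lambda>x. \<Sum>i. qc q (f x) (g x) i * h x ^ i) sequentially"
  proof (rule Weierstrass_m_test)
    show "summable (\<lambda>n. qcbound q * ((real n + 1)\<^sup>2 * \<bar>s\<bar> ^ n))" using s h by (intro summable_mult summable_square_power) auto
    fix n x assume x: "x \<in> A"
    have "\<bar>qc q (f x) (g x) n\<bar> * \<bar>h x\<bar> ^ n \<le> (qcbound q * (real n + 1)\<^sup>2) * \<bar>s\<bar> ^ n"
      using qc_bound[OF q f(2)[OF x] g(2)[OF x], of n] h(2)[OF x] s
      by (intro mult_mono power_mono) (auto intro: order_trans[OF abs_ge_zero])
    then show "norm (qc q (f x) (g x) n * h x ^ n) \<le> qcbound q * ((real n + 1)\<^sup>2 * \<bar>s\<bar> ^ n)"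
      by (simp add: abs_mult power_abs mult.assoc)
  qed
  then show ?thesis unfolding qK_def
    by (rule uniform_limit_theorem[rotated])
       (auto simp: qc_def intro!: always_eventually continuous_intros f g h less_imp_neq[OF qfac_pos[OF q], THEN not_sym] simp del: qfac_simps)
qed auto

text \<open>Approximation of the identity at \<open>r \<rightarrow> 1\<close>: Korovkin's argument for the Poisson kernel
  \<open>qK 0 r u\<close> of the semicircle law, whose first two moments are explicit.\<close>

lemma qK_0_eq:
  assumes "\<bar>u\<bar> \<le> 2" "\<bar>v\<bar> \<le> 2" "\<bar>r\<bar> < 1"
  shows "pmd r u v * qK 0 r u v = 1 - r\<^sup>2"
  using qK_functional_equation[OF _ qc_summable, of 0 u v r] assms by simp

text \<open>Separates the singular behaviour as \<open>r\<close> tends to 1: the first factor is the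
  Poisson kernel, which concentrates at \<open>v = u\<close>, and the second is jointly continuous
  up to \<open>r = 1\<close>, where its value on the diagonal is \<open>psi q u\<close>.\<close>

lemma qK_split:
  assumes q: "\<bar>q\<bar> < 1" and "\<bar>u\<bar> \<le> 2" "\<bar>v\<bar> \<le> 2" "\<bar>r\<bar> < 1"
  shows "qK q r u v = qK 0 r u v * ((1 - q * r\<^sup>2) * qK q (q * r) u v)"
proof -
  have "pmd r u v * qK q r u v = (1 - r\<^sup>2) * ((1 - q * r\<^sup>2) * qK q (q * r) u v)"
    using qK_functional_equation[OF q qc_summable[OF q]] assms by simp
  also have "\<dots> = pmd r u v * (qK 0 r u v * ((1 - q * r\<^sup>2) * qK q (q * r) u v))"
    using qK_0_eq[of u v r] assms by (simp add: mult.assoc)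
  finally show ?thesis using pmd_pos[of r u v] assms by simp
qed

text \<open>\<open>(v - u)\<^sup>2\<close> is a combination of the Chebyshev polynomials of degree
  at most 2, which the kernel multiplies by powers of \<open>r\<close>. The resulting second moment
  about \<open>u\<close> tends to 0 as \<open>r\<close> tends to 1, which is all that concentration
  requires.\<close>

lemma semicircle_variance:
  assumes u: "\<bar>u\<bar> \<le> 2" and r: "\<bar>r\<bar> < 1"
  shows "(\<integral>v. qK 0 r u v * (v - u)\<^sup>2 \<partial>semicircle) = (1 - r)\<^sup>2 * u\<^sup>2 + (1 - r\<^sup>2)"
    and "(\<integral>v. qK 0 r u v \<partial>semicircle) = 1"
    and "integrable semicircle (\<lambda>v. qK 0 r u v)"
    and "integrable semicircle (\<lambda>v. qK 0 r u v * (v - u)\<^sup>2)"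
proof -
  interpret prob_space semicircle by (rule prob_space_semicircle)
  have [measurable_cong]: "sets semicircle = sets borel" by (simp add: semicircle_def)
  have I: "expectation (\<lambda>v. qK 0 r u v * qh 0 j v) = r ^ j * qh 0 j u" for j
    using integral_qK[of 0 r u "\<lambda>v. v" j] u r AE_semicircle semicircle_mean by simp
  have int: "integrable semicircle (\<lambda>v. qK 0 r u v * p v)" if p: "continuous_on {-2..2} p" and [measurable]: "p \<in> borel_measurable borel" for p
  proof -
    have "bounded (p ` {-2..2})" using p by (intro compact_imp_bounded compact_continuous_image) auto
    then obtain C where C: "\<forall>x\<in>{-2..2}. \<bar>p x\<bar> \<le> C" by (auto simp: bounded_iff)
    show ?thesis
    proof (rule integrable_const_bound)
      show "AE v in semicircle. norm (qK 0 r u v * p v) \<le> qKbound 0 \<bar>r\<bar> * C"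
        using AE_semicircle
      proof eventually_elim
        case (elim v)
        have "\<bar>p v\<bar> \<le> C" using C elim by (auto simp: abs_le_iff)
        then show ?case unfolding real_norm_def abs_mult using qK_bound[of 0 u v r "\<bar>r\<bar>"] u elim r
          by (intro mult_mono) (auto intro: order_trans[OF abs_ge_zero])
      qed
    qed measurable
  qed
  show "integrable semicircle (\<lambda>v. qK 0 r u v)" using int[of "\<lambda>_. 1"] by simp
  show "expectation (\<lambda>v. qK 0 r u v) = 1" using I[of 0] by simp
  show "integrable semicircle (\<lambda>v. qK 0 r u v * (v - u)\<^sup>2)" by (rule int) (auto intro!: continuous_intros)
  have "(\<lambda>v. qK 0 r u v * (v - u)\<^sup>2) = (\<lambda>v. (qK 0 r u v * qh 0 2 v - 2 * u * (qK 0 r u v * qh 0 1 v)) + (1 + u\<^sup>2) * (qK 0 r u v * qh 0 0 v))"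
    by (auto simp: numeral_2_eq_2 power2_eq_square algebra_simps)
  then have "expectation (\<lambda>v. qK 0 r u v * (v - u)\<^sup>2)
    = (expectation (\<lambda>v. qK 0 r u v * qh 0 2 v) - 2 * u * expectation (\<lambda>v. qK 0 r u v * qh 0 1 v)) + (1 + u\<^sup>2) * expectation (\<lambda>v. qK 0 r u v * qh 0 0 v)"
    by (simp only:) (subst Bochner_Integration.integral_add Bochner_Integration.integral_diff,
       (intro Bochner_Integration.integrable_diff integrable_mult_right int continuous_intros; measurable)+,
       subst Bochner_Integration.integral_diff, (intro integrable_mult_right int continuous_intros; measurable)+, simp)
  also have "\<dots> = (1 - r)\<^sup>2 * u\<^sup>2 + (1 - r\<^sup>2)"
    unfolding I by (simp add: numeral_2_eq_2 power2_eq_square algebra_simps)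
  finally show "expectation (\<lambda>v. qK 0 r u v * (v - u)\<^sup>2) = (1 - r)\<^sup>2 * u\<^sup>2 + (1 - r\<^sup>2)" .
qed

section \<open>Recovering a law from its polynomial means\<close>

context prob_space
begin

context
  fixes q :: real and U :: "'a \<Rightarrow> real"
  assumes q: "\<bar>q\<bar> < 1" and U [measurable]: "U \<in> borel_measurable M" and U2: "AE \<omega> in M. \<bar>U \<omega>\<bar> \<le> 2"
    and mean: "\<And>n. expectation (\<lambda>\<omega>. qh q n (U \<omega>)) = (if n = 0 then 1 else 0)"
begin

text \<open>Integrate over \<open>U\<close> first: for fixed \<open>v\<close> the mean of
  \<open>qK q r (U \<omega>) v\<close> is 1, by the reproducing property in degree 0. The value
  therefore does not depend on \<open>r\<close>.\<close>

lemma kernel_smoothing_integral: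
  assumes r: "0 \<le> r" "r < 1" and g: "continuous_on {-2..2} g" and [measurable]: "g \<in> borel_measurable borel"
  shows "expectation (\<lambda>\<omega>. \<integral>v. qK q r (U \<omega>) v * g v \<partial>semicircle) = (\<integral>v. g v \<partial>semicircle)"
proof -
  interpret S: prob_space semicircle by (rule prob_space_semicircle)
  interpret P: pair_sigma_finite M semicircle ..
  have [measurable_cong]: "sets semicircle = sets borel" by (simp add: semicircle_def)
  \<comment> \<open>Clamping to the interval from -2 to 2 changes nothing almost everywhere and
    makes the integrand bounded everywhere, so that Fubini's theorem applies.\<close>
  define cl where "cl x = max (-2) (min 2 x)" for x :: real
  have cl: "\<bar>cl x\<bar> \<le> 2" for x by (auto simp: cl_def)
  have clid: "\<bar>x\<bar> \<le> 2 \<Longrightarrow> cl x = x" for x by (auto simp: cl_def)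
  have [measurable]: "cl \<in> borel_measurable borel" unfolding cl_def by measurable
  have "bounded (g ` {-2..2})" using g by (intro compact_imp_bounded compact_continuous_image) auto
  then obtain C where C: "\<forall>x\<in>{-2..2}. \<bar>g x\<bar> \<le> C" by (auto simp: bounded_iff)
  have gC: "\<bar>g (cl v)\<bar> \<le> C" for v using C cl[of v] by (auto simp: abs_le_iff)
  have K: "\<bar>qK q r (cl u) (cl v) * g (cl v)\<bar> \<le> qKbound q r * C" for u v
    unfolding abs_mult using qK_bound[OF q cl[of u] cl[of v], of r r] r gC[of v]
    by (intro mult_mono) (auto intro: order_trans[OF abs_ge_zero])
  have i: "integrable (M \<Otimes>\<^sub>M semicircle) (\<lambda>(\<omega>, v). qK q r (cl (U \<omega>)) (cl v) * g (cl v))"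
  proof -
    interpret MS: pair_prob_space M semicircle ..
    show ?thesis by (rule MS.integrable_const_bound[where B = "qKbound q r * C"]) (use K in auto)
  qed
  have "expectation (\<lambda>\<omega>. \<integral>v. qK q r (U \<omega>) v * g v \<partial>semicircle) = expectation (\<lambda>\<omega>. \<integral>v. qK q r (cl (U \<omega>)) (cl v) * g (cl v) \<partial>semicircle)"
    apply (rule integral_cong_AE, measurable)
    using U2
    apply eventually_elim
    apply (rule integral_cong_AE, measurable)
    using AE_semicircle
    apply eventually_elim
    apply (simp add: clid)
    done
  also have "\<dots> = (\<integral>v. expectation (\<lambda>\<omega>. qK q r (cl (U \<omega>)) (cl v) * g (cl v)) \<partial>semicircle)"
    using P.Fubini_integral[OF i] by simp
  also have "\<dots> = (\<integral>v. g v \<partial>semicircle)"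
  proof (rule integral_cong_AE)
    show "AE v in semicircle. expectation (\<lambda>\<omega>. qK q r (cl (U \<omega>)) (cl v) * g (cl v)) = g v"
      using AE_semicircle
    proof eventually_elim
      case (elim v)
      have "expectation (\<lambda>\<omega>. qK q r (cl (U \<omega>)) (cl v) * g (cl v)) = expectation (\<lambda>\<omega>. qK q r v (U \<omega>)) * g v"
        unfolding Bochner_Integration.integral_mult_left_zero[symmetric]
        by (rule integral_cong_AE, measurable) (use U2 in eventually_elim, simp add: clid elim qK_def qc_def mult.commute[of "qh q _ v"])
      then show ?case using integral_qK[OF q _ elim U U2 mean, of r 0] r by simp
    qed
  qed measurable
  finally show ?thesis .
qed

lemma kernel_smoothing_limit:
  assumes u: "\<bar>u\<bar> \<le> 2" and g: "continuous_on {-2..2} g" and [measurable]: "g \<in> borel_measurable borel"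
    and C: "\<forall>x\<in>{-2..2}. \<bar>g x\<bar> \<le> C"
  shows "\<And>r. 0 \<le> r \<Longrightarrow> r < 1 \<Longrightarrow> \<bar>\<integral>v. qK q r u v * g v \<partial>semicircle\<bar> \<le> 2 * qKbound q \<bar>q\<bar> * C"
    and "((\<lambda>r. \<integral>v. qK q r u v * g v \<partial>semicircle) \<longlongrightarrow> psi q u * g u) (at_left 1)"
proof -
  interpret S: prob_space semicircle by (rule prob_space_semicircle)
  have [measurable_cong]: "sets semicircle = sets borel" by (simp add: semicircle_def)
  define F where "F r v = (1 - q * r\<^sup>2) * qK q (q * r) u v * g v" for r v
  have [measurable]: "F r \<in> borel_measurable borel" for r unfolding F_def by measurable
  define B where "B = 2 * qKbound q \<bar>q\<bar> * C"
  have qr: "\<bar>q * r\<bar> \<le> \<bar>q\<bar>" if "0 \<le> r" "r \<le> 1" for r using that by (simp add: abs_mult mult_left_le)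
  have FB: "\<bar>F r v\<bar> \<le> B" if "0 \<le> r" "r \<le> 1" "\<bar>v\<bar> \<le> 2" for r v
  proof -
    have "\<bar>q * r\<^sup>2\<bar> \<le> 1 * 1" unfolding abs_mult using q that by (intro mult_mono) (auto simp: power_le_one)
    then have "\<bar>1 - q * r\<^sup>2\<bar> \<le> 2" by linarith
    moreover have "\<bar>qK q (q * r) u v\<bar> \<le> qKbound q \<bar>q\<bar>" by (rule qK_bound[OF q u that(3) qr q]) (use that in auto)
    moreover have "\<bar>g v\<bar> \<le> C" using C that by (auto simp: abs_le_iff)
    ultimately show ?thesis unfolding F_def B_def abs_mult by (intro mult_mono) (auto intro: order_trans[OF abs_ge_zero])
  qed
  have int: "integrable semicircle (\<lambda>v. qK 0 r u v * F s v)" if r: "0 \<le> r" "r < 1" and s: "0 \<le> s" "s \<le> 1" for r s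
  proof (rule S.integrable_const_bound)
    show "AE v in semicircle. norm (qK 0 r u v * F s v) \<le> qKbound 0 r * B"
      using AE_semicircle
    proof eventually_elim
      case (elim v)
      show ?case unfolding real_norm_def abs_mult using qK_bound[of 0 u v r r] u elim r FB[OF s elim]
        by (intro mult_mono) (auto intro: order_trans[OF abs_ge_zero])
    qed
  qed measurable
  have eq: "(\<integral>v. qK q r u v * g v \<partial>semicircle) = (\<integral>v. qK 0 r u v * F r v \<partial>semicircle)" if r: "0 \<le> r" "r < 1" for r
  proof (rule integral_cong_AE)
    show "AE v in semicircle. qK q r u v * g v = qK 0 r u v * F r v"
      using AE_semicircle
    proof eventually_elim
      case (elim v)
      have "qK q r u v = qK 0 r u v * ((1 - q * r\<^sup>2) * qK q (q * r) u v)" by (rule qK_split[OF q u elim]) (use r in auto)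
      then show ?case by (simp add: F_def mult.assoc)
    qed
  qed measurable
  { fix r :: real assume r: "0 \<le> r" "r < 1"
    have "\<bar>\<integral>v. qK 0 r u v * F r v \<partial>semicircle\<bar> \<le> (\<integral>v. \<bar>qK 0 r u v * F r v\<bar> \<partial>semicircle)" by (rule integral_abs_bound)
    also have "\<dots> \<le> (\<integral>v. qK 0 r u v * B \<partial>semicircle)"
    proof (rule integral_mono_AE)
      show "AE v in semicircle. \<bar>qK 0 r u v * F r v\<bar> \<le> qK 0 r u v * B"
        using AE_semicircle
      proof eventually_elim
        case (elim v)
        then show ?case unfolding abs_mult using qK_pos[of 0 u v r] u r FB[of r v] by (simp add: mult_left_mono)
      qed
    qed (use int[of r r] r semicircle_variance(3)[OF u, of r] in auto)
    also have "\<dots> = B" using semicircle_variance(2)[OF u, of r] r by simp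
    finally show "\<bar>\<integral>v. qK q r u v * g v \<partial>semicircle\<bar> \<le> 2 * qKbound q \<bar>q\<bar> * C" unfolding eq[OF r] B_def . }
  have cont: "continuous_on ({0..1} \<times> {-2..2}) (\<lambda>(r, v). F r v)"
    unfolding F_def split_beta
    by (intro continuous_intros continuous_on_qK[OF q, where s = "\<bar>q\<bar>"] continuous_on_compose2[OF g])
       (use u q qr in \<open>auto simp: abs_le_iff\<close>)
  show "((\<lambda>r. \<integral>v. qK q r u v * g v \<partial>semicircle) \<longlongrightarrow> psi q u * g u) (at_left 1)"
  proof (rule tendstoI)
    fix e :: real assume e: "0 < e"
    obtain d where d: "0 < d" "\<And>x. x \<in> {0..1} \<times> {-2..2} \<Longrightarrow> dist x (1, u) < d \<Longrightarrow> dist ((\<lambda>(r, v). F r v) x) ((\<lambda>(r, v). F r v) (1, u)) < e / 2"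
      using cont[unfolded continuous_on_iff, rule_format, of "(1, u)" "e / 2"] u e by (auto simp: abs_le_iff)
    \<comment> \<open>Chosen so that, at distance at least \<open>d / 2\<close> from
      \<open>u\<close>, the crude bound \<open>2 * B\<close> on the oscillation is at most
      \<open>D * (v - u)\<^sup>2\<close>; the second moment of the Poisson kernel then controls the
      tail.\<close>
    define D where "D = 2 * B / (d / 2)\<^sup>2"
    have B0: "0 \<le> B" using FB[of 0 0] by auto
    have D0: "0 \<le> D" using B0 by (simp add: D_def)
    have main: "\<bar>F r v - F 1 u\<bar> \<le> e / 2 + D * (v - u)\<^sup>2" if r: "0 \<le> r" "r < 1" "1 - r < d / 2" and v: "\<bar>v\<bar> \<le> 2" for r v
    proof (cases "\<bar>v - u\<bar> < d / 2")
      case True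
      have "dist (r, v) (1, u) \<le> \<bar>r - 1\<bar> + \<bar>v - u\<bar>" unfolding dist_prod_def dist_real_def
        by (rule order_trans[OF sqrt_sum_squares_le_sum_abs]) simp
      also have "\<dots> < d" using True r by linarith
      finally have "\<bar>F r v - F 1 u\<bar> < e / 2" using d(2)[of "(r, v)"] r v by (auto simp: dist_real_def abs_le_iff)
      then show ?thesis using D0 by (smt (verit) mult_nonneg_nonneg zero_le_power2)
    next
      case False
      then have "(d / 2)\<^sup>2 \<le> (v - u)\<^sup>2" using d(1) by (metis abs_le_square_iff abs_of_pos half_gt_zero linorder_not_less)
      then have "D * (d / 2)\<^sup>2 \<le> D * (v - u)\<^sup>2" using D0 by (rule mult_left_mono)
      then have "2 * B \<le> D * (v - u)\<^sup>2" using d by (simp add: D_def)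
      moreover have "\<bar>F r v - F 1 u\<bar> \<le> 2 * B" using FB[of r v] FB[of 1 u] r v u by linarith
      ultimately show ?thesis using e by linarith
    qed
    have lim: "((\<lambda>r. e / 2 + D * ((1 - r)\<^sup>2 * u\<^sup>2 + (1 - r\<^sup>2))) \<longlongrightarrow> e / 2 + D * ((1 - 1)\<^sup>2 * u\<^sup>2 + (1 - 1\<^sup>2))) (at_left 1)"
      by (intro tendsto_intros)
    have "\<forall>\<^sub>F r in at_left 1. e / 2 + D * ((1 - r)\<^sup>2 * u\<^sup>2 + (1 - r\<^sup>2)) < e"
      by (rule order_tendstoD(2)[OF lim]) (use e in auto)
    moreover have "\<forall>\<^sub>F r in at_left (1::real). max 0 (1 - d / 2) < r \<and> r < 1"
      using d(1) by (intro eventually_at_leftI[of "max 0 (1 - d / 2)"]) auto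
    ultimately show "\<forall>\<^sub>F r in at_left 1. dist (\<integral>v. qK q r u v * g v \<partial>semicircle) (psi q u * g u) < e"
    proof eventually_elim
      case (elim r)
      then have r: "0 \<le> r" "r < 1" "1 - r < d / 2" "\<bar>r\<bar> < 1" by auto
      have k: "integrable semicircle (\<lambda>v. qK 0 r u v * F 1 u)" using semicircle_variance(3)[OF u r(4)] by simp
      have "(\<integral>v. qK 0 r u v * F r v \<partial>semicircle) - F 1 u = (\<integral>v. qK 0 r u v * F r v \<partial>semicircle) - (\<integral>v. qK 0 r u v * F 1 u \<partial>semicircle)"
        using semicircle_variance(2)[OF u r(4)] by simp
      also have "\<dots> = (\<integral>v. qK 0 r u v * F r v - qK 0 r u v * F 1 u \<partial>semicircle)"
        by (rule Bochner_Integration.integral_diff[symmetric]) (use int[of r r] r k in auto)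
      finally have "\<bar>(\<integral>v. qK 0 r u v * F r v \<partial>semicircle) - F 1 u\<bar> = \<bar>\<integral>v. qK 0 r u v * F r v - qK 0 r u v * F 1 u \<partial>semicircle\<bar>" by (rule arg_cong)
      also have "\<dots> \<le> (\<integral>v. \<bar>qK 0 r u v * F r v - qK 0 r u v * F 1 u\<bar> \<partial>semicircle)" by (rule integral_abs_bound)
      also have "\<dots> \<le> (\<integral>v. e / 2 * qK 0 r u v + D * (qK 0 r u v * (v - u)\<^sup>2) \<partial>semicircle)"
      proof (rule integral_mono_AE)
        show "AE v in semicircle. \<bar>qK 0 r u v * F r v - qK 0 r u v * F 1 u\<bar> \<le> e / 2 * qK 0 r u v + D * (qK 0 r u v * (v - u)\<^sup>2)"
          using AE_semicircle
        proof eventually_elim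
          case (elim v)
          have kp: "0 < qK 0 r u v" using qK_pos[of 0 u v r] u r elim by simp
          have "\<bar>qK 0 r u v * F r v - qK 0 r u v * F 1 u\<bar> = qK 0 r u v * \<bar>F r v - F 1 u\<bar>"
            using kp by (simp add: right_diff_distrib[symmetric] abs_mult)
          also have "\<dots> \<le> qK 0 r u v * (e / 2 + D * (v - u)\<^sup>2)" using kp main[OF r(1-3) elim] by (intro mult_left_mono) auto
          finally show ?case by (simp add: algebra_simps)
        qed
      qed (use int[of r r] r k semicircle_variance(3,4)[OF u r(4)] in auto)
      also have "\<dots> = e / 2 + D * ((1 - r)\<^sup>2 * u\<^sup>2 + (1 - r\<^sup>2))"
        using semicircle_variance[OF u r(4)] by simp
      finally show ?case using elim unfolding eq[OF r(1,2)] by (simp add: dist_real_def F_def psi_def)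
    qed
  qed
qed

text \<open>The smoothed expectation is the same for all \<open>r\<close>, while under the
  expectation it converges to \<open>psi q (U \<omega>) * g (U \<omega>)\<close> as \<open>r\<close>
  tends to 1. Hence \<open>psi q\<close> times the law of \<open>U\<close> is the semicircle law,
  which identifies the law without solving a moment problem.\<close>

lemma law_functional:
  assumes g: "continuous_on {-2..2} g" and [measurable]: "g \<in> borel_measurable borel"
  shows "expectation (\<lambda>\<omega>. psi q (U \<omega>) * g (U \<omega>)) = (\<integral>v. g v \<partial>semicircle)"
proof -
  have [measurable_cong]: "sets semicircle = sets borel" by (simp add: semicircle_def)
  interpret S: prob_space semicircle by (rule prob_space_semicircle)
  have "bounded (g ` {-2..2})" using g by (intro compact_imp_bounded compact_continuous_image) auto
  then obtain C where C: "\<forall>x\<in>{-2..2}. \<bar>g x\<bar> \<le> C" by (auto simp: bounded_iff)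
  define r where "r n = 1 - 1 / (real n + 1)" for n
  have r: "0 \<le> r n" "r n < 1" for n by (auto simp: r_def field_simps)
  have "r \<longlonglongrightarrow> 1" unfolding r_def by real_asymp
  then have rl: "filterlim r (at_left 1) sequentially" using r by (auto simp: filterlim_at less_imp_neq)
  have "(\<lambda>n. expectation (\<lambda>\<omega>. \<integral>v. qK q (r n) (U \<omega>) v * g v \<partial>semicircle)) \<longlonglongrightarrow> expectation (\<lambda>\<omega>. psi q (U \<omega>) * g (U \<omega>))"
  proof (rule integral_dominated_convergence[where w = "\<lambda>_. 2 * qKbound q \<bar>q\<bar> * C"])
    show "AE \<omega> in M. (\<lambda>n. \<integral>v. qK q (r n) (U \<omega>) v * g v \<partial>semicircle) \<longlonglongrightarrow> psi q (U \<omega>) * g (U \<omega>)"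
      using U2
    proof eventually_elim
      case (elim \<omega>)
      show ?case by (rule filterlim_compose[OF kernel_smoothing_limit(2)[OF elim g _ C] rl]) measurable
    qed
    show "AE \<omega> in M. norm (\<integral>v. qK q (r n) (U \<omega>) v * g v \<partial>semicircle) \<le> 2 * qKbound q \<bar>q\<bar> * C" for n
      using U2
    proof eventually_elim
      case (elim \<omega>)
      show ?case using kernel_smoothing_limit(1)[OF elim g _ C r] by simp
    qed
  qed (unfold psi_def, measurable)
  then show ?thesis by (simp add: kernel_smoothing_integral[OF r g assms(2)] LIMSEQ_const_iff)
qed

end
end

section \<open>The \<open>q\<close>-normal law\<close>

text \<open>The \<open>q\<close>-integer, written as a sum instead of a quotient so that it also
  covers \<open>q = 1\<close>.\<close>

definition qint :: "real \<Rightarrow> nat \<Rightarrow> real" where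
  "qint q n = (\<Sum>i<n. q ^ i)"

lemma qint_simps [simp]: "qint q 0 = 0" "qint q (Suc n) = qint q n + q ^ n"
  by (simp_all add: qint_def)

lemma qint_Suc': "qint q (Suc n) = 1 + q * qint q n"
  unfolding qint_def sum.lessThan_Suc_shift sum_distrib_left by simp

lemma qint_geometric: "(1 - q) * qint q n = 1 - q ^ n"
proof (induction n)
  case (Suc n)
  then show ?case by (simp only: qint_simps distrib_left) (simp add: algebra_simps)
qed simp

lemma qh_scale:
  assumes "q < 1"
  shows "qh q n (sqrt (1 - q) * x) = sqrt (1 - q) ^ n * opoly (qint q) n x"
  using opoly_scale[of "sqrt (1 - q)" "qint q" n x] assms by (simp add: qint_geometric)

lemma f_N_eq_semicircle:
  assumes q: "\<bar>q\<bar> < 1"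
  shows "f_N x q = sqrt (1 - q) * (scw (sqrt (1 - q) * x) / psi q (sqrt (1 - q) * x))"
  unfolding f_N_eq[OF q] scw_def by (auto simp: indicator_def abs_le_iff split: if_splits)

lemma f_N_measurable [measurable]:
  assumes q: "\<bar>q\<bar> < 1" shows "(\<lambda>x. f_N x q) \<in> borel_measurable borel"
  unfolding f_N_eq_semicircle[OF q] psi_def by measurable

lemma f_N_nonneg:
  assumes q: "\<bar>q\<bar> < 1" shows "0 \<le> f_N x q"
proof (cases "\<bar>sqrt (1 - q) * x\<bar> \<le> 2")
  case True
  then show ?thesis unfolding f_N_eq_semicircle[OF q] using q scw_nonneg psi_pos[OF q True]
    by (intro mult_nonneg_nonneg divide_nonneg_pos) auto
qed (simp add: f_N_eq[OF q])

context prob_space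
begin

text \<open>By orthogonality the diagonal series \<open>qc q U U n * r ^ n\<close> has expectation
  equal to the geometric series, so it converges almost surely for every \<open>r\<close> below 1.
  If |U| exceeded 2, then \<open>pmd r U U\<close> would vanish for some \<open>r\<close> strictly
  between 0 and 1, and the functional equation would force zeros of a series with nonnegative
  coefficients.\<close>

lemma qh_support:
  assumes q: "\<bar>q\<bar> < 1" and U [measurable]: "U \<in> borel_measurable M"
    and int: "\<And>n. integrable M (\<lambda>\<omega>. qh q n (U \<omega>) * qh q n (U \<omega>))"
    and orth: "\<And>n. expectation (\<lambda>\<omega>. qh q n (U \<omega>) * qh q n (U \<omega>)) = qfac q n"
  shows "AE \<omega> in M. \<bar>U \<omega>\<bar> \<le> 2"
proof -
  have qcn: "0 \<le> qc q u u n" for u n using qfac_pos[OF q, of n] by (simp add: qc_def)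
  have sm: "AE \<omega> in M. summable (\<lambda>n. qc q (U \<omega>) (U \<omega>) n * r ^ n)" if r: "0 \<le> r" "r < 1" for r
  proof -
    have "(\<integral>\<^sup>+\<omega>. (\<Sum>n. ennreal (qc q (U \<omega>) (U \<omega>) n * r ^ n)) \<partial>M) = (\<Sum>n. \<integral>\<^sup>+\<omega>. ennreal (qc q (U \<omega>) (U \<omega>) n * r ^ n) \<partial>M)"
      by (rule nn_integral_suminf) (unfold qc_def, measurable)
    also have "\<dots> = (\<Sum>n. ennreal (r ^ n))"
    proof (rule suminf_cong)
      fix n
      have "(\<integral>\<^sup>+\<omega>. ennreal (qc q (U \<omega>) (U \<omega>) n * r ^ n) \<partial>M) = ennreal (expectation (\<lambda>\<omega>. qc q (U \<omega>) (U \<omega>) n * r ^ n))"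
      proof (rule nn_integral_eq_integral)
        show "integrable M (\<lambda>\<omega>. qc q (U \<omega>) (U \<omega>) n * r ^ n)" using int[of n] by (simp add: qc_def)
        show "AE \<omega> in M. 0 \<le> qc q (U \<omega>) (U \<omega>) n * r ^ n" using qcn r by auto
      qed
      also have "expectation (\<lambda>\<omega>. qc q (U \<omega>) (U \<omega>) n * r ^ n) = r ^ n"
        using orth[of n] qfac_pos[OF q, of n] by (simp add: qc_def)
      finally show "(\<integral>\<^sup>+\<omega>. ennreal (qc q (U \<omega>) (U \<omega>) n * r ^ n) \<partial>M) = ennreal (r ^ n)" .
    qed
    also have "\<dots> < \<infinity>" using r by (simp add: suminf_ennreal2 summable_geometric)
    finally have "AE \<omega> in M. (\<Sum>n. ennreal (qc q (U \<omega>) (U \<omega>) n * r ^ n)) \<noteq> \<infinity>"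
      by (intro nn_integral_PInf_AE) (auto simp: qc_def)
    then show ?thesis by eventually_elim (rule summable_suminf_not_top, use qcn r in auto)
  qed
  \<comment> \<open>Radii tending to 1 along a sequence give a single null set; convergence at one
    of them implies convergence at every smaller nonnegative \<open>r\<close>.\<close>
  have "AE \<omega> in M. \<forall>j. summable (\<lambda>n. qc q (U \<omega>) (U \<omega>) n * (1 - 1 / (real j + 1)) ^ n)"
    unfolding AE_all_countable by (intro allI sm) (auto simp: field_simps)
  then show ?thesis
  proof eventually_elim
    case (elim \<omega>)
    define u where "u = U \<omega>"
    show ?case
    proof (rule ccontr)
      assume "\<not> \<bar>U \<omega>\<bar> \<le> 2"
      then have u4: "4 < u\<^sup>2" using power_strict_mono[of 2 "\<bar>u\<bar>" 2] by (simp add: u_def)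
      define F where "F r = (1 + r)\<^sup>2 - u\<^sup>2 * r" for r
      have "\<exists>r\<ge>0. r \<le> 1 \<and> F r = 0"
        by (rule IVT2') (use u4 in \<open>auto simp: F_def intro!: continuous_intros\<close>)
      then obtain r where r: "0 \<le> r" "r \<le> 1" "F r = 0" by auto
      have "r \<noteq> 0" "r \<noteq> 1" using r u4 by (auto simp: F_def)
      with r have r01: "0 < r" "r < 1" by auto
      obtain j :: nat where j: "1 / (1 - r) < real j" using reals_Archimedean2 by blast
      then have rj: "r \<le> 1 - 1 / (real j + 1)" using r01 by (simp add: field_simps)
      have S0: "summable (\<lambda>n. norm (qc q u u n * r ^ n))"
      proof (rule summable_comparison_test'[where N = 0])
        show "summable (\<lambda>n. qc q u u n * (1 - 1 / (real j + 1)) ^ n)" using elim by (simp add: u_def)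
        fix n show "norm (norm (qc q u u n * r ^ n)) \<le> qc q u u n * (1 - 1 / (real j + 1)) ^ n"
          using qcn[of u n] r01 rj by (auto simp: abs_mult power_abs intro!: mult_left_mono power_mono)
      qed
      have le: "norm (qc q u u n * (q ^ k * r) ^ n) \<le> norm (qc q u u n * r ^ n)" for n k
      proof -
        have "\<bar>q\<bar> ^ k \<le> 1" using q by (simp add: power_le_one)
        then have "\<bar>q ^ k * r\<bar> \<le> \<bar>r\<bar>" by (simp add: abs_mult power_abs mult_left_le_one_le)
        then show ?thesis unfolding real_norm_def abs_mult[of "qc q u u n"] power_abs by (intro mult_left_mono power_mono) auto
      qed
      have S: "summable (\<lambda>n. norm (qc q u u n * (q ^ k * r) ^ n))" for k
      proof (rule summable_comparison_test'[OF S0, of 0])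
        fix n show "norm (norm (qc q u u n * (q ^ k * r) ^ n)) \<le> norm (qc q u u n * r ^ n)"
          using le[of n k] by simp
      qed
      have fac: "(1 - (q ^ k * r)\<^sup>2) * (1 - q * (q ^ k * r)\<^sup>2) \<noteq> 0" for k
      proof -
        have "\<bar>q\<bar> ^ k \<le> 1" using q by (simp add: power_le_one)
        then have "\<bar>q\<bar> ^ k * r \<le> 1 * r" using r01 by (intro mult_right_mono) auto
        moreover have "\<bar>q ^ k * r\<bar> = \<bar>q\<bar> ^ k * r" using r01 by (simp add: abs_mult power_abs)
        ultimately have "\<bar>q ^ k * r\<bar> < 1" using r01 by linarith
        then have 1: "(q ^ k * r)\<^sup>2 < 1" by (simp add: abs_square_less_1)
        have "q * (q ^ k * r)\<^sup>2 \<le> \<bar>q\<bar> * (q ^ k * r)\<^sup>2" by (intro mult_right_mono) auto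
        also have "\<dots> \<le> 1 * (q ^ k * r)\<^sup>2" using q by (intro mult_right_mono) auto
        finally show ?thesis using 1 by auto
      qed
      have "pmd r u u = 0" using r by (simp add: pmd_diagonal F_def mult.commute)
      then have "qK q (q * r) u u = 0" using qK_functional_equation[OF q S[of 0, unfolded power_0 mult_1]] fac[of 0] by simp
      then have "qK q (q ^ 2 * r) u u = 0"
        using qK_functional_equation[OF q S[of 1]] fac[of 1] by (simp add: power2_eq_square mult.assoc)
      \<comment> \<open>The zero at \<open>q * r\<close> is no contradiction when \<open>q\<close>
        is negative. A second use of the equation moves it to \<open>q ^ 2 * r\<close>, which is
        nonnegative, and there the constant term alone contributes 1.\<close>
      moreover have "1 \<le> qK q (q ^ 2 * r) u u"
      proof -
        have "(\<Sum>n<1. qc q u u n * (q ^ 2 * r) ^ n) \<le> qK q (q ^ 2 * r) u u" unfolding qK_def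
          using summable_norm_cancel[OF S[of 2]] qcn r01 by (intro sum_le_suminf) auto
        then show ?thesis by (simp add: qc_def)
      qed
      ultimately show False by simp
    qed
  qed
qed

text \<open>Applying \<open>law_functional\<close> to \<open>g / psi\<close> removes the weight and
  gives the integral of any continuous \<open>g\<close> against \<open>f_N\<close>; cosine and sine
  then give equal characteristic functions.\<close>

lemma q_normal_law:
  assumes q: "\<bar>q\<bar> < 1" and X [measurable]: "X \<in> borel_measurable M"
    and bd: "AE \<omega> in M. \<bar>sqrt (1 - q) * X \<omega>\<bar> \<le> 2"
    and mean: "\<And>n. expectation (\<lambda>\<omega>. qh q n (sqrt (1 - q) * X \<omega>)) = (if n = 0 then 1 else 0)"
  shows "distr M borel X = density lborel (\<lambda>x. ennreal (f_N x q))"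
proof -
  define s where "s = sqrt (1 - q)"
  have s: "0 < s" using q by (simp add: s_def)
  note [measurable] = f_N_measurable[OF q]
  have psi_cont: "continuous_on {-2..2} (psi q)" unfolding psi_def
    by (intro continuous_intros continuous_on_qK[OF q, where s = "\<bar>q\<bar>"]) (use q in \<open>auto simp: abs_le_iff\<close>)
  have [measurable]: "psi q \<in> borel_measurable borel" unfolding psi_def by measurable
  have key: "expectation (\<lambda>\<omega>. g (X \<omega>)) = (\<integral>x. g x * f_N x q \<partial>lborel)"
    if g: "continuous_on UNIV g" for g :: "real \<Rightarrow> real"
  proof -
    have [measurable]: "g \<in> borel_measurable borel" using g by (rule borel_measurable_continuous_onI)
    have "expectation (\<lambda>\<omega>. g (X \<omega>)) = expectation (\<lambda>\<omega>. psi q (s * X \<omega>) * (g (s * X \<omega> / s) / psi q (s * X \<omega>)))"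
      by (rule integral_cong_AE, measurable) (use bd in eventually_elim, use psi_pos[OF q] s in \<open>force simp: s_def\<close>)
    also have "\<dots> = (\<integral>v. g (v / s) / psi q v \<partial>semicircle)"
    proof (rule law_functional[where U = "\<lambda>\<omega>. s * X \<omega>" and g = "\<lambda>v. g (v / s) / psi q v", OF q])
      show "continuous_on {-2..2} (\<lambda>v. g (v / s) / psi q v)"
        by (intro continuous_intros psi_cont continuous_on_compose2[OF g]) (use s psi_pos[OF q] in \<open>force simp: abs_le_iff\<close>)+
    qed (use bd mean in \<open>auto simp: s_def\<close>)
    also have "\<dots> = (\<integral>v. g (v / s) / psi q v * scw v \<partial>lborel)"
      by (subst integral_semicircle) (auto simp: scw_def)
    also have "\<dots> = \<bar>s\<bar> *\<^sub>R (\<integral>x. g ((0 + s * x) / s) / psi q (0 + s * x) * scw (0 + s * x) \<partial>lborel)"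
      by (rule lborel_integral_real_affine) (use s in simp)
    also have "\<dots> = (\<integral>x. g x * f_N x q \<partial>lborel)"
      using s by (simp add: f_N_eq_semicircle[OF q] flip: s_def Bochner_Integration.integral_mult_right_zero) (simp add: mult_ac)
    finally show ?thesis .
  qed
  have one: "(\<integral>x. f_N x q \<partial>lborel) = 1" using key[of "\<lambda>_. 1"] by (simp add: prob_space)
  then have int: "integrable lborel (\<lambda>x. f_N x q)" using not_integrable_integral_eq by fastforce
  have nn: "(\<integral>\<^sup>+x. f_N x q \<partial>lborel) = 1" using int one f_N_nonneg[OF q] by (subst nn_integral_eq_integral) auto
  interpret X: real_distribution "distr M borel X" by (rule real_distribution_distr) measurable
  interpret D: prob_space "density lborel (\<lambda>x. ennreal (f_N x q))"
    using nn by (intro prob_spaceI) (simp add: emeasure_density)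
  have rd: "real_distribution (density lborel (\<lambda>x. ennreal (f_N x q)))"
    by (intro real_distribution.intro real_distribution_axioms.intro D.prob_space_axioms) auto
  show ?thesis
  proof (rule Levy_uniqueness[OF X.real_distribution_axioms rd], rule ext)
    fix t
    have i1: "integrable M (\<lambda>\<omega>. iexp (t * X \<omega>))" by (rule integrable_const_bound[where B = 1]) auto
    have i2: "integrable lborel (\<lambda>x. f_N x q *\<^sub>R iexp (t * x))"
      by (rule Bochner_Integration.integrable_bound[OF int]) (auto simp: norm_mult)
    have "char (distr M borel X) t = expectation (\<lambda>\<omega>. iexp (t * X \<omega>))"
      unfolding char_def by (subst integral_distr) auto
    also have "\<dots> = Complex (expectation (\<lambda>\<omega>. cos (t * X \<omega>))) (expectation (\<lambda>\<omega>. sin (t * X \<omega>)))"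
      using integral_Re[OF i1] integral_Im[OF i1] by (simp add: complex_eq_iff Re_exp Im_exp)
    also have "\<dots> = Complex (\<integral>x. cos (t * x) * f_N x q \<partial>lborel) (\<integral>x. sin (t * x) * f_N x q \<partial>lborel)"
      using key[of "\<lambda>x. cos (t * x)"] key[of "\<lambda>x. sin (t * x)"] by (simp add: continuous_intros)
    also have "\<dots> = (\<integral>x. f_N x q *\<^sub>R iexp (t * x) \<partial>lborel)"
      using integral_Re[OF i2] integral_Im[OF i2] by (simp add: complex_eq_iff Re_exp Im_exp mult.commute)
    also have "\<dots> = char (density lborel (\<lambda>x. ennreal (f_N x q))) t"
      unfolding char_def by (subst integral_density) (use f_N_nonneg[OF q] in auto)
    finally show "char (distr M borel X) t = char (density lborel (\<lambda>x. ennreal (f_N x q))) t" .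
  qed
qed

end

section \<open>Conditional expectations on generated sigma-algebras\<close>

lemma space_generated_algebra [simp]: "space (generated_algebra M I X) = space M"
  unfolding generated_algebra_def by (rule space_measure_of) auto

lemma sets_generated_algebra:
  "sets (generated_algebra M I X) = sigma_sets (space M) {X i -` S \<inter> space M | i S. i \<in> I \<and> S \<in> sets borel}"
  unfolding generated_algebra_def by (rule sets_measure_of) auto

lemma measurable_generated_algebra:
  assumes "i \<in> I" shows "X i \<in> borel_measurable (generated_algebra M I X)"
proof (rule measurableI)
  fix S :: "real set" assume "S \<in> sets borel"
  then show "X i -` S \<inter> space (generated_algebra M I X) \<in> sets (generated_algebra M I X)"
    using assms by (auto simp: sets_generated_algebra)
qed simp

lemma subalgebra_generated_algebra:
  assumes "\<And>i. i \<in> I \<Longrightarrow> X i \<in> borel_measurable M"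
  shows "subalgebra M (generated_algebra M I X)"
proof -
  have "{X i -` S \<inter> space M | i S. i \<in> I \<and> S \<in> sets borel} \<subseteq> sets M"
    using assms by (auto intro: measurable_sets)
  then have "sets (generated_algebra M I X) \<subseteq> sets M"
    unfolding sets_generated_algebra by (rule sets.sigma_sets_subset)
  then show ?thesis by (simp add: subalgebra_def)
qed

lemma sets_generated_algebra_mono:
  "I \<subseteq> J \<Longrightarrow> sets (generated_algebra M I X) \<subseteq> sets (generated_algebra M J X)"
  unfolding sets_generated_algebra by (rule sigma_sets_mono') auto

lemma measurable_generated_algebra_mono:
  assumes "g \<in> borel_measurable (generated_algebra M I X)" "I \<subseteq> J"
  shows "g \<in> borel_measurable (generated_algebra M J X)"
  by (rule measurable_from_subalg[OF _ assms(1)]) (use sets_generated_algebra_mono[OF assms(2)] in \<open>simp add: subalgebra_def\<close>)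

context prob_space
begin

lemma sigma_finite_subalgebraI: "subalgebra M G \<Longrightarrow> sigma_finite_subalgebra M G"
  by (intro finite_measure_subalgebra_is_sigma_finite finite_measure_subalgebra.intro finite_measure_subalgebra_axioms.intro)
     (auto intro: finite_measure_axioms)

lemma cond_exp_eqI:
  assumes G: "subalgebra M G" and "integrable M U" "integrable M V" "V \<in> borel_measurable G"
    and eq: "\<And>F. F \<in> sets G \<Longrightarrow> expectation (\<lambda>\<omega>. indicator F \<omega> * U \<omega>) = expectation (\<lambda>\<omega>. indicator F \<omega> * V \<omega>)"
  shows "AE \<omega> in M. real_cond_exp M G U \<omega> = V \<omega>"
proof -
  interpret sigma_finite_subalgebra M G by (rule sigma_finite_subalgebraI[OF G])
  show ?thesis by (rule real_cond_exp_charact) (use assms in \<open>auto simp: set_lebesgue_integral_def\<close>)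
qed

lemma cond_exp_mult:
  assumes G: "subalgebra M G" and ce: "AE \<omega> in M. real_cond_exp M G U \<omega> = V \<omega>"
    and [measurable]: "g \<in> borel_measurable G" "U \<in> borel_measurable M" "V \<in> borel_measurable M"
    and i: "integrable M (\<lambda>\<omega>. g \<omega> * U \<omega>)"
  shows "expectation (\<lambda>\<omega>. g \<omega> * U \<omega>) = expectation (\<lambda>\<omega>. g \<omega> * V \<omega>)"
proof -
  interpret sigma_finite_subalgebra M G by (rule sigma_finite_subalgebraI[OF G])
  have [measurable]: "g \<in> borel_measurable M" by (rule measurable_from_subalg[OF G]) fact
  have "expectation (\<lambda>\<omega>. g \<omega> * U \<omega>) = expectation (\<lambda>\<omega>. g \<omega> * real_cond_exp M G U \<omega>)"
    by (rule real_cond_exp_intg(2)[symmetric]) (use i in auto)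
  also have "\<dots> = expectation (\<lambda>\<omega>. g \<omega> * V \<omega>)" using ce by (intro integral_cong_AE) auto
  finally show ?thesis .
qed

lemma AE_eq_of_integrals:
  fixes U V :: "'a \<Rightarrow> real"
  assumes G: "subalgebra M G" and U: "integrable M U" "U \<in> borel_measurable G" and V: "integrable M V" "V \<in> borel_measurable G"
    and eq: "\<And>F. F \<in> sets G \<Longrightarrow> expectation (\<lambda>\<omega>. indicator F \<omega> * U \<omega>) = expectation (\<lambda>\<omega>. indicator F \<omega> * V \<omega>)"
  shows "AE \<omega> in M. U \<omega> = V \<omega>"
proof -
  interpret sigma_finite_subalgebra M G by (rule sigma_finite_subalgebraI[OF G])
  have "AE \<omega> in M. real_cond_exp M G U \<omega> = V \<omega>" by (rule cond_exp_eqI[OF G U(1) V eq])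
  with real_cond_exp_F_meas[OF U] show ?thesis by eventually_elim simp
qed

text \<open>Dynkin's argument: cylinders given by finitely many upper bounds are stable under
  intersection and generate the algebra. The case \<open>J = {}\<close> is the equality of the full
  expectations, on which the step for complements rests.\<close>

lemma generated_algebra_integral_eqI:
  fixes X :: "'i \<Rightarrow> 'a \<Rightarrow> real" and U V :: "'a \<Rightarrow> real"
  assumes X [measurable]: "\<And>i. i \<in> I \<Longrightarrow> X i \<in> borel_measurable M" and U: "integrable M U" and V: "integrable M V"
    and eq: "\<And>J c. finite J \<Longrightarrow> J \<subseteq> I \<Longrightarrow>
       expectation (\<lambda>\<omega>. indicator {\<omega> \<in> space M. \<forall>i\<in>J. X i \<omega> \<le> c i} \<omega> * U \<omega>)
     = expectation (\<lambda>\<omega>. indicator {\<omega> \<in> space M. \<forall>i\<in>J. X i \<omega> \<le> c i} \<omega> * V \<omega>)"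
    and F: "F \<in> sets (generated_algebra M I X)"
  shows "expectation (\<lambda>\<omega>. indicator F \<omega> * U \<omega>) = expectation (\<lambda>\<omega>. indicator F \<omega> * V \<omega>)"
proof -
  define P where "P = {{\<omega> \<in> space M. \<forall>i\<in>J. X i \<omega> \<le> c i} | J c. finite J \<and> J \<subseteq> I}"
  have Pow: "P \<subseteq> Pow (space M)" by (auto simp: P_def)
  have "sets (generated_algebra M I X) \<subseteq> sigma_sets (space M) P"
    unfolding sets_generated_algebra
  proof (rule sigma_sets_mono, safe)
    fix i and S :: "real set" assume i: "i \<in> I" and S: "S \<in> sets borel"
    have "X i \<in> borel_measurable (sigma (space M) P)"
    proof (rule borel_measurable_iff_le[THEN iffD2], safe)
      fix a
      have "{w \<in> space M. \<forall>i\<in>{i}. X i w \<le> a} \<in> P" unfolding P_def using i by (intro CollectI exI[of _ "{i}"] exI[of _ "\<lambda>_. a"]) auto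
      then show "{w \<in> space (sigma (space M) P). X i w \<le> a} \<in> sets (sigma (space M) P)"
        using Pow by (simp add: space_measure_of sets_measure_of)
    qed
    from measurable_sets[OF this S] show "X i -` S \<inter> space M \<in> sigma_sets (space M) P"
      using Pow by (simp add: space_measure_of sets_measure_of)
  qed
  with F have F': "F \<in> sigma_sets (space M) P" by auto
  have "P \<subseteq> sets M"
  proof safe
    fix A assume "A \<in> P"
    then obtain J c where A: "A = {\<omega> \<in> space M. \<forall>i\<in>J. X i \<omega> \<le> c i}" "finite J" "J \<subseteq> I" by (auto simp: P_def)
    show "A \<in> sets M" unfolding A(1) using A(2,3) by (intro sets.sets_Collect_finite_All) (auto intro!: borel_measurable_le X)
  qed
  then have sM: "sigma_sets (space M) P \<subseteq> sets M" by (rule sets.sigma_sets_subset)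
  have "Int_stable P"
  proof (rule Int_stableI)
    fix A B assume "A \<in> P" "B \<in> P"
    then obtain J c K d where A: "A = {\<omega> \<in> space M. \<forall>i\<in>J. X i \<omega> \<le> c i}" "finite J" "J \<subseteq> I"
      and B: "B = {\<omega> \<in> space M. \<forall>i\<in>K. X i \<omega> \<le> d i}" "finite K" "K \<subseteq> I" by (auto simp: P_def)
    define e where "e i = (if i \<in> J then if i \<in> K then min (c i) (d i) else c i else d i)" for i
    have "A \<inter> B = {\<omega> \<in> space M. \<forall>i\<in>J \<union> K. X i \<omega> \<le> e i}"
      unfolding A B e_def by (auto split: if_splits)
    then show "A \<inter> B \<in> P" using A B by (auto simp: P_def intro!: exI[of _ "J \<union> K"])
  qed
  have i: "integrable M (\<lambda>\<omega>. indicator A \<omega> * W \<omega>)" if "A \<in> sets M" "integrable M W" for A and W :: "'a \<Rightarrow> real"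
    using integrable_mult_indicator[OF that] by simp
  show ?thesis
    using \<open>Int_stable P\<close> Pow F'
  proof (induction rule: sigma_sets_induct_disjoint)
    case (basic A)
    then show ?case using eq by (auto simp: P_def)
  next
    case empty then show ?case by simp
  next
    case (compl A)
    have A: "A \<in> sets M" using compl sM by auto
    have "expectation (\<lambda>\<omega>. indicator (space M - A) \<omega> * W \<omega>) = expectation W - expectation (\<lambda>\<omega>. indicator A \<omega> * W \<omega>)" if "integrable M W" for W :: "'a \<Rightarrow> real"
    proof -
      have "expectation (\<lambda>\<omega>. indicator (space M - A) \<omega> * W \<omega>) = expectation (\<lambda>\<omega>. W \<omega> - indicator A \<omega> * W \<omega>)"
        by (rule Bochner_Integration.integral_cong) (auto simp: indicator_def)
      then show ?thesis using Bochner_Integration.integral_diff[OF that i[OF A that]] by simp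
    qed
    moreover have "expectation U = expectation V" using eq[of "{}"] by (simp add: indicator_def cong: Bochner_Integration.integral_cong)
    ultimately show ?case using compl U V by simp
  next
    case (union A)
    have A: "A n \<in> sets M" for n using union(2) sM by auto
    have "expectation (\<lambda>\<omega>. indicator (\<Union>n. A n) \<omega> * W \<omega>) = (\<Sum>n. expectation (\<lambda>\<omega>. indicator (A n) \<omega> * W \<omega>))" if W: "integrable M W" for W :: "'a \<Rightarrow> real"
    proof -
      have "set_integrable M (\<Union>n. A n) W" unfolding set_integrable_def using i[of "\<Union>n. A n" W] A W by auto
      from lebesgue_integral_countable_add[OF A _ this] union(1) show ?thesis
        by (auto simp: set_lebesgue_integral_def disjoint_family_on_def)
    qed
    then show ?case using union(3) U V by simp
  qed
qed

end

section \<open>One-sided regressions of a 1TSP\<close>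

text \<open>\<open>D\<close> is the gap at \<open>U\<close> between the strictly convex function
  \<open>sqrt (1 + x\<^sup>2)\<close> and its tangent at \<open>V\<close>. It is nonnegative,
  vanishes only for \<open>U = V\<close>, and has expectation 0 by equality of laws and by the
  hypothesis on the tangent term. The function grows linearly, so integrability of \<open>U\<close>
  and \<open>V\<close> suffices; they will be squares of square integrable variables.\<close>

lemma (in prob_space) AE_eq_of_stationary_martingale:
  assumes U: "integrable M U" and V: "integrable M V" and law: "distr M borel U = distr M borel V"
    and eq: "expectation (\<lambda>\<omega>. V \<omega> / sqrt (1 + (V \<omega>)\<^sup>2) * U \<omega>) = expectation (\<lambda>\<omega>. V \<omega> / sqrt (1 + (V \<omega>)\<^sup>2) * (V \<omega> :: real))"
  shows "AE \<omega> in M. U \<omega> = V \<omega>"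
proof -
  have [measurable]: "U \<in> borel_measurable M" "V \<in> borel_measurable M" using U V by auto
  have sq: "sqrt (1 + x\<^sup>2) \<le> 1 + \<bar>x\<bar>" for x :: real
    by (rule real_le_lsqrt) (auto simp: power2_eq_square algebra_simps)
  have le1: "\<bar>x / sqrt (1 + x\<^sup>2)\<bar> \<le> 1" for x :: real
  proof -
    have "\<bar>x\<bar> \<le> sqrt (1 + x\<^sup>2)" by (rule real_le_rsqrt) simp
    moreover have "0 < sqrt (1 + x\<^sup>2)" by (simp add: add_pos_nonneg)
    ultimately show ?thesis by (simp add: abs_divide)
  qed
  have iU: "integrable M (\<lambda>\<omega>. sqrt (1 + (U \<omega>)\<^sup>2))" "integrable M (\<lambda>\<omega>. sqrt (1 + (V \<omega>)\<^sup>2))"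
    by (rule Bochner_Integration.integrable_bound[of _ "\<lambda>\<omega>. 1 + \<bar>U \<omega>\<bar>"], use U sq in auto,
        rule Bochner_Integration.integrable_bound[of _ "\<lambda>\<omega>. 1 + \<bar>V \<omega>\<bar>"], use V sq in auto)
  have iVU: "integrable M (\<lambda>\<omega>. V \<omega> / sqrt (1 + (V \<omega>)\<^sup>2) * W \<omega>)" if W: "integrable M W" for W
  proof (rule Bochner_Integration.integrable_bound[OF W])
    show "AE \<omega> in M. norm (V \<omega> / sqrt (1 + (V \<omega>)\<^sup>2) * W \<omega>) \<le> norm (W \<omega>)"
    proof (rule AE_I2)
      fix \<omega>
      have "\<bar>V \<omega> / sqrt (1 + (V \<omega>)\<^sup>2)\<bar> * \<bar>W \<omega>\<bar> \<le> 1 * \<bar>W \<omega>\<bar>" by (intro mult_right_mono le1) simp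
      then show "norm (V \<omega> / sqrt (1 + (V \<omega>)\<^sup>2) * W \<omega>) \<le> norm (W \<omega>)" by (simp only: real_norm_def abs_mult mult_1)
    qed
  qed (use W in measurable)
  define D where "D \<omega> = sqrt (1 + (U \<omega>)\<^sup>2) - sqrt (1 + (V \<omega>)\<^sup>2) - (V \<omega> / sqrt (1 + (V \<omega>)\<^sup>2) * U \<omega> - V \<omega> / sqrt (1 + (V \<omega>)\<^sup>2) * V \<omega>)" for \<omega>
  have D: "0 \<le> sqrt (1 + u\<^sup>2) - sqrt (1 + v\<^sup>2) - (v / sqrt (1 + v\<^sup>2) * u - v / sqrt (1 + v\<^sup>2) * v)
     \<and> (sqrt (1 + u\<^sup>2) - sqrt (1 + v\<^sup>2) - (v / sqrt (1 + v\<^sup>2) * u - v / sqrt (1 + v\<^sup>2) * v) = 0 \<longrightarrow> u = v)" for u v :: real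
  proof -
    define a where "a = sqrt (1 + u\<^sup>2)"
    define b where "b = sqrt (1 + v\<^sup>2)"
    have s: "0 < 1 + x\<^sup>2" for x :: real using zero_le_power2[of x] by linarith
    have p: "0 < a" "0 < b" using s by (simp_all add: a_def b_def)
    have p': "a * a = 1 + u * u" "b * b = 1 + v * v"
      using s by (simp_all add: a_def b_def power2_eq_square less_imp_le)
    have e: "a - b - (v / b * u - v / b * v) = (a * b - (1 + u * v)) / b"
      using p p'(2) by (simp add: divide_simps) (simp add: algebra_simps)
    have "(a * b)\<^sup>2 = (1 + u * v)\<^sup>2 + (u - v)\<^sup>2"
    proof -
      have "(a * b)\<^sup>2 = (a * a) * (b * b)" by (simp add: power2_eq_square)
      then show ?thesis unfolding p' by (simp add: power2_eq_square algebra_simps)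
    qed
    note sq = this
    have 1: "1 + u * v \<le> a * b" by (rule power2_le_imp_le) (use sq p in auto)
    have 2: "u = v" if "a * b = 1 + u * v" using sq unfolding that by simp
    have "0 \<le> (a * b - (1 + u * v)) / b" using p 1 by (intro divide_nonneg_pos) auto
    moreover have "u = v" if "(a * b - (1 + u * v)) / b = 0" using that p by (intro 2) simp
    ultimately show ?thesis unfolding a_def[symmetric] b_def[symmetric] e by blast
  qed
  have iD: "integrable M D" unfolding D_def by (intro Bochner_Integration.integrable_diff iU iVU U V)
  have "expectation (\<lambda>\<omega>. sqrt (1 + (W \<omega>)\<^sup>2)) = (\<integral>x. sqrt (1 + x\<^sup>2) \<partial>distr M borel W)" if "W \<in> borel_measurable M" for W
    by (rule integral_distr[symmetric]) (use that in auto)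
  from this[of U] this[of V] have eq': "expectation (\<lambda>\<omega>. sqrt (1 + (U \<omega>)\<^sup>2)) = expectation (\<lambda>\<omega>. sqrt (1 + (V \<omega>)\<^sup>2))"
    unfolding law by simp
  have "expectation D = expectation (\<lambda>\<omega>. sqrt (1 + (U \<omega>)\<^sup>2)) - expectation (\<lambda>\<omega>. sqrt (1 + (V \<omega>)\<^sup>2))
     - (expectation (\<lambda>\<omega>. V \<omega> / sqrt (1 + (V \<omega>)\<^sup>2) * U \<omega>) - expectation (\<lambda>\<omega>. V \<omega> / sqrt (1 + (V \<omega>)\<^sup>2) * V \<omega>))"
    unfolding D_def
    by (simp only: Bochner_Integration.integral_diff Bochner_Integration.integrable_diff iU iVU[OF U] iVU[OF V])
  then have D0: "expectation D = 0" unfolding eq eq' by simp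
  have "AE \<omega> in M. 0 \<le> D \<omega>" using D unfolding D_def by (intro AE_I2) blast
  then have "AE \<omega> in M. D \<omega> = 0" using integral_nonneg_eq_0_iff_AE[OF iD] D0 by simp
  then show ?thesis
  proof eventually_elim
    case (elim \<omega>) then show ?case using D[of "U \<omega>" "V \<omega>"] unfolding D_def by blast
  qed
qed

text \<open>The solutions are spanned by \<open>\<rho>^k\<close> and \<open>\<rho>^-k\<close>; boundedness excludes the second.\<close>

lemma bounded_recurrence:
  fixes z :: "nat \<Rightarrow> real"
  assumes rho: "0 < \<rho>" "\<rho> < 1" and bd: "\<And>k. \<bar>z k\<bar> \<le> 1"
    and rec: "\<And>k. (1 + \<rho>\<^sup>2) * z (Suc k) = \<rho> * (z k + z (Suc (Suc k)))"
  shows "z k = \<rho> ^ k * z 0"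
proof -
  define d where "d k = z (Suc k) - \<rho> * z k" for k
  have d: "\<rho> * d (Suc k) = d k" for k
    using rec[of k] by (simp add: d_def power2_eq_square algebra_simps)
  have dk: "\<rho> ^ k * d (j + k) = d j" for k j
  proof (induction k)
    case (Suc k)
    have "\<rho> ^ Suc k * d (j + Suc k) = \<rho> ^ k * (\<rho> * d (Suc (j + k)))" by (simp add: mult_ac)
    then show ?case using Suc d[of "j + k"] by simp
  qed simp
  have "d j = 0" for j
  proof -
    have "\<bar>d j\<bar> \<le> 2 * \<rho> ^ k" for k
    proof -
      have "\<bar>d (j + k)\<bar> \<le> \<bar>z (Suc (j + k))\<bar> + \<bar>\<rho> * z (j + k)\<bar>" unfolding d_def by linarith
      also have "\<bar>\<rho> * z (j + k)\<bar> \<le> 1" unfolding abs_mult using rho bd[of "j + k"] by (intro mult_le_one) auto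
      finally have "\<bar>d (j + k)\<bar> \<le> 2" using bd[of "Suc (j + k)"] by linarith
      then have "\<rho> ^ k * \<bar>d (j + k)\<bar> \<le> \<rho> ^ k * 2" using rho by (intro mult_left_mono) auto
      then show ?thesis using dk[of k j] rho by (metis abs_mult abs_of_nonneg less_imp_le mult.commute power_abs)
    qed
    moreover have "(\<lambda>k. 2 * \<rho> ^ k) \<longlonglongrightarrow> 2 * 0" using rho by (intro tendsto_intros LIMSEQ_power_zero) auto
    ultimately have "\<bar>d j\<bar> \<le> 2 * 0" by (intro LIMSEQ_le_const[where X = "\<lambda>k. 2 * \<rho> ^ k"]) auto
    then show ?thesis by simp
  qed
  then have "z (Suc k) = \<rho> * z k" for k by (simp add: d_def)
  then show ?thesis by (induction k) auto
qed

text \<open>A grid sequence in normalized form. The coefficient of the linear regression is already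
  expressed by the correlation, and two facts that the grid conditions do not state directly are
  included: the equality of the one-dimensional laws, inherited from the stationary process, and
  \<open>B > 0\<close>.\<close>

locale tsp = prob_space M for M :: "'a measure" +
  fixes X :: "int \<Rightarrow> 'a \<Rightarrow> real" and \<rho> A B C D :: real
  assumes X_meas [measurable]: "\<And>n. X n \<in> borel_measurable M"
    and X_sq: "\<And>n. integrable M (\<lambda>\<omega>. (X n \<omega>)\<^sup>2)"
    and X_mean: "\<And>n. expectation (X n) = 0"
    and X_var: "\<And>n. expectation (\<lambda>\<omega>. (X n \<omega>)\<^sup>2) = 1"
    and X_law: "\<And>n. distr M borel (X n) = distr M borel (X 0)"
    and rho: "0 < \<rho>" "\<rho> < 1" and B_pos: "0 < B"
    and reg1: "\<And>n. AE \<omega> in M. real_cond_exp M (generated_algebra M (- {n}) X) (X n) \<omega>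
            = \<rho> / (1 + \<rho>\<^sup>2) * (X (n - 1) \<omega> + X (n + 1) \<omega>)"
    and reg2: "\<And>n. AE \<omega> in M. real_cond_exp M (generated_algebra M (- {n}) X) (\<lambda>\<eta>. (X n \<eta>)\<^sup>2) \<omega>
            = A * ((X (n - 1) \<omega>)\<^sup>2 + (X (n + 1) \<omega>)\<^sup>2) + B * X (n - 1) \<omega> * X (n + 1) \<omega>
              + D * (X (n - 1) \<omega> + X (n + 1) \<omega>) + C"
begin

abbreviation past :: "int \<Rightarrow> 'a measure" where "past n \<equiv> generated_algebra M {..n} X"
abbreviation others :: "int \<Rightarrow> 'a measure" where "others n \<equiv> generated_algebra M (- {n}) X"

text \<open>The two-sided conditions are symmetric in time, so each forward regression has a
  backward one; \<open>moment_step\<close> uses both.\<close>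

lemma tsp_reverse: "tsp M (\<lambda>n. X (- n)) \<rho> A B C D"
proof
  have g: "generated_algebra M (- {n}) (\<lambda>n. X (- n)) = generated_algebra M (- {- n}) X" for n
  proof -
    have "{X (- i) -` S \<inter> space M |i S. i \<in> - {n} \<and> S \<in> sets borel} = {X i -` S \<inter> space M |i S. i \<in> - {- n} \<and> S \<in> sets borel}"
      (is "?L = ?R")
    proof (intro equalityI subsetI)
      fix A assume "A \<in> ?L"
      then obtain i S where "A = X (- i) -` S \<inter> space M" "i \<in> - {n}" "S \<in> sets borel" by blast
      then show "A \<in> ?R" by (intro CollectI exI[of _ "- i"] exI[of _ S]) auto
    next
      fix A assume "A \<in> ?R"
      then obtain i S where "A = X i -` S \<inter> space M" "i \<in> - {- n}" "S \<in> sets borel" by blast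
      then show "A \<in> ?L" by (intro CollectI exI[of _ "- i"] exI[of _ S]) auto
    qed
    then show ?thesis unfolding generated_algebra_def by simp
  qed
  have idx: "- (n - 1) = - n + 1" "- (n + 1) = - n - 1" for n :: int by auto
  show "AE \<omega> in M. real_cond_exp M (generated_algebra M (- {n}) (\<lambda>n. X (- n))) (X (- n)) \<omega>
            = \<rho> / (1 + \<rho>\<^sup>2) * (X (- (n - 1)) \<omega> + X (- (n + 1)) \<omega>)" for n
    unfolding g idx using reg1[of "- n"] by eventually_elim (simp only: add.commute)
  show "AE \<omega> in M. real_cond_exp M (generated_algebra M (- {n}) (\<lambda>n. X (- n))) (\<lambda>\<eta>. (X (- n) \<eta>)\<^sup>2) \<omega>
            = A * ((X (- (n - 1)) \<omega>)\<^sup>2 + (X (- (n + 1)) \<omega>)\<^sup>2) + B * X (- (n - 1)) \<omega> * X (- (n + 1)) \<omega>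
              + D * (X (- (n - 1)) \<omega> + X (- (n + 1)) \<omega>) + C" for n
    unfolding g idx using reg2[of "- n"]
  proof eventually_elim
    case (elim \<omega>)
    show ?case unfolding elim by (simp only: add_ac mult_ac)
  qed
  show "distr M borel (X (- n)) = distr M borel (X (- 0))" for n using X_law[of "- n"] by simp
qed (fact X_meas X_sq X_mean X_var rho B_pos)+

lemma X_int: "integrable M (X n)"
  by (rule square_integrable_imp_integrable) (use X_sq in auto)

lemma XX_int: "integrable M (\<lambda>\<omega>. X n \<omega> * X m \<omega>)"
proof (rule Bochner_Integration.integrable_bound[of _ "\<lambda>\<omega>. (X n \<omega>)\<^sup>2 + (X m \<omega>)\<^sup>2"])
  have "\<bar>x * y\<bar> \<le> x\<^sup>2 + y\<^sup>2" for x y :: real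
  proof -
    have "2 * (\<bar>x\<bar> * \<bar>y\<bar>) \<le> x\<^sup>2 + y\<^sup>2" using sum_squares_bound[of "\<bar>x\<bar>" "\<bar>y\<bar>"] by (simp add: mult.assoc)
    moreover have "0 \<le> \<bar>x\<bar> * \<bar>y\<bar>" by simp
    ultimately show ?thesis unfolding abs_mult by linarith
  qed
  then show "AE \<omega> in M. norm (X n \<omega> * X m \<omega>) \<le> norm ((X n \<omega>)\<^sup>2 + (X m \<omega>)\<^sup>2)" by simp
qed (use X_sq in auto)

lemma past_sub: "subalgebra M (past n)" and others_sub: "subalgebra M (others n)"
  by (auto intro!: subalgebra_generated_algebra)

lemma past_measurable: "k \<le> n \<Longrightarrow> X k \<in> borel_measurable (past n)"
  by (rule measurable_generated_algebra) auto

lemma others_measurable: "k \<noteq> n \<Longrightarrow> X k \<in> borel_measurable (others n)"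
  by (rule measurable_generated_algebra) auto

lemma past_mono: "g \<in> borel_measurable (past n) \<Longrightarrow> n \<le> m \<Longrightarrow> g \<in> borel_measurable (past m)"
  by (erule measurable_generated_algebra_mono) auto

lemma past_others: "g \<in> borel_measurable (past n) \<Longrightarrow> n < m \<Longrightarrow> g \<in> borel_measurable (others m)"
  by (erule measurable_generated_algebra_mono) auto

lemma indicator_past: "F \<in> sets (past n) \<Longrightarrow> (indicator F :: 'a \<Rightarrow> real) \<in> borel_measurable (past n)"
  by (rule borel_measurable_indicator)

lemma past_sets: "F \<in> sets (past n) \<Longrightarrow> F \<in> sets M"
  using past_sub by (auto simp: subalgebra_def)

lemma reg1_mult:
  assumes "g \<in> borel_measurable (others n)" "integrable M (\<lambda>\<omega>. g \<omega> * X n \<omega>)"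
    "integrable M (\<lambda>\<omega>. g \<omega> * X (n - 1) \<omega>)" "integrable M (\<lambda>\<omega>. g \<omega> * X (n + 1) \<omega>)"
  shows "expectation (\<lambda>\<omega>. g \<omega> * X n \<omega>) = \<rho> / (1 + \<rho>\<^sup>2) * (expectation (\<lambda>\<omega>. g \<omega> * X (n - 1) \<omega>) + expectation (\<lambda>\<omega>. g \<omega> * X (n + 1) \<omega>))"
proof -
  have "expectation (\<lambda>\<omega>. g \<omega> * X n \<omega>) = expectation (\<lambda>\<omega>. g \<omega> * (\<rho> / (1 + \<rho>\<^sup>2) * (X (n - 1) \<omega> + X (n + 1) \<omega>)))"
    by (rule cond_exp_mult[OF others_sub reg1]) (use assms in auto)
  also have "\<dots> = expectation (\<lambda>\<omega>. \<rho> / (1 + \<rho>\<^sup>2) * (g \<omega> * X (n - 1) \<omega> + g \<omega> * X (n + 1) \<omega>))"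
    by (simp add: algebra_simps)
  also have "\<dots> = \<rho> / (1 + \<rho>\<^sup>2) * (expectation (\<lambda>\<omega>. g \<omega> * X (n - 1) \<omega>) + expectation (\<lambda>\<omega>. g \<omega> * X (n + 1) \<omega>))"
    using assms by (simp only: integral_mult_right_zero Bochner_Integration.integral_add)
  finally show ?thesis .
qed

lemma reg2_mult:
  assumes g: "g \<in> borel_measurable (others n)" and i: "integrable M (\<lambda>\<omega>. g \<omega> * (X n \<omega>)\<^sup>2)"
    "integrable M (\<lambda>\<omega>. g \<omega> * (X (n - 1) \<omega>)\<^sup>2)" "integrable M (\<lambda>\<omega>. g \<omega> * (X (n + 1) \<omega>)\<^sup>2)"
    "integrable M (\<lambda>\<omega>. g \<omega> * (X (n - 1) \<omega> * X (n + 1) \<omega>))" "integrable M g"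
    "integrable M (\<lambda>\<omega>. g \<omega> * X (n - 1) \<omega>)" "integrable M (\<lambda>\<omega>. g \<omega> * X (n + 1) \<omega>)"
  shows "expectation (\<lambda>\<omega>. g \<omega> * (X n \<omega>)\<^sup>2) = A * (expectation (\<lambda>\<omega>. g \<omega> * (X (n - 1) \<omega>)\<^sup>2) + expectation (\<lambda>\<omega>. g \<omega> * (X (n + 1) \<omega>)\<^sup>2))
     + B * expectation (\<lambda>\<omega>. g \<omega> * (X (n - 1) \<omega> * X (n + 1) \<omega>))
     + D * (expectation (\<lambda>\<omega>. g \<omega> * X (n - 1) \<omega>) + expectation (\<lambda>\<omega>. g \<omega> * X (n + 1) \<omega>)) + C * expectation g"
proof -
  have "expectation (\<lambda>\<omega>. g \<omega> * (X n \<omega>)\<^sup>2) = expectation (\<lambda>\<omega>. g \<omega> * (A * ((X (n - 1) \<omega>)\<^sup>2 + (X (n + 1) \<omega>)\<^sup>2) + B * X (n - 1) \<omega> * X (n + 1) \<omega>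
              + D * (X (n - 1) \<omega> + X (n + 1) \<omega>) + C))"
    by (rule cond_exp_mult[OF others_sub reg2]) (use assms in auto)
  also have "\<dots> = expectation (\<lambda>\<omega>. A * (g \<omega> * (X (n - 1) \<omega>)\<^sup>2 + g \<omega> * (X (n + 1) \<omega>)\<^sup>2) + B * (g \<omega> * (X (n - 1) \<omega> * X (n + 1) \<omega>))
              + D * (g \<omega> * X (n - 1) \<omega> + g \<omega> * X (n + 1) \<omega>) + C * g \<omega>)"
    by (simp add: algebra_simps)
  also have "\<dots> = A * (expectation (\<lambda>\<omega>. g \<omega> * (X (n - 1) \<omega>)\<^sup>2) + expectation (\<lambda>\<omega>. g \<omega> * (X (n + 1) \<omega>)\<^sup>2))
     + B * expectation (\<lambda>\<omega>. g \<omega> * (X (n - 1) \<omega> * X (n + 1) \<omega>))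
     + D * (expectation (\<lambda>\<omega>. g \<omega> * X (n - 1) \<omega>) + expectation (\<lambda>\<omega>. g \<omega> * X (n + 1) \<omega>)) + C * expectation g"
    using i by (simp only: integral_mult_right_zero Bochner_Integration.integral_add Bochner_Integration.integrable_add integrable_mult_right)
  finally show ?thesis .
qed

lemma ind_int: "F \<in> sets (past n) \<Longrightarrow> integrable M U \<Longrightarrow> integrable M (\<lambda>\<omega>. indicator F \<omega> * U \<omega>)" for U :: "'a \<Rightarrow> real"
  using integrable_mult_indicator[of F M U] past_sets by simp

lemma one_sided_regression_set:
  assumes F: "F \<in> sets (past n)"
  shows "expectation (\<lambda>\<omega>. indicator F \<omega> * X (n + int k) \<omega>) = \<rho> ^ k * expectation (\<lambda>\<omega>. indicator F \<omega> * X n \<omega>)"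
proof -
  define z where "z k = expectation (\<lambda>\<omega>. indicator F \<omega> * X (n + int k) \<omega>)" for k
  have bd: "\<bar>z k\<bar> \<le> 1" for k
  proof -
    have "\<bar>z k\<bar> \<le> expectation (\<lambda>\<omega>. \<bar>indicator F \<omega> * X (n + int k) \<omega>\<bar>)" unfolding z_def by (rule integral_abs_bound)
    also have "\<dots> \<le> expectation (\<lambda>\<omega>. (1 + (X (n + int k) \<omega>)\<^sup>2) / 2)"
    proof (rule integral_mono)
      show "integrable M (\<lambda>\<omega>. \<bar>indicator F \<omega> * X (n + int k) \<omega>\<bar>)" using ind_int[OF F X_int] by (rule integrable_abs)
      show "integrable M (\<lambda>\<omega>. (1 + (X (n + int k) \<omega>)\<^sup>2) / 2)" using X_sq by simp
      fix \<omega>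
      have "2 * \<bar>x\<bar> \<le> 1 + x\<^sup>2" for x :: real using zero_le_power2[of "\<bar>x\<bar> - 1"] by (simp add: power2_eq_square algebra_simps)
      from this[of "X (n + int k) \<omega>"] show "\<bar>indicator F \<omega> * X (n + int k) \<omega>\<bar> \<le> (1 + (X (n + int k) \<omega>)\<^sup>2) / 2"
        by (auto simp: indicator_def)
    qed
    also have "\<dots> = 1" using X_sq X_var by (simp add: prob_space)
    finally show ?thesis .
  qed
  have rec: "z (Suc k) = \<rho> / (1 + \<rho>\<^sup>2) * (z k + z (Suc (Suc k)))" for k
  proof -
    have e: "n + int (Suc k) - 1 = n + int k" "n + int (Suc k) + 1 = n + int (Suc (Suc k))" by auto
    show ?thesis unfolding z_def
      using reg1_mult[of "indicator F" "n + int (Suc k)"] past_others[OF indicator_past[OF F], of "n + int (Suc k)"]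
      unfolding e by (simp add: ind_int[OF F X_int])
  qed
  have "z k = \<rho> ^ k * z 0"
  proof (rule bounded_recurrence[OF rho bd])
    fix k
    have "0 < 1 + \<rho>\<^sup>2" using zero_le_power2[of \<rho>] by linarith
    then show "(1 + \<rho>\<^sup>2) * z (Suc k) = \<rho> * (z k + z (Suc (Suc k)))" using rec[of k] by (simp add: field_simps)
  qed
  then show ?thesis by (simp add: z_def)
qed

lemma one_sided_regression: "AE \<omega> in M. real_cond_exp M (past n) (X (n + int k)) \<omega> = \<rho> ^ k * X n \<omega>"
proof (rule cond_exp_eqI[OF past_sub])
  show "(\<lambda>\<omega>. \<rho> ^ k * X n \<omega>) \<in> borel_measurable (past n)" using past_measurable[of n n] by measurable
  fix F assume "F \<in> sets (past n)"
  from one_sided_regression_set[OF this, of k]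
  show "expectation (\<lambda>\<omega>. indicator F \<omega> * X (n + int k) \<omega>) = expectation (\<lambda>\<omega>. indicator F \<omega> * (\<rho> ^ k * X n \<omega>))"
    by (simp add: mult.left_commute[of _ "\<rho> ^ k"])
qed (auto intro!: X_int integrable_mult_right)

lemma one_sided_mult:
  assumes "g \<in> borel_measurable (past n)" "integrable M (\<lambda>\<omega>. g \<omega> * X (n + int k) \<omega>)"
  shows "expectation (\<lambda>\<omega>. g \<omega> * X (n + int k) \<omega>) = \<rho> ^ k * expectation (\<lambda>\<omega>. g \<omega> * X n \<omega>)"
  using cond_exp_mult[OF past_sub one_sided_regression assms(1) _ _ assms(2)] by (simp add: mult.left_commute[of _ "\<rho> ^ k"])

end

section \<open>The quadratic regression and the values of its constants\<close>

context tsp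
begin

lemma indicator_mult_int: "F \<in> sets (past n) \<Longrightarrow> integrable M (\<lambda>\<omega>. indicator F \<omega> * (X i \<omega> * X j \<omega>))"
  by (rule ind_int[OF _ XX_int])

lemma lag_product:
  assumes F: "F \<in> sets (past n)" and m: "n \<le> m"
  shows "expectation (\<lambda>\<omega>. indicator F \<omega> * (X m \<omega> * X (m + int k) \<omega>)) = \<rho> ^ k * expectation (\<lambda>\<omega>. indicator F \<omega> * (X m \<omega>)\<^sup>2)"
proof -
  have "(\<lambda>\<omega>. indicator F \<omega> * X m \<omega>) \<in> borel_measurable (past m)"
    using past_mono[OF indicator_past[OF F] m] past_measurable[of m m] by measurable
  from one_sided_mult[OF this, of k] show ?thesis
    using indicator_mult_int[OF F] by (simp add: mult.assoc power2_eq_square)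
qed

text \<open>For the first equation, the mean of \<open>X m * X (m + 1)\<close> over \<open>F\<close>
  is computed once by one-sided regression and once by the linear regression of \<open>X m\<close>
  on all other variables. The second is the quadratic regression integrated over \<open>F\<close>,
  with the mixed term reduced by one-sided regression at lag two.\<close>

lemma second_moment_recursion:
  assumes F: "F \<in> sets (past n)"
  defines "W \<equiv> \<lambda>k. expectation (\<lambda>\<omega>. indicator F \<omega> * (X (n + int k) \<omega>)\<^sup>2)"
  shows "W (Suc (Suc k)) - W (Suc k) = \<rho>\<^sup>2 * (W (Suc k) - W k)"
    and "W (Suc k) = A * (W k + W (Suc (Suc k))) + B * \<rho>\<^sup>2 * W k
       + D * (\<rho> ^ k * (1 + \<rho>\<^sup>2)) * expectation (\<lambda>\<omega>. indicator F \<omega> * X n \<omega>) + C * prob F"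
proof -
  define m where "m = n + int (Suc k)"
  have m: "m - 1 = n + int k" "m + 1 = n + int (Suc (Suc k))" "n \<le> m" "n \<le> m - 1" "n < m" by (auto simp: m_def)
  have FM: "F \<in> sets M" by (rule past_sets[OF F])
  have [measurable]: "(indicator F :: 'a \<Rightarrow> real) \<in> borel_measurable (others m)" using past_others[OF indicator_past[OF F] m(5)] .
  have sq: "integrable M (\<lambda>\<omega>. indicator F \<omega> * (X i \<omega>)\<^sup>2)" for i by (rule ind_int[OF F X_sq])
  have WS: "W k = expectation (\<lambda>\<omega>. indicator F \<omega> * (X (m - 1) \<omega>)\<^sup>2)"
    "W (Suc k) = expectation (\<lambda>\<omega>. indicator F \<omega> * (X m \<omega>)\<^sup>2)"
    "W (Suc (Suc k)) = expectation (\<lambda>\<omega>. indicator F \<omega> * (X (m + 1) \<omega>)\<^sup>2)"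
    unfolding W_def m(1,2) by (simp_all only: m_def)
  have "m - 1 + int 2 = m + 1" "m + int 1 = m + 1" by simp_all
  then have mid: "expectation (\<lambda>\<omega>. indicator F \<omega> * (X (m - 1) \<omega> * X (m + 1) \<omega>)) = \<rho>\<^sup>2 * W k"
    and P: "expectation (\<lambda>\<omega>. indicator F \<omega> * (X m \<omega> * X (m + 1) \<omega>)) = \<rho> * W (Suc k)"
    using lag_product[OF F m(4), of 2] lag_product[OF F m(3), of 1] unfolding WS by (simp_all only: power_one_right)
  have c: "indicator F \<omega> * X (m + 1) \<omega> * X i \<omega> = indicator F \<omega> * (X i \<omega> * X (m + 1) \<omega>)" for i \<omega> by (simp add: mult_ac)
  have "expectation (\<lambda>\<omega>. indicator F \<omega> * X (m + 1) \<omega> * X m \<omega>)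
     = \<rho> / (1 + \<rho>\<^sup>2) * (expectation (\<lambda>\<omega>. indicator F \<omega> * X (m + 1) \<omega> * X (m - 1) \<omega>) + expectation (\<lambda>\<omega>. indicator F \<omega> * X (m + 1) \<omega> * X (m + 1) \<omega>))"
  proof (rule reg1_mult)
    show "(\<lambda>\<omega>. indicator F \<omega> * X (m + 1) \<omega>) \<in> borel_measurable (others m)"
      using others_measurable[of "m + 1" m] by measurable
  qed (use indicator_mult_int[OF F] in \<open>simp_all add: mult.assoc\<close>)
  then have "\<rho> * W (Suc k) = \<rho> / (1 + \<rho>\<^sup>2) * (\<rho>\<^sup>2 * W k + W (Suc (Suc k)))"
    unfolding c mid P WS(3) power2_eq_square[of "X _ _"] by simp
  moreover have "0 < 1 + \<rho>\<^sup>2" using zero_le_power2[of \<rho>] by linarith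
  ultimately have "\<rho> * (W (Suc k) * (1 + \<rho>\<^sup>2)) = \<rho> * (\<rho>\<^sup>2 * W k + W (Suc (Suc k)))"
    by (simp add: field_simps)
  then have "W (Suc k) * (1 + \<rho>\<^sup>2) = \<rho>\<^sup>2 * W k + W (Suc (Suc k))"
    using rho by (simp only: mult_cancel_left) auto
  then show "W (Suc (Suc k)) - W (Suc k) = \<rho>\<^sup>2 * (W (Suc k) - W k)" by (simp add: algebra_simps)
  have "W (Suc k) = A * (W k + W (Suc (Suc k))) + B * (\<rho>\<^sup>2 * W k) + D * (expectation (\<lambda>\<omega>. indicator F \<omega> * X (m - 1) \<omega>) + expectation (\<lambda>\<omega>. indicator F \<omega> * X (m + 1) \<omega>)) + C * expectation (indicator F)"
    unfolding mid[symmetric] unfolding WS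
    by (rule reg2_mult) (use sq indicator_mult_int[OF F] ind_int[OF F X_int] ind_int[OF F, of "\<lambda>_. 1"] in auto)
  moreover have "expectation (\<lambda>\<omega>. indicator F \<omega> * X (m - 1) \<omega>) + expectation (\<lambda>\<omega>. indicator F \<omega> * X (m + 1) \<omega>)
     = \<rho> ^ k * (1 + \<rho>\<^sup>2) * expectation (\<lambda>\<omega>. indicator F \<omega> * X n \<omega>)"
    unfolding m(1,2) one_sided_regression_set[OF F] by (simp add: power2_eq_square algebra_simps)
  ultimately show "W (Suc k) = A * (W k + W (Suc (Suc k))) + B * \<rho>\<^sup>2 * W k
       + D * (\<rho> ^ k * (1 + \<rho>\<^sup>2)) * expectation (\<lambda>\<omega>. indicator F \<omega> * X n \<omega>) + C * prob F"
    using FM by (simp add: mult.assoc)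
qed

lemma not_degenerate: "\<not> (AE \<omega> in M. X n \<omega> = 0)"
proof
  assume "AE \<omega> in M. X n \<omega> = 0"
  then have "expectation (\<lambda>\<omega>. (X n \<omega>)\<^sup>2) = expectation (\<lambda>_. 0)" by (intro integral_cong_AE) auto
  then show False using X_var by simp
qed

lemma positive_part: "\<exists>F \<in> sets (past n). expectation (\<lambda>\<omega>. indicator F \<omega> * X n \<omega>) \<noteq> 0"
proof (rule ccontr)
  assume *: "\<not> ?thesis"
  have "AE \<omega> in M. X n \<omega> = 0"
    by (rule AE_eq_of_integrals[OF past_sub[of n] X_int past_measurable]) (use * in auto)
  then show False using not_degenerate by simp
qed

text \<open>Differencing the quadratic regression at consecutive times removes the constant
  \<open>C\<close>. The increments of \<open>W\<close> are geometric with ratio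
  \<open>\<rho>\<^sup>2\<close>, the contribution of \<open>D\<close> with ratio
  \<open>\<rho>\<close>; as these differ, three consecutive times separate them.\<close>

lemma second_moment_increment:
  assumes F: "F \<in> sets (past n)"
  defines "W \<equiv> \<lambda>k. expectation (\<lambda>\<omega>. indicator F \<omega> * (X (n + int k) \<omega>)\<^sup>2)"
  shows "D * expectation (\<lambda>\<omega>. indicator F \<omega> * X n \<omega>) = 0"
    and "D = 0 \<Longrightarrow> (W 1 - W 0) * (A * (1 + \<rho> ^ 4) - (1 - B) * \<rho>\<^sup>2) = 0"
    and "D = 0 \<Longrightarrow> (W 1 - W 0) * (1 - A * (1 + \<rho>\<^sup>2)) = (2 * A + B * \<rho>\<^sup>2 - 1) * W 0 + C * prob F"
proof -
  define x where "x = expectation (\<lambda>\<omega>. indicator F \<omega> * X n \<omega>)"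
  define v where "v = W 1 - W 0"
  define s where "s = \<rho>\<^sup>2"
  have s: "s = \<rho> * \<rho>" "0 < s" using rho by (simp_all add: s_def power2_eq_square)
  have d: "W (Suc (Suc k)) - W (Suc k) = s * (W (Suc k) - W k)" for k
    unfolding W_def s_def by (rule second_moment_recursion(1)[OF F])
  have num: "Suc 0 = 1" "Suc 1 = 2" "Suc 2 = 3" "Suc 3 = 4" by auto
  have W: "W 2 = W 1 + s * v" "W 3 = W 2 + s * (s * v)" "W 4 = W 3 + s * (s * (s * v))"
    using d[of 0] d[of 1] d[of 2] unfolding num by (simp_all add: v_def)
  have e: "W (Suc k) = A * (W k + W (Suc (Suc k))) + B * s * W k + D * (\<rho> ^ k * (1 + s)) * x + C * prob F" for k
    unfolding W_def s_def x_def by (rule second_moment_recursion(2)[OF F])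
  have e0: "W 1 = A * (W 0 + W 2) + B * s * W 0 + D * (1 * (1 + s)) * x + C * prob F"
    using e[of 0] unfolding num by simp
  have e1: "W 2 = A * (W 1 + W 3) + B * s * W 1 + D * (\<rho> * (1 + s)) * x + C * prob F"
    using e[of 1] unfolding num by simp
  have e2: "W 3 = A * (W 2 + W 4) + B * s * W 2 + D * (s * (1 + s)) * x + C * prob F"
    using e[of 2] unfolding num by (simp add: s_def)
  have alg: "w2 - w1 = A * ((w1 + w3) - (w0 + w2)) + B * s * (w1 - w0) + D * x * ((b - a) * (1 + s))"
    if "w1 = A * (w0 + w2) + B * s * w0 + D * (a * (1 + s)) * x + C * prob F"
      "w2 = A * (w1 + w3) + B * s * w1 + D * (b * (1 + s)) * x + C * prob F" for w0 w1 w2 w3 a b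
  proof -
    have "w2 - w1 = A * (w1 + w3) + B * s * w1 + D * (b * (1 + s)) * x + C * prob F
       - (A * (w0 + w2) + B * s * w0 + D * (a * (1 + s)) * x + C * prob F)" using that by linarith
    also have "\<dots> = A * ((w1 + w3) - (w0 + w2)) + B * s * (w1 - w0) + D * x * ((b - a) * (1 + s))" by (simp add: algebra_simps)
    finally show ?thesis .
  qed
  have W13: "W 1 + W 3 - (W 0 + W 2) = v + s * (s * v)" "W 2 + W 4 - (W 1 + W 3) = s * v + s * (s * (s * v))"
    "W 2 - W 1 = s * v" "W 3 - W 2 = s * (s * v)" "W 1 - W 0 = v"
    unfolding W by (simp_all add: v_def)
  have f1: "s * v = A * (v + s * (s * v)) + B * s * v + D * x * ((\<rho> - 1) * (1 + s))"
    using alg[OF e0 e1] unfolding W13 .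
  have f2: "s * (s * v) = A * (s * v + s * (s * (s * v))) + B * s * (s * v) + D * x * ((s - \<rho>) * (1 + s))"
    using alg[OF e1 e2] unfolding W13 .
  have "D * x * ((s * (\<rho> - 1) - (s - \<rho>)) * (1 + s)) = 0"
  proof -
    have "s * (s * v) = s * (A * (v + s * (s * v)) + B * s * v + D * x * ((\<rho> - 1) * (1 + s)))"
      by (rule arg_cong[OF f1])
    then have "s * (A * (v + s * (s * v)) + B * s * v + D * x * ((\<rho> - 1) * (1 + s)))
      - (A * (s * v + s * (s * (s * v))) + B * s * (s * v) + D * x * ((s - \<rho>) * (1 + s))) = 0"
      using f2 by linarith
    then show ?thesis by (simp add: algebra_simps)
  qed
  moreover have "(s * (\<rho> - 1) - (s - \<rho>)) * (1 + s) \<noteq> 0"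
  proof -
    have "s * (\<rho> - 1) - (s - \<rho>) = \<rho> * ((1 - \<rho>) * (1 - \<rho>))" unfolding s by (simp add: algebra_simps)
    moreover have "0 < \<rho> * ((1 - \<rho>) * (1 - \<rho>)) * (1 + s)" using rho s(2) by (intro mult_pos_pos) auto
    ultimately show ?thesis by (metis less_irrefl)
  qed
  ultimately show "D * x = 0" by simp
  show "(W 1 - W 0) * (A * (1 + \<rho> ^ 4) - (1 - B) * \<rho>\<^sup>2) = 0" if "D = 0"
  proof -
    have "\<rho> ^ 4 = s * s" by (simp add: s power4_eq_xxxx)
    then show ?thesis using f1 that unfolding s_def[symmetric] v_def[symmetric] by (simp add: algebra_simps)
  qed
  show "(W 1 - W 0) * (1 - A * (1 + \<rho>\<^sup>2)) = (2 * A + B * \<rho>\<^sup>2 - 1) * W 0 + C * prob F" if "D = 0"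
  proof -
    have "W 0 + v = A * (W 0 + (W 0 + v + s * v)) + B * s * W 0 + C * prob F"
      using e0 that unfolding W(1) by (simp add: v_def)
    then show ?thesis unfolding s_def[symmetric] v_def[symmetric] by (simp add: algebra_simps)
  qed
qed

lemma D_eq: "D = 0"
  using positive_part[of 0] second_moment_increment(1)[of _ 0] by auto

lemma C_eq: "C = 1 - 2 * A - B * \<rho>\<^sup>2"
proof -
  have "space M \<in> sets (past 0)" using sets.top[of "past 0"] by simp
  from second_moment_increment(3)[OF this D_eq] have "0 = 2 * A + B * \<rho>\<^sup>2 - 1 + C"
    using X_var by (simp add: prob_space cong: Bochner_Integration.integral_cong)
  then show ?thesis by simp
qed

text \<open>If \<open>X\<^sup>2\<close> were a martingale, stationarity would make it constant in time; the quadratic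
  regression then forces \<open>X 0 = 0\<close>.\<close>

lemma A_eq: "A * (1 + \<rho> ^ 4) = (1 - B) * \<rho>\<^sup>2"
proof (rule ccontr)
  assume *: "\<not> ?thesis"
  have eq: "AE \<omega> in M. (X (n + 1) \<omega>)\<^sup>2 = (X n \<omega>)\<^sup>2" for n
  proof (rule AE_eq_of_stationary_martingale[OF X_sq X_sq])
    have "distr M borel (\<lambda>\<omega>. (X k \<omega>)\<^sup>2) = distr (distr M borel (X k)) borel (\<lambda>x. x\<^sup>2)" for k
      by (subst distr_distr) (auto simp: o_def)
    then show "distr M borel (\<lambda>\<omega>. (X (n + 1) \<omega>)\<^sup>2) = distr M borel (\<lambda>\<omega>. (X n \<omega>)\<^sup>2)"
      using X_law[of n] X_law[of "n + 1"] by simp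
    have ce: "AE \<omega> in M. real_cond_exp M (past n) (\<lambda>\<omega>. (X (n + 1) \<omega>)\<^sup>2) \<omega> = (X n \<omega>)\<^sup>2"
    proof (rule cond_exp_eqI[OF past_sub X_sq X_sq])
      show "(\<lambda>\<omega>. (X n \<omega>)\<^sup>2) \<in> borel_measurable (past n)" using past_measurable[of n n] by measurable
      fix F assume "F \<in> sets (past n)"
      from second_moment_increment(2)[OF this D_eq] *
      show "expectation (\<lambda>\<omega>. indicator F \<omega> * (X (n + 1) \<omega>)\<^sup>2) = expectation (\<lambda>\<omega>. indicator F \<omega> * (X n \<omega>)\<^sup>2)" by simp
    qed
    let ?g = "\<lambda>\<omega>. (X n \<omega>)\<^sup>2 / sqrt (1 + ((X n \<omega>)\<^sup>2)\<^sup>2)"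
    show "expectation (\<lambda>\<omega>. ?g \<omega> * (X (n + 1) \<omega>)\<^sup>2) = expectation (\<lambda>\<omega>. ?g \<omega> * (X n \<omega>)\<^sup>2)"
    proof (rule cond_exp_mult[OF past_sub ce])
      show "?g \<in> borel_measurable (past n)" using past_measurable[of n n] by measurable
      show "integrable M (\<lambda>\<omega>. ?g \<omega> * (X (n + 1) \<omega>)\<^sup>2)"
      proof (rule Bochner_Integration.integrable_bound[OF X_sq[of "n + 1"]])
        have le1: "\<bar>x / sqrt (1 + x\<^sup>2)\<bar> \<le> 1" for x :: real
        proof -
          have "\<bar>x\<bar> \<le> sqrt (1 + x\<^sup>2)" by (rule real_le_rsqrt) simp
          moreover have "0 < sqrt (1 + x\<^sup>2)" by (simp add: add_pos_nonneg)
          ultimately show ?thesis by (simp add: abs_divide)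
        qed
        have "\<bar>?g \<omega>\<bar> * \<bar>(X (n + 1) \<omega>)\<^sup>2\<bar> \<le> 1 * \<bar>(X (n + 1) \<omega>)\<^sup>2\<bar>" for \<omega> by (rule mult_right_mono[OF le1 abs_ge_zero])
        then show "AE \<omega> in M. norm (?g \<omega> * (X (n + 1) \<omega>)\<^sup>2) \<le> norm ((X (n + 1) \<omega>)\<^sup>2)"
          by (intro AE_I2) (simp only: real_norm_def abs_mult mult_1)
      qed measurable
    qed measurable
  qed
  have e01: "AE \<omega> in M. (X 1 \<omega>)\<^sup>2 = (X 0 \<omega>)\<^sup>2" and e12: "AE \<omega> in M. (X 2 \<omega>)\<^sup>2 = (X 1 \<omega>)\<^sup>2"
    using eq[of 0] eq[of 1] by auto
  have m0: "X 0 \<in> borel_measurable (others 1)" by (rule others_measurable) simp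
  have m00: "X 0 \<in> borel_measurable (past 0)" by (rule past_measurable) simp
  interpret O: sigma_finite_subalgebra M "others 1" by (rule sigma_finite_subalgebraI[OF others_sub])
  have "AE \<omega> in M. real_cond_exp M (others 1) (\<lambda>\<eta>. (X 1 \<eta>)\<^sup>2) \<omega> = real_cond_exp M (others 1) (\<lambda>\<eta>. (X 0 \<eta>)\<^sup>2) \<omega>"
    by (rule O.real_cond_exp_cong[OF e01]) auto
  moreover have "AE \<omega> in M. real_cond_exp M (others 1) (\<lambda>\<eta>. (X 0 \<eta>)\<^sup>2) \<omega> = (X 0 \<omega>)\<^sup>2"
    by (rule O.real_cond_exp_F_meas[OF X_sq]) (use m0 in measurable)
  ultimately have rel: "AE \<omega> in M. B * (X 0 \<omega> * X 2 \<omega>) = (1 - 2 * A) * (X 0 \<omega>)\<^sup>2 - C"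
    using reg2[of 1] e01 e12
  proof eventually_elim
    case (elim \<omega>)
    then show ?case using D_eq by (simp add: algebra_simps)
  qed
  \<comment> \<open>By \<open>rel\<close>, \<open>B * (X 0 * X 2)\<close> is almost surely a
    function of \<open>X 0\<close>, hence equal to its conditional expectation given the past of 0,
    which is \<open>B * \<rho>\<^sup>2\<close> times the square of \<open>X 0\<close>. Since the
    squares of \<open>X 0\<close> and \<open>X 2\<close> agree, squaring leaves
    \<open>1 - \<rho> ^ 4\<close> times the fourth power of \<open>X 0\<close> equal to 0.\<close>
  have "AE \<omega> in M. (1 - 2 * A) * (X 0 \<omega>)\<^sup>2 - C = B * \<rho>\<^sup>2 * (X 0 \<omega>)\<^sup>2"
  proof (rule AE_eq_of_integrals[OF past_sub[of 0]])
    fix F assume F: "F \<in> sets (past 0)"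
    have "expectation (\<lambda>\<omega>. indicator F \<omega> * ((1 - 2 * A) * (X 0 \<omega>)\<^sup>2 - C)) = expectation (\<lambda>\<omega>. B * (indicator F \<omega> * (X 0 \<omega> * X 2 \<omega>)))"
      using rel past_sets[OF F] by (intro integral_cong_AE) (auto elim!: eventually_mono)
    also have "\<dots> = B * \<rho>\<^sup>2 * expectation (\<lambda>\<omega>. indicator F \<omega> * (X 0 \<omega>)\<^sup>2)" using lag_product[OF F order_refl, of 2] by simp
    also have "\<dots> = expectation (\<lambda>\<omega>. indicator F \<omega> * (B * \<rho>\<^sup>2 * (X 0 \<omega>)\<^sup>2))" by (simp add: mult.left_commute[of _ "B * \<rho>\<^sup>2"])
    finally show "expectation (\<lambda>\<omega>. indicator F \<omega> * ((1 - 2 * A) * (X 0 \<omega>)\<^sup>2 - C)) = expectation (\<lambda>\<omega>. indicator F \<omega> * (B * \<rho>\<^sup>2 * (X 0 \<omega>)\<^sup>2))" .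
  qed (use X_sq m00 in auto)
  with rel e01 e12 have "AE \<omega> in M. X 0 \<omega> = 0"
  proof eventually_elim
    case (elim \<omega>)
    then have "B * (X 0 \<omega> * X 2 \<omega>) = B * (\<rho>\<^sup>2 * (X 0 \<omega>)\<^sup>2)" by simp
    then have "X 0 \<omega> * X 2 \<omega> = \<rho>\<^sup>2 * (X 0 \<omega>)\<^sup>2" using B_pos by simp
    then have "(X 0 \<omega>)\<^sup>2 * (X 2 \<omega>)\<^sup>2 = (\<rho>\<^sup>2 * (X 0 \<omega>)\<^sup>2)\<^sup>2" by (metis power_mult_distrib)
    then have "(1 - \<rho> ^ 4) * ((X 0 \<omega>)\<^sup>2 * (X 0 \<omega>)\<^sup>2) = 0" using elim by (simp add: power_mult_distrib power2_eq_square power4_eq_xxxx algebra_simps)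
    moreover have "\<rho> ^ 4 < 1" using rho by (simp add: power_less_one_iff)
    ultimately show ?case by simp
  qed
  then show False using not_degenerate by simp
qed

text \<open>\<open>1 - A * (1 + \<rho>\<^sup>2)\<close> is the coefficient, and later the
  determinant, of the linear equations for conditional moments; its positivity makes them uniquely
  solvable.\<close>

lemma A_bound: "0 < 1 - A * (1 + \<rho>\<^sup>2)" and C_alt: "C = (1 - \<rho>\<^sup>2) * (1 - A * (1 + \<rho>\<^sup>2))"
proof -
  define s where "s = \<rho>\<^sup>2"
  have "\<rho> * \<rho> < 1 * 1" using rho by (intro mult_strict_mono) auto
  then have s: "0 < s" "s < 1" "\<rho> ^ 4 = s * s" using rho by (auto simp: s_def power4_eq_xxxx power2_eq_square)
  have Aeq: "A * (1 + s * s) = (1 - B) * s" using A_eq unfolding s(3) s_def[symmetric] .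
  have "(1 - A * (1 + s)) * (1 + s * s) = 1 + s * s - (A * (1 + s * s)) * (1 + s)" by (simp add: algebra_simps)
  also have "\<dots> = 1 - s + B * s * (1 + s)" unfolding Aeq by (simp add: algebra_simps)
  also have "\<dots> > 0" using s B_pos by (intro add_pos_pos) auto
  finally have p: "0 < (1 - A * (1 + s)) * (1 + s * s)" .
  have "0 < 1 + s * s" using s by (simp add: add_pos_nonneg)
  then show "0 < 1 - A * (1 + \<rho>\<^sup>2)" using p unfolding s_def[symmetric] by (metis zero_less_mult_pos2)
  show "C = (1 - \<rho>\<^sup>2) * (1 - A * (1 + \<rho>\<^sup>2))"
  proof -
    have "(1 - s) * (1 - A * (1 + s)) = 1 - s - 2 * A + A * (1 + s * s)" by (simp add: algebra_simps)
    also have "\<dots> = 1 - 2 * A - B * s" unfolding Aeq by (simp add: algebra_simps)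
    finally show ?thesis unfolding C_eq s_def[symmetric] by simp
  qed
qed

lemma squared_regression_set:
  assumes F: "F \<in> sets (past n)"
  shows "expectation (\<lambda>\<omega>. indicator F \<omega> * (X (n + 1) \<omega>)\<^sup>2) = \<rho>\<^sup>2 * expectation (\<lambda>\<omega>. indicator F \<omega> * (X n \<omega>)\<^sup>2) + (1 - \<rho>\<^sup>2) * prob F"
proof -
  define w0 where "w0 = expectation (\<lambda>\<omega>. indicator F \<omega> * (X n \<omega>)\<^sup>2)"
  define w1 where "w1 = expectation (\<lambda>\<omega>. indicator F \<omega> * (X (n + 1) \<omega>)\<^sup>2)"
  have "(w1 - w0) * (1 - A * (1 + \<rho>\<^sup>2)) = C * (prob F - w0)"
  proof -
    have "(w1 - w0) * (1 - A * (1 + \<rho>\<^sup>2)) = (2 * A + B * \<rho>\<^sup>2 - 1) * w0 + C * prob F"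
      using second_moment_increment(3)[OF F D_eq] unfolding w0_def w1_def by simp
    moreover have "2 * A + B * \<rho>\<^sup>2 - 1 = - C" using C_eq by simp
    ultimately show ?thesis by (simp only:) (simp add: right_diff_distrib)
  qed
  also have "\<dots> = ((1 - \<rho>\<^sup>2) * (prob F - w0)) * (1 - A * (1 + \<rho>\<^sup>2))" unfolding C_alt by (simp add: mult_ac)
  finally have "w1 - w0 = (1 - \<rho>\<^sup>2) * (prob F - w0)" using A_bound by simp
  then show ?thesis unfolding w0_def[symmetric] w1_def[symmetric] by (simp add: algebra_simps)
qed

end

section \<open>Moments and polynomial regressions\<close>

context prob_space
begin

text \<open>All absolute moments are required at once because this class, unlike the integrable
  functions of one fixed order, is closed under products.\<close>

definition mom :: "('a \<Rightarrow> real) \<Rightarrow> bool" where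
  "mom U \<longleftrightarrow> U \<in> borel_measurable M \<and> (\<forall>k. integrable M (\<lambda>\<omega>. \<bar>U \<omega>\<bar> ^ k))"

lemma momD [measurable_dest]: "mom U \<Longrightarrow> U \<in> borel_measurable M"
  by (simp add: mom_def)

lemma mom_integrable: "mom U \<Longrightarrow> integrable M U"
  using integrable_abs_cancel[of M U] by (auto simp: mom_def dest: spec[of _ 1])

lemma mom_const [intro]: "mom (\<lambda>_. c)"
  by (simp add: mom_def)

lemma mom_indicator [intro]: "F \<in> sets M \<Longrightarrow> mom (indicator F)"
  unfolding mom_def by (auto intro!: integrable_const_bound[where B = 1] AE_I2 power_le_one)

lemma mom_mult [intro]: assumes "mom U" "mom V" shows "mom (\<lambda>\<omega>. U \<omega> * V \<omega>)"
  unfolding mom_def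
proof (intro conjI allI)
  note [measurable] = momD[OF assms(1)] momD[OF assms(2)]
  show "(\<lambda>\<omega>. U \<omega> * V \<omega>) \<in> borel_measurable M" by measurable
  fix k
  show "integrable M (\<lambda>\<omega>. \<bar>U \<omega> * V \<omega>\<bar> ^ k)"
  proof (rule Bochner_Integration.integrable_bound)
    show "integrable M (\<lambda>\<omega>. \<bar>U \<omega>\<bar> ^ (2 * k) + \<bar>V \<omega>\<bar> ^ (2 * k))" using assms by (auto simp: mom_def)
    have "\<bar>u * v\<bar> ^ k \<le> \<bar>u\<bar> ^ (2 * k) + \<bar>v\<bar> ^ (2 * k)" for u v :: real
    proof -
      have "2 * (\<bar>u\<bar> ^ k * \<bar>v\<bar> ^ k) \<le> (\<bar>u\<bar> ^ k)\<^sup>2 + (\<bar>v\<bar> ^ k)\<^sup>2" using sum_squares_bound[of "\<bar>u\<bar> ^ k" "\<bar>v\<bar> ^ k"] by (simp add: mult.assoc)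
      moreover have "0 \<le> \<bar>u\<bar> ^ k * \<bar>v\<bar> ^ k" by simp
      ultimately have "\<bar>u\<bar> ^ k * \<bar>v\<bar> ^ k \<le> (\<bar>u\<bar> ^ k)\<^sup>2 + (\<bar>v\<bar> ^ k)\<^sup>2" by linarith
      then show ?thesis by (simp add: abs_mult power_mult_distrib power_mult[symmetric] mult.commute[of k 2])
    qed
    then show "AE \<omega> in M. norm (\<bar>U \<omega> * V \<omega>\<bar> ^ k) \<le> norm (\<bar>U \<omega>\<bar> ^ (2 * k) + \<bar>V \<omega>\<bar> ^ (2 * k))" by simp
  qed measurable
qed

lemma mom_add [intro]: assumes "mom U" "mom V" shows "mom (\<lambda>\<omega>. U \<omega> + V \<omega>)"
  unfolding mom_def
proof (intro conjI allI)
  note [measurable] = momD[OF assms(1)] momD[OF assms(2)]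
  show "(\<lambda>\<omega>. U \<omega> + V \<omega>) \<in> borel_measurable M" by measurable
  fix k
  show "integrable M (\<lambda>\<omega>. \<bar>U \<omega> + V \<omega>\<bar> ^ k)"
  proof (rule Bochner_Integration.integrable_bound)
    show "integrable M (\<lambda>\<omega>. 2 ^ k * (\<bar>U \<omega>\<bar> ^ k + \<bar>V \<omega>\<bar> ^ k))" using assms by (auto simp: mom_def)
    have "\<bar>u + v\<bar> ^ k \<le> 2 ^ k * (\<bar>u\<bar> ^ k + \<bar>v\<bar> ^ k)" for u v :: real
    proof -
      have "\<bar>u + v\<bar> ^ k \<le> (2 * max \<bar>u\<bar> \<bar>v\<bar>) ^ k" by (rule power_mono) auto
      also have "\<dots> = 2 ^ k * max \<bar>u\<bar> \<bar>v\<bar> ^ k" by (rule power_mult_distrib)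
      also have "max \<bar>u\<bar> \<bar>v\<bar> ^ k \<le> \<bar>u\<bar> ^ k + \<bar>v\<bar> ^ k" by (simp add: max_def)
      finally show ?thesis by simp
    qed
    then show "AE \<omega> in M. norm (\<bar>U \<omega> + V \<omega>\<bar> ^ k) \<le> norm (2 ^ k * (\<bar>U \<omega>\<bar> ^ k + \<bar>V \<omega>\<bar> ^ k))"
      by (simp add: abs_mult)
  qed measurable
qed

lemma mom_cmult: "mom U \<Longrightarrow> mom (\<lambda>\<omega>. c * U \<omega>)" by auto

lemma mom_power [intro]: "mom U \<Longrightarrow> mom (\<lambda>\<omega>. U \<omega> ^ n)"
  by (induction n) auto

lemma mom_opoly [intro]: "mom U \<Longrightarrow> mom (\<lambda>\<omega>. opoly b n (U \<omega>))"
proof (induction n rule: induct_nat_012)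
  case (ge2 n)
  have "mom (\<lambda>\<omega>. U \<omega> * opoly b (Suc n) (U \<omega>) + (- b (Suc n)) * opoly b n (U \<omega>))"
    by (intro mom_add mom_mult mom_const ge2)
  then show ?case by simp
qed auto

definition EF :: "'a set \<Rightarrow> ('a \<Rightarrow> real) \<Rightarrow> real" where
  "EF F U = expectation (\<lambda>\<omega>. indicator F \<omega> * U \<omega>)"

lemma EF_add: "F \<in> sets M \<Longrightarrow> mom U \<Longrightarrow> mom V \<Longrightarrow> EF F (\<lambda>\<omega>. U \<omega> + V \<omega>) = EF F U + EF F V"
  unfolding EF_def distrib_left
  by (intro Bochner_Integration.integral_add mom_integrable mom_mult mom_indicator)

lemma EF_cmult: "EF F (\<lambda>\<omega>. c * U \<omega>) = c * EF F U"
  unfolding EF_def by (simp add: mult.left_commute[of _ c])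

end

text \<open>If |y| is below \<open>r / 2 * \<bar>x\<bar>\<close>, then \<open>y - r * x\<close>
  alone is at least that large, which gives the constant \<open>4 / r\<^sup>2\<close>. Otherwise |x|
  is at most \<open>2 / r * \<bar>y\<bar>\<close>, so the two weights are comparable, and
  \<open>(1 - r\<^sup>2) * x\<close> is a combination of the two residuals, which gives the second
  constant.\<close>

lemma power_bound_two_sided:
  fixes x y r :: real
  assumes r: "0 < r" "r < 1"
  shows "\<bar>x\<bar> ^ (k + 2) \<le> (4 / r\<^sup>2 + 2 / (1 - r\<^sup>2)\<^sup>2 * (1 + (2 / r) ^ k)) * (\<bar>x\<bar> ^ k * (y - r * x)\<^sup>2 + \<bar>y\<bar> ^ k * (x - r * y)\<^sup>2)"
proof -
  define e where "e = y - r * x"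
  define f where "f = x - r * y"
  define a where "a = \<bar>x\<bar> ^ k"
  define b where "b = \<bar>y\<bar> ^ k"
  have "r * r < 1 * 1" using r by (intro mult_strict_mono) auto
  then have "r\<^sup>2 < 1" by (simp add: power2_eq_square)
  then have s: "0 < 1 - r\<^sup>2" by simp
  have nn: "0 \<le> a" "0 \<le> b" "0 \<le> a * e\<^sup>2" "0 \<le> b * f\<^sup>2" by (simp_all add: a_def b_def)
  have xk: "\<bar>x\<bar> ^ (k + 2) = a * x\<^sup>2" by (simp add: a_def power_add power2_eq_square)
  have K: "0 \<le> 4 / r\<^sup>2" "0 \<le> 2 / (1 - r\<^sup>2)\<^sup>2" "0 \<le> (2 / r) ^ k" using r by auto
  show ?thesis
  proof (cases "\<bar>y\<bar> < r / 2 * \<bar>x\<bar>")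
    case True
    have "r * \<bar>x\<bar> \<le> \<bar>e\<bar> + \<bar>y\<bar>" using r abs_triangle_ineq4[of y e] by (simp add: e_def abs_mult)
    then have "r / 2 * \<bar>x\<bar> \<le> \<bar>e\<bar>" using True by (simp add: field_simps)
    then have "(r / 2 * \<bar>x\<bar>)\<^sup>2 \<le> \<bar>e\<bar>\<^sup>2" using r by (intro power_mono) auto
    then have "x\<^sup>2 \<le> 4 / r\<^sup>2 * e\<^sup>2" using r by (simp add: field_simps power2_eq_square)
    then have "a * x\<^sup>2 \<le> a * (4 / r\<^sup>2 * e\<^sup>2)" using nn by (intro mult_left_mono)
    also have "\<dots> = 4 / r\<^sup>2 * (a * e\<^sup>2)" by simp
    also have "\<dots> \<le> (4 / r\<^sup>2 + 2 / (1 - r\<^sup>2)\<^sup>2 * (1 + (2 / r) ^ k)) * (a * e\<^sup>2 + b * f\<^sup>2)"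
      using nn K by (intro mult_mono add_increasing2 mult_nonneg_nonneg add_nonneg_nonneg) auto
    finally show ?thesis unfolding xk e_def f_def a_def b_def .
  next
    case False
    then have "\<bar>x\<bar> \<le> 2 / r * \<bar>y\<bar>" using r by (simp add: field_simps)
    then have "\<bar>x\<bar> ^ k \<le> (2 / r * \<bar>y\<bar>) ^ k" by (intro power_mono) auto
    then have ab: "a \<le> (2 / r) ^ k * b" unfolding a_def b_def power_mult_distrib .
    have "(1 - r\<^sup>2) * x = f + r * e" by (simp add: e_def f_def algebra_simps power2_eq_square)
    then have "((1 - r\<^sup>2) * x)\<^sup>2 = (f + r * e)\<^sup>2" by simp
    also have "\<dots> \<le> 2 * f\<^sup>2 + 2 * (r * e)\<^sup>2"
      using zero_le_power2[of "f - r * e"] by (simp add: power2_eq_square algebra_simps)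
    also have "(r * e)\<^sup>2 \<le> 1 * e\<^sup>2" unfolding power_mult_distrib using \<open>r\<^sup>2 < 1\<close> by (intro mult_right_mono) auto
    finally have "(1 - r\<^sup>2)\<^sup>2 * x\<^sup>2 \<le> 2 * (e\<^sup>2 + f\<^sup>2)" by (simp add: power_mult_distrib)
    then have "x\<^sup>2 \<le> 2 / (1 - r\<^sup>2)\<^sup>2 * (e\<^sup>2 + f\<^sup>2)" using s by (simp add: field_simps)
    then have "a * x\<^sup>2 \<le> a * (2 / (1 - r\<^sup>2)\<^sup>2 * (e\<^sup>2 + f\<^sup>2))" using nn by (intro mult_left_mono)
    also have "\<dots> = 2 / (1 - r\<^sup>2)\<^sup>2 * (a * e\<^sup>2 + a * f\<^sup>2)" by (simp add: algebra_simps)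
    also have "\<dots> \<le> 2 / (1 - r\<^sup>2)\<^sup>2 * (1 * (a * e\<^sup>2) + (2 / r) ^ k * (b * f\<^sup>2))"
      using mult_right_mono[OF ab, of "f\<^sup>2"] K by (intro mult_left_mono add_mono) (auto simp: mult.assoc)
    also have "\<dots> \<le> 2 / (1 - r\<^sup>2)\<^sup>2 * ((1 + (2 / r) ^ k) * (a * e\<^sup>2 + b * f\<^sup>2))"
    proof (rule mult_left_mono[OF _ K(2)])
      have "0 \<le> (2 / r) ^ k * (a * e\<^sup>2)" "0 \<le> 1 * (b * f\<^sup>2)" using nn K by auto
      then show "1 * (a * e\<^sup>2) + (2 / r) ^ k * (b * f\<^sup>2) \<le> (1 + (2 / r) ^ k) * (a * e\<^sup>2 + b * f\<^sup>2)"
        by (simp add: algebra_simps)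
    qed
    also have "\<dots> \<le> (4 / r\<^sup>2 + 2 / (1 - r\<^sup>2)\<^sup>2 * (1 + (2 / r) ^ k)) * (a * e\<^sup>2 + b * f\<^sup>2)"
      unfolding mult.assoc[symmetric] by (rule mult_right_mono) (use nn K in auto)
    finally show ?thesis unfolding xk e_def f_def a_def b_def .
  qed
qed

context tsp
begin

lemma conditional_variance:
  assumes F: "F \<in> sets (past n)"
  shows "expectation (\<lambda>\<omega>. indicator F \<omega> * (X (n + 1) \<omega> - \<rho> * X n \<omega>)\<^sup>2) = (1 - \<rho>\<^sup>2) * prob F"
proof -
  have e: "(\<lambda>\<omega>. indicator F \<omega> * (X (n + 1) \<omega> - \<rho> * X n \<omega>)\<^sup>2)
     = (\<lambda>\<omega>. indicator F \<omega> * (X (n + 1) \<omega>)\<^sup>2 + (- (2 * \<rho>)) * (indicator F \<omega> * (X n \<omega> * X (n + 1) \<omega>)) + \<rho>\<^sup>2 * (indicator F \<omega> * (X n \<omega>)\<^sup>2))"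
    by (auto simp: power2_eq_square algebra_simps)
  have "expectation (\<lambda>\<omega>. indicator F \<omega> * (X (n + 1) \<omega> - \<rho> * X n \<omega>)\<^sup>2)
     = expectation (\<lambda>\<omega>. indicator F \<omega> * (X (n + 1) \<omega>)\<^sup>2) + (- (2 * \<rho>)) * expectation (\<lambda>\<omega>. indicator F \<omega> * (X n \<omega> * X (n + 1) \<omega>)) + \<rho>\<^sup>2 * expectation (\<lambda>\<omega>. indicator F \<omega> * (X n \<omega>)\<^sup>2)"
    unfolding e using ind_int[OF F X_sq] indicator_mult_int[OF F]
    by (simp only: integral_mult_right_zero Bochner_Integration.integral_add Bochner_Integration.integrable_add integrable_mult_right)
  then show ?thesis using lag_product[OF F order_refl, of 1] squared_regression_set[OF F]
    by (simp add: power2_eq_square algebra_simps)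
qed

text \<open>Formulated for weights in the extended nonnegative reals: in
  \<open>weighted_variance_integrable\<close> the finiteness of the left side is the conclusion, so
  it must not be presupposed.\<close>

lemma conditional_variance_nn:
  assumes [measurable]: "g \<in> borel_measurable (past n)"
  shows "(\<integral>\<^sup>+\<omega>. g \<omega> * ennreal ((X (n + 1) \<omega> - \<rho> * X n \<omega>)\<^sup>2) \<partial>M) = (\<integral>\<^sup>+\<omega>. g \<omega> * ennreal (1 - \<rho>\<^sup>2) \<partial>M)"
proof -
  interpret G: sigma_finite_subalgebra M "past n" by (rule sigma_finite_subalgebraI[OF past_sub])
  have r2: "0 \<le> 1 - \<rho>\<^sup>2" using rho by (simp add: abs_square_le_1)
  have int: "integrable M (\<lambda>\<omega>. (X (n + 1) \<omega> - \<rho> * X n \<omega>)\<^sup>2)"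
  proof -
    have e: "(\<lambda>\<omega>. (X (n + 1) \<omega> - \<rho> * X n \<omega>)\<^sup>2)
     = (\<lambda>\<omega>. (X (n + 1) \<omega>)\<^sup>2 + (- (2 * \<rho>)) * (X n \<omega> * X (n + 1) \<omega>) + \<rho>\<^sup>2 * (X n \<omega>)\<^sup>2)"
      by (auto simp: power2_eq_square algebra_simps)
    show ?thesis unfolding e by (intro Bochner_Integration.integrable_add integrable_mult_right X_sq XX_int)
  qed
  have "AE \<omega> in M. ennreal (1 - \<rho>\<^sup>2) = nn_cond_exp M (past n) (\<lambda>\<omega>. ennreal ((X (n + 1) \<omega> - \<rho> * X n \<omega>)\<^sup>2)) \<omega>"
  proof (rule G.nn_cond_exp_charact)
    fix F assume F: "F \<in> sets (past n)"
    have "(\<integral>\<^sup>+\<omega>\<in>F. ennreal ((X (n + 1) \<omega> - \<rho> * X n \<omega>)\<^sup>2) \<partial>M) = (\<integral>\<^sup>+\<omega>. ennreal (indicator F \<omega> * (X (n + 1) \<omega> - \<rho> * X n \<omega>)\<^sup>2) \<partial>M)"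
      by (intro nn_integral_cong) (auto simp: indicator_def)
    also have "\<dots> = ennreal ((1 - \<rho>\<^sup>2) * prob F)"
      unfolding conditional_variance[OF F, symmetric] using ind_int[OF F int] by (intro nn_integral_eq_integral) auto
    also have "\<dots> = (\<integral>\<^sup>+\<omega>\<in>F. ennreal (1 - \<rho>\<^sup>2) \<partial>M)"
      using past_sets[OF F] r2 by (simp add: nn_integral_cmult_indicator ennreal_mult emeasure_eq_measure)
    finally show "(\<integral>\<^sup>+\<omega>\<in>F. ennreal ((X (n + 1) \<omega> - \<rho> * X n \<omega>)\<^sup>2) \<partial>M) = (\<integral>\<^sup>+\<omega>\<in>F. ennreal (1 - \<rho>\<^sup>2) \<partial>M)" .
  qed measurable
  then have "(\<integral>\<^sup>+\<omega>. g \<omega> * ennreal (1 - \<rho>\<^sup>2) \<partial>M) = (\<integral>\<^sup>+\<omega>. g \<omega> * nn_cond_exp M (past n) (\<lambda>\<omega>. ennreal ((X (n + 1) \<omega> - \<rho> * X n \<omega>)\<^sup>2)) \<omega> \<partial>M)"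
    by (intro nn_integral_cong_AE) (auto elim!: eventually_mono)
  then show ?thesis using G.nn_cond_exp_intg[OF assms, of "\<lambda>\<omega>. ennreal ((X (n + 1) \<omega> - \<rho> * X n \<omega>)\<^sup>2)"] by simp
qed

lemma weighted_variance_integrable:
  assumes "integrable M (\<lambda>\<omega>. \<bar>X n \<omega>\<bar> ^ k)"
  shows "integrable M (\<lambda>\<omega>. \<bar>X n \<omega>\<bar> ^ k * (X (n + 1) \<omega> - \<rho> * X n \<omega>)\<^sup>2)"
proof (rule integrableI_bounded)
  note [measurable] = past_measurable[OF order_refl, of n]
  have [measurable]: "(\<lambda>\<omega>. ennreal (\<bar>X n \<omega>\<bar> ^ k)) \<in> borel_measurable (past n)" by measurable
  have "(\<integral>\<^sup>+\<omega>. ennreal (norm (\<bar>X n \<omega>\<bar> ^ k * (X (n + 1) \<omega> - \<rho> * X n \<omega>)\<^sup>2)) \<partial>M)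
    = (\<integral>\<^sup>+\<omega>. ennreal (\<bar>X n \<omega>\<bar> ^ k) * ennreal ((X (n + 1) \<omega> - \<rho> * X n \<omega>)\<^sup>2) \<partial>M)"
    by (intro nn_integral_cong) (simp add: abs_mult ennreal_mult)
  also have "\<dots> = (\<integral>\<^sup>+\<omega>. ennreal (\<bar>X n \<omega>\<bar> ^ k) \<partial>M) * ennreal (1 - \<rho>\<^sup>2)"
    by (subst conditional_variance_nn) (auto intro!: nn_integral_multc)
  also have "(\<integral>\<^sup>+\<omega>. ennreal (\<bar>X n \<omega>\<bar> ^ k) \<partial>M) = ennreal (expectation (\<lambda>\<omega>. \<bar>X n \<omega>\<bar> ^ k))"
    using assms by (intro nn_integral_eq_integral) auto
  finally show "(\<integral>\<^sup>+\<omega>. ennreal (norm (\<bar>X n \<omega>\<bar> ^ k * (X (n + 1) \<omega> - \<rho> * X n \<omega>)\<^sup>2)) \<partial>M) < \<infinity>"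
    by (simp add: ennreal_mult_less_top)
qed measurable

text \<open>If \<open>|X n|\<close> is large, then \<open>X (n + 1) - \<rho> X n\<close> and \<open>X n - \<rho> X (n + 1)\<close> cannot both be small,
  and both have constant conditional variance (the second by time reversal).\<close>

lemma moment_step:
  assumes int: "\<And>n. integrable M (\<lambda>\<omega>. \<bar>X n \<omega>\<bar> ^ k)"
  shows "integrable M (\<lambda>\<omega>. \<bar>X n \<omega>\<bar> ^ (k + 2))"
proof -
  interpret R: tsp M "\<lambda>n. X (- n)" \<rho> A B C D by (rule tsp_reverse)
  have i1: "integrable M (\<lambda>\<omega>. \<bar>X n \<omega>\<bar> ^ k * (X (n + 1) \<omega> - \<rho> * X n \<omega>)\<^sup>2)"
    by (rule weighted_variance_integrable[OF int])
  have i2: "integrable M (\<lambda>\<omega>. \<bar>X (n + 1) \<omega>\<bar> ^ k * (X n \<omega> - \<rho> * X (n + 1) \<omega>)\<^sup>2)"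
    using R.weighted_variance_integrable[of "- n - 1" k] int by (simp add: add.commute)
  define K where "K = 4 / \<rho>\<^sup>2 + 2 / (1 - \<rho>\<^sup>2)\<^sup>2 * (1 + (2 / \<rho>) ^ k)"
  show ?thesis
  proof (rule Bochner_Integration.integrable_bound)
    show "integrable M (\<lambda>\<omega>. K * (\<bar>X n \<omega>\<bar> ^ k * (X (n + 1) \<omega> - \<rho> * X n \<omega>)\<^sup>2 + \<bar>X (n + 1) \<omega>\<bar> ^ k * (X n \<omega> - \<rho> * X (n + 1) \<omega>)\<^sup>2))"
      by (intro integrable_mult_right Bochner_Integration.integrable_add i1 i2)
    show "AE \<omega> in M. norm (\<bar>X n \<omega>\<bar> ^ (k + 2)) \<le> norm (K * (\<bar>X n \<omega>\<bar> ^ k * (X (n + 1) \<omega> - \<rho> * X n \<omega>)\<^sup>2 + \<bar>X (n + 1) \<omega>\<bar> ^ k * (X n \<omega> - \<rho> * X (n + 1) \<omega>)\<^sup>2))"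
    proof (rule AE_I2)
      fix \<omega>
      have "norm (\<bar>X n \<omega>\<bar> ^ (k + 2)) = \<bar>X n \<omega>\<bar> ^ (k + 2)" by simp
      also have "\<dots> \<le> K * (\<bar>X n \<omega>\<bar> ^ k * (X (n + 1) \<omega> - \<rho> * X n \<omega>)\<^sup>2 + \<bar>X (n + 1) \<omega>\<bar> ^ k * (X n \<omega> - \<rho> * X (n + 1) \<omega>)\<^sup>2)"
        unfolding K_def by (rule power_bound_two_sided[OF rho])
      also have "\<dots> \<le> norm \<dots>" by (simp only: real_norm_def abs_ge_self)
      finally show "norm (\<bar>X n \<omega>\<bar> ^ (k + 2)) \<le> norm (K * (\<bar>X n \<omega>\<bar> ^ k * (X (n + 1) \<omega> - \<rho> * X n \<omega>)\<^sup>2 + \<bar>X (n + 1) \<omega>\<bar> ^ k * (X n \<omega> - \<rho> * X (n + 1) \<omega>)\<^sup>2))" .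
    qed
  qed measurable
qed

lemma X_mom: "mom (X n)"
proof -
  have "\<forall>n. integrable M (\<lambda>\<omega>. \<bar>X n \<omega>\<bar> ^ k)" for k
  proof (induction k rule: induct_nat_012)
    case 1 show ?case using X_int by (auto intro: integrable_abs)
  next
    case (ge2 k) then show ?case using moment_step[of k] by auto
  qed auto
  then show ?thesis by (simp add: mom_def)
qed

end

section \<open>One-sided regression of the \<open>q\<close>-Hermite polynomials\<close>

context tsp
begin

definition hreg :: "real \<Rightarrow> nat \<Rightarrow> bool" where
  "hreg q m \<longleftrightarrow> (\<forall>n. \<forall>F\<in>sets (past n). EF F (\<lambda>\<omega>. opoly (qint q) m (X (n + 1) \<omega>)) = \<rho> ^ m * EF F (\<lambda>\<omega>. opoly (qint q) m (X n \<omega>)))"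

lemma hreg_mult:
  assumes h: "hreg q m" and F: "F \<in> sets (past n)" and g: "g \<in> borel_measurable (past n)" "mom g"
  shows "EF F (\<lambda>\<omega>. g \<omega> * opoly (qint q) m (X (n + 1) \<omega>)) = \<rho> ^ m * EF F (\<lambda>\<omega>. g \<omega> * opoly (qint q) m (X n \<omega>))"
proof -
  have mX: "mom (\<lambda>\<omega>. opoly (qint q) m (X k \<omega>))" for k by (intro mom_opoly X_mom)
  have mXn: "(\<lambda>\<omega>. \<rho> ^ m * opoly (qint q) m (X n \<omega>)) \<in> borel_measurable (past n)"
    using past_measurable[OF order_refl, of n] by measurable
  have ce: "AE \<omega> in M. real_cond_exp M (past n) (\<lambda>\<omega>. opoly (qint q) m (X (n + 1) \<omega>)) \<omega> = \<rho> ^ m * opoly (qint q) m (X n \<omega>)"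
  proof (rule cond_exp_eqI[OF past_sub _ _ mXn])
    fix G assume "G \<in> sets (past n)"
    then have "EF G (\<lambda>\<omega>. opoly (qint q) m (X (n + 1) \<omega>)) = EF G (\<lambda>\<omega>. \<rho> ^ m * opoly (qint q) m (X n \<omega>))"
      using h by (simp add: hreg_def EF_cmult)
    then show "expectation (\<lambda>\<omega>. indicator G \<omega> * opoly (qint q) m (X (n + 1) \<omega>)) = expectation (\<lambda>\<omega>. indicator G \<omega> * (\<rho> ^ m * opoly (qint q) m (X n \<omega>)))"
      by (simp add: EF_def)
  qed (auto intro!: mom_integrable mX mom_cmult)
  have "expectation (\<lambda>\<omega>. (indicator F \<omega> * g \<omega>) * opoly (qint q) m (X (n + 1) \<omega>)) = expectation (\<lambda>\<omega>. (indicator F \<omega> * g \<omega>) * (\<rho> ^ m * opoly (qint q) m (X n \<omega>)))"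
  proof (rule cond_exp_mult[OF past_sub ce])
    show "(\<lambda>\<omega>. indicator F \<omega> * g \<omega>) \<in> borel_measurable (past n)"
      using indicator_past[OF F] g(1) by measurable
    show "integrable M (\<lambda>\<omega>. indicator F \<omega> * g \<omega> * opoly (qint q) m (X (n + 1) \<omega>))"
      by (intro mom_integrable mom_mult mom_indicator past_sets[OF F] g mX)
  qed measurable
  then show ?thesis unfolding EF_def
    by (simp add: mult.assoc mult.left_commute[of _ "\<rho> ^ m"])
qed

text \<open>\<open>E[X 1 H (X 2) | past]\<close> and \<open>E[(X 1)^2 H (X 2) | past]\<close>, computed by conditioning on the past of \<open>X 1\<close>
  and by conditioning on everything but \<open>X 1\<close>, are two linear equations that determine the conditional
  expectations of the next polynomial.\<close>

lemma hermite_step: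
  assumes q: "(1 + q) * (1 - 2 * A) * \<rho>\<^sup>2 = B * \<rho>\<^sup>2 * \<rho>\<^sup>2 * q + B"
    and IH: "\<And>i. i < k + 2 \<Longrightarrow> hreg q i"
  shows "hreg q (k + 2)"
  unfolding hreg_def
proof (intro allI ballI)
  fix n F assume F: "F \<in> sets (past n)"
  define m where "m = n + 1"
  have m: "m + 1 - 1 = m" "n = m - 1" "n < m" by (auto simp: m_def)
  have FM: "F \<in> sets M" by (rule past_sets[OF F])
  have Fm: "F \<in> sets (past m)" using F sets_generated_algebra_mono[of "{..n}" "{..m}" M X] by (auto simp: m_def)
  define H where "H i x = opoly (qint q) i x" for i and x :: real
  have mH: "mom (\<lambda>\<omega>. H i (X j \<omega>))" for i j unfolding H_def by (intro mom_opoly X_mom)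
  have pH: "(\<lambda>\<omega>. H i (X j \<omega>)) \<in> borel_measurable (past n')" if "j \<le> n'" for i j n'
    unfolding H_def using past_measurable[OF that] by measurable
  note IHm = hreg_mult[OF IH, folded H_def]
  define b where "b = qint q"
  have b0: "b 0 = 0" by (simp add: b_def)
  have b1: "b (Suc k) = 1 + q * b k" unfolding b_def by (rule qint_Suc')
  have xH: "x * H i x = H (Suc i) x + b i * H (i - 1) x" for x i
    unfolding H_def b_def by (rule opoly_mult_x) simp
  define c2 where "c2 = b (Suc k) + b k"
  define c3 where "c3 = b k * b (k - 1)"
  have x2H: "x * (x * H k x) = H (k + 2) x + c2 * H k x + c3 * H (k - 2) x" for x
  proof -
    have "b k * (x * H (k - 1) x) = b k * H k x + c3 * H (k - 2) x"
      unfolding xH c3_def using b0 by (cases k) (auto simp: algebra_simps numeral_2_eq_2)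
    then show ?thesis unfolding xH distrib_left mult.left_commute[of x "b k"] by (simp add: xH c2_def algebra_simps)
  qed
  define e where "e i = EF F (\<lambda>\<omega>. H i (X n \<omega>))" for i
  define W1 where "W1 = EF F (\<lambda>\<omega>. H (k + 2) (X m \<omega>))"
  define W2 where "W2 = EF F (\<lambda>\<omega>. H (k + 2) (X (m + 1) \<omega>))"
  have E1: "EF F (\<lambda>\<omega>. g \<omega> * H i (X m \<omega>)) = \<rho> ^ i * EF F (\<lambda>\<omega>. g \<omega> * H i (X n \<omega>))"
    if "i < k + 2" "g \<in> borel_measurable (past n)" "mom g" for i g
    using IHm[OF that(1) F that(2,3)] by (simp add: m_def)
  have E2: "EF F (\<lambda>\<omega>. g \<omega> * H i (X (m + 1) \<omega>)) = \<rho> ^ i * EF F (\<lambda>\<omega>. g \<omega> * H i (X m \<omega>))"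
    if "i < k + 2" "g \<in> borel_measurable (past m)" "mom g" for i g
    using IHm[OF that(1) Fm that(2,3)] by simp
  have E12: "EF F (\<lambda>\<omega>. g \<omega> * H i (X (m + 1) \<omega>)) = \<rho> ^ i * \<rho> ^ i * EF F (\<lambda>\<omega>. g \<omega> * H i (X n \<omega>))"
    if "i < k + 2" "g \<in> borel_measurable (past n)" "mom g" for i g
    using E2[OF that(1) past_mono[OF that(2)] that(3)] E1[OF that] by (simp add: m_def)
  have one: "(\<lambda>_. 1) \<in> borel_measurable (past n')" for n' by measurable
  have e1: "EF F (\<lambda>\<omega>. H i (X m \<omega>)) = \<rho> ^ i * e i" if "i < k + 2" for i
    using E1[OF that one mom_const] by (simp add: e_def)
  have e2: "EF F (\<lambda>\<omega>. H i (X (m + 1) \<omega>)) = \<rho> ^ i * \<rho> ^ i * e i" if "i < k + 2" for i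
    using E12[OF that one mom_const] by (simp add: e_def)
  have lin2: "EF F (\<lambda>\<omega>. X j \<omega> * H i (X j \<omega>)) = EF F (\<lambda>\<omega>. H (Suc i) (X j \<omega>)) + b i * EF F (\<lambda>\<omega>. H (i - 1) (X j \<omega>))" for i j
    unfolding xH by (simp add: EF_add[OF FM mH mom_cmult[OF mH]] EF_cmult)
  have lin3: "EF F (\<lambda>\<omega>. X j \<omega> * (X j \<omega> * H k (X j \<omega>))) = EF F (\<lambda>\<omega>. H (k + 2) (X j \<omega>)) + c2 * EF F (\<lambda>\<omega>. H k (X j \<omega>)) + c3 * EF F (\<lambda>\<omega>. H (k - 2) (X j \<omega>))" for j
    unfolding x2H by (simp add: EF_add[OF FM mom_add[OF mH mom_cmult[OF mH]] mom_cmult[OF mH]] EF_add[OF FM mH mom_cmult[OF mH]] EF_cmult)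
  have Xn: "X n \<in> borel_measurable (past n)" "X m \<in> borel_measurable (past m)" by (auto intro: past_measurable)
  have Xn2: "(\<lambda>\<omega>. X n \<omega> * X n \<omega>) \<in> borel_measurable (past n)" "(\<lambda>\<omega>. X m \<omega> * X m \<omega>) \<in> borel_measurable (past m)"
    using Xn by measurable
  define P where "P = \<rho> ^ k"
  have P: "P > 0" using rho by (simp add: P_def)
  define s where "s = \<rho>\<^sup>2"
  have s: "s = \<rho> * \<rho>" by (simp add: s_def power2_eq_square)
  have gm: "(\<lambda>\<omega>. indicator F \<omega> * H i (X (m + 1) \<omega>)) \<in> borel_measurable (others m)" for i
    using past_others[OF indicator_past[OF F] m(3)] others_measurable[of "m + 1" m] unfolding H_def by measurable
  have mg: "mom (\<lambda>\<omega>. indicator F \<omega> * H i (X (m + 1) \<omega>))" for i by (intro mom_mult mom_indicator FM mH)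

  have T1: "EF F (\<lambda>\<omega>. X m \<omega> * H (Suc k) (X (m + 1) \<omega>)) = \<rho> * P * (W1 + b (Suc k) * (P * e k))"
    using E2[of "Suc k" "X m"] Xn X_mom lin2[of m "Suc k"] e1[of k] by (simp add: P_def W1_def)
  have T1': "EF F (\<lambda>\<omega>. X m \<omega> * H (Suc k) (X (m + 1) \<omega>)) =
     \<rho> / (1 + s) * (s * P * P * (e (k + 2) + b (Suc k) * e k) + (W2 + b (Suc k) * (P * P * e k)))"
  proof -
    have "expectation (\<lambda>\<omega>. indicator F \<omega> * H (Suc k) (X (m + 1) \<omega>) * X m \<omega>) = \<rho> / (1 + \<rho>\<^sup>2) *
       (expectation (\<lambda>\<omega>. indicator F \<omega> * H (Suc k) (X (m + 1) \<omega>) * X (m - 1) \<omega>) + expectation (\<lambda>\<omega>. indicator F \<omega> * H (Suc k) (X (m + 1) \<omega>) * X (m + 1) \<omega>))"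
      by (rule reg1_mult[OF gm]) (auto intro!: mom_integrable mom_mult mg X_mom)
    then have "EF F (\<lambda>\<omega>. X m \<omega> * H (Suc k) (X (m + 1) \<omega>)) = \<rho> / (1 + s) *
       (EF F (\<lambda>\<omega>. X n \<omega> * H (Suc k) (X (m + 1) \<omega>)) + EF F (\<lambda>\<omega>. X (m + 1) \<omega> * H (Suc k) (X (m + 1) \<omega>)))"
      unfolding EF_def m(2) s_def by (simp add: mult.assoc mult.commute[of "H _ _"])
    also have "EF F (\<lambda>\<omega>. X n \<omega> * H (Suc k) (X (m + 1) \<omega>)) = s * P * P * (e (k + 2) + b (Suc k) * e k)"
      using E12[of "Suc k" "X n"] Xn X_mom lin2[of n "Suc k"] by (simp add: P_def e_def s mult_ac)
    also have "EF F (\<lambda>\<omega>. X (m + 1) \<omega> * H (Suc k) (X (m + 1) \<omega>)) = W2 + b (Suc k) * (P * P * e k)"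
      using lin2[of "m + 1" "Suc k"] e2[of k] by (simp add: P_def W2_def)
    finally show ?thesis .
  qed
  \<comment> \<open>For \<open>k < 2\<close> the exponent \<open>k - 2\<close> is truncated, but
    then \<open>c3 = 0\<close> because \<open>b 0 = 0\<close>; likewise \<open>b k = 0\<close> at
    \<open>k = 0\<close> protects \<open>u\<close>. The relations below multiply by powers of
    \<open>s\<close> to restore the expected exponents in all cases.\<close>
  define y where "y = c3 * \<rho> ^ (k - 2)"
  define z where "z = c3 * (\<rho> ^ (k - 2) * \<rho> ^ (k - 2))"
  define u where "u = b k * (\<rho> ^ (k - 1) * \<rho> ^ (k - 1))"
  have y: "y * s = c3 * P" and z: "z * (s * s) = c3 * (P * P)" and u: "u * s = b k * (P * P)" 
    using b0 by (cases k; cases "k - 1"; auto simp: y_def z_def u_def s c3_def P_def algebra_simps)+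
  have T2: "EF F (\<lambda>\<omega>. (X m \<omega> * X m \<omega>) * H k (X (m + 1) \<omega>)) = P * (W1 + c2 * (P * e k) + y * e (k - 2))"
    using E2[of k, OF _ Xn2(2)] lin3[of m] e1[of k] e1[of "k - 2"] X_mom by (simp add: P_def W1_def y_def mom_mult mult.assoc)
  have T2': "EF F (\<lambda>\<omega>. (X m \<omega> * X m \<omega>) * H k (X (m + 1) \<omega>)) =
     A * (P * P * (e (k + 2) + c2 * e k + c3 * e (k - 2)) + (W2 + c2 * (P * P * e k) + z * e (k - 2)))
     + B * (s * P * P * (e (k + 2) + b (Suc k) * e k) + u * (e k + b (k - 1) * e (k - 2))) + C * (P * P * e k)"
  proof -
    have "expectation (\<lambda>\<omega>. indicator F \<omega> * H k (X (m + 1) \<omega>) * (X m \<omega>)\<^sup>2) =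
       A * (expectation (\<lambda>\<omega>. indicator F \<omega> * H k (X (m + 1) \<omega>) * (X (m - 1) \<omega>)\<^sup>2) + expectation (\<lambda>\<omega>. indicator F \<omega> * H k (X (m + 1) \<omega>) * (X (m + 1) \<omega>)\<^sup>2))
       + B * expectation (\<lambda>\<omega>. indicator F \<omega> * H k (X (m + 1) \<omega>) * (X (m - 1) \<omega> * X (m + 1) \<omega>))
       + D * (expectation (\<lambda>\<omega>. indicator F \<omega> * H k (X (m + 1) \<omega>) * X (m - 1) \<omega>) + expectation (\<lambda>\<omega>. indicator F \<omega> * H k (X (m + 1) \<omega>) * X (m + 1) \<omega>))
       + C * expectation (\<lambda>\<omega>. indicator F \<omega> * H k (X (m + 1) \<omega>))"
      by (rule reg2_mult[OF gm]) (auto intro!: mom_integrable mom_mult mom_power mg X_mom)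
    then have "EF F (\<lambda>\<omega>. (X m \<omega> * X m \<omega>) * H k (X (m + 1) \<omega>)) =
       A * (EF F (\<lambda>\<omega>. (X n \<omega> * X n \<omega>) * H k (X (m + 1) \<omega>)) + EF F (\<lambda>\<omega>. X (m + 1) \<omega> * (X (m + 1) \<omega> * H k (X (m + 1) \<omega>))))
       + B * EF F (\<lambda>\<omega>. X n \<omega> * (X (m + 1) \<omega> * H k (X (m + 1) \<omega>))) + C * EF F (\<lambda>\<omega>. H k (X (m + 1) \<omega>))"
      unfolding EF_def m(2) D_eq power2_eq_square by (simp add: mult_ac)
    also have "EF F (\<lambda>\<omega>. (X n \<omega> * X n \<omega>) * H k (X (m + 1) \<omega>)) = P * P * (e (k + 2) + c2 * e k + c3 * e (k - 2))"
      using E12[of k, OF _ Xn2(1)] lin3[of n] X_mom by (simp add: P_def e_def mom_mult mult.assoc)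
    also have "EF F (\<lambda>\<omega>. X (m + 1) \<omega> * (X (m + 1) \<omega> * H k (X (m + 1) \<omega>))) = W2 + c2 * (P * P * e k) + z * e (k - 2)"
      using lin3[of "m + 1"] e2[of k] e2[of "k - 2"] by (simp add: P_def W2_def z_def mult.assoc)
    also have "EF F (\<lambda>\<omega>. X n \<omega> * (X (m + 1) \<omega> * H k (X (m + 1) \<omega>))) = s * P * P * (e (k + 2) + b (Suc k) * e k) + u * (e k + b (k - 1) * e (k - 2))"
    proof -
      have "EF F (\<lambda>\<omega>. X n \<omega> * (X (m + 1) \<omega> * H k (X (m + 1) \<omega>))) = EF F (\<lambda>\<omega>. X n \<omega> * H (Suc k) (X (m + 1) \<omega>) + b k * (X n \<omega> * H (k - 1) (X (m + 1) \<omega>)))"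
        unfolding xH by (simp add: algebra_simps)
      also have "\<dots> = EF F (\<lambda>\<omega>. X n \<omega> * H (Suc k) (X (m + 1) \<omega>)) + b k * EF F (\<lambda>\<omega>. X n \<omega> * H (k - 1) (X (m + 1) \<omega>))"
        by (simp add: EF_add[OF FM mom_mult[OF X_mom mH] mom_cmult[OF mom_mult[OF X_mom mH]]] EF_cmult)
      also have "EF F (\<lambda>\<omega>. X n \<omega> * H (Suc k) (X (m + 1) \<omega>)) = s * P * P * (e (k + 2) + b (Suc k) * e k)"
        using E12[of "Suc k" "X n"] Xn X_mom lin2[of n "Suc k"] by (simp add: P_def e_def s mult_ac)
      also have "b k * EF F (\<lambda>\<omega>. X n \<omega> * H (k - 1) (X (m + 1) \<omega>)) = u * (e k + b (k - 1) * e (k - 2))"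
        using E12[of "k - 1" "X n"] Xn X_mom lin2[of n "k - 1"] b0 
        by (cases k) (simp_all add: u_def e_def mult_ac numeral_2_eq_2)
      finally show ?thesis .
    qed
    also have "EF F (\<lambda>\<omega>. H k (X (m + 1) \<omega>)) = P * P * e k"
      using e2[of k] by (simp add: P_def)
    finally show ?thesis .
  qed
  have s0: "0 < s" using rho by (simp add: s)
  have Aeq: "A * (1 + s * s) = (1 - B) * s" using A_eq by (simp add: s power4_eq_xxxx power2_eq_square mult.assoc)
  have Abd: "1 - A * (1 + s) > 0" using A_bound by (simp add: s_def)
  have qs: "(1 + q) * (1 - 2 * A) * s = B * s * s * q + B" using q by (simp add: s_def)
  have Cs: "C = 1 - 2 * A - B * s" using C_eq by (simp add: s_def)
  have eq1: "(1 + s) * P * W1 = s * P * P * e (k + 2) + W2"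
  proof -
    have "\<rho> * P * (W1 + b (Suc k) * (P * e k)) * (1 + s) = \<rho> * (s * P * P * (e (k + 2) + b (Suc k) * e k) + (W2 + b (Suc k) * (P * P * e k)))"
      using T1 T1' s0 by (simp add: field_simps)
    then have "P * (W1 + b (Suc k) * (P * e k)) * (1 + s) = s * P * P * (e (k + 2) + b (Suc k) * e k) + (W2 + b (Suc k) * (P * P * e k))"
      using rho by (simp add: mult.assoc)
    then show ?thesis by (simp add: algebra_simps)
  qed
  \<comment> \<open>The coefficients of \<open>e k\<close> in the second equation cancel. This is
    the place where the relation between \<open>q\<close>, \<open>A\<close> and \<open>B\<close> is
    used, through \<open>b (Suc k) = 1 + q * b k\<close>.\<close>
  have ek: "P * P * c2 = 2 * A * c2 * P * P + B * s * P * P * b (Suc k) + B * u + C * P * P"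
  proof -
    have "s * (P * P * c2) - s * (2 * A * c2 * P * P + B * s * P * P * b (Suc k) + B * u + C * P * P)
      = P * P * (s * c2 * (1 - 2 * A) - B * s * s * b (Suc k) - C * s) - B * (u * s)" by (simp add: algebra_simps)
    also have "\<dots> = P * P * (b k * ((1 + q) * (1 - 2 * A) * s - (B * s * s * q + B)) + s * (1 - 2 * A - B * s - C))"
      unfolding u c2_def b1 by (simp add: algebra_simps)
    also have "\<dots> = 0" unfolding qs Cs by simp
    finally show ?thesis using s0 by simp
  qed
  \<comment> \<open>The coefficients of \<open>e (k - 2)\<close> cancel by \<open>A_eq\<close>,
    whatever the value of \<open>q\<close>.\<close>
  have ek2: "P * y = A * (P * P * c3 + z) + B * (u * b (k - 1))"
  proof -
    have "s * s * (P * y) - s * s * (A * (P * P * c3 + z) + B * (u * b (k - 1)))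
       = P * s * (y * s) - A * (s * s * P * P * c3) - A * (z * (s * s)) - B * s * (u * s) * b (k - 1)" by (simp add: algebra_simps)
    also have "\<dots> = P * P * c3 * (s - A * (1 + s * s) - B * s)" unfolding y z u c3_def by (simp add: algebra_simps)
    also have "\<dots> = 0" unfolding Aeq by (simp add: algebra_simps)
    finally show ?thesis using s0 by simp
  qed
  have "P * (W1 + c2 * (P * e k) + y * e (k - 2)) - (P * P * c2) * e k - (P * y) * e (k - 2)
     = A * (P * P * (e (k + 2) + c2 * e k + c3 * e (k - 2)) + (W2 + c2 * (P * P * e k) + z * e (k - 2)))
     + B * (s * P * P * (e (k + 2) + b (Suc k) * e k) + u * (e k + b (k - 1) * e (k - 2))) + C * (P * P * e k)
     - (2 * A * c2 * P * P + B * s * P * P * b (Suc k) + B * u + C * P * P) * e k - (A * (P * P * c3 + z) + B * (u * b (k - 1))) * e (k - 2)"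
    using T2 T2' ek ek2 by simp
  then have eq2: "P * W1 = A * P * P * e (k + 2) + A * W2 + B * s * P * P * e (k + 2)"
    by (simp add: algebra_simps)
  have W2': "W2 = (1 + s) * P * W1 - s * P * P * e (k + 2)" using eq1 by simp
  \<comment> \<open>Eliminating \<open>W2\<close> from the two equations leaves one for
    \<open>W1\<close> with coefficient \<open>P * (1 - A * (1 + s))\<close>, positive by
    \<open>A_bound\<close>.\<close>
  have "(P * (1 - A * (1 + s))) * (W1 - P * s * e (k + 2)) = P * W1 - A * ((1 + s) * P * W1) - P * P * s * e (k + 2) + (A * (1 + s * s)) * (P * P * e (k + 2)) + A * s * P * P * e (k + 2) - A * P * P * e (k + 2)"
    by (simp add: algebra_simps)
  also have "\<dots> = 0" unfolding eq2 Aeq W2' by (simp add: algebra_simps)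
  finally have "W1 = P * s * e (k + 2)" using P Abd by simp
  then show "EF F (\<lambda>\<omega>. opoly (qint q) (k + 2) (X (n + 1) \<omega>)) = \<rho> ^ (k + 2) * EF F (\<lambda>\<omega>. opoly (qint q) (k + 2) (X n \<omega>))"
    by (simp add: W1_def e_def H_def P_def s power2_eq_square m_def del: opoly.simps)
qed

theorem hermite_regression:
  assumes q: "(1 + q) * (1 - 2 * A) * \<rho>\<^sup>2 = B * \<rho>\<^sup>2 * \<rho>\<^sup>2 * q + B"
  shows "hreg q m"
proof (induction m rule: less_induct)
  case (less m)
  consider "m = 0" | "m = 1" | k where "m = k + 2" by (metis One_nat_def add_2_eq_Suc' not0_implies_Suc)
  then show ?case
  proof cases
    case 1 then show ?thesis by (simp add: hreg_def)
  next
    case 2 then show ?thesis using one_sided_regression_set[of _ _ 1] by (simp add: hreg_def EF_def)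
  next
    case 3 then show ?thesis using hermite_step[OF q, of k] less by simp
  qed
qed

end

section \<open>The continuous-time process\<close>

text \<open>The Cauchy--Schwarz inequality in weighted form: |a b| is at most
  \<open>c * a\<^sup>2 + b\<^sup>2 / c\<close>. First \<open>c\<close> is fixed so that the term
  with \<open>g\<close> is small, then the mean squares of \<open>D n\<close> tend to 0.\<close>

lemma (in prob_space) L2_tendsto:
  assumes g: "g \<in> borel_measurable M" "integrable M (\<lambda>\<omega>. (g \<omega>)\<^sup>2)"
    and D: "\<And>n. D n \<in> borel_measurable M" "\<And>n. integrable M (\<lambda>\<omega>. (D n \<omega> :: real)\<^sup>2)"
    and lim: "((\<lambda>n. expectation (\<lambda>\<omega>. (D n \<omega>)\<^sup>2)) \<longlongrightarrow> 0) F"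
  shows "((\<lambda>n. expectation (\<lambda>\<omega>. \<bar>g \<omega> * D n \<omega>\<bar>)) \<longlongrightarrow> 0) F"
    and "\<And>n. integrable M (\<lambda>\<omega>. g \<omega> * D n \<omega>)"
proof -
  note [measurable] = g(1) D(1)
  have ineq: "\<bar>a * b\<bar> \<le> c * a\<^sup>2 + b\<^sup>2 / c" if "0 < c" for a b c :: real
  proof -
    have "0 \<le> (sqrt c * \<bar>a\<bar> - \<bar>b\<bar> / sqrt c)\<^sup>2" by simp
    also have "\<dots> = (sqrt c * \<bar>a\<bar>)\<^sup>2 + (\<bar>b\<bar> / sqrt c)\<^sup>2 - 2 * ((sqrt c * \<bar>a\<bar>) * (\<bar>b\<bar> / sqrt c))"
      by (simp add: power2_diff)
    also have "\<dots> = c * a\<^sup>2 + b\<^sup>2 / c - 2 * \<bar>a * b\<bar>"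
      using that by (simp add: power_mult_distrib power_divide abs_mult)
    finally show ?thesis using abs_ge_zero[of "a * b"] by linarith
  qed
  show int: "integrable M (\<lambda>\<omega>. g \<omega> * D n \<omega>)" for n
  proof (rule Bochner_Integration.integrable_bound)
    show "integrable M (\<lambda>\<omega>. 1 * (g \<omega>)\<^sup>2 + (D n \<omega>)\<^sup>2 / 1)" using g D by simp
    show "AE \<omega> in M. norm (g \<omega> * D n \<omega>) \<le> norm (1 * (g \<omega>)\<^sup>2 + (D n \<omega>)\<^sup>2 / 1)"
      using ineq[of 1] by (intro AE_I2) (simp only: real_norm_def, force)
  qed measurable
  have bd: "expectation (\<lambda>\<omega>. \<bar>g \<omega> * D n \<omega>\<bar>) \<le> c * expectation (\<lambda>\<omega>. (g \<omega>)\<^sup>2) + expectation (\<lambda>\<omega>. (D n \<omega>)\<^sup>2) / c" if "0 < c" for c n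
  proof -
    have "expectation (\<lambda>\<omega>. \<bar>g \<omega> * D n \<omega>\<bar>) \<le> expectation (\<lambda>\<omega>. c * (g \<omega>)\<^sup>2 + (D n \<omega>)\<^sup>2 / c)"
      using int[of n] g D ineq[OF that] by (intro integral_mono) auto
    then show ?thesis using g D by simp
  qed
  show "((\<lambda>n. expectation (\<lambda>\<omega>. \<bar>g \<omega> * D n \<omega>\<bar>)) \<longlongrightarrow> 0) F"
  proof (rule tendstoI)
    fix e :: real assume e: "0 < e"
    define E where "E = expectation (\<lambda>\<omega>. (g \<omega>)\<^sup>2)"
    have E: "0 \<le> E" unfolding E_def by (rule integral_nonneg_AE) simp
    define c where "c = e / (2 * (E + 1))"
    have c: "0 < c" "c * E < e / 2" using e E by (auto simp: c_def field_simps)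
    have "\<forall>\<^sub>F n in F. dist (expectation (\<lambda>\<omega>. (D n \<omega>)\<^sup>2)) 0 < c * (e / 2)"
      by (rule tendstoD[OF lim]) (use c e in auto)
    then show "\<forall>\<^sub>F n in F. dist (expectation (\<lambda>\<omega>. \<bar>g \<omega> * D n \<omega>\<bar>)) 0 < e"
    proof eventually_elim
      case (elim n)
      then have "expectation (\<lambda>\<omega>. (D n \<omega>)\<^sup>2) / c < e / 2" using c by (simp add: field_simps)
      then have "expectation (\<lambda>\<omega>. \<bar>g \<omega> * D n \<omega>\<bar>) < e" using bd[OF c(1), of n] c(2) unfolding E_def by linarith
      moreover have "0 \<le> expectation (\<lambda>\<omega>. \<bar>g \<omega> * D n \<omega>\<bar>)" by (rule integral_nonneg_AE) simp
      ultimately show ?case by simp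
    qed
  qed
qed

text \<open>With \<open>s = r\<^sup>2\<close> the second parameter reduces to
  \<open>Q = n / (s * d)\<close>, and \<open>p1\<close>, \<open>p2\<close> evaluate
  \<open>1 + Q\<close> and \<open>1 - Q\<close> times \<open>s * d\<close>. For positive
  \<open>d\<close>, \<open>p1\<close> and \<open>Q > -1\<close> give \<open>B > 0\<close>. For
  negative \<open>d\<close>, \<open>p1\<close> would make \<open>B\<close> negative, whereupon
  \<open>p2\<close> contradicts \<open>Q \<le> 1\<close>. The second conclusion is the relation that
  makes \<open>hermite_step\<close> work.\<close>

lemma second_parameter_relations:
  assumes r: "0 < r" "r < 1" and dn: "second_parameter_denom r B \<noteq> 0" and q: "second_parameter r B \<in> {-1<..1}"
  shows "0 < B"
    and "A * (1 + r ^ 4) = (1 - B) * r\<^sup>2 \<Longrightarrow>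
      (1 + second_parameter r B) * (1 - 2 * A) * r\<^sup>2 = B * r\<^sup>2 * r\<^sup>2 * second_parameter r B + B"
proof -
  define s where "s = r\<^sup>2"
  have "r * r < 1 * 1" using r by (intro mult_strict_mono) auto
  then have s: "0 < s" "s < 1" using r by (auto simp: s_def power2_eq_square)
  have r4: "r ^ 4 = s * s" by (simp add: s_def power4_eq_xxxx power2_eq_square)
  have b: "B * (r + 1 / r)\<^sup>2 = B * (1 + s)\<^sup>2 / s" using r by (simp add: s_def power2_eq_square field_simps)
  define d where "d = 1 - s + B * s * (1 + s)"
  define n where "n = B * (1 + s) - s * (1 - s)"
  have D: "second_parameter_denom r B = (1 + s) * d"
    unfolding second_parameter_denom_def r4 b d_def using s by (simp add: field_simps power2_eq_square)
  have N: "r ^ 4 + B * (r + 1 / r)\<^sup>2 - 1 = (1 + s) * n / s"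
    unfolding r4 b n_def using s by (simp add: field_simps power2_eq_square)
  define Q where "Q = second_parameter r B"
  have Q: "Q = (1 + s) * n / s / ((1 + s) * d)" unfolding Q_def second_parameter_def D N ..
  have d0: "d \<noteq> 0" using dn D by auto
  have "Q = n / (s * d)" unfolding Q using s by simp
  then have Qd: "Q * s * d = n" using d0 s by simp
  have q1: "-1 < Q" "Q \<le> 1" using q by (auto simp: Q_def)
  have p1: "(1 + Q) * (s * d) = (1 + s * s) * B * (1 + s)"
  proof -
    have "(1 + Q) * (s * d) = s * d + Q * s * d" by (simp add: algebra_simps)
    then show ?thesis unfolding Qd by (simp add: d_def n_def algebra_simps)
  qed
  have p2: "(1 - Q) * (s * d) = (1 - s) * (2 * s - B * (1 + s) * (1 + s))"
  proof -
    have "(1 - Q) * (s * d) = s * d - Q * s * d" by (simp add: algebra_simps)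
    then show ?thesis unfolding Qd by (simp add: d_def n_def algebra_simps)
  qed
  have ss: "0 < 1 + s * s" "0 < 1 + s" using s by (auto intro: add_pos_pos)
  show "0 < B"
  proof (cases "d > 0")
    case True
    then have "0 < (1 + Q) * (s * d)" using q1 s by simp
    then have "0 < (1 + s * s) * B * (1 + s)" unfolding p1 .
    then show ?thesis using ss by (simp add: zero_less_mult_iff)
  next
    case False
    then have d: "d < 0" using d0 by simp
    then have "(1 + Q) * (s * d) < 0" using q1 s by (simp add: mult_less_0_iff)
    then have "(1 + s * s) * B * (1 + s) < 0" unfolding p1 .
    then have B: "B < 0" using ss by (simp add: mult_less_0_iff zero_less_mult_iff)
    have "(1 - Q) * (s * d) \<le> 0" using q1 s d by (simp add: mult_nonneg_nonpos mult_le_0_iff)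
    moreover have "0 < 2 * s - B * (1 + s) * (1 + s)" 
    proof -
      have "B * (1 + s) * (1 + s) \<le> 0" using B ss by (simp add: mult_nonpos_nonneg)
      then show ?thesis using s by linarith
    qed
    then have "0 < (1 - Q) * (s * d)" unfolding p2 using s by simp
    ultimately show ?thesis by linarith
  qed
  show "(1 + second_parameter r B) * (1 - 2 * A) * r\<^sup>2 = B * r\<^sup>2 * r\<^sup>2 * second_parameter r B + B"
    if A: "A * (1 + r ^ 4) = (1 - B) * r\<^sup>2"
  proof -
    have A': "A * (1 + s * s) = (1 - B) * s" using A unfolding r4 s_def[symmetric] .
    have "((1 + Q) * (1 - 2 * A) * s - (B * s * s * Q + B)) * (1 + s * s)
      = (1 + Q) * s * (1 + s * s) - 2 * (1 + Q) * s * (A * (1 + s * s)) - (B * s * s * Q + B) * (1 + s * s)"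
      by (simp add: algebra_simps)
    also have "\<dots> = (1 - s) * (Q * s * d - n)" unfolding A' d_def n_def by (simp add: algebra_simps)
    also have "\<dots> = 0" unfolding Qd by simp
    finally show ?thesis using ss unfolding Q_def[symmetric] s_def[symmetric] by simp
  qed
qed

locale ctsp =
  fixes M :: "'a measure" and Y :: "real \<Rightarrow> 'a \<Rightarrow> real"
  assumes ctsp: "continuous_time_regular_TSP M Y"

sublocale ctsp \<subseteq> prob_space M
  using ctsp by (simp add: continuous_time_regular_TSP_def stochastic_process_def)

context ctsp
begin

lemma Y_meas [measurable]: "Y t \<in> borel_measurable M"
  using ctsp by (simp add: continuous_time_regular_TSP_def stochastic_process_def)

lemma Y_sq: "integrable M (\<lambda>\<omega>. (Y t \<omega>)\<^sup>2)"
  using ctsp by (simp add: continuous_time_regular_TSP_def L2_continuous_def square_integrable_def)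

lemma Y_diff_sq: "integrable M (\<lambda>\<omega>. (Y s \<omega> - Y t \<omega>)\<^sup>2)"
proof (rule Bochner_Integration.integrable_bound)
  show "integrable M (\<lambda>\<omega>. 2 * ((Y s \<omega>)\<^sup>2 + (Y t \<omega>)\<^sup>2))" using Y_sq by simp
  have "(a - b)\<^sup>2 \<le> 2 * (a\<^sup>2 + b\<^sup>2)" for a b :: real
    using zero_le_power2[of "a + b"] by (simp add: power2_eq_square algebra_simps)
  then show "AE \<omega> in M. norm ((Y s \<omega> - Y t \<omega>)\<^sup>2) \<le> norm (2 * ((Y s \<omega>)\<^sup>2 + (Y t \<omega>)\<^sup>2))" by simp
qed measurable

lemma Y_L2: "((\<lambda>s. expectation (\<lambda>\<omega>. (Y s \<omega> - Y t \<omega>)\<^sup>2)) \<longlongrightarrow> 0) (nhds t)"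
proof -
  have "((\<lambda>s. expectation (\<lambda>\<omega>. (Y s \<omega> - Y t \<omega>)\<^sup>2)) \<longlongrightarrow> 0) (at t)"
    using ctsp by (simp add: continuous_time_regular_TSP_def L2_continuous_def)
  then show ?thesis by (simp add: tendsto_nhds_iff)
qed

lemma stationary_integral:
  assumes J: "finite J" and [measurable]: "f \<in> borel_measurable (PiM J (\<lambda>_. borel))"
  shows "expectation (\<lambda>\<omega>. f (\<lambda>t\<in>J. Y (t + h) \<omega>)) = expectation (\<lambda>\<omega>. f (\<lambda>t\<in>J. Y t \<omega>) :: real)"
proof -
  have s: "distr M (PiM J (\<lambda>_. borel)) (\<lambda>\<omega>. \<lambda>t\<in>J. Y (t + h) \<omega>) = distr M (PiM J (\<lambda>_. borel)) (\<lambda>\<omega>. \<lambda>t\<in>J. Y t \<omega>)"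
    using ctsp J unfolding continuous_time_regular_TSP_def stationary_def by blast
  have "expectation (\<lambda>\<omega>. f (\<lambda>t\<in>J. Y (t + k) \<omega>)) = (\<integral>x. f x \<partial>distr M (PiM J (\<lambda>_. borel)) (\<lambda>\<omega>. \<lambda>t\<in>J. Y (t + k) \<omega>))" for k
    by (rule integral_distr[symmetric]) measurable
  from this[of h] this[of 0] show ?thesis using s by simp
qed

lemma Y_law: "distr M borel (Y t) = distr M borel (Y 0)"
proof -
  have s: "distr M (PiM {0} (\<lambda>_. borel)) (\<lambda>\<omega>. \<lambda>u\<in>{0}. Y (u + t) \<omega>) = distr M (PiM {0} (\<lambda>_. borel)) (\<lambda>\<omega>. \<lambda>u\<in>{0}. Y u \<omega>)"
    using ctsp unfolding continuous_time_regular_TSP_def stationary_def by blast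
  have "distr M borel (Y (0 + k)) = distr (distr M (PiM {0} (\<lambda>_. borel)) (\<lambda>\<omega>. \<lambda>u\<in>{0}. Y (u + k) \<omega>)) borel (\<lambda>x. x 0)" for k
    by (subst distr_distr) (auto simp: o_def)
  from this[of t] this[of 0] show ?thesis using s by simp
qed

lemma Y_law_integral: "f \<in> borel_measurable borel \<Longrightarrow> expectation (\<lambda>\<omega>. f (Y t \<omega>) :: real) = expectation (\<lambda>\<omega>. f (Y 0 \<omega>))"
  using integral_distr[of "Y t" M borel f] integral_distr[of "Y 0" M borel f] Y_law[of t] by simp

lemma grid: "0 < \<delta> \<Longrightarrow> regular_one_TSP M (\<lambda>n. Y (of_int n * \<delta>))"
  using ctsp by (simp add: continuous_time_regular_TSP_def)

lemma Y_mean: "expectation (Y t) = 0" and Y_var: "expectation (\<lambda>\<omega>. (Y t \<omega>)\<^sup>2) = 1"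
proof -
  have "expectation (Y 0) = 0" "expectation (\<lambda>\<omega>. (Y 0 \<omega>)\<^sup>2) = 1"
    using grid[of 1] unfolding regular_one_TSP_def one_TSP_with_def by (auto dest: spec[of _ 0])
  then show "expectation (Y t) = 0" "expectation (\<lambda>\<omega>. (Y t \<omega>)\<^sup>2) = 1"
    using Y_law_integral[of "\<lambda>x. x" t] Y_law_integral[of "\<lambda>x. x\<^sup>2" t] by auto
qed

definition R :: "real \<Rightarrow> real" where "R t = expectation (\<lambda>\<omega>. Y 0 \<omega> * Y t \<omega>)"

lemma YY_int: "integrable M (\<lambda>\<omega>. Y s \<omega> * Y t \<omega>)"
proof (rule Bochner_Integration.integrable_bound)
  show "integrable M (\<lambda>\<omega>. (Y s \<omega>)\<^sup>2 + (Y t \<omega>)\<^sup>2)" using Y_sq by simp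
  have "\<bar>x * y\<bar> \<le> x\<^sup>2 + y\<^sup>2" for x y :: real
  proof -
    have "2 * (\<bar>x\<bar> * \<bar>y\<bar>) \<le> x\<^sup>2 + y\<^sup>2" using sum_squares_bound[of "\<bar>x\<bar>" "\<bar>y\<bar>"] by (simp add: mult.assoc)
    moreover have "0 \<le> \<bar>x\<bar> * \<bar>y\<bar>" by simp
    ultimately show ?thesis unfolding abs_mult by linarith
  qed
  then show "AE \<omega> in M. norm (Y s \<omega> * Y t \<omega>) \<le> norm ((Y s \<omega>)\<^sup>2 + (Y t \<omega>)\<^sup>2)" by simp
qed measurable

lemma R_0: "R 0 = 1" using Y_var[of 0] by (simp add: R_def power2_eq_square)

lemma R_abs_le: "\<bar>R t\<bar> \<le> 1"
proof -
  have "\<bar>R t\<bar> \<le> expectation (\<lambda>\<omega>. \<bar>Y 0 \<omega> * Y t \<omega>\<bar>)" unfolding R_def by (rule integral_abs_bound)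
  also have "\<dots> \<le> expectation (\<lambda>\<omega>. ((Y 0 \<omega>)\<^sup>2 + (Y t \<omega>)\<^sup>2) / 2)"
  proof (rule integral_mono)
    have half: "2 * p \<le> c \<Longrightarrow> p \<le> c / 2" for p c :: real by simp
    fix \<omega>
    have "2 * (\<bar>Y 0 \<omega>\<bar> * \<bar>Y t \<omega>\<bar>) \<le> (Y 0 \<omega>)\<^sup>2 + (Y t \<omega>)\<^sup>2" using sum_squares_bound[of "\<bar>Y 0 \<omega>\<bar>" "\<bar>Y t \<omega>\<bar>"] by (simp add: mult.assoc)
    then show "\<bar>Y 0 \<omega> * Y t \<omega>\<bar> \<le> ((Y 0 \<omega>)\<^sup>2 + (Y t \<omega>)\<^sup>2) / 2" unfolding abs_mult by (rule half)
  qed (use YY_int Y_sq in auto)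
  also have "\<dots> = 1" using Y_sq Y_var by simp
  finally show ?thesis .
qed

lemma R_cont: "continuous_on UNIV R"
proof -
  have "(R \<longlongrightarrow> R t) (nhds t)" for t
  proof -
    have "((\<lambda>s. expectation (\<lambda>\<omega>. \<bar>Y 0 \<omega> * (Y s \<omega> - Y t \<omega>)\<bar>)) \<longlongrightarrow> 0) (nhds t)"
      by (rule L2_tendsto(1)) (use Y_sq Y_diff_sq Y_L2 in auto)
    then have "((\<lambda>s. R s - R t) \<longlongrightarrow> 0) (nhds t)"
    proof (rule Lim_null_comparison[rotated], intro always_eventually allI)
      fix s
      have "R s - R t = expectation (\<lambda>\<omega>. Y 0 \<omega> * (Y s \<omega> - Y t \<omega>))" unfolding R_def right_diff_distrib
        by (rule Bochner_Integration.integral_diff[symmetric]) (rule YY_int)+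
      then show "norm (R s - R t) \<le> expectation (\<lambda>\<omega>. \<bar>Y 0 \<omega> * (Y s \<omega> - Y t \<omega>)\<bar>)"
        unfolding real_norm_def by (simp only:) (rule integral_abs_bound)
    qed
    then show ?thesis by (simp add: LIM_zero_iff)
  qed
  then show ?thesis by (simp add: continuous_on_eq_continuous_at isCont_def tendsto_mono[OF _] at_within_le_nhds) (meson at_within_le_nhds tendsto_mono)
qed

lemma correlation_grid: "correlation M (Y 0) (Y t) = R t"
  by (simp add: correlation_def covariance_def Y_mean R_def Y_var flip: power2_eq_square)

text \<open>\<open>R\<close> is continuous with \<open>R 0 = 1\<close>, and a zero at a positive
  time would make the grid of that mesh violate the nonvanishing of its correlation. So negative
  correlations, allowed for a single sequence, cannot occur here.\<close>

lemma R_pos: assumes "0 \<le> t" shows "0 < R t"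
proof (rule ccontr)
  assume "\<not> 0 < R t"
  then have "\<exists>x\<ge>0. x \<le> t \<and> R x = 0"
    using IVT2'[of R t 0 0] assms R_0 continuous_on_subset[OF R_cont] by force
  then obtain x where x: "0 \<le> x" "R x = 0" by auto
  then have "0 < x" using R_0 by (cases "x = 0") auto
  from grid[OF this] x correlation_grid[of x] show False
    by (auto simp: regular_one_TSP_def Let_def)
qed

lemma R_less_1: assumes "0 < t" shows "R t < 1"
  using grid[OF assms] correlation_grid[of t] by (auto simp: regular_one_TSP_def Let_def)

text \<open>For a coefficient at least \<open>1/2\<close> the correlations would be concave, hence eventually negative.\<close>

lemma grid_covariance:
  assumes d: "0 < \<delta>" and tsp: "one_TSP_with M (\<lambda>n. Y (of_int n * \<delta>)) a A B C D"
  shows "a = R \<delta> / (1 + (R \<delta>)\<^sup>2)" and "R (real k * \<delta>) = R \<delta> ^ k"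
proof -
  define r where "r k = R (real k * \<delta>)" for k
  have sub: "subalgebra M (generated_algebra M (- {n}) (\<lambda>n. Y (of_int n * \<delta>)))" for n :: int
    by (rule subalgebra_generated_algebra) measurable
  have rec: "r (Suc k) = a * (r k + r (Suc (Suc k)))" for k
  proof -
    let ?n = "int (Suc k)"
    have ce: "AE \<omega> in M. real_cond_exp M (generated_algebra M (- {?n}) (\<lambda>n. Y (of_int n * \<delta>))) (Y (of_int ?n * \<delta>)) \<omega>
      = a * (Y (of_int (?n - 1) * \<delta>) \<omega> + Y (of_int (?n + 1) * \<delta>) \<omega>)"
      using tsp unfolding one_TSP_with_def by blast
    have "expectation (\<lambda>\<omega>. Y 0 \<omega> * Y (of_int ?n * \<delta>) \<omega>) = expectation (\<lambda>\<omega>. Y 0 \<omega> * (a * (Y (of_int (?n - 1) * \<delta>) \<omega> + Y (of_int (?n + 1) * \<delta>) \<omega>)))"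
    proof (rule cond_exp_mult[OF sub ce])
      show "Y 0 \<in> borel_measurable (generated_algebra M (- {?n}) (\<lambda>n. Y (of_int n * \<delta>)))"
        using measurable_generated_algebra[of 0 "- {?n}" "\<lambda>n. Y (of_int n * \<delta>)" M] by simp
    qed (auto intro: YY_int)
    also have "\<dots> = expectation (\<lambda>\<omega>. a * (Y 0 \<omega> * Y (of_int (?n - 1) * \<delta>) \<omega> + Y 0 \<omega> * Y (of_int (?n + 1) * \<delta>) \<omega>))"
      by (simp add: algebra_simps)
    also have "\<dots> = a * (R (of_int (?n - 1) * \<delta>) + R (of_int (?n + 1) * \<delta>))"
      unfolding R_def by (simp only: integral_mult_right_zero Bochner_Integration.integral_add YY_int)
    finally show ?thesis unfolding r_def R_def[symmetric] by (simp add: algebra_simps)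
  qed
  have r0: "r 0 = 1" by (simp add: r_def R_0)
  have pos: "0 < r k" for k unfolding r_def using d by (intro R_pos) simp
  have le1: "\<bar>r k\<bar> \<le> 1" for k by (simp add: r_def R_abs_le)
  have r1: "r 1 = R \<delta>" "r 1 < 1" using R_less_1[OF d] by (auto simp: r_def)
  have a: "0 < a" using rec[of 0] pos[of 1] pos[of 0] pos[of 2]
    by (metis One_nat_def Suc_1 add_pos_pos zero_less_mult_pos2)
  have a2: "2 * a < 1"
  proof (rule ccontr)
    assume "\<not> 2 * a < 1"
    then have a2: "1 \<le> 2 * a" by simp
    have conc: "r (Suc (Suc k)) - r (Suc k) \<le> r (Suc k) - r k" for k
    proof -
      have "r k + r (Suc (Suc k)) \<le> 2 * a * (r k + r (Suc (Suc k)))"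
        using a2 pos[of k] pos[of "Suc (Suc k)"] by simp
      then show ?thesis using rec[of k] by (simp add: mult.assoc)
    qed
    have step: "r (Suc k) - r k \<le> r 1 - 1" for k
      by (induction k) (use r0 conc order_trans in \<open>auto, blast\<close>)
    have "r k \<le> 1 - real k * (1 - r 1)" for k
    proof (induction k)
      case (Suc k) then show ?case using step[of k] by (simp add: algebra_simps)
    qed (simp add: r0)
    moreover obtain k :: nat where "1 / (1 - r 1) < real k" using reals_Archimedean2 by blast
    then have "1 < real k * (1 - r 1)" using r1 by (simp add: field_simps)
    ultimately show False using pos[of k] by (smt (verit))
  qed
  \<comment> \<open>The smaller root of \<open>a * (1 + l\<^sup>2) = l\<close>, real because
    \<open>2 * a < 1\<close>. The other root is its inverse, and \<open>bounded_recurrence\<close>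
    discards the corresponding solution.\<close>
  define l where "l = (1 - sqrt (1 - (2 * a)\<^sup>2)) / (2 * a)"
  have "(2 * a) * (2 * a) < 1 * 1" using a a2 by (intro mult_strict_mono) auto
  then have sq: "0 < 1 - (2 * a)\<^sup>2" by (simp add: power2_eq_square)
  define w where "w = sqrt (1 - (2 * a)\<^sup>2)"
  have w: "0 < w" "w * w = 1 - 2 * a * (2 * a)" using sq by (auto simp: w_def power2_eq_square)
  have "w < 1"
  proof -
    have "1 - (2 * a)\<^sup>2 < 1" using a by simp
    then show ?thesis unfolding w_def by (simp add: real_sqrt_lt_1_iff)
  qed
  moreover have "1 - 2 * a < w"
  proof (rule power2_less_imp_less)
    have "(1 - 2 * a) * (1 - 2 * a) = w * w - 4 * a * (1 - 2 * a)" unfolding w by (simp add: algebra_simps)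
    moreover have "0 < 4 * a * (1 - 2 * a)" using a a2 by simp
    ultimately show "(1 - 2 * a)\<^sup>2 < w\<^sup>2" by (simp add: power2_eq_square)
  qed (use w in auto)
  moreover have lw: "l = (1 - w) / (2 * a)" by (simp only: l_def w_def)
  ultimately have l: "0 < l" "l < 1" using a unfolding lw by (auto simp: divide_less_eq)
  have la: "l = a * (1 + l\<^sup>2)"
  proof -
    have l2: "2 * a * l = 1 - w" using a by (simp add: lw)
    have "4 * a * (a * (1 + l\<^sup>2)) = 4 * a * a + (2 * a * l) * (2 * a * l)" by (simp add: power2_eq_square algebra_simps)
    also have "\<dots> = 1 + w * w - 2 * w + 4 * a * a" unfolding l2 by (simp add: algebra_simps)
    also have "\<dots> = 2 * (1 - w)" unfolding w by simp
    also have "\<dots> = 4 * a * l" unfolding l2[symmetric] by simp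
    finally show ?thesis using a by simp
  qed
  have rk: "r k = l ^ k * r 0" for k
  proof (rule bounded_recurrence[OF l le1])
    fix k
    have "(1 + l\<^sup>2) * r (Suc k) = (a * (1 + l\<^sup>2)) * (r k + r (Suc (Suc k)))" unfolding rec[of k] by simp
    then show "(1 + l\<^sup>2) * r (Suc k) = l * (r k + r (Suc (Suc k)))" unfolding la[symmetric] .
  qed
  have lR: "l = R \<delta>" using rk[of 1] r0 r1 by simp
  show "R (real k * \<delta>) = R \<delta> ^ k" using rk[of k] r0 by (simp add: r_def lR)
  have "0 < 1 + l\<^sup>2" using zero_le_power2[of l] by linarith
  then show "a = R \<delta> / (1 + (R \<delta>)\<^sup>2)" using la unfolding lR by (simp add: field_simps)
qed

definition alpha :: real where "alpha = - ln (R 1)"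

lemma alpha_pos: "0 < alpha"
  using R_pos[of 1] R_less_1[of 1] by (simp add: alpha_def)

lemma R_power: "0 < \<delta> \<Longrightarrow> R (real k * \<delta>) = R \<delta> ^ k"
  using grid[of \<delta>] grid_covariance(2) unfolding regular_one_TSP_def by blast

text \<open>The power law on the mesh \<open>1 / Suc n\<close> fixes \<open>R\<close> at the
  multiples of that mesh; continuity extends it to their limits.\<close>

lemma R_eq: assumes t: "0 \<le> t" shows "R t = exp (- alpha * t)"
proof -
  have inv: "R (1 / real (Suc n)) = exp (- alpha / real (Suc n))" for n
  proof -
    have "R (1 / real (Suc n)) ^ Suc n = R 1" using R_power[of "1 / real (Suc n)" "Suc n"] by simp
    also have "R 1 = exp (- alpha)" using R_pos[of 1] by (simp add: alpha_def)
    also have "\<dots> = exp (- alpha / real (Suc n)) ^ Suc n" by (subst exp_of_nat_mult[symmetric]) simp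
    finally show ?thesis by (rule power_eq_imp_eq_base) (use R_pos[of "1 / real (Suc n)"] in auto)
  qed
  define x where "x n = real (nat \<lfloor>t * real (Suc n)\<rfloor>) * (1 / real (Suc n))" for n
  have Rx: "R (x n) = exp (- alpha * x n)" for n
  proof -
    have "R (x n) = exp (- alpha / real (Suc n)) ^ nat \<lfloor>t * real (Suc n)\<rfloor>"
      unfolding x_def inv[symmetric] by (rule R_power) simp
    also have "\<dots> = exp (- alpha * x n)" unfolding exp_of_nat_mult[symmetric] x_def by simp
    finally show ?thesis .
  qed
  have xb: "t - 1 / real (Suc n) \<le> x n" "x n \<le> t" for n
  proof -
    have "real (nat \<lfloor>t * real (Suc n)\<rfloor>) = of_int \<lfloor>t * real (Suc n)\<rfloor>" using t by simp
    then have xn: "x n = of_int \<lfloor>t * real (Suc n)\<rfloor> / real (Suc n)" by (simp add: x_def del: of_nat_Suc)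
    have "(t * real (Suc n) - 1) / real (Suc n) \<le> x n" "x n \<le> t * real (Suc n) / real (Suc n)"
      unfolding xn using real_of_int_floor_add_one_ge[of "t * real (Suc n)"]
      by (intro divide_right_mono; linarith)+
    then show "t - 1 / real (Suc n) \<le> x n" "x n \<le> t" by (simp_all add: diff_divide_distrib del: of_nat_Suc)
  qed
  have "(\<lambda>n. t - 1 / real (Suc n)) \<longlonglongrightarrow> t" by real_asymp
  then have x: "x \<longlonglongrightarrow> t" by (rule tendsto_sandwich[rotated 2]) (use xb in auto)
  have "(\<lambda>n. R (x n)) \<longlonglongrightarrow> R t"
    using continuous_on_tendsto_compose[OF R_cont x] by simp
  moreover have "(\<lambda>n. exp (- alpha * x n)) \<longlonglongrightarrow> exp (- alpha * t)" by (intro tendsto_intros x)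
  ultimately show ?thesis unfolding Rx by (rule LIMSEQ_unique)
qed

end

lemma (in tsp) hreg_iterate:
  assumes h: "hreg q m" and g: "g \<in> borel_measurable (past n)" "mom g"
  shows "expectation (\<lambda>\<omega>. g \<omega> * opoly (qint q) m (X (n + int k) \<omega>)) = (\<rho> ^ k) ^ m * expectation (\<lambda>\<omega>. g \<omega> * opoly (qint q) m (X n \<omega>))"
proof (induction k)
  case (Suc k)
  have sp: "space M \<in> sets (past i)" for i using sets.top[of "past i"] by simp
  have EFs: "EF (space M) U = expectation U" for U
    unfolding EF_def by (intro Bochner_Integration.integral_cong) auto
  have "expectation (\<lambda>\<omega>. g \<omega> * opoly (qint q) m (X (n + int k + 1) \<omega>)) = \<rho> ^ m * expectation (\<lambda>\<omega>. g \<omega> * opoly (qint q) m (X (n + int k) \<omega>))"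
    using hreg_mult[OF h sp past_mono[OF g(1)] g(2), of "n + int k"] by (simp add: EFs)
  then show ?case using Suc by (simp add: algebra_simps power_mult_distrib)
qed simp

context ctsp
begin

lemma zero_less_one_real: "(0 :: real) < 1" by simp

lemma grid_tsp:
  assumes d: "0 < \<delta>"
  obtains A B C D where "tsp M (\<lambda>n. Y (of_int n * \<delta>)) (R \<delta>) A B C D"
    "second_parameter (R \<delta>) B \<in> {-1<..1}" "second_parameter_denom (R \<delta>) B \<noteq> 0"
proof -
  obtain a A B C D where t: "one_TSP_with M (\<lambda>n. Y (of_int n * \<delta>)) a A B C D"
    and q: "second_parameter (R \<delta>) B \<in> {-1<..1}" "second_parameter_denom (R \<delta>) B \<noteq> 0"
    using grid[OF d] unfolding regular_one_TSP_def Let_def by (auto simp: correlation_grid)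
  have a: "a = R \<delta> / (1 + (R \<delta>)\<^sup>2)" by (rule grid_covariance(1)[OF d t])
  have r: "0 < R \<delta>" "R \<delta> < 1" using R_pos[of \<delta>] R_less_1[OF d] d by auto
  have "tsp M (\<lambda>n. Y (of_int n * \<delta>)) (R \<delta>) A B C D"
  proof unfold_locales
    show "0 < B" by (rule second_parameter_relations(1)[OF r q(2,1)])
    show "AE \<omega> in M. real_cond_exp M (generated_algebra M (- {n}) (\<lambda>n. Y (of_int n * \<delta>))) (Y (of_int n * \<delta>)) \<omega>
            = R \<delta> / (1 + (R \<delta>)\<^sup>2) * (Y (of_int (n - 1) * \<delta>) \<omega> + Y (of_int (n + 1) * \<delta>) \<omega>)" for n
      using t unfolding one_TSP_with_def a by blast
    show "AE \<omega> in M. real_cond_exp M (generated_algebra M (- {n}) (\<lambda>n. Y (of_int n * \<delta>))) (\<lambda>\<eta>. (Y (of_int n * \<delta>) \<eta>)\<^sup>2) \<omega>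
            = A * ((Y (of_int (n - 1) * \<delta>) \<omega>)\<^sup>2 + (Y (of_int (n + 1) * \<delta>) \<omega>)\<^sup>2) + B * Y (of_int (n - 1) * \<delta>) \<omega> * Y (of_int (n + 1) * \<delta>) \<omega>
              + D * (Y (of_int (n - 1) * \<delta>) \<omega> + Y (of_int (n + 1) * \<delta>) \<omega>) + C" for n
      using t unfolding one_TSP_with_def by blast
    show "distr M borel (Y (of_int n * \<delta>)) = distr M borel (Y (of_int 0 * \<delta>))" for n using Y_law[of "of_int n * \<delta>"] by simp
  qed (use Y_sq Y_mean Y_var r in auto)
  then show thesis using q that by blast
qed

lemma Y_mom: "mom (Y t)"
proof -
  obtain A B C D where "tsp M (\<lambda>n. Y (of_int n * 1)) (R 1) A B C D"
    by (rule grid_tsp[OF zero_less_one_real])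
  then interpret T: tsp M "\<lambda>n. Y (of_int n * 1)" "R 1" A B C D .
  have "mom (Y 0)" using T.X_mom[of 0] by simp
  then have i: "integrable M (\<lambda>\<omega>. \<bar>Y 0 \<omega>\<bar> ^ k)" for k by (simp add: mom_def)
  have "integrable M (\<lambda>\<omega>. \<bar>Y t \<omega>\<bar> ^ k)" for k
    using i[of k] Y_law[of t] integrable_distr_eq[of "Y t" M borel "\<lambda>x. \<bar>x\<bar> ^ k"] integrable_distr_eq[of "Y 0" M borel "\<lambda>x. \<bar>x\<bar> ^ k"] by simp
  then show ?thesis by (simp add: mom_def)
qed

definition qpar :: real where "qpar = expectation (\<lambda>\<omega>. Y 0 \<omega> ^ 4) - 2"

abbreviation hq :: "nat \<Rightarrow> real \<Rightarrow> real" where "hq \<equiv> opoly (qint qpar)"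

text \<open>The fourth moment identifies the second parameter, so it does not depend on the mesh.\<close>

lemma grid_hreg:
  assumes d: "0 < \<delta>"
  obtains A B C D where "tsp M (\<lambda>n. Y (of_int n * \<delta>)) (R \<delta>) A B C D" "tsp.hreg M (\<lambda>n. Y (of_int n * \<delta>)) (R \<delta>) qpar m"
    "qpar \<in> {-1<..1}" "m > 0 \<Longrightarrow> expectation (\<lambda>\<omega>. hq m (Y 0 \<omega>)) = 0"
proof -
  obtain A B C D where t: "tsp M (\<lambda>n. Y (of_int n * \<delta>)) (R \<delta>) A B C D"
    and q: "second_parameter (R \<delta>) B \<in> {-1<..1}" "second_parameter_denom (R \<delta>) B \<noteq> 0"
    by (rule grid_tsp[OF d])
  interpret T: tsp M "\<lambda>n. Y (of_int n * \<delta>)" "R \<delta>" A B C D by (rule t)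
  have r: "0 < R \<delta>" "R \<delta> < 1" by (rule T.rho)+
  define Q where "Q = second_parameter (R \<delta>) B"
  have h: "T.hreg Q i" for i
    unfolding Q_def by (rule T.hermite_regression[OF second_parameter_relations(2)[OF r q(2,1) T.A_eq]])
  \<comment> \<open>The regression multiplies the mean by a positive power of
    \<open>R \<delta>\<close>, which is below 1, whereas equality of the laws of
    \<open>Y \<delta>\<close> and \<open>Y 0\<close> leaves it unchanged.\<close>
  have mean: "expectation (\<lambda>\<omega>. opoly (qint Q) i (Y 0 \<omega>)) = 0" if "i > 0" for i
  proof -
    have "expectation (\<lambda>\<omega>. opoly (qint Q) i (Y \<delta> \<omega>)) = R \<delta> ^ i * expectation (\<lambda>\<omega>. opoly (qint Q) i (Y 0 \<omega>))"
      using T.hreg_iterate[OF h[of i], of "\<lambda>_. 1" 0 1] by (simp add: mom_const)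
    moreover have "expectation (\<lambda>\<omega>. opoly (qint Q) i (Y \<delta> \<omega>)) = expectation (\<lambda>\<omega>. opoly (qint Q) i (Y 0 \<omega>))"
      by (rule Y_law_integral) measurable
    moreover have "R \<delta> ^ i < 1" using r that by (simp add: power_less_one_iff)
    ultimately show ?thesis by simp
  qed
  \<comment> \<open>The polynomial of degree 4 has mean 0; since the second moment is 1, this reads:
    the fourth moment equals \<open>Q + 2\<close>. The fourth moment involves no mesh.\<close>
  have "Q = qpar"
  proof -
    have "(\<lambda>\<omega>. opoly (qint Q) 4 (Y 0 \<omega>)) = (\<lambda>\<omega>. Y 0 \<omega> ^ 4 - (3 + 2 * Q + Q\<^sup>2) * (Y 0 \<omega>)\<^sup>2 + (1 + Q + Q\<^sup>2))"
      by (rule ext) (simp add: numeral_eq_Suc algebra_simps)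
    then have "0 = expectation (\<lambda>\<omega>. Y 0 \<omega> ^ 4 - (3 + 2 * Q + Q\<^sup>2) * (Y 0 \<omega>)\<^sup>2 + (1 + Q + Q\<^sup>2))"
      using mean[of 4] by simp
    also have "\<dots> = expectation (\<lambda>\<omega>. Y 0 \<omega> ^ 4) - (3 + 2 * Q + Q\<^sup>2) + (1 + Q + Q\<^sup>2)"
      using mom_integrable[OF mom_power[OF Y_mom[of 0]], of 4] Y_sq[of 0] Y_var[of 0]
      by (simp add: prob_space)
    finally show ?thesis by (simp add: qpar_def)
  qed
  then show thesis using that[OF t] h mean q by (auto simp: Q_def)
qed

lemma qpar_range: "-1 < qpar" "qpar \<le> 1"
  by (rule grid_hreg[OF zero_less_one_real, of 0]; simp)+

lemma hq_mean: "expectation (\<lambda>\<omega>. hq m (Y t \<omega>)) = (if m = 0 then 1 else 0)"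
proof (cases "m = 0")
  case True then show ?thesis by (simp add: prob_space)
next
  case False
  have "expectation (\<lambda>\<omega>. hq m (Y 0 \<omega>)) = 0" by (rule grid_hreg[OF zero_less_one_real, of m]) (use False in simp)
  then show ?thesis using Y_law_integral[of "hq m" t] False by simp
qed

lemma hq_mom: "mom (\<lambda>\<omega>. hq m (Y t \<omega>))"
  by (intro mom_opoly Y_mom)

section \<open>From grids to the full past\<close>

lemma prod_diff_le:
  fixes z w :: "'i \<Rightarrow> real"
  assumes "finite J" "\<And>i. i \<in> J \<Longrightarrow> \<bar>z i\<bar> \<le> 1" "\<And>i. i \<in> J \<Longrightarrow> \<bar>w i\<bar> \<le> 1"
  shows "\<bar>(\<Prod>i\<in>J. z i) - (\<Prod>i\<in>J. w i)\<bar> \<le> (\<Sum>i\<in>J. \<bar>z i - w i\<bar>)"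
  using norm_prod_diff[of J z w] assms by simp

text \<open>Lipschitz approximation of the indicator of the nonnegative half line. Mean-square
  continuity passes through Lipschitz functions but not through indicators, so cylinder events are
  approached by products of ramps.\<close>

definition ramp :: "nat \<Rightarrow> real \<Rightarrow> real" where
  "ramp k x = max 0 (min 1 (1 + real k * x))"

lemma ramp_bounds: "0 \<le> ramp k x" "ramp k x \<le> 1" "\<bar>ramp k x\<bar> \<le> 1"
  by (auto simp: ramp_def)

lemma ramp_lipschitz: "\<bar>ramp k x - ramp k y\<bar> \<le> real k * \<bar>x - y\<bar>"
proof -
  have "\<bar>ramp k x - ramp k y\<bar> \<le> \<bar>(1 + real k * x) - (1 + real k * y)\<bar>" unfolding ramp_def by linarith
  also have "\<dots> = real k * \<bar>x - y\<bar>" by (simp add: abs_mult right_diff_distrib[symmetric])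
  finally show ?thesis .
qed

lemma ramp_limit: "(\<lambda>k. ramp k x) \<longlonglongrightarrow> (if 0 \<le> x then 1 else 0)"
proof (cases "0 \<le> x")
  case True
  then have "ramp k x = 1" for k by (simp add: ramp_def min_def)
  then show ?thesis using True by simp
next
  case False
  obtain N :: nat where N: "1 / (- x) < real N" using reals_Archimedean2 by blast
  have "ramp k x = 0" if "N \<le> k" for k
  proof -
    have "1 < real N * (- x)" using N False by (simp add: field_simps)
    also have "\<dots> \<le> real k * (- x)" using that False by (intro mult_right_mono) auto
    finally show ?thesis by (simp add: ramp_def)
  qed
  then have "(\<lambda>k. ramp k x) \<longlonglongrightarrow> 0" by (intro tendsto_eventually) (auto simp: eventually_sequentially)
  then show ?thesis using False by simp
qed

lemma ramp_measurable [measurable]: "ramp k \<in> borel_measurable borel"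
  unfolding ramp_def by measurable

text \<open>The meshes \<open>s / Suc n\<close> keep both 0 and \<open>s\<close> on the grid. Each
  past time \<open>i\<close> is replaced by the grid point \<open>\<tau> n i\<close> just below it,
  which is still in the past of 0, so the grid regression applies; the replacement costs nothing in
  the limit, because the ramps are Lipschitz and the process is mean-square continuous.\<close>

lemma regression_ramp:
  assumes s: "0 < s" and J: "finite J" "J \<subseteq> {..0}"
  shows "expectation (\<lambda>\<omega>. (\<Prod>i\<in>J. ramp k (c i - Y i \<omega>)) * hq m (Y s \<omega>)) = R s ^ m * expectation (\<lambda>\<omega>. (\<Prod>i\<in>J. ramp k (c i - Y i \<omega>)) * hq m (Y 0 \<omega>))"
proof -
  define \<tau> where "\<tau> n i = of_int \<lfloor>i * real (Suc n) / s\<rfloor> * (s / real (Suc n))" for n i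
  define G where "G n \<omega> = (\<Prod>i\<in>J. ramp k (c i - Y (\<tau> n i) \<omega>))" for n \<omega>
  define G0 where "G0 \<omega> = (\<Prod>i\<in>J. ramp k (c i - Y i \<omega>))" for \<omega>
  have [measurable]: "G n \<in> borel_measurable M" "G0 \<in> borel_measurable M" for n unfolding G_def G0_def by measurable
  have Gb: "\<bar>G n \<omega>\<bar> \<le> 1" "\<bar>G0 \<omega>\<bar> \<le> 1" for n \<omega>
    unfolding G_def G0_def abs_prod by (auto intro!: prod_le_1 ramp_bounds)
  have \<tau>lim: "(\<lambda>n. \<tau> n i) \<longlonglongrightarrow> i" for i
  proof (rule tendsto_sandwich[where f = "\<lambda>n. i - s / real (Suc n)" and h = "\<lambda>n. i"])
    show "(\<lambda>n. i - s / real (Suc n)) \<longlonglongrightarrow> i" by real_asymp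
    have "i - s / real (Suc n) \<le> \<tau> n i \<and> \<tau> n i \<le> i" for n
    proof -
      define N where "N = real (Suc n)"
      have N: "0 < N" by (simp add: N_def)
      have "i * N / s - 1 \<le> of_int \<lfloor>i * N / s\<rfloor>" "of_int \<lfloor>i * N / s\<rfloor> \<le> i * N / s"
        using real_of_int_floor_add_one_ge[of "i * N / s"] by auto
      then have "(i * N / s - 1) * (s / N) \<le> \<tau> n i" "\<tau> n i \<le> (i * N / s) * (s / N)"
        unfolding \<tau>_def N_def[symmetric] using s N by (simp_all only: mult_right_mono divide_nonneg_pos less_imp_le)
      moreover have "(i * N / s - 1) * (s / N) = i - s / N" "(i * N / s) * (s / N) = i"
        using s N by (auto simp: field_simps)
      ultimately show ?thesis unfolding N_def[symmetric] by simp
    qed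
    then show "\<forall>\<^sub>F n in sequentially. i - s / real (Suc n) \<le> \<tau> n i" "\<forall>\<^sub>F n in sequentially. \<tau> n i \<le> i" by auto
  qed simp
  have step: "expectation (\<lambda>\<omega>. G n \<omega> * hq m (Y s \<omega>)) = R s ^ m * expectation (\<lambda>\<omega>. G n \<omega> * hq m (Y 0 \<omega>))" for n
  proof -
    define \<delta> where "\<delta> = s / real (Suc n)"
    have d: "0 < \<delta>" using s by (simp add: \<delta>_def)
    obtain A B C D where t: "tsp M (\<lambda>n. Y (of_int n * \<delta>)) (R \<delta>) A B C D" and h: "tsp.hreg M (\<lambda>n. Y (of_int n * \<delta>)) (R \<delta>) qpar m"
      by (rule grid_hreg[OF d, of m])
    interpret T: tsp M "\<lambda>n. Y (of_int n * \<delta>)" "R \<delta>" A B C D by (rule t)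
    have "(\<lambda>\<omega>. ramp k (c i - Y (\<tau> n i) \<omega>)) \<in> borel_measurable (T.past 0)" if "i \<in> J" for i
    proof -
      have "i * real (Suc n) / s \<le> 0" using J(2) that s by (auto simp: divide_nonpos_pos mult_nonpos_nonneg)
      then have "\<lfloor>i * real (Suc n) / s\<rfloor> \<le> 0" by (simp add: floor_le_iff)
      from T.past_measurable[OF this] have [measurable]: "Y (\<tau> n i) \<in> borel_measurable (T.past 0)" by (simp add: \<tau>_def \<delta>_def)
      show ?thesis by measurable
    qed
    then have Gm: "G n \<in> borel_measurable (T.past 0)" unfolding G_def[abs_def] by (rule borel_measurable_prod)
    have Gmom: "mom (G n)" unfolding mom_def
      using Gb(1)[of n] by (auto intro!: integrable_const_bound[where B = 1] AE_I2 power_le_one)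
    have e: "of_int (0 + int (Suc n)) * \<delta> = s" by (simp add: \<delta>_def del: of_nat_Suc)
    have e': "R \<delta> ^ Suc n = R s" using R_power[OF d, of "Suc n"] by (simp add: \<delta>_def del: of_nat_Suc)
    show ?thesis using T.hreg_iterate[OF h Gm Gmom, of "Suc n"] unfolding e e' by simp
  qed
  have lim: "(\<lambda>n. expectation (\<lambda>\<omega>. G n \<omega> * hq m (Y t \<omega>))) \<longlonglongrightarrow> expectation (\<lambda>\<omega>. G0 \<omega> * hq m (Y t \<omega>))" for t
  proof -
    have h2: "integrable M (\<lambda>\<omega>. (hq m (Y t \<omega>))\<^sup>2)" by (intro mom_integrable mom_power hq_mom)
    have hm: "(\<lambda>\<omega>. hq m (Y t \<omega>)) \<in> borel_measurable M" by measurable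
    have L2: "(\<lambda>n. expectation (\<lambda>\<omega>. \<bar>hq m (Y t \<omega>) * (Y (\<tau> n i) \<omega> - Y i \<omega>)\<bar>)) \<longlonglongrightarrow> 0"
      and L2i: "integrable M (\<lambda>\<omega>. hq m (Y t \<omega>) * (Y (\<tau> n i) \<omega> - Y i \<omega>))" for i n
      using L2_tendsto[OF hm h2, of "\<lambda>n \<omega>. Y (\<tau> n i) \<omega> - Y i \<omega>" sequentially] Y_diff_sq
        filterlim_compose[OF Y_L2 \<tau>lim[of i]] by auto
    have iG: "integrable M (\<lambda>\<omega>. G n \<omega> * hq m (Y t \<omega>))" "integrable M (\<lambda>\<omega>. G0 \<omega> * hq m (Y t \<omega>))" for n
      by (rule Bochner_Integration.integrable_bound[OF mom_integrable[OF hq_mom[of m t]]]; use Gb in \<open>auto simp: abs_mult intro!: mult_left_le_one_le\<close>)+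
    have "(\<lambda>n. expectation (\<lambda>\<omega>. G n \<omega> * hq m (Y t \<omega>)) - expectation (\<lambda>\<omega>. G0 \<omega> * hq m (Y t \<omega>))) \<longlonglongrightarrow> 0"
    proof (rule Lim_null_comparison, intro always_eventually allI)
      fix n
      have "\<bar>expectation (\<lambda>\<omega>. G n \<omega> * hq m (Y t \<omega>)) - expectation (\<lambda>\<omega>. G0 \<omega> * hq m (Y t \<omega>))\<bar>
        = \<bar>expectation (\<lambda>\<omega>. G n \<omega> * hq m (Y t \<omega>) - G0 \<omega> * hq m (Y t \<omega>))\<bar>" using iG by simp
      also have "\<dots> \<le> expectation (\<lambda>\<omega>. \<bar>G n \<omega> * hq m (Y t \<omega>) - G0 \<omega> * hq m (Y t \<omega>)\<bar>)" by (rule integral_abs_bound)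
      also have "\<dots> \<le> expectation (\<lambda>\<omega>. \<Sum>i\<in>J. real k * \<bar>hq m (Y t \<omega>) * (Y (\<tau> n i) \<omega> - Y i \<omega>)\<bar>)"
      proof (rule integral_mono)
        fix \<omega>
        have "\<bar>G n \<omega> - G0 \<omega>\<bar> \<le> (\<Sum>i\<in>J. \<bar>ramp k (c i - Y (\<tau> n i) \<omega>) - ramp k (c i - Y i \<omega>)\<bar>)"
          unfolding G_def G0_def by (rule prod_diff_le[OF J(1)]) (auto intro: ramp_bounds)
        also have "\<dots> \<le> (\<Sum>i\<in>J. real k * \<bar>Y (\<tau> n i) \<omega> - Y i \<omega>\<bar>)"
        proof (rule sum_mono)
          fix i
          show "\<bar>ramp k (c i - Y (\<tau> n i) \<omega>) - ramp k (c i - Y i \<omega>)\<bar> \<le> real k * \<bar>Y (\<tau> n i) \<omega> - Y i \<omega>\<bar>"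
            using ramp_lipschitz[of k "c i - Y (\<tau> n i) \<omega>" "c i - Y i \<omega>"] by (simp add: abs_minus_commute)
        qed
        finally have "\<bar>hq m (Y t \<omega>)\<bar> * \<bar>G n \<omega> - G0 \<omega>\<bar> \<le> \<bar>hq m (Y t \<omega>)\<bar> * (\<Sum>i\<in>J. real k * \<bar>Y (\<tau> n i) \<omega> - Y i \<omega>\<bar>)"
          by (rule mult_left_mono) simp
        then show "\<bar>G n \<omega> * hq m (Y t \<omega>) - G0 \<omega> * hq m (Y t \<omega>)\<bar> \<le> (\<Sum>i\<in>J. real k * \<bar>hq m (Y t \<omega>) * (Y (\<tau> n i) \<omega> - Y i \<omega>)\<bar>)"
          by (simp add: left_diff_distrib[symmetric] abs_mult sum_distrib_left mult_ac)
      qed (use iG L2i in auto)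
      also have "\<dots> = (\<Sum>i\<in>J. real k * expectation (\<lambda>\<omega>. \<bar>hq m (Y t \<omega>) * (Y (\<tau> n i) \<omega> - Y i \<omega>)\<bar>))"
        using L2i by (subst Bochner_Integration.integral_sum) auto
      finally show "norm (expectation (\<lambda>\<omega>. G n \<omega> * hq m (Y t \<omega>)) - expectation (\<lambda>\<omega>. G0 \<omega> * hq m (Y t \<omega>)))
        \<le> (\<Sum>i\<in>J. real k * expectation (\<lambda>\<omega>. \<bar>hq m (Y t \<omega>) * (Y (\<tau> n i) \<omega> - Y i \<omega>)\<bar>))" by simp
    next
      have "(\<lambda>n. \<Sum>i\<in>J. real k * expectation (\<lambda>\<omega>. \<bar>hq m (Y t \<omega>) * (Y (\<tau> n i) \<omega> - Y i \<omega>)\<bar>)) \<longlonglongrightarrow> (\<Sum>i\<in>J. real k * 0)"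
        by (intro tendsto_sum tendsto_mult tendsto_const L2)
      then show "(\<lambda>n. \<Sum>i\<in>J. real k * expectation (\<lambda>\<omega>. \<bar>hq m (Y t \<omega>) * (Y (\<tau> n i) \<omega> - Y i \<omega>)\<bar>)) \<longlonglongrightarrow> 0" by simp
    qed
    then show ?thesis by (rule LIM_zero_cancel)
  qed
  have "(\<lambda>n. expectation (\<lambda>\<omega>. G n \<omega> * hq m (Y s \<omega>))) \<longlonglongrightarrow> R s ^ m * expectation (\<lambda>\<omega>. G0 \<omega> * hq m (Y 0 \<omega>))"
    unfolding step by (intro tendsto_intros lim)
  then show ?thesis using LIMSEQ_unique[OF lim[of s]] unfolding G0_def by blast
qed

lemma regression_cylinder_0:
  assumes s: "0 < s" and J: "finite J" "J \<subseteq> {..0}"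
  shows "expectation (\<lambda>\<omega>. indicator {\<omega> \<in> space M. \<forall>i\<in>J. Y i \<omega> \<le> c i} \<omega> * hq m (Y s \<omega>))
    = R s ^ m * expectation (\<lambda>\<omega>. indicator {\<omega> \<in> space M. \<forall>i\<in>J. Y i \<omega> \<le> c i} \<omega> * hq m (Y 0 \<omega>))"
proof -
  have lim: "(\<lambda>k. expectation (\<lambda>\<omega>. (\<Prod>i\<in>J. ramp k (c i - Y i \<omega>)) * hq m (Y t \<omega>))) \<longlonglongrightarrow>
     expectation (\<lambda>\<omega>. indicator {\<omega> \<in> space M. \<forall>i\<in>J. Y i \<omega> \<le> c i} \<omega> * hq m (Y t \<omega>))" for t
  proof (rule integral_dominated_convergence[where w = "\<lambda>\<omega>. \<bar>hq m (Y t \<omega>)\<bar>"])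
    show "integrable M (\<lambda>\<omega>. \<bar>hq m (Y t \<omega>)\<bar>)" using mom_integrable[OF hq_mom] by auto
    show "AE \<omega> in M. (\<lambda>k. (\<Prod>i\<in>J. ramp k (c i - Y i \<omega>)) * hq m (Y t \<omega>)) \<longlonglongrightarrow> indicator {\<omega> \<in> space M. \<forall>i\<in>J. Y i \<omega> \<le> c i} \<omega> * hq m (Y t \<omega>)"
    proof (rule AE_I2)
      fix \<omega> assume w: "\<omega> \<in> space M"
      have "(\<lambda>k. \<Prod>i\<in>J. ramp k (c i - Y i \<omega>)) \<longlonglongrightarrow> (\<Prod>i\<in>J. if 0 \<le> c i - Y i \<omega> then 1 else 0)"
        by (intro tendsto_prod ramp_limit)
      also have "(\<Prod>i\<in>J. if 0 \<le> c i - Y i \<omega> then 1 else 0) = (indicator {\<omega> \<in> space M. \<forall>i\<in>J. Y i \<omega> \<le> c i} \<omega> :: real)"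
        using J(1) w by (auto simp: indicator_def prod_zero_iff)
      finally show "(\<lambda>k. (\<Prod>i\<in>J. ramp k (c i - Y i \<omega>)) * hq m (Y t \<omega>)) \<longlonglongrightarrow> indicator {\<omega> \<in> space M. \<forall>i\<in>J. Y i \<omega> \<le> c i} \<omega> * hq m (Y t \<omega>)"
        by (intro tendsto_mult tendsto_const)
    qed
    fix k
    have "\<bar>\<Prod>i\<in>J. ramp k (c i - Y i \<omega>)\<bar> \<le> 1" for \<omega> unfolding abs_prod by (auto intro!: prod_le_1 ramp_bounds)
    then show "AE \<omega> in M. norm ((\<Prod>i\<in>J. ramp k (c i - Y i \<omega>)) * hq m (Y t \<omega>)) \<le> \<bar>hq m (Y t \<omega>)\<bar>"
      by (auto simp: abs_mult intro!: mult_left_le_one_le)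
  qed (use J(1) in measurable)
  have "(\<lambda>k. expectation (\<lambda>\<omega>. (\<Prod>i\<in>J. ramp k (c i - Y i \<omega>)) * hq m (Y s \<omega>))) \<longlonglongrightarrow>
     R s ^ m * expectation (\<lambda>\<omega>. indicator {\<omega> \<in> space M. \<forall>i\<in>J. Y i \<omega> \<le> c i} \<omega> * hq m (Y 0 \<omega>))"
    unfolding regression_ramp[OF s J] by (intro tendsto_intros lim)
  then show ?thesis by (rule LIMSEQ_unique[OF lim])
qed

text \<open>The hypothesis on grids concerns multiples of the mesh only, hence grids through 0.
  Stationarity of the finite-dimensional laws carries the case of a general \<open>t\<close> to
  \<open>t = 0\<close>.\<close>

lemma regression_cylinder:
  assumes st: "t < s" and J: "finite J" "J \<subseteq> {..t}"
  shows "expectation (\<lambda>\<omega>. indicator {\<omega> \<in> space M. \<forall>i\<in>J. Y i \<omega> \<le> c i} \<omega> * hq m (Y s \<omega>))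
    = R (s - t) ^ m * expectation (\<lambda>\<omega>. indicator {\<omega> \<in> space M. \<forall>i\<in>J. Y i \<omega> \<le> c i} \<omega> * hq m (Y t \<omega>))"
proof -
  define J' where "J' = (\<lambda>i. i - t) ` J"
  have J': "finite J'" "J' \<subseteq> {..0}" using J by (auto simp: J'_def)
  have shift: "expectation (\<lambda>\<omega>. indicator {\<omega> \<in> space M. \<forall>i\<in>J. Y i \<omega> \<le> c i} \<omega> * hq m (Y u \<omega>))
     = expectation (\<lambda>\<omega>. indicator {\<omega> \<in> space M. \<forall>i\<in>J'. Y i \<omega> \<le> c (i + t)} \<omega> * hq m (Y (u - t) \<omega>))" for u
  proof -
    define K where "K = insert (u - t) J'"
    have K: "finite K" "J' \<subseteq> K" "u - t \<in> K" using J' by (auto simp: K_def)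
    define f where "f x = (if \<forall>i\<in>J'. x i \<le> c (i + t) then 1 else 0) * hq m (x (u - t))" for x :: "real \<Rightarrow> real"
    have comp: "(\<lambda>x :: real \<Rightarrow> real. x i) \<in> borel_measurable (PiM K (\<lambda>_. borel))" if "i \<in> K" for i
      using that by (rule measurable_component_singleton)
    have "{x \<in> space (PiM K (\<lambda>_. borel)). \<forall>i\<in>J'. x i \<le> c (i + t)} \<in> sets (PiM K (\<lambda>_. borel :: real measure))"
      using J'(1) K(2) by (intro sets.sets_Collect_finite_All borel_measurable_le comp borel_measurable_const) auto
    then have fm: "f \<in> borel_measurable (PiM K (\<lambda>_. borel))"
      unfolding f_def by (intro borel_measurable_times measurable_If borel_measurable_const borel_measurable_opoly comp K(3))
    have "expectation (\<lambda>\<omega>. indicator {\<omega> \<in> space M. \<forall>i\<in>J. Y i \<omega> \<le> c i} \<omega> * hq m (Y u \<omega>)) = expectation (\<lambda>\<omega>. f (\<lambda>i\<in>K. Y (i + t) \<omega>))"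
      using K by (intro Bochner_Integration.integral_cong) (auto simp: f_def indicator_def J'_def subset_iff)
    also have "\<dots> = expectation (\<lambda>\<omega>. f (\<lambda>i\<in>K. Y i \<omega>))" by (rule stationary_integral[OF K(1) fm])
    also have "\<dots> = expectation (\<lambda>\<omega>. indicator {\<omega> \<in> space M. \<forall>i\<in>J'. Y i \<omega> \<le> c (i + t)} \<omega> * hq m (Y (u - t) \<omega>))"
      using K by (intro Bochner_Integration.integral_cong) (auto simp: f_def indicator_def subset_iff)
    finally show ?thesis .
  qed
  show ?thesis unfolding shift using regression_cylinder_0[of "s - t" J'] st J' by simp
qed

theorem regression:
  assumes st: "t < s" and F: "F \<in> sets (generated_algebra M {..t} Y)"
  shows "expectation (\<lambda>\<omega>. indicator F \<omega> * hq m (Y s \<omega>)) = R (s - t) ^ m * expectation (\<lambda>\<omega>. indicator F \<omega> * hq m (Y t \<omega>))"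
proof -
  have "expectation (\<lambda>\<omega>. indicator F \<omega> * hq m (Y s \<omega>)) = expectation (\<lambda>\<omega>. indicator F \<omega> * (R (s - t) ^ m * hq m (Y t \<omega>)))"
  proof (rule generated_algebra_integral_eqI[OF _ _ _ _ F])
    fix J c assume "finite J" "J \<subseteq> {..t}"
    from regression_cylinder[OF st this]
    show "expectation (\<lambda>\<omega>. indicator {\<omega> \<in> space M. \<forall>i\<in>J. Y i \<omega> \<le> c i} \<omega> * hq m (Y s \<omega>)) =
      expectation (\<lambda>\<omega>. indicator {\<omega> \<in> space M. \<forall>i\<in>J. Y i \<omega> \<le> c i} \<omega> * (R (s - t) ^ m * hq m (Y t \<omega>)))"
      by (simp add: mult.left_commute[of _ "R (s - t) ^ m"])
  qed (auto intro!: mom_integrable hq_mom integrable_mult_right)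
  then show ?thesis by (simp add: mult.left_commute[of _ "R (s - t) ^ m"])
qed

end

section \<open>Transition laws\<close>

context prob_space
begin

text \<open>On each event \<open>F\<close>, Levy's uniqueness theorem compares the law of \<open>X\<close> with the mixture of the densities \<open>k x V\<close> over \<open>F\<close>.\<close>

lemma conditional_law_from_char:
  assumes G: "subalgebra M G" and [measurable]: "X \<in> borel_measurable M" "V \<in> borel_measurable M"
    and k [measurable]: "(\<lambda>(x, y). k x y) \<in> borel_measurable (borel \<Otimes>\<^sub>M borel)"
    and k0: "\<And>x y. 0 \<le> k x (y :: real)" and k1: "\<And>y. (\<integral>\<^sup>+x. ennreal (k x y) \<partial>lborel) = 1"
    and F: "F \<in> sets G"
    and char: "\<And>t. expectation (\<lambda>\<omega>. indicator F \<omega> *\<^sub>R iexp (t * X \<omega>)) = expectation (\<lambda>\<omega>. indicator F \<omega> *\<^sub>R (\<integral>x. k x (V \<omega>) *\<^sub>R iexp (t * x) \<partial>lborel))"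
    and S [measurable]: "S \<in> sets borel"
  shows "expectation (\<lambda>\<omega>. indicator F \<omega> * indicator S (X \<omega>)) = expectation (\<lambda>\<omega>. indicator F \<omega> * (\<integral>x. k x (V \<omega>) * indicator S x \<partial>lborel))"
proof -
  have FM [measurable]: "F \<in> sets M" using F G by (auto simp: subalgebra_def)
  interpret P: pair_sigma_finite M lborel ..
  show ?thesis
  proof (cases "prob F = 0")
    case True
    then have "AE \<omega> in M. \<omega> \<notin> F" by (simp add: prob_eq_0)
    then have "expectation (\<lambda>\<omega>. indicator F \<omega> * g \<omega>) = 0" for g :: "'a \<Rightarrow> real"
      by (intro integral_eq_zero_AE) (auto elim!: eventually_mono)
    then show ?thesis by simp
  next
    case False
    define c where "c = prob F"
    have c: "0 < c" using False measure_nonneg[of M F] by (simp add: c_def less_le)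
    have iF: "(\<integral>\<^sup>+\<omega>. ennreal (indicator F \<omega> / c) \<partial>M) = 1"
      using c mom_integrable[OF mom_indicator[OF FM]] by (subst nn_integral_eq_integral) (auto simp: c_def)
    \<comment> \<open>The joint law of a sample point conditioned on \<open>F\<close> and of an
      independent draw from the density \<open>k x (V \<omega>)\<close>. Its second marginal
      \<open>\<mu>\<close> is the mixture to be compared with the law \<open>\<nu>\<close> of
      \<open>X\<close> conditioned on \<open>F\<close>.\<close>
    define N where "N = density (M \<Otimes>\<^sub>M lborel) (\<lambda>(\<omega>, x). ennreal (indicator F \<omega> / c * k x (V \<omega>)))"
    have km [measurable]: "(\<lambda>z. k (g z) (h z)) \<in> borel_measurable L" if "g \<in> borel_measurable L" "h \<in> borel_measurable L" for g h and L :: "'z measure"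
      using measurable_compose[OF measurable_Pair[OF that] k] by simp
    have km2 [measurable]: "(\<lambda>z. k (snd z) (V (fst z))) \<in> borel_measurable (M \<Otimes>\<^sub>M lborel)"
      by (rule km) measurable
    have wm [measurable]: "(\<lambda>z. indicator F (fst z) / c * k (snd z) (V (fst z))) \<in> borel_measurable (M \<Otimes>\<^sub>M lborel)"
      by measurable
    have km3 [measurable]: "(\<lambda>x. k x y) \<in> borel_measurable borel" for y by (rule km) measurable
    have nnI: "(\<integral>\<^sup>+z. ennreal (indicator F (fst z) / c * k (snd z) (V (fst z))) \<partial>(M \<Otimes>\<^sub>M lborel)) = 1"
    proof -
      have "(\<integral>\<^sup>+z. ennreal (indicator F (fst z) / c * k (snd z) (V (fst z))) \<partial>(M \<Otimes>\<^sub>M lborel))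
        = (\<integral>\<^sup>+\<omega>. \<integral>\<^sup>+x. ennreal (indicator F \<omega> / c * k x (V \<omega>)) \<partial>lborel \<partial>M)"
        by (subst lborel.nn_integral_fst[symmetric]) auto
      also have "\<dots> = (\<integral>\<^sup>+\<omega>. ennreal (indicator F \<omega> / c) \<partial>M)"
      proof (rule nn_integral_cong)
        fix \<omega>
        have "(\<integral>\<^sup>+x. ennreal (indicator F \<omega> / c * k x (V \<omega>)) \<partial>lborel) = (\<integral>\<^sup>+x. ennreal (indicator F \<omega> / c) * ennreal (k x (V \<omega>)) \<partial>lborel)"
          using c k0 by (intro nn_integral_cong ennreal_mult) auto
        also have "\<dots> = ennreal (indicator F \<omega> / c)" by (subst nn_integral_cmult) (auto simp: k1)
        finally show "(\<integral>\<^sup>+x. ennreal (indicator F \<omega> / c * k x (V \<omega>)) \<partial>lborel) = ennreal (indicator F \<omega> / c)" .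
      qed
      finally show ?thesis using iF by simp
    qed
    have wint: "integrable (M \<Otimes>\<^sub>M lborel) (\<lambda>z. indicator F (fst z) / c * k (snd z) (V (fst z)))"
    proof (rule integrableI_bounded)
      have "(\<integral>\<^sup>+z. ennreal (norm (indicator F (fst z) / c * k (snd z) (V (fst z)))) \<partial>(M \<Otimes>\<^sub>M lborel))
        = (\<integral>\<^sup>+z. ennreal (indicator F (fst z) / c * k (snd z) (V (fst z))) \<partial>(M \<Otimes>\<^sub>M lborel))"
        using c k0 by (intro nn_integral_cong) (simp add: abs_mult)
      then show "(\<integral>\<^sup>+z. ennreal (norm (indicator F (fst z) / c * k (snd z) (V (fst z)))) \<partial>(M \<Otimes>\<^sub>M lborel)) < \<infinity>"
        using nnI by simp
    qed measurable
    have N': "N = density (M \<Otimes>\<^sub>M lborel) (\<lambda>z. ennreal (indicator F (fst z) / c * k (snd z) (V (fst z))))"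
      by (simp add: N_def split_beta')
    have setsN [measurable_cong]: "sets N = sets (M \<Otimes>\<^sub>M lborel)" by (simp add: N')
    have probN: "prob_space N"
    proof (rule prob_spaceI)
      have "emeasure N (space N) = (\<integral>\<^sup>+z. ennreal (indicator F (fst z) / c * k (snd z) (V (fst z))) * indicator (space N) z \<partial>(M \<Otimes>\<^sub>M lborel))"
        unfolding N' by (rule emeasure_density) (measurable, use sets.top[of N] setsN N' in simp)
      also have "\<dots> = 1" unfolding nnI[symmetric] by (rule nn_integral_cong) (simp add: N')
      finally show "emeasure N (space N) = 1" .
    qed
    define \<mu> where "\<mu> = distr N borel snd"
    have mu_int: "(\<integral>x. f x \<partial>\<mu>) = expectation (\<lambda>\<omega>. (indicator F \<omega> / c) *\<^sub>R (\<integral>x. k x (V \<omega>) *\<^sub>R f x \<partial>lborel))"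
      if [measurable]: "f \<in> borel_measurable borel" and fb: "\<And>x. norm (f x) \<le> 1" for f :: "real \<Rightarrow> complex"
    proof -
      have "(\<integral>x. f x \<partial>\<mu>) = (\<integral>z. f (snd z) \<partial>N)" unfolding \<mu>_def by (rule integral_distr) measurable
      also have "\<dots> = (\<integral>z. (indicator F (fst z) / c * k (snd z) (V (fst z))) *\<^sub>R f (snd z) \<partial>(M \<Otimes>\<^sub>M lborel))"
        unfolding N' using c k0 by (subst integral_density) auto
      also have "\<dots> = expectation (\<lambda>\<omega>. \<integral>x. (indicator F \<omega> / c * k x (V \<omega>)) *\<^sub>R f x \<partial>lborel)"
      proof -
        have "integrable (M \<Otimes>\<^sub>M lborel) (\<lambda>z. (indicator F (fst z) / c * k (snd z) (V (fst z))) *\<^sub>R f (snd z))"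
        proof (rule Bochner_Integration.integrable_bound[OF wint])
          show "AE z in M \<Otimes>\<^sub>M lborel. norm ((indicator F (fst z) / c * k (snd z) (V (fst z))) *\<^sub>R f (snd z)) \<le> norm (indicator F (fst z) / c * k (snd z) (V (fst z)))"
            unfolding norm_scaleR real_norm_def by (intro AE_I2 mult_left_le fb) simp
        qed measurable
        from pair_sigma_finite.integral_fst'[OF _ this] show ?thesis
          by (simp add: pair_sigma_finite_def sigma_finite_measure_axioms lborel.sigma_finite_measure_axioms)
      qed
      also have "\<dots> = expectation (\<lambda>\<omega>. (indicator F \<omega> / c) *\<^sub>R (\<integral>x. k x (V \<omega>) *\<^sub>R f x \<partial>lborel))"
        unfolding scaleR_scaleR[symmetric] integral_scaleR_right by simp
      finally show ?thesis .
    qed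
    define \<nu> where "\<nu> = distr (density M (\<lambda>\<omega>. ennreal (indicator F \<omega> / c))) borel X"
    have probD: "prob_space (density M (\<lambda>\<omega>. ennreal (indicator F \<omega> / c)))"
      using iF by (intro prob_spaceI) (simp add: emeasure_density)
    have nu_int: "(\<integral>x. f x \<partial>\<nu>) = expectation (\<lambda>\<omega>. (indicator F \<omega> / c) *\<^sub>R f (X \<omega>))"
      if [measurable]: "f \<in> borel_measurable borel" for f :: "real \<Rightarrow> complex"
      unfolding \<nu>_def using c by (subst integral_distr, measurable, subst integral_density) auto
    have eq: "\<nu> = \<mu>"
    proof (rule Levy_uniqueness)
      show "real_distribution \<nu>" unfolding \<nu>_def by (rule prob_space.real_distribution_distr[OF probD]) simp
      show "real_distribution \<mu>" unfolding \<mu>_def by (rule prob_space.real_distribution_distr[OF probN]) measurable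
      show "char \<nu> = char \<mu>"
      proof (rule ext)
        fix t
        have sc: "expectation (\<lambda>\<omega>. (indicator F \<omega> / c) *\<^sub>R g \<omega>) = (1 / c) *\<^sub>R expectation (\<lambda>\<omega>. indicator F \<omega> *\<^sub>R g \<omega>)" for g :: "'a \<Rightarrow> complex"
          unfolding integral_scaleR_right[symmetric] scaleR_scaleR by simp
        show "char \<nu> t = char \<mu> t" unfolding char_def
          by (subst nu_int, measurable, subst mu_int, measurable) (simp_all only: sc char norm_exp_i_times order_refl)
      qed
    qed
    have "complex_of_real (expectation (\<lambda>\<omega>. indicator F \<omega> / c * indicator S (X \<omega>))) = (\<integral>x. complex_of_real (indicator S x) \<partial>\<nu>)"
      by (subst nu_int) (auto simp flip: integral_complex_of_real simp: scaleR_conv_of_real)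
    also have "\<dots> = complex_of_real (expectation (\<lambda>\<omega>. indicator F \<omega> / c * (\<integral>x. k x (V \<omega>) * indicator S x \<partial>lborel)))"
      unfolding eq by (subst mu_int) (auto simp flip: integral_complex_of_real simp: scaleR_conv_of_real indicator_def)
    finally have "expectation (\<lambda>\<omega>. indicator F \<omega> / c * indicator S (X \<omega>)) = expectation (\<lambda>\<omega>. indicator F \<omega> / c * (\<integral>x. k x (V \<omega>) * indicator S x \<partial>lborel))"
      by (simp only: of_real_eq_iff)
    then have "expectation (\<lambda>\<omega>. 1 / c * (indicator F \<omega> * indicator S (X \<omega>))) = expectation (\<lambda>\<omega>. 1 / c * (indicator F \<omega> * (\<integral>x. k x (V \<omega>) * indicator S x \<partial>lborel)))"
      by simp
    then show ?thesis using c unfolding integral_mult_right_zero by simp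
  qed
qed

end

section \<open>The transition law for q < 1\<close>

lemma qK_commute: "qK q r u v = qK q r v u"
  by (simp add: qK_def qc_def mult.commute)

context ctsp
begin

context
  assumes q1: "qpar < 1"
begin

lemma q_abs: "\<bar>qpar\<bar> < 1"
  using q1 qpar_range by auto

abbreviation sq :: real where "sq \<equiv> sqrt (1 - qpar)"

lemma sq_pos: "0 < sq" using q1 by simp

lemma qh_mean: "expectation (\<lambda>\<omega>. qh qpar n (sq * Y t \<omega>)) = (if n = 0 then 1 else 0)"
  unfolding qh_scale[OF q1] by (simp add: hq_mean)

lemma Y_support: "AE \<omega> in M. \<bar>sq * Y t \<omega>\<bar> \<le> 2"
proof (rule qh_support[OF q_abs])
  have i: "integrable M (\<lambda>\<omega>. qh qpar n (sq * Y t \<omega>) * qh qpar m (sq * Y t \<omega>))" for n m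
    by (intro mom_integrable mom_mult mom_opoly mom_const Y_mom)
  show "integrable M (\<lambda>\<omega>. qh qpar n (sq * Y t \<omega>) * qh qpar n (sq * Y t \<omega>))" for n by (rule i)
  show "expectation (\<lambda>\<omega>. qh qpar n (sq * Y t \<omega>) * qh qpar n (sq * Y t \<omega>)) = qfac qpar n" for n
    unfolding qfac_def by (subst opoly_orthogonal_integral) (auto intro: i simp: qh_mean)
qed measurable

lemma Y_density: "distr M borel (Y t) = density lborel (\<lambda>x. ennreal (f_N x qpar))"
  by (rule q_normal_law[OF q_abs _ Y_support qh_mean]) measurable

lemma f_N_integral:
  assumes [measurable]: "g \<in> borel_measurable borel"
  shows "(\<integral>x. f_N x qpar * g x \<partial>lborel) = expectation (\<lambda>\<omega>. g (Y 0 \<omega>))"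
proof -
  note [measurable] = f_N_measurable[OF q_abs]
  have "expectation (\<lambda>\<omega>. g (Y 0 \<omega>)) = (\<integral>x. g x \<partial>distr M borel (Y 0))" by (rule integral_distr[symmetric]) measurable
  also have "\<dots> = (\<integral>x. f_N x qpar * g x \<partial>lborel)"
    unfolding Y_density using f_N_nonneg[OF q_abs] by (subst integral_density) auto
  finally show ?thesis ..
qed

text \<open>For \<open>y\<close> in the support this is \<open>f_CN\<close> in series form.
  Elsewhere, where the series need not converge, the kernel is replaced by the marginal density, so
  that it is a probability density for every \<open>y\<close>, as
  \<open>conditional_law_from_char\<close> demands; the points affected have probability 0.\<close>

definition qker :: "real \<Rightarrow> real \<Rightarrow> real \<Rightarrow> real" where
  "qker r x y = f_N x qpar * (if \<bar>sq * y\<bar> \<le> 2 then qK qpar r (sq * y) (sq * x) else 1)"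

lemma f_N_support: "2 < \<bar>sq * x\<bar> \<Longrightarrow> f_N x qpar = 0"
  by (simp add: f_N_eq[OF q_abs])

lemma qker_f_CN: "\<bar>sq * y\<bar> \<le> 2 \<Longrightarrow> \<bar>r\<bar> < 1 \<Longrightarrow> f_CN x y r qpar = qker r x y"
  by (simp add: qker_def f_CN_eq[OF q_abs] qK_commute)

lemma qker_measurable: "(\<lambda>(x, y). qker r x y) \<in> borel_measurable (borel \<Otimes>\<^sub>M borel)"
proof -
  note [measurable] = f_N_measurable[OF q_abs]
  show ?thesis unfolding qker_def by measurable
qed

lemma qker_measurable1 [measurable]: "(\<lambda>x. qker r x y) \<in> borel_measurable borel"
proof -
  note [measurable] = f_N_measurable[OF q_abs]
  show ?thesis unfolding qker_def by measurable
qed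

lemma qker_nonneg: assumes r: "\<bar>r\<bar> < 1" shows "0 \<le> qker r x y"
proof (cases "\<bar>sq * x\<bar> \<le> 2")
  case True
  have "0 \<le> f_N x qpar * qK qpar r (sq * y) (sq * x)" if "\<bar>sq * y\<bar> \<le> 2"
    by (rule mult_nonneg_nonneg[OF f_N_nonneg[OF q_abs] less_imp_le[OF qK_pos[OF q_abs that True r]]])
  then show ?thesis using f_N_nonneg[OF q_abs, of x] by (auto simp: qker_def)
qed (simp add: qker_def f_N_support)

lemma qker_opoly:
  assumes r: "\<bar>r\<bar> < 1" and y: "\<bar>sq * y\<bar> \<le> 2"
  shows "(\<integral>x. qker r x y * hq m x \<partial>lborel) = r ^ m * hq m y"
proof -
  have "(\<integral>x. qker r x y * hq m x \<partial>lborel) = (\<integral>x. f_N x qpar * (qK qpar r (sq * y) (sq * x) * hq m x) \<partial>lborel)"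
    using y by (simp add: qker_def mult.assoc)
  also have "\<dots> = expectation (\<lambda>\<omega>. qK qpar r (sq * y) (sq * Y 0 \<omega>) * hq m (Y 0 \<omega>))"
    by (rule f_N_integral) measurable
  finally have "sq ^ m * (\<integral>x. qker r x y * hq m x \<partial>lborel) = sq ^ m * expectation (\<lambda>\<omega>. qK qpar r (sq * y) (sq * Y 0 \<omega>) * hq m (Y 0 \<omega>))" by simp
  also have "\<dots> = expectation (\<lambda>\<omega>. qK qpar r (sq * y) (sq * Y 0 \<omega>) * qh qpar m (sq * Y 0 \<omega>))"
    unfolding qh_scale[OF q1] integral_mult_right_zero[symmetric] by (simp add: mult_ac)
  also have "\<dots> = r ^ m * qh qpar m (sq * y)"
    by (rule integral_qK[OF q_abs r y _ Y_support qh_mean]) measurable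
  also have "\<dots> = sq ^ m * (r ^ m * hq m y)" unfolding qh_scale[OF q1] by simp
  finally show ?thesis using sq_pos by simp
qed

lemma qker_integral: assumes r: "\<bar>r\<bar> < 1" shows "(\<integral>x. qker r x y \<partial>lborel) = 1"
proof (cases "\<bar>sq * y\<bar> \<le> 2")
  case True then show ?thesis using qker_opoly[OF r True, of 0] by simp
next
  case False
  then show ?thesis using f_N_integral[of "\<lambda>_. 1"] by (simp add: qker_def prob_space)
qed

lemma qker_integrable: "\<bar>r\<bar> < 1 \<Longrightarrow> integrable lborel (\<lambda>x. qker r x y)"
  using qker_integral[of r y] not_integrable_integral_eq by fastforce

lemma qker_nn: "\<bar>r\<bar> < 1 \<Longrightarrow> (\<integral>\<^sup>+x. ennreal (qker r x y) \<partial>lborel) = 1"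
  using qker_integrable qker_integral qker_nonneg by (subst nn_integral_eq_integral) auto

lemma qker_cont_bound:
  assumes r: "\<bar>r\<bar> < 1" and f: "continuous_on UNIV f" and e: "\<And>x. \<bar>x\<bar> \<le> 2 / sq \<Longrightarrow> \<bar>f x\<bar> \<le> e"
  shows "integrable lborel (\<lambda>x. qker r x y * f x)" and "\<bar>\<integral>x. qker r x y * f x \<partial>lborel\<bar> \<le> e"
proof -
  have [measurable]: "f \<in> borel_measurable borel" using f by (rule borel_measurable_continuous_onI)
  have le: "\<bar>qker r x y * f x\<bar> \<le> e * qker r x y" for x
  proof (cases "\<bar>sq * x\<bar> \<le> 2")
    case True
    then have "\<bar>x\<bar> \<le> 2 / sq" using sq_pos by (simp add: abs_mult field_simps)
    then show ?thesis using e[of x] qker_nonneg[OF r, of x y] by (simp add: abs_mult mult.commute mult_right_mono)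
  qed (simp add: qker_def f_N_support)
  have e0: "0 \<le> e" using e[of 0] sq_pos by auto
  show i: "integrable lborel (\<lambda>x. qker r x y * f x)"
  proof (rule Bochner_Integration.integrable_bound)
    show "integrable lborel (\<lambda>x. e * qker r x y)" by (intro integrable_mult_right qker_integrable r)
    show "AE x in lborel. norm (qker r x y * f x) \<le> norm (e * qker r x y)"
      using le e0 qker_nonneg[OF r] by (intro AE_I2) (simp add: abs_mult)
  qed measurable
  have "\<bar>\<integral>x. qker r x y * f x \<partial>lborel\<bar> \<le> (\<integral>x. \<bar>qker r x y * f x\<bar> \<partial>lborel)" by (rule integral_abs_bound)
  also have "\<dots> \<le> (\<integral>x. e * qker r x y \<partial>lborel)"
    by (rule integral_mono) (use i le in \<open>auto intro!: integrable_mult_right qker_integrable r\<close>)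
  also have "\<dots> = e" using qker_integral[OF r] by simp
  finally show "\<bar>\<integral>x. qker r x y * f x \<partial>lborel\<bar> \<le> e" .
qed

lemma cont_bound_ex:
  assumes f: "continuous_on UNIV (f :: real \<Rightarrow> real)"
  shows "\<exists>e. \<forall>x. \<bar>x\<bar> \<le> 2 / sq \<longrightarrow> \<bar>f x\<bar> \<le> e"
proof -
  have "bounded (f ` {-(2 / sq)..2 / sq})"
    using continuous_on_subset[OF f] by (intro compact_imp_bounded compact_continuous_image) auto
  then obtain C where "\<forall>x\<in>{-(2 / sq)..2 / sq}. \<bar>f x\<bar> \<le> C" by (auto simp: bounded_iff)
  then show ?thesis by (intro exI[of _ C]) (auto simp: abs_le_iff)
qed

context
  fixes s t :: real and F r
  assumes st: "t < s" and F: "F \<in> sets (generated_algebra M {..t} Y)" and r_def: "r = R (s - t)"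
begin

lemma r_abs: "\<bar>r\<bar> < 1"
  using R_pos[of "s - t"] R_less_1[of "s - t"] st by (simp add: r_def)

lemma F_events: "F \<in> sets M"
  using F subalgebra_generated_algebra[of "{..t}" Y M] by (auto simp: subalgebra_def)

text \<open>The test functions for which the transition formula holds on \<open>F\<close>. Both
  sides integrate against laws carried by the compact support, so this class is linear and closed
  under uniform approximation there; starting from the \<open>hq m\<close> it reaches the
  polynomials and then all continuous functions.\<close>

definition good :: "(real \<Rightarrow> real) \<Rightarrow> bool" where
  "good f \<longleftrightarrow> continuous_on UNIV f \<and> expectation (\<lambda>\<omega>. indicator F \<omega> * f (Y s \<omega>))
     = expectation (\<lambda>\<omega>. indicator F \<omega> * (\<integral>x. qker r x (Y t \<omega>) * f x \<partial>lborel))"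

lemma expectation_cont:
  assumes f: "continuous_on UNIV f" and e: "\<And>x. \<bar>x\<bar> \<le> 2 / sq \<Longrightarrow> \<bar>f x\<bar> \<le> e"
  shows "integrable M (\<lambda>\<omega>. indicator F \<omega> * f (Y s \<omega>))" "\<bar>expectation (\<lambda>\<omega>. indicator F \<omega> * f (Y s \<omega>))\<bar> \<le> e"
    and "integrable M (\<lambda>\<omega>. indicator F \<omega> * (\<integral>x. qker r x (Y t \<omega>) * f x \<partial>lborel))"
      "\<bar>expectation (\<lambda>\<omega>. indicator F \<omega> * (\<integral>x. qker r x (Y t \<omega>) * f x \<partial>lborel))\<bar> \<le> e"
proof -
  have [measurable]: "f \<in> borel_measurable borel" using f by (rule borel_measurable_continuous_onI)
  note [measurable] = F_events f_N_measurable[OF q_abs]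
  have e0: "0 \<le> e" using e[of 0] sq_pos by auto
  have *: "integrable M U \<and> \<bar>expectation U\<bar> \<le> e" if [measurable]: "U \<in> borel_measurable M" and U: "AE \<omega> in M. \<bar>U \<omega>\<bar> \<le> e" for U
  proof
    show i: "integrable M U" by (rule integrable_const_bound[of _ e]) (use U in auto)
    have "\<bar>expectation U\<bar> \<le> expectation (\<lambda>\<omega>. \<bar>U \<omega>\<bar>)" by (rule integral_abs_bound)
    also have "\<dots> \<le> e" by (rule integral_le_const) (use i U in auto)
    finally show "\<bar>expectation U\<bar> \<le> e" .
  qed
  have "AE \<omega> in M. \<bar>indicator F \<omega> * f (Y s \<omega>)\<bar> \<le> e"
    using Y_support[of s]
  proof eventually_elim
    case (elim \<omega>)
    then have "\<bar>Y s \<omega>\<bar> \<le> 2 / sq" using sq_pos by (simp add: abs_mult field_simps)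
    from e[OF this] show ?case using e0 by (auto simp: indicator_def)
  qed
  with *[of "\<lambda>\<omega>. indicator F \<omega> * f (Y s \<omega>)"]
  show "integrable M (\<lambda>\<omega>. indicator F \<omega> * f (Y s \<omega>))" "\<bar>expectation (\<lambda>\<omega>. indicator F \<omega> * f (Y s \<omega>))\<bar> \<le> e" by auto
  have "(\<lambda>\<omega>. indicator F \<omega> * (\<integral>x. qker r x (Y t \<omega>) * f x \<partial>lborel)) \<in> borel_measurable M"
    unfolding qker_def by measurable
  moreover have "AE \<omega> in M. \<bar>indicator F \<omega> * (\<integral>x. qker r x (Y t \<omega>) * f x \<partial>lborel)\<bar> \<le> e"
    using qker_cont_bound(2)[OF r_abs f e] e0 by (intro AE_I2) (auto simp: indicator_def)
  ultimately show "integrable M (\<lambda>\<omega>. indicator F \<omega> * (\<integral>x. qker r x (Y t \<omega>) * f x \<partial>lborel))"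
      "\<bar>expectation (\<lambda>\<omega>. indicator F \<omega> * (\<integral>x. qker r x (Y t \<omega>) * f x \<partial>lborel))\<bar> \<le> e"
    using *[of "\<lambda>\<omega>. indicator F \<omega> * (\<integral>x. qker r x (Y t \<omega>) * f x \<partial>lborel)"] by auto
qed

lemma linear_combination:
  assumes f: "continuous_on UNIV f" and g: "continuous_on UNIV g"
  shows "expectation (\<lambda>\<omega>. indicator F \<omega> * (f (Y s \<omega>) + c * g (Y s \<omega>)))
     = expectation (\<lambda>\<omega>. indicator F \<omega> * f (Y s \<omega>)) + c * expectation (\<lambda>\<omega>. indicator F \<omega> * g (Y s \<omega>))"
   and "expectation (\<lambda>\<omega>. indicator F \<omega> * (\<integral>x. qker r x (Y t \<omega>) * (f x + c * g x) \<partial>lborel))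
     = expectation (\<lambda>\<omega>. indicator F \<omega> * (\<integral>x. qker r x (Y t \<omega>) * f x \<partial>lborel)) + c * expectation (\<lambda>\<omega>. indicator F \<omega> * (\<integral>x. qker r x (Y t \<omega>) * g x \<partial>lborel))"
proof -
  obtain e where "\<forall>x. \<bar>x\<bar> \<le> 2 / sq \<longrightarrow> \<bar>f x\<bar> \<le> e" using cont_bound_ex[OF f] by blast
  then have e: "\<And>x. \<bar>x\<bar> \<le> 2 / sq \<Longrightarrow> \<bar>f x\<bar> \<le> e" by blast
  obtain d where "\<forall>x. \<bar>x\<bar> \<le> 2 / sq \<longrightarrow> \<bar>g x\<bar> \<le> d" using cont_bound_ex[OF g] by blast
  then have d: "\<And>x. \<bar>x\<bar> \<le> 2 / sq \<Longrightarrow> \<bar>g x\<bar> \<le> d" by blast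
  note ef = expectation_cont[OF f e] and eg = expectation_cont[OF g d]
  have "(\<lambda>\<omega>. indicator F \<omega> * (f (Y s \<omega>) + c * g (Y s \<omega>))) = (\<lambda>\<omega>. indicator F \<omega> * f (Y s \<omega>) + c * (indicator F \<omega> * g (Y s \<omega>)))"
    by (auto simp: algebra_simps)
  then show "expectation (\<lambda>\<omega>. indicator F \<omega> * (f (Y s \<omega>) + c * g (Y s \<omega>)))
     = expectation (\<lambda>\<omega>. indicator F \<omega> * f (Y s \<omega>)) + c * expectation (\<lambda>\<omega>. indicator F \<omega> * g (Y s \<omega>))"
    using ef(1) eg(1) by simp
  have "(\<integral>x. qker r x y * (f x + c * g x) \<partial>lborel) = (\<integral>x. qker r x y * f x \<partial>lborel) + c * (\<integral>x. qker r x y * g x \<partial>lborel)" for y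
  proof -
    have "(\<lambda>x. qker r x y * (f x + c * g x)) = (\<lambda>x. qker r x y * f x + c * (qker r x y * g x))" by (auto simp: algebra_simps)
    then show ?thesis using qker_cont_bound(1)[OF r_abs f e] qker_cont_bound(1)[OF r_abs g d] by simp
  qed
  then have "(\<lambda>\<omega>. indicator F \<omega> * (\<integral>x. qker r x (Y t \<omega>) * (f x + c * g x) \<partial>lborel))
    = (\<lambda>\<omega>. indicator F \<omega> * (\<integral>x. qker r x (Y t \<omega>) * f x \<partial>lborel) + c * (indicator F \<omega> * (\<integral>x. qker r x (Y t \<omega>) * g x \<partial>lborel)))"
    by (auto simp: algebra_simps)
  then show "expectation (\<lambda>\<omega>. indicator F \<omega> * (\<integral>x. qker r x (Y t \<omega>) * (f x + c * g x) \<partial>lborel))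
     = expectation (\<lambda>\<omega>. indicator F \<omega> * (\<integral>x. qker r x (Y t \<omega>) * f x \<partial>lborel)) + c * expectation (\<lambda>\<omega>. indicator F \<omega> * (\<integral>x. qker r x (Y t \<omega>) * g x \<partial>lborel))"
    using ef(3) eg(3) by simp
qed

lemma good_linear: "good f \<Longrightarrow> good g \<Longrightarrow> good (\<lambda>x. f x + c * g x)"
  unfolding good_def using linear_combination[of f g c] by (auto intro!: continuous_intros)

lemma good_hq: "good (hq m)"
  unfolding good_def
proof
  show "continuous_on UNIV (hq m)" by (intro continuous_intros)
  note [measurable] = F_events f_N_measurable[OF q_abs]
  have "expectation (\<lambda>\<omega>. indicator F \<omega> * hq m (Y s \<omega>)) = expectation (\<lambda>\<omega>. indicator F \<omega> * (r ^ m * hq m (Y t \<omega>)))"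
    unfolding regression[OF st F] r_def by (simp add: mult.left_commute[of _ "R (s - t) ^ m"])
  also have "\<dots> = expectation (\<lambda>\<omega>. indicator F \<omega> * (\<integral>x. qker r x (Y t \<omega>) * hq m x \<partial>lborel))"
  proof (rule integral_cong_AE)
    show "AE \<omega> in M. indicator F \<omega> * (r ^ m * hq m (Y t \<omega>)) = indicator F \<omega> * (\<integral>x. qker r x (Y t \<omega>) * hq m x \<partial>lborel)"
      using Y_support[of t] by eventually_elim (simp add: qker_opoly[OF r_abs])
    show "(\<lambda>\<omega>. indicator F \<omega> * (\<integral>x. qker r x (Y t \<omega>) * hq m x \<partial>lborel)) \<in> borel_measurable M"
      unfolding qker_def by measurable
  qed measurable
  finally show "expectation (\<lambda>\<omega>. indicator F \<omega> * hq m (Y s \<omega>)) = expectation (\<lambda>\<omega>. indicator F \<omega> * (\<integral>x. qker r x (Y t \<omega>) * hq m x \<partial>lborel))" .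
qed

lemma good_power: "good (\<lambda>x. x ^ n)"
proof -
  \<comment> \<open>The factor \<open>hq m\<close> makes the induction possible: one power of
    \<open>x\<close> is absorbed by the three-term recurrence, at the price of neighbouring degrees
    \<open>m\<close>.\<close>
  have "good (\<lambda>x. x ^ n * hq m x)" for m
  proof (induction n arbitrary: m)
    case 0 then show ?case using good_hq by simp
  next
    case (Suc n)
    have "(\<lambda>x. x ^ Suc n * hq m x) = (\<lambda>x. x ^ n * hq (Suc m) x + qint qpar m * (x ^ n * hq (m - 1) x))"
    proof
      fix x
      have "x ^ Suc n * hq m x = x ^ n * (x * hq m x)" by simp
      then show "x ^ Suc n * hq m x = x ^ n * hq (Suc m) x + qint qpar m * (x ^ n * hq (m - 1) x)"
        unfolding opoly_mult_x[of "qint qpar", OF qint_simps(1)] by (simp add: algebra_simps)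
    qed
    then show ?case using good_linear[OF Suc Suc] by simp
  qed
  from this[of 0] show ?thesis by simp
qed

lemma good_polynomial: "good (\<lambda>x. \<Sum>i\<le>n. a i * x ^ i)"
proof (induction n)
  case 0
  have "good (\<lambda>x. x ^ 0 + (a 0 - 1) * x ^ 0)" by (rule good_linear[OF good_power good_power])
  then show ?case by simp
next
  case (Suc n) then show ?case using good_linear[OF Suc good_power, of "a (Suc n)" "Suc n"] by simp
qed

lemma good_continuous:
  assumes f: "continuous_on UNIV f" shows "good f"
proof -
  define d where "d = expectation (\<lambda>\<omega>. indicator F \<omega> * f (Y s \<omega>)) - expectation (\<lambda>\<omega>. indicator F \<omega> * (\<integral>x. qker r x (Y t \<omega>) * f x \<partial>lborel))"
  have "\<bar>d\<bar> \<le> 0 + e" if e: "0 < e" for e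
  proof -
    obtain g where g: "real_polynomial_function g" "\<And>x. x \<in> {-(2 / sq)..2 / sq} \<Longrightarrow> \<bar>f x - g x\<bar> < e / 2"
      using Stone_Weierstrass_real_polynomial_function[of "{-(2 / sq)..2 / sq}" f "e / 2"] continuous_on_subset[OF f] e by auto
    then obtain a n where "g = (\<lambda>x. \<Sum>i\<le>n. a i * x ^ i)" using real_polynomial_function_iff_sum by blast
    then have gg: "good g" using good_polynomial by simp
    have gc: "continuous_on UNIV g" using gg by (simp add: good_def)
    define h where "h x = f x + (-1) * g x" for x
    have hc: "continuous_on UNIV h" unfolding h_def by (intro continuous_intros f gc)
    have hb: "\<bar>h x\<bar> \<le> e / 2" if "\<bar>x\<bar> \<le> 2 / sq" for x using g(2)[of x] that by (auto simp: h_def abs_le_iff)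
    note eh = expectation_cont(2,4)[OF hc hb]
    have "d = expectation (\<lambda>\<omega>. indicator F \<omega> * h (Y s \<omega>)) - expectation (\<lambda>\<omega>. indicator F \<omega> * (\<integral>x. qker r x (Y t \<omega>) * h x \<partial>lborel))"
      using linear_combination[OF f gc, of "-1"] gg unfolding h_def d_def good_def by simp
    then show ?thesis using eh by linarith
  qed
  then have "\<bar>d\<bar> \<le> 0" by (rule field_le_epsilon)
  then show ?thesis using f by (simp add: good_def d_def)
qed

lemma qker_char:
  "expectation (\<lambda>\<omega>. indicator F \<omega> *\<^sub>R iexp (u * Y s \<omega>)) = expectation (\<lambda>\<omega>. indicator F \<omega> *\<^sub>R (\<integral>x. qker r x (Y t \<omega>) *\<^sub>R iexp (u * x) \<partial>lborel))"
proof -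
  note [measurable] = F_events f_N_measurable[OF q_abs]
  have ik: "integrable lborel (\<lambda>x. qker r x y *\<^sub>R iexp (u * x))" for y
    by (rule Bochner_Integration.integrable_bound[OF qker_integrable[OF r_abs, of y]]) auto
  have i1: "integrable M (\<lambda>\<omega>. indicator F \<omega> *\<^sub>R iexp (u * Y s \<omega>))"
    by (rule integrable_const_bound[where B = 1]) (auto simp: indicator_def)
  have kb: "norm (\<integral>x. qker r x y *\<^sub>R iexp (u * x) \<partial>lborel) \<le> 1" for y
  proof -
    have "norm (\<integral>x. qker r x y *\<^sub>R iexp (u * x) \<partial>lborel) \<le> (\<integral>x. norm (qker r x y *\<^sub>R iexp (u * x)) \<partial>lborel)" by (rule integral_norm_bound)
    also have "\<dots> = 1" using qker_nonneg[OF r_abs] qker_integral[OF r_abs] by simp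
    finally show ?thesis .
  qed
  have i2: "integrable M (\<lambda>\<omega>. indicator F \<omega> *\<^sub>R (\<integral>x. qker r x (Y t \<omega>) *\<^sub>R iexp (u * x) \<partial>lborel))"
  proof (rule integrable_const_bound[where B = 1])
    show "AE \<omega> in M. norm (indicator F \<omega> *\<^sub>R (\<integral>x. qker r x (Y t \<omega>) *\<^sub>R iexp (u * x) \<partial>lborel)) \<le> 1"
      using kb by (intro AE_I2) (auto simp: indicator_def)
    show "(\<lambda>\<omega>. indicator F \<omega> *\<^sub>R (\<integral>x. qker r x (Y t \<omega>) *\<^sub>R iexp (u * x) \<partial>lborel)) \<in> borel_measurable M"
      unfolding qker_def by measurable
  qed
  have re: "Re (\<integral>x. qker r x y *\<^sub>R iexp (u * x) \<partial>lborel) = (\<integral>x. qker r x y * cos (u * x) \<partial>lborel)"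
    and im: "Im (\<integral>x. qker r x y *\<^sub>R iexp (u * x) \<partial>lborel) = (\<integral>x. qker r x y * sin (u * x) \<partial>lborel)" for y
    using integral_Re[OF ik[of y]] integral_Im[OF ik[of y]] by (simp_all add: Re_exp Im_exp)
  have "good (\<lambda>x. cos (u * x))" "good (\<lambda>x. sin (u * x))" by (intro good_continuous continuous_intros)+
  then have g: "expectation (\<lambda>\<omega>. indicator F \<omega> * cos (u * Y s \<omega>)) = expectation (\<lambda>\<omega>. indicator F \<omega> * (\<integral>x. qker r x (Y t \<omega>) * cos (u * x) \<partial>lborel))"
    "expectation (\<lambda>\<omega>. indicator F \<omega> * sin (u * Y s \<omega>)) = expectation (\<lambda>\<omega>. indicator F \<omega> * (\<integral>x. qker r x (Y t \<omega>) * sin (u * x) \<partial>lborel))"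
    by (simp_all add: good_def)
  show ?thesis
  proof (rule complex_eqI)
    show "Re (expectation (\<lambda>\<omega>. indicator F \<omega> *\<^sub>R iexp (u * Y s \<omega>))) = Re (expectation (\<lambda>\<omega>. indicator F \<omega> *\<^sub>R (\<integral>x. qker r x (Y t \<omega>) *\<^sub>R iexp (u * x) \<partial>lborel)))"
      unfolding integral_Re[OF i1, symmetric] integral_Re[OF i2, symmetric] scaleR_complex.simps re using g(1) by (simp add: Re_exp)
    show "Im (expectation (\<lambda>\<omega>. indicator F \<omega> *\<^sub>R iexp (u * Y s \<omega>))) = Im (expectation (\<lambda>\<omega>. indicator F \<omega> *\<^sub>R (\<integral>x. qker r x (Y t \<omega>) *\<^sub>R iexp (u * x) \<partial>lborel)))"
      unfolding integral_Im[OF i1, symmetric] integral_Im[OF i2, symmetric] scaleR_complex.simps im using g(2) by (simp add: Im_exp)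
  qed
qed

end
end
end

section \<open>The transition law for q = 1\<close>

lemma qint_1 [simp]: "qint 1 n = real n"
  by (simp add: qint_def)

abbreviation herm :: "nat \<Rightarrow> real \<Rightarrow> real" where "herm \<equiv> opoly (qint 1)"

text \<open>The generating function \<open>g\<close> of the Hermite polynomials solves \<open>g' = (x - z) g\<close>.\<close>

lemma hermite_generating_function:
  fixes x :: real and z :: complex
  assumes s: "\<And>K :: nat. summable (\<lambda>n. \<bar>herm n x\<bar> * real K ^ n / fact n)"
  shows "(\<Sum>n. of_real (herm n x) / fact n * z ^ n) = exp (of_real x * z - z\<^sup>2 / 2)"
proof -
  define c :: "nat \<Rightarrow> complex" where "c n = of_real (herm n x) / fact n" for n
  have sm: "summable (\<lambda>n. c n * w ^ n)" for w
  proof -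
    obtain K :: nat where K: "norm w < real K" using reals_Archimedean2 by blast
    show ?thesis
    proof (rule summable_comparison_test'[OF s[of K], of 0])
      fix n
      have "norm (c n * w ^ n) = \<bar>herm n x\<bar> * norm w ^ n / fact n" by (simp add: c_def norm_mult norm_divide norm_power)
      also have "\<dots> \<le> \<bar>herm n x\<bar> * real K ^ n / fact n"
        using K by (intro divide_right_mono mult_left_mono power_mono) auto
      finally show "norm (c n * w ^ n) \<le> \<bar>herm n x\<bar> * real K ^ n / fact n" .
    qed
  qed
  define g where "g w = (\<Sum>n. c n * w ^ n)" for w
  have dc: "diffs c n = of_real x * c n - (if n = 0 then 0 else c (n - 1))" for n
  proof (cases n)
    case 0 then show ?thesis by (simp add: diffs_def c_def)
  next
    case (Suc k)
    have "diffs c n = of_nat (Suc n) * (of_real (herm (Suc n) x) / fact (Suc n))" by (simp only: diffs_def c_def)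
    also have "\<dots> = of_real (herm (Suc n) x) / fact n" by (simp add: field_simps del: of_nat_Suc opoly.simps)
    also have "herm (Suc n) x = x * herm n x - real n * herm k x" using Suc by simp
    also have "of_real (x * herm n x - real n * herm k x) / fact n = of_real x * c n - (of_nat n * of_real (herm k x)) / fact n"
      by (simp add: c_def diff_divide_distrib)
    also have "(of_nat n * of_real (herm k x)) / fact n = c k" unfolding Suc c_def by (simp add: field_simps del: of_nat_Suc)
    finally show ?thesis using Suc by simp
  qed
  have dg: "(g has_field_derivative (of_real x - w) * g w) (at w)" for w
  proof -
    have "(g has_field_derivative (\<Sum>n. diffs c n * w ^ n)) (at w)"
      unfolding g_def[abs_def] by (rule termdiffs_strong_converges_everywhere[OF sm])
    moreover have "(\<lambda>n. diffs c n * w ^ n) sums ((of_real x - w) * g w)"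
    proof -
      have 1: "(\<lambda>n. c n * w ^ n) sums g w" unfolding g_def by (rule summable_sums[OF sm])
      have "(\<lambda>n. w * (c n * w ^ n)) sums (w * g w)" by (rule sums_mult[OF 1])
      then have "(\<lambda>n. (if Suc n = 0 then 0 else c (Suc n - 1)) * w ^ Suc n) sums (w * g w)" by (simp add: mult_ac)
      then have 2: "(\<lambda>n. (if n = 0 then 0 else c (n - 1)) * w ^ n) sums (w * g w)"
        by (subst (asm) sums_Suc_iff) simp
      have "(\<lambda>n. of_real x * (c n * w ^ n) - (if n = 0 then 0 else c (n - 1)) * w ^ n) sums (of_real x * g w - w * g w)"
        by (intro sums_diff sums_mult 1 2)
      then show ?thesis unfolding dc by (simp add: algebra_simps)
    qed
    ultimately show ?thesis by (simp add: sums_unique[symmetric])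
  qed
  \<comment> \<open>The series divided by its claimed value. The differential equation makes the
    derivative 0 on the whole plane, so \<open>h\<close> keeps its value 1 at the origin.\<close>
  define h where "h w = g w * exp (w\<^sup>2 / 2 - of_real x * w)" for w
  have "(h has_field_derivative 0) (at w within UNIV)" for w
    unfolding h_def by (rule derivative_eq_intros dg refl | simp)+ (simp add: algebra_simps)
  then obtain C where C: "\<And>w. h w = C" using has_field_derivative_zero_constant[of UNIV h] by auto
  have "g 0 = c 0" unfolding g_def by (rule powser_zero)
  then have "h 0 = 1" by (simp add: h_def c_def)
  then have "g z * exp (z\<^sup>2 / 2 - of_real x * z) = 1" using C[of 0] C[of z] by (simp add: h_def)
  then have "g z * exp (z\<^sup>2 / 2 - of_real x * z) * exp (of_real x * z - z\<^sup>2 / 2) = exp (of_real x * z - z\<^sup>2 / 2)" by simp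
  then have "g z = exp (of_real x * z - z\<^sup>2 / 2)" by (simp add: mult.assoc exp_add[symmetric])
  then show ?thesis by (simp add: g_def c_def)
qed

lemma summable_power_sqrt_fact: "summable (\<lambda>n. r ^ n / sqrt (fact n))" for r :: real
proof (rule summable_norm_cancel)
  obtain N :: nat where N: "4 * r\<^sup>2 < real N" using reals_Archimedean2 by blast
  show "summable (\<lambda>n. norm (r ^ n / sqrt (fact n)))"
  proof (rule summable_ratio_test[of "1 / 2" N])
    fix n assume n: "N \<le> n"
    have "(2 * \<bar>r\<bar>)\<^sup>2 \<le> real (Suc n)" using N n by (simp add: power_mult_distrib)
    then have "2 * \<bar>r\<bar> \<le> sqrt (real (Suc n))" by (rule real_le_rsqrt)
    then have "\<bar>r\<bar> / sqrt (real (Suc n)) \<le> 1 / 2" by (simp add: divide_le_eq del: of_nat_Suc)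
    then have "\<bar>r\<bar> / sqrt (real (Suc n)) * (\<bar>r\<bar> ^ n / sqrt (fact n)) \<le> 1 / 2 * (\<bar>r\<bar> ^ n / sqrt (fact n))"
      by (intro mult_right_mono) auto
    then show "norm (norm (r ^ Suc n / sqrt (fact (Suc n)))) \<le> 1 / 2 * norm (norm (r ^ n / sqrt (fact n)))"
      by (simp add: abs_mult power_abs real_sqrt_mult mult_ac)
  qed simp
qed

context prob_space
begin

text \<open>The generating function at z = i u is exp (i u X) times exp (u^2 / 2), which explains
  the factor on the right. Orthogonality bounds the mean of
  \<open>\<bar>herm n (X \<omega>)\<bar>\<close> by \<open>sqrt (fact n)\<close>, and division by
  \<open>fact n\<close> leaves a summable series that justifies integrating termwise over
  \<open>F\<close>.\<close>

lemma hermite_char_expansion: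
  assumes X: "mom X" and mean: "\<And>n. expectation (\<lambda>\<omega>. herm n (X \<omega>)) = (if n = 0 then 1 else 0)"
    and F [measurable]: "F \<in> sets M"
  shows "(\<lambda>n. (\<i> * of_real u) ^ n / fact n * of_real (expectation (\<lambda>\<omega>. indicator F \<omega> * herm n (X \<omega>)))) sums
    (expectation (\<lambda>\<omega>. indicator F \<omega> *\<^sub>R iexp (u * X \<omega>)) * exp (of_real (u\<^sup>2 / 2)))"
proof -
  note [measurable] = momD[OF X]
  have mh: "mom (\<lambda>\<omega>. herm n (X \<omega>))" for n by (intro mom_opoly X)
  have sq: "expectation (\<lambda>\<omega>. herm n (X \<omega>) * herm n (X \<omega>)) = fact n" for n
  proof -
    have "integrable M (\<lambda>\<omega>. herm i (X \<omega>) * herm j (X \<omega>))" for i j by (intro mom_integrable mom_mult mh)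
    then show ?thesis by (subst opoly_orthogonal_integral) (auto simp: mean fact_prod)
  qed
  have abs1: "expectation (\<lambda>\<omega>. \<bar>herm n (X \<omega>)\<bar>) \<le> sqrt (fact n)" for n
  proof -
    define f where "f = sqrt (fact n :: real)"
    have f: "0 < f" "f * f = fact n" by (auto simp: f_def)
    have "expectation (\<lambda>\<omega>. \<bar>herm n (X \<omega>)\<bar>) \<le> expectation (\<lambda>\<omega>. (f + herm n (X \<omega>) * herm n (X \<omega>) / f) / 2)"
    proof (rule integral_mono)
      fix \<omega>
      define h where "h = \<bar>herm n (X \<omega>)\<bar>"
      have "0 \<le> (f - h) * (f - h)" by simp
      then have "2 * h * f \<le> f * f + h * h" by (simp add: algebra_simps)
      then have "h \<le> (f + h * h / f) / 2" using f by (simp add: field_simps)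
      then show "\<bar>herm n (X \<omega>)\<bar> \<le> (f + herm n (X \<omega>) * herm n (X \<omega>) / f) / 2" by (simp add: h_def)
    next
      show "integrable M (\<lambda>\<omega>. \<bar>herm n (X \<omega>)\<bar>)" by (rule integrable_abs[OF mom_integrable[OF mh]])
      show "integrable M (\<lambda>\<omega>. (f + herm n (X \<omega>) * herm n (X \<omega>) / f) / 2)"
        using mom_integrable[OF mom_mult[OF mh mh], of n n] by simp
    qed
    also have "\<dots> = (f + fact n / f) / 2"
      using mom_integrable[OF mom_mult[OF mh mh], of n n] by (simp add: sq prob_space)
    also have "\<dots> = f" using f by (simp add: field_simps)
    finally show ?thesis by (simp add: f_def)
  qed
  have smE: "summable (\<lambda>n. expectation (\<lambda>\<omega>. \<bar>herm n (X \<omega>)\<bar> * \<bar>v\<bar> ^ n / fact n))" for v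
  proof (rule summable_comparison_test'[OF summable_power_sqrt_fact[of "\<bar>v\<bar>"], of 0])
    fix n
    have "expectation (\<lambda>\<omega>. \<bar>herm n (X \<omega>)\<bar> * \<bar>v\<bar> ^ n / fact n) = expectation (\<lambda>\<omega>. \<bar>herm n (X \<omega>)\<bar>) * (\<bar>v\<bar> ^ n / fact n)" by simp
    also have "\<dots> \<le> sqrt (fact n) * (\<bar>v\<bar> ^ n / fact n)" by (intro mult_right_mono abs1) auto
    also have "\<dots> = \<bar>v\<bar> ^ n / sqrt (fact n)"
    proof -
      have "fact n = sqrt (fact n) * sqrt (fact n :: real)" by simp
      then show ?thesis by (metis (no_types, lifting) divide_divide_eq_right mult.commute nonzero_mult_div_cancel_left real_sqrt_eq_0_iff fact_nonzero times_divide_eq_right mult_divide_mult_cancel_left)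
    qed
    finally show "norm (expectation (\<lambda>\<omega>. \<bar>herm n (X \<omega>)\<bar> * \<bar>v\<bar> ^ n / fact n)) \<le> \<bar>v\<bar> ^ n / sqrt (fact n)"
      by (simp add: integral_nonneg_AE)
  qed
  have sm: "AE \<omega> in M. summable (\<lambda>n. \<bar>herm n (X \<omega>)\<bar> * real K ^ n / fact n)" for K
  proof -
    have i: "integrable M (\<lambda>\<omega>. \<bar>herm n (X \<omega>)\<bar> * real K ^ n / fact n)" for n
      using mom_integrable[OF mh, of n] by auto
    have "(\<integral>\<^sup>+\<omega>. (\<Sum>n. ennreal (\<bar>herm n (X \<omega>)\<bar> * real K ^ n / fact n)) \<partial>M) = (\<Sum>n. \<integral>\<^sup>+\<omega>. ennreal (\<bar>herm n (X \<omega>)\<bar> * real K ^ n / fact n) \<partial>M)"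
      by (rule nn_integral_suminf) measurable
    also have "\<dots> = (\<Sum>n. ennreal (expectation (\<lambda>\<omega>. \<bar>herm n (X \<omega>)\<bar> * real K ^ n / fact n)))"
      by (intro suminf_cong nn_integral_eq_integral i) auto
    also have "\<dots> < \<infinity>" using smE[of "real K"] by (simp add: suminf_ennreal2 integral_nonneg_AE)
    finally have "AE \<omega> in M. (\<Sum>n. ennreal (\<bar>herm n (X \<omega>)\<bar> * real K ^ n / fact n)) \<noteq> \<infinity>"
      by (intro nn_integral_PInf_AE) auto
    then show ?thesis by eventually_elim (rule summable_suminf_not_top, auto)
  qed
  \<comment> \<open>Summability is obtained outside a null set for each natural radius, and
    countably many of these dominate every complex argument; this is why
    \<open>hermite_generating_function\<close> is stated with natural numbers
    \<open>K\<close>.\<close>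
  then have smK: "AE \<omega> in M. \<forall>K :: nat. summable (\<lambda>n. \<bar>herm n (X \<omega>)\<bar> * real K ^ n / fact n)"
    by (simp add: AE_all_countable)
  define f where "f n \<omega> = (of_real (indicator F \<omega> * herm n (X \<omega>)) :: complex) / fact n * (\<i> * of_real u) ^ n" for n \<omega>
  have [measurable]: "f n \<in> borel_measurable M" for n unfolding f_def by measurable
  have fb: "norm (f n \<omega>) \<le> \<bar>herm n (X \<omega>)\<bar> * \<bar>u\<bar> ^ n / fact n" for n \<omega>
    by (auto simp: f_def norm_mult norm_divide norm_power indicator_def)
  have ib: "integrable M (\<lambda>\<omega>. \<bar>herm n (X \<omega>)\<bar> * \<bar>u\<bar> ^ n / fact n)" for n
    using mom_integrable[OF mh, of n] by auto
  have fi: "integrable M (f n)" for n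
    by (rule Bochner_Integration.integrable_bound[OF ib[of n]]) (use fb in \<open>auto simp: abs_mult\<close>)
  have s1: "AE \<omega> in M. summable (\<lambda>n. norm (f n \<omega>))"
    using smK
  proof eventually_elim
    case (elim \<omega>)
    obtain K :: nat where K: "\<bar>u\<bar> < real K" using reals_Archimedean2 by blast
    show ?case
    proof (rule summable_comparison_test'[OF elim[rule_format, of K], of 0])
      fix n
      have "norm (f n \<omega>) \<le> \<bar>herm n (X \<omega>)\<bar> * real K ^ n / fact n"
        by (rule order_trans[OF fb]) (use K in \<open>intro divide_right_mono mult_left_mono power_mono, auto\<close>)
      then show "norm (norm (f n \<omega>)) \<le> \<bar>herm n (X \<omega>)\<bar> * real K ^ n / fact n" by simp
    qed
  qed
  have s2: "summable (\<lambda>n. expectation (\<lambda>\<omega>. norm (f n \<omega>)))"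
  proof (rule summable_comparison_test'[OF smE[of u], of 0])
    fix n
    have "expectation (\<lambda>\<omega>. norm (f n \<omega>)) \<le> expectation (\<lambda>\<omega>. \<bar>herm n (X \<omega>)\<bar> * \<bar>u\<bar> ^ n / fact n)"
      using fi ib fb by (intro integral_mono) auto
    then show "norm (expectation (\<lambda>\<omega>. norm (f n \<omega>))) \<le> expectation (\<lambda>\<omega>. \<bar>herm n (X \<omega>)\<bar> * \<bar>u\<bar> ^ n / fact n)"
      by (simp add: integral_nonneg_AE)
  qed
  have "(\<lambda>n. expectation (f n)) sums expectation (\<lambda>\<omega>. \<Sum>n. f n \<omega>)"
    by (rule sums_integral[OF fi s1 s2])
  also have "expectation (\<lambda>\<omega>. \<Sum>n. f n \<omega>) = expectation (\<lambda>\<omega>. indicator F \<omega> *\<^sub>R iexp (u * X \<omega>) * exp (of_real (u\<^sup>2 / 2)))"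
  proof (rule integral_cong_AE)
    show "AE \<omega> in M. (\<Sum>n. f n \<omega>) = indicator F \<omega> *\<^sub>R iexp (u * X \<omega>) * exp (of_real (u\<^sup>2 / 2))"
      using smK
    proof eventually_elim
      case (elim \<omega>)
      have "(\<Sum>n. of_real (herm n (X \<omega>)) / fact n * (\<i> * of_real u) ^ n) = exp (of_real (X \<omega>) * (\<i> * of_real u) - (\<i> * of_real u)\<^sup>2 / 2)"
        by (rule hermite_generating_function) (use elim in blast)
      also have "\<dots> = iexp (u * X \<omega>) * exp (of_real (u\<^sup>2 / 2))"
        by (simp add: exp_add[symmetric] power_mult_distrib mult_ac)
      finally show ?case by (auto simp: f_def indicator_def)
    qed
  qed measurable
  also have "\<dots> = expectation (\<lambda>\<omega>. indicator F \<omega> *\<^sub>R iexp (u * X \<omega>)) * exp (of_real (u\<^sup>2 / 2))" by (rule integral_mult_left_zero)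
  also have "(\<lambda>n. expectation (f n)) = (\<lambda>n. (\<i> * of_real u) ^ n / fact n * of_real (expectation (\<lambda>\<omega>. indicator F \<omega> * herm n (X \<omega>))))"
  proof
    fix n
    have "f n = (\<lambda>\<omega>. (\<i> * of_real u) ^ n / fact n * complex_of_real (indicator F \<omega> * herm n (X \<omega>)))" by (auto simp: f_def)
    then show "expectation (f n) = (\<i> * of_real u) ^ n / fact n * of_real (expectation (\<lambda>\<omega>. indicator F \<omega> * herm n (X \<omega>)))"
      by (simp only: integral_mult_right_zero integral_complex_of_real)
  qed
  finally show ?thesis .
qed

end

lemma normal_char:
  assumes s: "0 < \<sigma>"
  shows "(\<integral>x. normal_density \<mu> \<sigma> x *\<^sub>R iexp (t * x) \<partial>lborel) = iexp (t * \<mu>) * of_real (exp (- (t * \<sigma>)\<^sup>2 / 2))"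
proof -
  have "(\<integral>x. normal_density \<mu> \<sigma> x *\<^sub>R iexp (t * x) \<partial>lborel) = \<bar>\<sigma>\<bar> *\<^sub>R (\<integral>z. normal_density \<mu> \<sigma> (\<mu> + \<sigma> * z) *\<^sub>R iexp (t * (\<mu> + \<sigma> * z)) \<partial>lborel)"
    by (rule lborel_integral_real_affine) (use s in simp)
  also have "\<dots> = (\<integral>z. iexp (t * \<mu>) * (std_normal_density z *\<^sub>R iexp (t * \<sigma> * z)) \<partial>lborel)"
  proof (subst integral_scaleR_right[symmetric], rule Bochner_Integration.integral_cong)
    fix z
    have "\<bar>\<sigma>\<bar> * normal_density \<mu> \<sigma> (\<mu> + \<sigma> * z) = std_normal_density z"
      using s by (simp add: normal_density_def real_sqrt_mult power_mult_distrib)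
    then show "\<bar>\<sigma>\<bar> *\<^sub>R normal_density \<mu> \<sigma> (\<mu> + \<sigma> * z) *\<^sub>R iexp (t * (\<mu> + \<sigma> * z)) = iexp (t * \<mu>) * (std_normal_density z *\<^sub>R iexp (t * \<sigma> * z))"
      unfolding scaleR_scaleR by (simp add: algebra_simps exp_add)
  qed simp
  also have "\<dots> = iexp (t * \<mu>) * (\<integral>z. std_normal_density z *\<^sub>R iexp (t * \<sigma> * z) \<partial>lborel)"
    by (rule integral_mult_right_zero)
  also have "(\<integral>z. std_normal_density z *\<^sub>R iexp (t * \<sigma> * z) \<partial>lborel) = char std_normal_distribution (t * \<sigma>)"
    unfolding char_def by (subst integral_density) auto
  also have "\<dots> = of_real (exp (- (t * \<sigma>)\<^sup>2 / 2))" by (simp add: char_std_normal_distribution)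
  finally show ?thesis .
qed

context ctsp
begin

context
  assumes q1: "qpar = 1"
begin

lemma Y_std_normal: "distr M borel (Y t) = density lborel (\<lambda>x. ennreal (f_N x qpar))"
proof -
  have e: "(\<lambda>x. f_N x qpar) = std_normal_density" by (auto simp: f_N_def q1 std_normal_density_def)
  have "distr M borel (Y t) = std_normal_distribution"
  proof (rule Levy_uniqueness)
    show "real_distribution (distr M borel (Y t))" by (rule real_distribution_distr) measurable
    show "real_distribution std_normal_distribution" by (rule real_dist_normal_dist)
    show "char (distr M borel (Y t)) = char std_normal_distribution"
    proof
      fix u
      have mean: "expectation (\<lambda>\<omega>. herm n (Y t \<omega>)) = (if n = 0 then 1 else 0)" for n
        using hq_mean[of n t] by (simp add: q1)
      have ind: "expectation (\<lambda>\<omega>. indicator (space M) \<omega> * U \<omega>) = expectation U" for U :: "'a \<Rightarrow> real"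
        by (intro Bochner_Integration.integral_cong) auto
      have ind': "expectation (\<lambda>\<omega>. indicator (space M) \<omega> *\<^sub>R U \<omega>) = expectation U" for U :: "'a \<Rightarrow> complex"
        by (intro Bochner_Integration.integral_cong) auto
      have "(\<lambda>n. (\<i> * of_real u) ^ n / fact n * of_real (if n = 0 then 1 else 0)) sums (expectation (\<lambda>\<omega>. iexp (u * Y t \<omega>)) * exp (of_real (u\<^sup>2 / 2)))"
        using hermite_char_expansion[OF Y_mom mean sets.top, of u] unfolding ind ind' mean .
      moreover have "(\<lambda>n. (\<i> * of_real u) ^ n / fact n * of_real (if n = 0 then 1 else 0)) sums (1 :: complex)"
        using sums_single[of 0 "\<lambda>_. 1 :: complex"] by (rule sums_cong[THEN iffD1, rotated]) auto
      ultimately have "expectation (\<lambda>\<omega>. iexp (u * Y t \<omega>)) * exp (of_real (u\<^sup>2 / 2)) = 1" by (rule sums_unique2)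
      then have "expectation (\<lambda>\<omega>. iexp (u * Y t \<omega>)) * exp (of_real (u\<^sup>2 / 2)) * exp (- of_real (u\<^sup>2 / 2)) = exp (- of_real (u\<^sup>2 / 2))" by simp
      then have "expectation (\<lambda>\<omega>. iexp (u * Y t \<omega>)) = exp (- of_real (u\<^sup>2 / 2))" by (simp only: mult.assoc exp_add[symmetric]) simp
      also have "\<dots> = complex_of_real (exp (- (u\<^sup>2) / 2))" by (simp add: exp_of_real[symmetric])
      finally show "char (distr M borel (Y t)) u = char std_normal_distribution u"
        unfolding char_std_normal_distribution char_def by (subst integral_distr) auto
    qed
  qed
  then show ?thesis using fun_cong[OF e] by simp
qed

definition gker :: "real \<Rightarrow> real \<Rightarrow> real \<Rightarrow> real" where
  "gker r x y = normal_density (r * y) (sqrt (1 - r\<^sup>2)) x"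

lemma gker_f_CN: "\<bar>r\<bar> < 1 \<Longrightarrow> f_CN x y r qpar = gker r x y"
proof -
  assume "\<bar>r\<bar> < 1"
  then have "0 < 1 - r\<^sup>2" by (simp add: abs_square_less_1)
  then show ?thesis by (simp add: f_CN_def q1 gker_def normal_density_def)
qed

text \<open>The regression multiplies the \<open>n\<close>-th coefficient of the expansion by
  \<open>r ^ n\<close>, which amounts to replacing \<open>u\<close> by \<open>u * r\<close>. The
  quotient of the two Gaussian factors is the characteristic function of a centred normal law of
  variance \<open>1 - r\<^sup>2\<close>.\<close>

lemma gker_char:
  assumes st: "t < s" and F: "F \<in> sets (generated_algebra M {..t} Y)" and r: "r = R (s - t)"
  shows "expectation (\<lambda>\<omega>. indicator F \<omega> *\<^sub>R iexp (u * Y s \<omega>)) = expectation (\<lambda>\<omega>. indicator F \<omega> *\<^sub>R (\<integral>x. gker r x (Y t \<omega>) *\<^sub>R iexp (u * x) \<partial>lborel))"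
proof -
  have r1: "\<bar>r\<bar> < 1" using R_pos[of "s - t"] R_less_1[of "s - t"] st by (simp add: r)
  then have r2: "0 < 1 - r\<^sup>2" by (simp add: abs_square_less_1)
  have FM [measurable]: "F \<in> sets M"
    using F subalgebra_generated_algebra[of "{..t}" Y M] by (auto simp: subalgebra_def)
  have mean: "expectation (\<lambda>\<omega>. herm n (Y i \<omega>)) = (if n = 0 then 1 else 0)" for n i
    using hq_mean[of n i] by (simp add: q1)
  have reg: "expectation (\<lambda>\<omega>. indicator F \<omega> * herm n (Y s \<omega>)) = r ^ n * expectation (\<lambda>\<omega>. indicator F \<omega> * herm n (Y t \<omega>))" for n
    using regression[OF st F, of n] by (simp add: q1 r)
  have "(\<lambda>n. (\<i> * of_real u) ^ n / fact n * of_real (r ^ n * expectation (\<lambda>\<omega>. indicator F \<omega> * herm n (Y t \<omega>)))) sums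
     (expectation (\<lambda>\<omega>. indicator F \<omega> *\<^sub>R iexp (u * Y s \<omega>)) * exp (of_real (u\<^sup>2 / 2)))"
    using hermite_char_expansion[OF Y_mom mean FM, of u s] unfolding reg .
  moreover have "(\<lambda>n. (\<i> * of_real u) ^ n / fact n * of_real (r ^ n * expectation (\<lambda>\<omega>. indicator F \<omega> * herm n (Y t \<omega>)))) sums
     (expectation (\<lambda>\<omega>. indicator F \<omega> *\<^sub>R iexp ((u * r) * Y t \<omega>)) * exp (of_real ((u * r)\<^sup>2 / 2)))"
    using hermite_char_expansion[OF Y_mom mean FM, of "u * r" t] by (simp add: power_mult_distrib mult_ac)
  ultimately have "expectation (\<lambda>\<omega>. indicator F \<omega> *\<^sub>R iexp (u * Y s \<omega>)) * exp (of_real (u\<^sup>2 / 2)) =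
     expectation (\<lambda>\<omega>. indicator F \<omega> *\<^sub>R iexp ((u * r) * Y t \<omega>)) * exp (of_real ((u * r)\<^sup>2 / 2))" by (rule sums_unique2)
  then have "expectation (\<lambda>\<omega>. indicator F \<omega> *\<^sub>R iexp (u * Y s \<omega>)) * exp (of_real (u\<^sup>2 / 2)) * exp (of_real (- (u\<^sup>2 / 2))) =
     expectation (\<lambda>\<omega>. indicator F \<omega> *\<^sub>R iexp ((u * r) * Y t \<omega>)) * exp (of_real ((u * r)\<^sup>2 / 2)) * exp (of_real (- (u\<^sup>2 / 2)))" by simp
  then have "expectation (\<lambda>\<omega>. indicator F \<omega> *\<^sub>R iexp (u * Y s \<omega>)) =
     expectation (\<lambda>\<omega>. indicator F \<omega> *\<^sub>R iexp ((u * r) * Y t \<omega>)) * exp (of_real ((u * r)\<^sup>2 / 2 - u\<^sup>2 / 2))"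
    by (simp only: mult.assoc exp_add[symmetric] of_real_add[symmetric]) simp
  also have "(u * r)\<^sup>2 / 2 - u\<^sup>2 / 2 = - (u * sqrt (1 - r\<^sup>2))\<^sup>2 / 2"
    using r2 by (simp add: power_mult_distrib field_simps)
  also have "expectation (\<lambda>\<omega>. indicator F \<omega> *\<^sub>R iexp ((u * r) * Y t \<omega>)) * exp (of_real (- (u * sqrt (1 - r\<^sup>2))\<^sup>2 / 2))
     = expectation (\<lambda>\<omega>. indicator F \<omega> *\<^sub>R (\<integral>x. gker r x (Y t \<omega>) *\<^sub>R iexp (u * x) \<partial>lborel))"
    unfolding gker_def normal_char[OF real_sqrt_gt_zero[OF r2]] integral_mult_left_zero[symmetric]
    by (simp add: exp_of_real[symmetric] mult_ac)
  finally show ?thesis .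
qed

end
end

section \<open>Markov property and conditional densities\<close>

context ctsp
begin

text \<open>The index set \<open>I\<close> ranges between \<open>{t}\<close> and
  \<open>{..t}\<close>. The conditional probability is a function of \<open>Y t\<close> that is the
  same for both extremes, which is the Markov property, and \<open>I = {t}\<close> gives the
  conditional density.\<close>

lemma conditional_law:
  assumes st: "t < s" and k: "(\<lambda>(x, y). k x y) \<in> borel_measurable (borel \<Otimes>\<^sub>M borel)"
    and k0: "\<And>x y. 0 \<le> k x y" and k1: "\<And>y. (\<integral>\<^sup>+x. ennreal (k x y) \<partial>lborel) = 1"
    and char: "\<And>F u. F \<in> sets (generated_algebra M {..t} Y) \<Longrightarrow>
      expectation (\<lambda>\<omega>. indicator F \<omega> *\<^sub>R iexp (u * Y s \<omega>)) = expectation (\<lambda>\<omega>. indicator F \<omega> *\<^sub>R (\<integral>x. k x (Y t \<omega>) *\<^sub>R iexp (u * x) \<partial>lborel))"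
    and S: "S \<in> sets borel" and I: "I \<subseteq> {..t}" "t \<in> I"
  shows "AE \<omega> in M. cond_prob_given M (generated_algebra M I Y) (Y s -` S \<inter> space M) \<omega> = measure (density lborel (\<lambda>x. ennreal (k x (Y t \<omega>)))) S"
proof -
  note [measurable] = S
  have sub: "subalgebra M (generated_algebra M I Y)" by (rule subalgebra_generated_algebra) measurable
  have subt: "subalgebra M (generated_algebra M {..t} Y)" by (rule subalgebra_generated_algebra) measurable
  have km [measurable]: "(\<lambda>z. k (g z) (h z)) \<in> borel_measurable L" if "g \<in> borel_measurable L" "h \<in> borel_measurable L" for g h and L :: "'z measure"
    using measurable_compose[OF measurable_Pair[OF that] k] by simp
  have km3 [measurable]: "(\<lambda>x. k x y) \<in> borel_measurable borel" for y by (rule km) measurable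
  define \<kappa> where "\<kappa> y = (\<integral>x. k x y * indicator S x \<partial>lborel)" for y
  have ki: "integrable lborel (\<lambda>x. k x y)" for y
    by (rule integrableI_nonneg) (use k0 k1[of y] in auto)
  have kS: "integrable lborel (\<lambda>x. k x y * indicator S x)" for y
    by (rule Bochner_Integration.integrable_bound[OF ki[of y]]) (auto simp: indicator_def)
  have meas: "measure (density lborel (\<lambda>x. ennreal (k x y))) S = \<kappa> y" for y
  proof -
    have "emeasure (density lborel (\<lambda>x. ennreal (k x y))) S = (\<integral>\<^sup>+x. ennreal (k x y) * indicator S x \<partial>lborel)"
      by (rule emeasure_density) auto
    also have "\<dots> = (\<integral>\<^sup>+x. ennreal (k x y * indicator S x) \<partial>lborel)" by (intro nn_integral_cong) (auto simp: indicator_def)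
    also have "\<dots> = ennreal (\<kappa> y)" unfolding \<kappa>_def by (rule nn_integral_eq_integral[OF kS]) (auto simp: k0)
    finally show ?thesis by (simp add: measure_def \<kappa>_def integral_nonneg_AE k0)
  qed
  have \<kappa>m [measurable]: "\<kappa> \<in> borel_measurable borel"
    unfolding \<kappa>_def by measurable
  have \<kappa>1: "\<bar>\<kappa> y\<bar> \<le> 1" for y
  proof -
    have "\<kappa> y \<le> (\<integral>x. k x y \<partial>lborel)" unfolding \<kappa>_def
      by (rule integral_mono[OF kS ki]) (auto simp: indicator_def k0)
    also have "\<dots> = 1" using nn_integral_eq_integral[OF ki[of y]] k0 k1[of y] by (simp add: integral_nonneg_AE ennreal_eq_1)
    finally show ?thesis by (simp add: \<kappa>_def integral_nonneg_AE k0)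
  qed
  have eq: "expectation (\<lambda>\<omega>. indicator F \<omega> * indicator (Y s -` S \<inter> space M) \<omega>) = expectation (\<lambda>\<omega>. indicator F \<omega> * \<kappa> (Y t \<omega>))"
    if "F \<in> sets (generated_algebra M I Y)" for F
  proof -
    have F: "F \<in> sets (generated_algebra M {..t} Y)" using sets_generated_algebra_mono[OF I(1)] that by auto
    have "expectation (\<lambda>\<omega>. indicator F \<omega> * indicator S (Y s \<omega>)) = expectation (\<lambda>\<omega>. indicator F \<omega> * (\<integral>x. k x (Y t \<omega>) * indicator S x \<partial>lborel))"
      by (rule conditional_law_from_char[OF subt _ _ k k0 k1 F char[OF F] S]) measurable
    moreover have "expectation (\<lambda>\<omega>. indicator F \<omega> * indicator (Y s -` S \<inter> space M) \<omega> :: real) = expectation (\<lambda>\<omega>. indicator F \<omega> * indicator S (Y s \<omega>))"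
      by (rule Bochner_Integration.integral_cong) (auto simp: indicator_def)
    ultimately show ?thesis
      by (simp add: \<kappa>_def)
  qed
  have "AE \<omega> in M. real_cond_exp M (generated_algebra M I Y) (indicator (Y s -` S \<inter> space M)) \<omega> = \<kappa> (Y t \<omega>)"
  proof (rule cond_exp_eqI[OF sub _ _ _ eq])
    show "integrable M (\<lambda>\<omega>. \<kappa> (Y t \<omega>))"
      by (rule integrable_const_bound[where B = 1]) (use \<kappa>1 in auto)
    show "(\<lambda>\<omega>. \<kappa> (Y t \<omega>)) \<in> borel_measurable (generated_algebra M I Y)"
      using measurable_compose[OF measurable_generated_algebra[OF I(2)] \<kappa>m] .
    show "integrable M (indicator (Y s -` S \<inter> space M) :: 'a \<Rightarrow> real)"
      by (intro mom_integrable mom_indicator) measurable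
  qed
  then show ?thesis by (simp add: cond_prob_given_def meas)
qed

lemma generated_algebra_unit: "generated_algebra M {()} (\<lambda>_. Y t) = generated_algebra M {t} Y"
proof -
  have "{Y t -` S \<inter> space M |(i :: unit) S. i \<in> {()} \<and> S \<in> sets borel} = {Y i -` S \<inter> space M |i S. i \<in> {t} \<and> S \<in> sets borel}" by auto
  then show ?thesis by (simp add: generated_algebra_def)
qed

text \<open>Common interface of the cases \<open>qpar < 1\<close> and \<open>qpar = 1\<close>. The
  kernel \<open>k\<close> is a probability density for every \<open>y\<close> and agrees with
  \<open>f_CN\<close> at almost all values of \<open>Y t\<close>.\<close>

lemma transition_kernel:
  assumes st: "t < s"
  obtains k where "(\<lambda>(x, y). k x y) \<in> borel_measurable (borel \<Otimes>\<^sub>M borel)" "\<And>x y. 0 \<le> k x y"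
    "\<And>y. (\<integral>\<^sup>+x. ennreal (k x y) \<partial>lborel) = 1"
    "\<And>F u. F \<in> sets (generated_algebra M {..t} Y) \<Longrightarrow>
      expectation (\<lambda>\<omega>. indicator F \<omega> *\<^sub>R iexp (u * Y s \<omega>)) = expectation (\<lambda>\<omega>. indicator F \<omega> *\<^sub>R (\<integral>x. k x (Y t \<omega>) *\<^sub>R iexp (u * x) \<partial>lborel))"
    "AE \<omega> in M. \<forall>x. f_CN x (Y t \<omega>) (R (s - t)) qpar = k x (Y t \<omega>)"
proof (cases "qpar < 1")
  case True
  have r: "\<bar>R (s - t)\<bar> < 1" using R_pos[of "s - t"] R_less_1[of "s - t"] st by auto
  show thesis
  proof (rule that[of "qker (R (s - t))"])
    show "AE \<omega> in M. \<forall>x. f_CN x (Y t \<omega>) (R (s - t)) qpar = qker (R (s - t)) x (Y t \<omega>)"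
      using Y_support[OF True, of t] by eventually_elim (simp add: qker_f_CN[OF True _ r])
  qed (use qker_measurable[OF True] qker_nonneg[OF True r] qker_nn[OF True r] qker_char[OF True st _ refl] in auto)
next
  case False
  then have q1: "qpar = 1" using qpar_range by simp
  have r: "\<bar>R (s - t)\<bar> < 1" using R_pos[of "s - t"] R_less_1[of "s - t"] st by auto
  then have r2: "0 < 1 - (R (s - t))\<^sup>2" by (simp add: abs_square_less_1)
  show thesis
  proof (rule that[of "gker (R (s - t))"])
    show "(\<lambda>(x, y). gker (R (s - t)) x y) \<in> borel_measurable (borel \<Otimes>\<^sub>M borel)"
      unfolding gker_def[OF q1] normal_density_def by measurable
    show "(\<integral>\<^sup>+x. ennreal (gker (R (s - t)) x y) \<partial>lborel) = 1" for y
      unfolding gker_def[OF q1] using r2 by (subst nn_integral_eq_integral) auto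
  qed (use gker_f_CN[OF q1 r] gker_char[OF q1 st _ refl] in \<open>auto simp: gker_def[OF q1]\<close>)
qed

lemma transition_law:
  assumes st: "t < s"
  shows "S \<in> sets borel \<Longrightarrow> I \<subseteq> {..t} \<Longrightarrow> t \<in> I \<Longrightarrow> AE \<omega> in M. cond_prob_given M (generated_algebra M I Y) (Y s -` S \<inter> space M) \<omega>
      = measure (density lborel (\<lambda>x. ennreal (f_CN x (Y t \<omega>) (R (s - t)) qpar))) S"
    and "AE \<omega> in M. probability_density (\<lambda>x. f_CN x (Y t \<omega>) (R (s - t)) qpar)"
proof -
  obtain k where k: "(\<lambda>(x, y). k x y) \<in> borel_measurable (borel \<Otimes>\<^sub>M borel)" "\<And>x y. 0 \<le> k x y"
    "\<And>y. (\<integral>\<^sup>+x. ennreal (k x y) \<partial>lborel) = 1"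
    "\<And>F u. F \<in> sets (generated_algebra M {..t} Y) \<Longrightarrow>
      expectation (\<lambda>\<omega>. indicator F \<omega> *\<^sub>R iexp (u * Y s \<omega>)) = expectation (\<lambda>\<omega>. indicator F \<omega> *\<^sub>R (\<integral>x. k x (Y t \<omega>) *\<^sub>R iexp (u * x) \<partial>lborel))"
    and eq: "AE \<omega> in M. \<forall>x. f_CN x (Y t \<omega>) (R (s - t)) qpar = k x (Y t \<omega>)"
    using transition_kernel[OF st] by blast
  { assume S: "S \<in> sets borel" and I: "I \<subseteq> {..t}" "t \<in> I"
    show "AE \<omega> in M. cond_prob_given M (generated_algebra M I Y) (Y s -` S \<inter> space M) \<omega>
      = measure (density lborel (\<lambda>x. ennreal (f_CN x (Y t \<omega>) (R (s - t)) qpar))) S"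
    proof -
      have "AE \<omega> in M. cond_prob_given M (generated_algebra M I Y) (Y s -` S \<inter> space M) \<omega> = measure (density lborel (\<lambda>x. ennreal (k x (Y t \<omega>)))) S"
        by (rule conditional_law[OF st k(1,2,3) _ S I]) (rule k(4))
      then show ?thesis using eq by eventually_elim simp
    qed }
  have "(\<lambda>x. k x y) \<in> borel_measurable borel" for y
    using measurable_compose[OF measurable_Pair1'[of y borel borel] k(1)] 
      measurable_compose[OF measurable_Pair[OF measurable_ident measurable_const] k(1), of y] by simp
  then have "probability_density (\<lambda>x. k x y)" for y using k(2,3) by (simp add: probability_density_def)
  then show "AE \<omega> in M. probability_density (\<lambda>x. f_CN x (Y t \<omega>) (R (s - t)) qpar)"
    using eq by (auto elim!: eventually_mono)
qed

theorem characterization: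
  "\<exists>q \<alpha>. -1 < q \<and> q \<le> 1 \<and> 0 < \<alpha> \<and>
          markov_process M Y \<and>
          (\<forall>t. distributed M lborel (Y t) (\<lambda>x. ennreal (f_N x q))) \<and>
          (\<forall>t s. t < s \<longrightarrow>
             has_conditional_density M (Y s) (Y t)
               (\<lambda>x y. f_CN x y (exp (- \<alpha> * \<bar>s - t\<bar>)) q))"
proof (rule exI[of _ qpar], rule exI[of _ alpha], intro conjI allI impI)
  show "-1 < qpar" "qpar \<le> 1" "0 < alpha" by (rule qpar_range alpha_pos)+
  show "markov_process M Y" unfolding markov_process_def
  proof (intro allI impI)
    fix t s :: real and S :: "real set" assume st: "t < s" and S: "S \<in> sets borel"
    show "AE \<omega> in M. cond_prob_given M (generated_algebra M {..t} Y) (Y s -` S \<inter> space M) \<omega>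
                  = cond_prob_given M (generated_algebra M {t} Y) (Y s -` S \<inter> space M) \<omega>"
      using transition_law(1)[OF st S, of "{..t}"] transition_law(1)[OF st S, of "{t}"] by auto
  qed
  fix t
  show "distributed M lborel (Y t) (\<lambda>x. ennreal (f_N x qpar))"
  proof -
    have "distr M borel (Y t) = density lborel (\<lambda>x. ennreal (f_N x qpar))"
    proof (cases "qpar < 1")
      case True then show ?thesis by (rule Y_density)
    next
      case False then show ?thesis using qpar_range by (intro Y_std_normal) simp
    qed
    moreover have "(\<lambda>x. f_N x qpar) \<in> borel_measurable borel"
    proof (cases "qpar < 1")
      case True then show ?thesis using qpar_range by (intro f_N_measurable) auto
    next
      case False then have "qpar = 1" using qpar_range by simp
      then show ?thesis by (simp add: f_N_def)
    qed
    moreover have "distr M lborel (Y t) = distr M borel (Y t)" by (rule distr_cong) auto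
    ultimately show ?thesis by (simp add: distributed_def)
  qed
  fix s assume st: "t < s"
  then have Rst: "R (s - t) = exp (- alpha * \<bar>s - t\<bar>)" by (subst R_eq) auto
  show "has_conditional_density M (Y s) (Y t) (\<lambda>x y. f_CN x y (exp (- alpha * \<bar>s - t\<bar>)) qpar)"
    unfolding has_conditional_density_def generated_algebra_unit Rst[symmetric]
    by (intro conjI ballI transition_law(2)[OF st] transition_law(1)[OF st]) auto
qed

end

section \<open>The Ornstein--Uhlenbeck process\<close>

text \<open>The Ornstein--Uhlenbeck transition density relative to the standard normal law.\<close>

definition mehler :: "real \<Rightarrow> real \<Rightarrow> real \<Rightarrow> real" where
  "mehler r x y = exp (- (r\<^sup>2 * (x\<^sup>2 + y\<^sup>2) - 2 * r * x * y) / (2 * (1 - r\<^sup>2))) / sqrt (1 - r\<^sup>2)"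

abbreviation gauss :: "real measure" where
  "gauss \<equiv> density lborel (\<lambda>x. ennreal (std_normal_density x))"

lemma mehler_measurable [measurable]:
  assumes [measurable]: "f \<in> borel_measurable L" "g \<in> borel_measurable L"
  shows "(\<lambda>z. mehler r (f z) (g z)) \<in> borel_measurable L"
  unfolding mehler_def by measurable

lemma mehler_nonneg: "\<bar>r\<bar> < 1 \<Longrightarrow> 0 \<le> mehler r x y"
  by (simp add: mehler_def abs_square_le_1)

lemma mehler_commute: "mehler r x y = mehler r y x"
  by (simp add: mehler_def add.commute mult_ac)

lemma std_normal_mehler:
  assumes "\<bar>r\<bar> < 1"
  shows "std_normal_density y * mehler r x y = normal_density (r * x) (sqrt (1 - r\<^sup>2)) y"
proof -
  define a where "a = 1 - r\<^sup>2"
  have a: "0 < a" using assms by (simp add: a_def abs_square_less_1)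
  define P where "P = r\<^sup>2 * (x\<^sup>2 + y\<^sup>2) - 2 * r * x * y"
  have "a * y\<^sup>2 + P = (y - r * x)\<^sup>2"
    by (simp add: a_def P_def power2_eq_square algebra_simps)
  moreover have "- y\<^sup>2 / 2 + - P / (2 * a) = - (a * y\<^sup>2 + P) / (2 * a)"
    using a by (simp add: field_simps)
  ultimately have "- y\<^sup>2 / 2 + - P / (2 * a) = - (y - r * x)\<^sup>2 / (2 * a)" by simp
  then show ?thesis using a
    unfolding mehler_def std_normal_density_def normal_density_def a_def[symmetric] P_def[symmetric]
    by (simp add: exp_add[symmetric] real_sqrt_mult del: minus_diff_eq mult_minus_right minus_mult_right)
qed

text \<open>Conditionally on the end points, the midpoint of a Gaussian Markov path \<open>x, y, z\<close> with correlations
  \<open>r\<close> and \<open>s\<close> is normal with these parameters.\<close>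

definition bridge_mean :: "real \<Rightarrow> real \<Rightarrow> real \<Rightarrow> real \<Rightarrow> real" where
  "bridge_mean r s x z = (r * (1 - s\<^sup>2) * x + s * (1 - r\<^sup>2) * z) / (1 - r\<^sup>2 * s\<^sup>2)"

definition bridge_var :: "real \<Rightarrow> real \<Rightarrow> real" where
  "bridge_var r s = (1 - r\<^sup>2) * (1 - s\<^sup>2) / (1 - r\<^sup>2 * s\<^sup>2)"

lemma bridge_var_pos:
  assumes "\<bar>r\<bar> < 1" "\<bar>s\<bar> < 1"
  shows "0 < bridge_var r s"
proof -
  have "r\<^sup>2 < 1" "s\<^sup>2 < 1" using assms by (simp_all add: abs_square_less_1)
  moreover from this have "r\<^sup>2 * s\<^sup>2 < 1" using mult_left_le[of "s\<^sup>2" "r\<^sup>2"] by auto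
  ultimately show ?thesis by (simp add: bridge_var_def)
qed

text \<open>Completing the square in \<open>y\<close>; \<open>poly\<close> is the identity of
  quadratic forms behind it. Integrated over \<open>y\<close> it is the Chapman--Kolmogorov
  equation, and the normal factor is the law of the bridge.\<close>

lemma std_normal_mehler_mehler:
  assumes r: "\<bar>r\<bar> < 1" and s: "\<bar>s\<bar> < 1"
  shows "std_normal_density y * (mehler r x y * mehler s y z)
    = mehler (r * s) x z * normal_density (bridge_mean r s x z) (sqrt (bridge_var r s)) y"
proof -
  define a b c where abc: "a = 1 - r\<^sup>2" "b = 1 - s\<^sup>2" "c = 1 - (r * s)\<^sup>2"
  have r2: "r\<^sup>2 < 1" and s2: "s\<^sup>2 < 1" using r s by (simp_all add: abs_square_less_1)
  have pos: "0 < a" "0 < b" "0 < c"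
    using r2 s2 mult_left_le[of "s\<^sup>2" "r\<^sup>2"] by (auto simp: abc power_mult_distrib)
  define P where "P = r\<^sup>2 * (x\<^sup>2 + y\<^sup>2) - 2 * r * x * y"
  define Q where "Q = s\<^sup>2 * (y\<^sup>2 + z\<^sup>2) - 2 * s * y * z"
  define S where "S = (r * s)\<^sup>2 * (x\<^sup>2 + z\<^sup>2) - 2 * (r * s) * x * z"
  define T where "T = c * y - (r * b * x + s * a * z)"
  have poly: "a * b * c * y\<^sup>2 + b * c * P + a * c * Q = a * b * S + T\<^sup>2"
    unfolding P_def Q_def S_def T_def abc power2_eq_square by (simp add: algebra_simps)
  have m: "bridge_mean r s x z = (r * b * x + s * a * z) / c" and v: "bridge_var r s = a * b / c"
    by (simp_all add: bridge_mean_def bridge_var_def abc power_mult_distrib)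
  have ym: "y - bridge_mean r s x z = T / c" using pos by (simp add: m T_def field_simps)
  have "y\<^sup>2 / 2 + P / (2 * a) + Q / (2 * b) = (a * b * c * y\<^sup>2 + b * c * P + a * c * Q) / (2 * a * b * c)"
    using pos by (simp add: field_simps)
  also have "\<dots> = S / (2 * c) + T\<^sup>2 / (2 * a * b * c)"
    unfolding poly using pos by (simp add: field_simps)
  also have "T\<^sup>2 / (2 * a * b * c) = (y - bridge_mean r s x z)\<^sup>2 / (2 * bridge_var r s)"
    unfolding ym v using pos by (simp add: field_simps power2_eq_square)
  finally have e: "exp (- (y\<^sup>2 / 2)) * (exp (- (P / (2 * a))) * exp (- (Q / (2 * b))))
      = exp (- (S / (2 * c))) * exp (- ((y - bridge_mean r s x z)\<^sup>2 / (2 * bridge_var r s)))"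
    by (simp add: exp_add[symmetric] algebra_simps)
  have vv: "(sqrt (bridge_var r s))\<^sup>2 = bridge_var r s" using bridge_var_pos[OF r s] by simp
  have f: "1 / sqrt (2 * pi) * (1 / sqrt a * (1 / sqrt b)) = 1 / sqrt c * (1 / sqrt (2 * pi * bridge_var r s))"
    unfolding v using pos by (simp add: real_sqrt_mult real_sqrt_divide)
  have "std_normal_density y * (mehler r x y * mehler s y z) = (1 / sqrt (2 * pi) * (1 / sqrt a * (1 / sqrt b)))
      * (exp (- (y\<^sup>2 / 2)) * (exp (- (P / (2 * a))) * exp (- (Q / (2 * b)))))"
    unfolding mehler_def std_normal_density_def P_def[symmetric] Q_def[symmetric] abc[symmetric] by simp
  also have "\<dots> = (1 / sqrt c * (1 / sqrt (2 * pi * bridge_var r s)))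
      * (exp (- (S / (2 * c))) * exp (- ((y - bridge_mean r s x z)\<^sup>2 / (2 * bridge_var r s))))"
    unfolding f e ..
  also have "\<dots> = mehler (r * s) x z * normal_density (bridge_mean r s x z) (sqrt (bridge_var r s)) y"
    unfolding mehler_def normal_density_def vv S_def[symmetric] abc[symmetric] by simp
  finally show ?thesis .
qed

lemma nn_integral_normal_density:
  assumes "0 < \<sigma>"
  shows "(\<integral>\<^sup>+y. ennreal (normal_density \<mu> \<sigma> y) \<partial>lborel) = 1"
  using assms by (subst nn_integral_eq_integral) auto

text \<open>The shift \<open>u\<close> allows work with nonnegative integrals throughout: the
  squares for \<open>u = 1\<close> and \<open>u = - 1\<close> differ by four times the variable, so
  first moments are recovered from second ones.\<close>

lemma nn_integral_normal_square:
  assumes \<sigma>: "0 < \<sigma>"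
  shows "(\<integral>\<^sup>+y. ennreal ((y + u)\<^sup>2) * ennreal (normal_density \<mu> \<sigma> y) \<partial>lborel) = ennreal ((\<mu> + u)\<^sup>2 + \<sigma>\<^sup>2)"
proof -
  have "has_bochner_integral lborel (\<lambda>y. normal_density \<mu> \<sigma> y * (y - \<mu>) ^ (2 * 1)) (fact (2 * 1) / ((2 / \<sigma>\<^sup>2) ^ 1 * fact 1))"
    by (rule normal_moment_even[OF \<sigma>])
  then have 2: "has_bochner_integral lborel (\<lambda>y. normal_density \<mu> \<sigma> y * (y - \<mu>)\<^sup>2) (\<sigma>\<^sup>2)" by simp
  have 1: "has_bochner_integral lborel (\<lambda>y. normal_density \<mu> \<sigma> y * (y - \<mu>)) 0"
    using normal_moment_odd[OF \<sigma>, of \<mu> 0] by simp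
  have 0: "has_bochner_integral lborel (normal_density \<mu> \<sigma>) 1"
    using \<sigma> by (simp add: has_bochner_integral_iff)
  have "has_bochner_integral lborel (\<lambda>y. normal_density \<mu> \<sigma> y * (y - \<mu>)\<^sup>2
      + (2 * (\<mu> + u)) * (normal_density \<mu> \<sigma> y * (y - \<mu>)) + (\<mu> + u)\<^sup>2 * normal_density \<mu> \<sigma> y)
      (\<sigma>\<^sup>2 + (2 * (\<mu> + u)) * 0 + (\<mu> + u)\<^sup>2 * 1)"
    by (intro has_bochner_integral_add has_bochner_integral_mult_right 0 1 2)
  also have "(\<lambda>y. normal_density \<mu> \<sigma> y * (y - \<mu>)\<^sup>2
      + (2 * (\<mu> + u)) * (normal_density \<mu> \<sigma> y * (y - \<mu>)) + (\<mu> + u)\<^sup>2 * normal_density \<mu> \<sigma> y)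
      = (\<lambda>y. (y + u)\<^sup>2 * normal_density \<mu> \<sigma> y)"
    by (rule ext) (simp add: power2_eq_square algebra_simps)
  finally have "(\<integral>\<^sup>+y. ennreal ((y + u)\<^sup>2 * normal_density \<mu> \<sigma> y) \<partial>lborel) = ennreal ((\<mu> + u)\<^sup>2 + \<sigma>\<^sup>2)"
    by (subst nn_integral_eq_integral) (auto simp: has_bochner_integral_iff add.commute)
  then show ?thesis by (simp add: ennreal_mult)
qed

lemma nn_integral_mehler:
  assumes r: "\<bar>r\<bar> < 1" and [measurable]: "g \<in> borel_measurable borel"
  shows "(\<integral>\<^sup>+y. g y * ennreal (mehler r x y) \<partial>gauss) = (\<integral>\<^sup>+y. g y * ennreal (normal_density (r * x) (sqrt (1 - r\<^sup>2)) y) \<partial>lborel)"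
proof -
  have "(\<integral>\<^sup>+y. g y * ennreal (mehler r x y) \<partial>gauss) = (\<integral>\<^sup>+y. g y * (ennreal (std_normal_density y) * ennreal (mehler r x y)) \<partial>lborel)"
    by (subst nn_integral_density) (auto simp: mult_ac)
  then show ?thesis unfolding ennreal_mult''[OF mehler_nonneg[OF r], symmetric] std_normal_mehler[OF r] .
qed

lemma nn_integral_mehler_mehler:
  assumes r: "\<bar>r\<bar> < 1" and s: "\<bar>s\<bar> < 1" and [measurable]: "g \<in> borel_measurable borel"
  shows "(\<integral>\<^sup>+y. g y * ennreal (mehler r x y * mehler s y z) \<partial>gauss)
    = ennreal (mehler (r * s) x z) * (\<integral>\<^sup>+y. g y * ennreal (normal_density (bridge_mean r s x z) (sqrt (bridge_var r s)) y) \<partial>lborel)"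
proof -
  have nn: "0 \<le> mehler r x y * mehler s y z" for y using mehler_nonneg[OF r] mehler_nonneg[OF s] by simp
  have "(\<integral>\<^sup>+y. g y * ennreal (mehler r x y * mehler s y z) \<partial>gauss)
      = (\<integral>\<^sup>+y. g y * (ennreal (std_normal_density y) * ennreal (mehler r x y * mehler s y z)) \<partial>lborel)"
    by (subst nn_integral_density) (auto simp: mult_ac)
  also have "\<dots> = (\<integral>\<^sup>+y. ennreal (mehler (r * s) x z) * (g y * ennreal (normal_density (bridge_mean r s x z) (sqrt (bridge_var r s)) y)) \<partial>lborel)"
    unfolding ennreal_mult''[OF nn, symmetric] std_normal_mehler_mehler[OF r s]
    by (intro nn_integral_cong) (simp add: ennreal_mult'' mult_ac)
  finally show ?thesis by (simp add: nn_integral_cmult)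
qed

section \<open>Finite-dimensional laws of the Ornstein--Uhlenbeck process\<close>

lemma sorted_list_of_setI:
  fixes l :: "'a :: linorder list"
  shows "sorted_wrt (<) l \<Longrightarrow> set l = A \<Longrightarrow> sorted_list_of_set A = l"
  by (metis List.finite_set set_sorted_list_of_set strict_sorted_equal strict_sorted_list_of_set)

text \<open>Density of the values at the listed increasing times relative to independent standard
  normal variables: by the Markov property a product over consecutive pairs with correlation
  \<open>exp (s - t)\<close>. Lists with fewer than two times give the empty product.\<close>

fun path_density :: "(real \<Rightarrow> real) \<Rightarrow> real list \<Rightarrow> real" where
  "path_density x (s # t # ts) = mehler (exp (s - t)) (x s) (x t) * path_density x (t # ts)"
| "path_density x _ = 1"

lemma path_density_append: "path_density x (us @ p # vs) = path_density x (us @ [p]) * path_density x (p # vs)"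
proof (induction us)
  case (Cons u us)
  then show ?case by (cases us) auto
qed simp

lemma path_density_cong: "(\<And>t. t \<in> set ts \<Longrightarrow> x t = y t) \<Longrightarrow> path_density x ts = path_density y ts"
  by (induction x ts rule: path_density.induct) auto

lemma path_density_nonneg: "sorted_wrt (<) ts \<Longrightarrow> 0 \<le> path_density x ts"
  by (induction x ts rule: path_density.induct) (auto intro!: mult_nonneg_nonneg mehler_nonneg)

lemma path_density_shift: "path_density x (map (\<lambda>t. t + h) ts) = path_density (\<lambda>t. x (t + h)) ts"
proof (induction ts)
  case (Cons t ts)
  then show ?case by (cases ts) auto
qed simp

lemma path_density_measurable [measurable]:
  "set ts \<subseteq> J \<Longrightarrow> (\<lambda>x. path_density x ts) \<in> borel_measurable (PiM J (\<lambda>_. borel))"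
proof (induction ts)
  case (Cons t ts)
  note [measurable] = measurable_component_singleton[of _ J "\<lambda>_. borel"]
  show ?case
  proof (cases ts)
    case (Cons s ss)
    with Cons.IH Cons.prems have [measurable]: "(\<lambda>x. path_density x (s # ss)) \<in> borel_measurable (PiM J (\<lambda>_. borel))" by simp
    have [measurable]: "(\<lambda>x. x t) \<in> borel_measurable (PiM J (\<lambda>_. borel :: real measure))" "(\<lambda>x. x s) \<in> borel_measurable (PiM J (\<lambda>_. borel :: real measure))"
      using Cons Cons.prems by (auto intro!: measurable_component_singleton)
    show ?thesis unfolding Cons path_density.simps by measurable
  qed simp
qed simp

text \<open>Only the two factors adjacent to \<open>s\<close> depend on the coordinate at
  \<open>s\<close>. Integrating them out leaves the factor joining \<open>p\<close> to
  \<open>z\<close>, that is, the path density without \<open>s\<close>, times the mean of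
  \<open>g\<close> under the bridge law.\<close>

lemma nn_integral_path_density_bridge:
  assumes sorted: "sorted_wrt (<) (us @ p # s # z # vs)" and [measurable]: "g \<in> borel_measurable borel"
  shows "(\<integral>\<^sup>+y. g y * ennreal (path_density (x(s := y)) (us @ p # s # z # vs)) \<partial>gauss)
    = ennreal (path_density x (us @ p # z # vs)) * (\<integral>\<^sup>+y. g y * ennreal (normal_density
        (bridge_mean (exp (p - s)) (exp (s - z)) (x p) (x z)) (sqrt (bridge_var (exp (p - s)) (exp (s - z)))) y) \<partial>lborel)"
proof -
  define L R where "L = path_density x (us @ [p])" and "R = path_density x (z # vs)"
  have ne: "s \<notin> set (us @ [p])" "s \<notin> set (z # vs)" using sorted by (auto simp: sorted_wrt_append)
  have ps: "p < s" "s < z" using sorted by (auto simp: sorted_wrt_append)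
  have L: "path_density (x(s := y)) (us @ [p]) = L" and R: "path_density (x(s := y)) (z # vs) = R" for y
    unfolding L_def R_def using ne by (auto intro!: path_density_cong)
  have "sorted_wrt (<) (us @ [p])" "sorted_wrt (<) (z # vs)" using sorted by (auto simp: sorted_wrt_append)
  then have LR: "0 \<le> L * R" unfolding L_def R_def by (intro mult_nonneg_nonneg path_density_nonneg)
  have sne: "s \<noteq> p" "s \<noteq> z" using ps by auto
  have 1: "path_density (x(s := y)) (us @ p # s # z # vs)
     = (L * R) * (mehler (exp (p - s)) (x p) y * mehler (exp (s - z)) y (x z))" for y
    unfolding path_density_append[of _ us p "s # z # vs"] L path_density.simps R using sne by simp
  have 2: "path_density x (us @ p # z # vs) = (L * R) * mehler (exp (p - s) * exp (s - z)) (x p) (x z)"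
    unfolding path_density_append[of _ us p "z # vs"] L_def[symmetric] path_density.simps R_def[symmetric] by (simp add: exp_add[symmetric])
  have e: "\<bar>exp (p - s)\<bar> < 1" "\<bar>exp (s - z)\<bar> < 1" using ps by auto
  have "(\<integral>\<^sup>+y. g y * ennreal (path_density (x(s := y)) (us @ p # s # z # vs)) \<partial>gauss)
      = (\<integral>\<^sup>+y. ennreal (L * R) * (g y * ennreal (mehler (exp (p - s)) (x p) y * mehler (exp (s - z)) y (x z))) \<partial>gauss)"
    unfolding 1 by (simp only: ennreal_mult'[OF LR] mult.left_commute)
  also have "\<dots> = ennreal (L * R) * (\<integral>\<^sup>+y. g y * ennreal (mehler (exp (p - s)) (x p) y * mehler (exp (s - z)) y (x z)) \<partial>gauss)"
    by (rule nn_integral_cmult) measurable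
  finally show ?thesis
    unfolding nn_integral_mehler_mehler[OF e assms(2)] 2 ennreal_mult'[OF LR] by (simp add: mult.assoc)
qed

lemma nn_integral_path_density_last:
  assumes sorted: "sorted_wrt (<) (us @ [p, s])" and [measurable]: "g \<in> borel_measurable borel"
  shows "(\<integral>\<^sup>+y. g y * ennreal (path_density (x(s := y)) (us @ [p, s])) \<partial>gauss)
    = ennreal (path_density x (us @ [p])) * (\<integral>\<^sup>+y. g y * ennreal (normal_density (exp (p - s) * x p) (sqrt (1 - (exp (p - s))\<^sup>2)) y) \<partial>lborel)"
proof -
  have ne: "s \<notin> set (us @ [p])" and ps: "p < s" "s \<noteq> p" using sorted by (auto simp: sorted_wrt_append)
  have L: "path_density (x(s := y)) (us @ [p]) = path_density x (us @ [p])" for y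
    using ne by (auto intro!: path_density_cong)
  have "sorted_wrt (<) (us @ [p])" using sorted by (auto simp: sorted_wrt_append)
  then have L0: "0 \<le> path_density x (us @ [p])" by (rule path_density_nonneg)
  have e: "\<bar>exp (p - s)\<bar> < 1" using ps by auto
  have "(\<integral>\<^sup>+y. g y * ennreal (path_density (x(s := y)) (us @ [p, s])) \<partial>gauss)
      = (\<integral>\<^sup>+y. ennreal (path_density x (us @ [p])) * (g y * ennreal (mehler (exp (p - s)) (x p) y)) \<partial>gauss)"
    unfolding path_density_append[of _ us p "[s]"] L using ps by (simp add: ennreal_mult'[OF L0] mult_ac)
  also have "\<dots> = ennreal (path_density x (us @ [p])) * (\<integral>\<^sup>+y. g y * ennreal (mehler (exp (p - s)) (x p) y) \<partial>gauss)"
    by (rule nn_integral_cmult) measurable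
  finally show ?thesis unfolding nn_integral_mehler[OF e assms(2)] .
qed

lemma nn_integral_path_density_first:
  assumes sorted: "sorted_wrt (<) (s # z # vs)"
  shows "(\<integral>\<^sup>+y. ennreal (path_density (x(s := y)) (s # z # vs)) \<partial>gauss) = ennreal (path_density x (z # vs))"
proof -
  have ne: "s \<notin> set (z # vs)" and sz: "s < z" "s \<noteq> z" using sorted by auto
  have L: "path_density (x(s := y)) (z # vs) = path_density x (z # vs)" for y
    using ne by (auto intro!: path_density_cong)
  have "sorted_wrt (<) (z # vs)" using sorted by auto
  then have L0: "0 \<le> path_density x (z # vs)" by (rule path_density_nonneg)
  have e: "\<bar>exp (s - z)\<bar> < 1" using sz by auto
  then have e2: "0 < sqrt (1 - (exp (s - z))\<^sup>2)" using abs_square_less_1[of "exp (s - z)"] by simp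
  have "(\<integral>\<^sup>+y. ennreal (path_density (x(s := y)) (s # z # vs)) \<partial>gauss)
      = (\<integral>\<^sup>+y. ennreal (path_density x (z # vs)) * (1 * ennreal (mehler (exp (s - z)) (x z) y)) \<partial>gauss)"
    unfolding path_density.simps L using sz by (simp add: ennreal_mult'[OF L0] mult_ac mehler_commute[of _ "x z"])
  also have "\<dots> = ennreal (path_density x (z # vs)) * (\<integral>\<^sup>+y. 1 * ennreal (mehler (exp (s - z)) (x z) y) \<partial>gauss)"
    by (rule nn_integral_cmult) measurable
  finally show ?thesis using nn_integral_mehler[OF e, of "\<lambda>_. 1" "x z"] nn_integral_normal_density[OF e2] by simp
qed

lemma gauss_space: "prob_space gauss" "sets gauss = sets borel" "space gauss = UNIV"
  using prob_space_normal_density[of 1 0] by simp_all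

text \<open>Consistency of the densities under omission of one time, according to whether that time
  is the only one, the first, the last or an interior one.\<close>

lemma nn_integral_path_density_remove:
  assumes sorted: "sorted_wrt (<) (us @ s # vs)"
  shows "(\<integral>\<^sup>+y. ennreal (path_density (x(s := y)) (us @ s # vs)) \<partial>gauss) = ennreal (path_density x (us @ vs))"
proof (cases us rule: rev_cases)
  case Nil
  show ?thesis
  proof (cases vs)
    case Nil
    then show ?thesis using \<open>us = []\<close> prob_space.emeasure_space_1[OF gauss_space(1)] by simp
  next
    case (Cons z vs')
    then show ?thesis using nn_integral_path_density_first[of s z vs' x] sorted \<open>us = []\<close> by simp
  qed
next
  case (snoc us' p)
  show ?thesis
  proof (cases vs)
    case Nil
    then have srt: "sorted_wrt (<) (us' @ [p, s])" using sorted snoc by simp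
    then have "\<bar>exp (p - s)\<bar> < 1" by (simp add: sorted_wrt_append)
    then have "0 < sqrt (1 - (exp (p - s))\<^sup>2)" using abs_square_less_1[of "exp (p - s)"] by simp
    from nn_integral_normal_density[OF this] show ?thesis
      using nn_integral_path_density_last[OF srt, of "\<lambda>_. 1" x] Nil snoc by simp
  next
    case (Cons z vs')
    then have srt: "sorted_wrt (<) (us' @ p # s # z # vs')" using sorted snoc by simp
    then have "\<bar>exp (p - s)\<bar> < 1" "\<bar>exp (s - z)\<bar> < 1" by (auto simp: sorted_wrt_append)
    then have "0 < sqrt (bridge_var (exp (p - s)) (exp (s - z)))" using bridge_var_pos by simp
    from nn_integral_normal_density[OF this] show ?thesis
      using nn_integral_path_density_bridge[OF srt, of "\<lambda>_. 1" x] Cons snoc by simp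
  qed
qed

interpretation gauss_product: product_sigma_finite "\<lambda>_ :: real. gauss"
  by (simp add: product_sigma_finite_def gauss_space(1) prob_space_imp_sigma_finite)

lemma sets_PiM_gauss: "sets (PiM J (\<lambda>_ :: real. gauss)) = sets (PiM J (\<lambda>_. borel))"
  by (rule sets_PiM_cong) auto

definition ou_law :: "real set \<Rightarrow> (real \<Rightarrow> real) measure" where
  "ou_law J = density (PiM J (\<lambda>_. gauss)) (\<lambda>x. ennreal (path_density x (sorted_list_of_set J)))"

lemma sets_ou_law [measurable_cong]: "sets (ou_law J) = sets (PiM J (\<lambda>_. borel))"
  by (simp add: ou_law_def sets_PiM_gauss)

lemma space_ou_law: "space (ou_law J) = space (PiM J (\<lambda>_. borel))"
  by (rule sets_eq_imp_space_eq[OF sets_ou_law])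

lemma path_density_sorted_measurable:
  "finite J \<Longrightarrow> (\<lambda>x. path_density x (sorted_list_of_set J)) \<in> borel_measurable (PiM J (\<lambda>_. gauss))"
  by (subst measurable_cong_sets[OF sets_PiM_gauss refl], rule path_density_measurable) simp

lemma nn_integral_ou_law:
  assumes J: "finite J" and f: "f \<in> borel_measurable (PiM J (\<lambda>_. borel))"
  shows "(\<integral>\<^sup>+x. f x \<partial>ou_law J) = (\<integral>\<^sup>+x. f x * ennreal (path_density x (sorted_list_of_set J)) \<partial>PiM J (\<lambda>_. gauss))"
proof -
  have "f \<in> borel_measurable (PiM J (\<lambda>_. gauss))" using f by (subst measurable_cong_sets[OF sets_PiM_gauss refl])
  then show ?thesis unfolding ou_law_def
    by (subst nn_integral_density) (auto simp: mult.commute intro!: measurable_compose[OF _ measurable_ennreal] path_density_sorted_measurable[OF J])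
qed

lemma measurable_fun_upd_borel:
  assumes "x \<in> space (PiM J (\<lambda>_. borel))"
  shows "(\<lambda>y. x(s := y)) \<in> measurable borel (PiM (insert s J) (\<lambda>_. borel :: real measure))"
  by (rule measurable_fun_upd[where J = J]) (use assms in auto)

text \<open>The coordinate at the new time is integrated innermost. With \<open>g = 1\<close> the
  inner integral gives consistency of the laws, and with \<open>g\<close> a square it gives the
  conditional second moments.\<close>

lemma nn_integral_ou_law_insert:
  assumes J: "finite J" and s: "s \<notin> J" and f: "f \<in> borel_measurable (PiM J (\<lambda>_. borel))" and g: "g \<in> borel_measurable borel"
  shows "(\<integral>\<^sup>+x. f (restrict x J) * g (x s) \<partial>ou_law (insert s J))
    = (\<integral>\<^sup>+x. f x * (\<integral>\<^sup>+y. g y * ennreal (path_density (x(s := y)) (sorted_list_of_set (insert s J))) \<partial>gauss) \<partial>PiM J (\<lambda>_. gauss))"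
proof -
  note [measurable] = f g
  have [measurable]: "(\<lambda>x. x s) \<in> borel_measurable (PiM (insert s J) (\<lambda>_. borel :: real measure))"
    by (rule measurable_component_singleton) simp
  have [measurable]: "(\<lambda>x. restrict x J) \<in> measurable (PiM (insert s J) (\<lambda>_. borel)) (PiM J (\<lambda>_. borel :: real measure))"
    by (rule measurable_restrict_subset) auto
  have [measurable]: "(\<lambda>x. path_density x (sorted_list_of_set (insert s J))) \<in> borel_measurable (PiM (insert s J) (\<lambda>_. borel))"
    by (rule path_density_measurable) (simp only: set_sorted_list_of_set[OF finite.insertI[OF J]] order_refl)
  have "(\<lambda>x. f (restrict x J) * g (x s) * ennreal (path_density x (sorted_list_of_set (insert s J)))) \<in> borel_measurable (PiM (insert s J) (\<lambda>_. borel))"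
    by measurable
  then have m: "(\<lambda>x. f (restrict x J) * g (x s) * ennreal (path_density x (sorted_list_of_set (insert s J)))) \<in> borel_measurable (PiM (insert s J) (\<lambda>_. gauss))"
    by (subst measurable_cong_sets[OF sets_PiM_gauss refl])
  have "(\<integral>\<^sup>+x. f (restrict x J) * g (x s) \<partial>ou_law (insert s J))
    = (\<integral>\<^sup>+x. f (restrict x J) * g (x s) * ennreal (path_density x (sorted_list_of_set (insert s J))) \<partial>PiM (insert s J) (\<lambda>_. gauss))"
    using J by (subst nn_integral_ou_law) auto
  also have "\<dots> = (\<integral>\<^sup>+x. \<integral>\<^sup>+y. f (restrict (x(s := y)) J) * g ((x(s := y)) s) * ennreal (path_density (x(s := y)) (sorted_list_of_set (insert s J))) \<partial>gauss \<partial>PiM J (\<lambda>_. gauss))"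
    by (rule gauss_product.product_nn_integral_insert[OF J s m])
  also have "\<dots> = (\<integral>\<^sup>+x. f x * (\<integral>\<^sup>+y. g y * ennreal (path_density (x(s := y)) (sorted_list_of_set (insert s J))) \<partial>gauss) \<partial>PiM J (\<lambda>_. gauss))"
  proof (rule nn_integral_cong)
    fix x assume x: "x \<in> space (PiM J (\<lambda>_. gauss))"
    then have "x \<in> extensional J" by (auto simp: space_PiM PiE_def)
    then have r: "restrict (x(s := y)) J = x" for y using s by (auto simp: restrict_def extensional_def fun_eq_iff)
    have [measurable]: "(\<lambda>y. x(s := y)) \<in> measurable borel (PiM (insert s J) (\<lambda>_. borel :: real measure))"
      using x by (intro measurable_fun_upd_borel) (simp add: space_PiM)
    have [measurable]: "(\<lambda>y. path_density (x(s := y)) (sorted_list_of_set (insert s J))) \<in> borel_measurable borel"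
      by measurable
    show "(\<integral>\<^sup>+y. f (restrict (x(s := y)) J) * g ((x(s := y)) s) * ennreal (path_density (x(s := y)) (sorted_list_of_set (insert s J))) \<partial>gauss)
      = f x * (\<integral>\<^sup>+y. g y * ennreal (path_density (x(s := y)) (sorted_list_of_set (insert s J))) \<partial>gauss)"
      unfolding r by (subst nn_integral_cmult[symmetric]) (auto simp: mult.assoc)
  qed
  finally show ?thesis .
qed

lemma ou_law_remove:
  assumes J: "finite J" and s: "s \<notin> J"
  shows "ou_law J = distr (ou_law (insert s J)) (PiM J (\<lambda>_. borel)) (\<lambda>x. restrict x J)"
proof (rule measure_eqI)
  fix A assume "A \<in> sets (ou_law J)"
  then have A [measurable]: "A \<in> sets (PiM J (\<lambda>_. borel))" by (simp add: sets_ou_law)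
  have [measurable]: "(\<lambda>x. restrict x J) \<in> measurable (ou_law (insert s J)) (PiM J (\<lambda>_. borel :: real measure))"
    by (subst measurable_cong_sets[OF sets_ou_law refl], rule measurable_restrict_subset) auto
  define us vs where "us = sorted_list_of_set {h \<in> J. h < s}" and "vs = sorted_list_of_set {h \<in> J. s < h}"
  have srt: "sorted_wrt (<) (us @ s # vs)" using J by (auto simp: us_def vs_def sorted_wrt_append)
  then have "sorted_wrt (<) (us @ vs)" by (auto simp: sorted_wrt_append)
  moreover have "set (us @ s # vs) = insert s J" "set (us @ vs) = J" using J s by (auto simp: us_def vs_def not_less le_less)
  ultimately have l: "sorted_list_of_set (insert s J) = us @ s # vs" "sorted_list_of_set J = us @ vs"
    using srt by (auto intro!: sorted_list_of_setI)
  have "emeasure (distr (ou_law (insert s J)) (PiM J (\<lambda>_. borel)) (\<lambda>x. restrict x J)) A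
      = (\<integral>\<^sup>+x. indicator A x \<partial>distr (ou_law (insert s J)) (PiM J (\<lambda>_. borel)) (\<lambda>x. restrict x J))"
    by simp
  also have "\<dots> = (\<integral>\<^sup>+x. indicator A (restrict x J) * 1 \<partial>ou_law (insert s J))"
    by (subst nn_integral_distr) auto
  also have "\<dots> = (\<integral>\<^sup>+x. indicator A x * (\<integral>\<^sup>+y. 1 * ennreal (path_density (x(s := y)) (sorted_list_of_set (insert s J))) \<partial>gauss) \<partial>PiM J (\<lambda>_. gauss))"
    by (rule nn_integral_ou_law_insert[OF J s]) auto
  also have "\<dots> = (\<integral>\<^sup>+x. indicator A x * ennreal (path_density x (sorted_list_of_set J)) \<partial>PiM J (\<lambda>_. gauss))"
    unfolding l mult_1_left nn_integral_path_density_remove[OF srt] ..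
  also have "\<dots> = (\<integral>\<^sup>+x. indicator A x \<partial>ou_law J)" by (rule nn_integral_ou_law[symmetric, OF J]) measurable
  also have "\<dots> = emeasure (ou_law J) A" by (simp add: sets_ou_law)
  finally show "emeasure (ou_law J) A = emeasure (distr (ou_law (insert s J)) (PiM J (\<lambda>_. borel)) (\<lambda>x. restrict x J)) A" ..
qed (simp add: sets_ou_law)

lemma ou_law_projective:
  assumes "finite H" "J \<subseteq> H"
  shows "ou_law J = distr (ou_law H) (PiM J (\<lambda>_. borel)) (\<lambda>x. restrict x J)"
proof -
  have "ou_law J = distr (ou_law (J \<union> K)) (PiM J (\<lambda>_. borel)) (\<lambda>x. restrict x J)" if "finite K" "K \<inter> J = {}" for K
    using that
  proof (induction K)
    case empty
    have "distr (ou_law J) (PiM J (\<lambda>_. borel)) (\<lambda>x. restrict x J) = distr (ou_law J) (ou_law J) (\<lambda>x. x)"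
      by (rule distr_cong) (auto simp: sets_ou_law space_ou_law space_PiM)
    also have "\<dots> = ou_law J" by (rule distr_id)
    finally show ?case unfolding Un_empty_right by (rule sym)
  next
    case (insert s K)
    have fin: "finite (J \<union> K)" using assms insert finite_subset by auto
    have s: "s \<notin> J \<union> K" using insert by auto
    have "ou_law J = distr (ou_law (J \<union> K)) (PiM J (\<lambda>_. borel)) (\<lambda>x. restrict x J)" using insert by blast
    also have "\<dots> = distr (distr (ou_law (insert s (J \<union> K))) (PiM (J \<union> K) (\<lambda>_. borel)) (\<lambda>x. restrict x (J \<union> K))) (PiM J (\<lambda>_. borel)) (\<lambda>x. restrict x J)"
      by (rule arg_cong[OF ou_law_remove[OF fin s], of "\<lambda>N. distr N (PiM J (\<lambda>_. borel)) (\<lambda>x. restrict x J)"])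
    also have "\<dots> = distr (ou_law (insert s (J \<union> K))) (PiM J (\<lambda>_. borel)) ((\<lambda>x. restrict x J) \<circ> (\<lambda>x. restrict x (J \<union> K)))"
    proof (rule distr_distr)
      show "(\<lambda>x. restrict x J) \<in> measurable (PiM (J \<union> K) (\<lambda>_. borel)) (PiM J (\<lambda>_. borel :: real measure))"
        by (rule measurable_restrict_subset) auto
      show "(\<lambda>x. restrict x (J \<union> K)) \<in> measurable (ou_law (insert s (J \<union> K))) (PiM (J \<union> K) (\<lambda>_. borel :: real measure))"
        by (subst measurable_cong_sets[OF sets_ou_law refl], rule measurable_restrict_subset) auto
    qed
    also have "(\<lambda>x :: real \<Rightarrow> real. restrict x J) \<circ> (\<lambda>x. restrict x (J \<union> K)) = (\<lambda>x. restrict x J)"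
      by (auto simp: fun_eq_iff restrict_def)
    finally show ?case by simp
  qed
  from this[of "H - J"] show ?thesis using assms finite_subset by (auto simp: Un_absorb1)
qed

text \<open>Project onto the empty index set: there the product measure has one point of mass 1 and
  the path density is 1, and projection preserves the total mass.\<close>

lemma prob_space_ou_law:
  assumes "finite J"
  shows "prob_space (ou_law J)"
proof (rule prob_spaceI)
  have "1 = emeasure (ou_law {}) (space (PiM {} (\<lambda>_. borel)))"
    unfolding ou_law_def
    by (subst emeasure_density) (auto simp: PiM_empty space_PiM)
  also have "\<dots> = emeasure (distr (ou_law J) (PiM {} (\<lambda>_. borel)) (\<lambda>x. restrict x {})) (space (PiM {} (\<lambda>_. borel)))"
    by (rule arg_cong[OF ou_law_projective[OF assms empty_subsetI]])
  also have "\<dots> = emeasure (ou_law J) ((\<lambda>x. restrict x {}) -` space (PiM {} (\<lambda>_. borel)) \<inter> space (ou_law J))"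
  proof (rule emeasure_distr)
    show "(\<lambda>x. restrict x {}) \<in> measurable (ou_law J) (PiM {} (\<lambda>_. borel :: real measure))"
      by (subst measurable_cong_sets[OF sets_ou_law refl], rule measurable_restrict_subset) auto
  qed simp
  also have "(\<lambda>x. restrict x {}) -` space (PiM {} (\<lambda>_. borel :: real measure)) \<inter> space (ou_law J) = space (ou_law J)"
    by (auto simp: space_PiM)
  finally show "emeasure (ou_law J) (space (ou_law J)) = 1" ..
qed

section \<open>The process on path space\<close>

locale ou_process = prob_space M for M :: "(real \<Rightarrow> real) measure" +
  assumes sets_M [measurable_cong]: "sets M = sets (PiM UNIV (\<lambda>_. borel))"
    and law: "finite J \<Longrightarrow> distr M (PiM J (\<lambda>_. borel)) (\<lambda>\<omega>. restrict \<omega> J) = ou_law J"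

text \<open>The limit measure is determined by its values on cylinders over finite index sets; these
  values are rewritten as the image law under restriction of paths.\<close>

lemma ou_process_exists: "\<exists>M. ou_process M"
proof -
  interpret polish_projective UNIV ou_law
    by (intro polish_projective.intro projective_family.intro ou_law_projective prob_space_ou_law)
  have "distr lim (PiM J (\<lambda>_. borel)) (\<lambda>\<omega>. restrict \<omega> J) = ou_law J" if J: "finite J" for J
  proof (rule measure_eqI)
    fix A assume "A \<in> sets (distr lim (PiM J (\<lambda>_. borel)) (\<lambda>\<omega>. restrict \<omega> J))"
    then have A: "A \<in> sets (PiM J (\<lambda>_. borel))" by simp
    have "(\<lambda>\<omega>. restrict \<omega> J) \<in> measurable lim (PiM J (\<lambda>_. borel))"
      by (subst measurable_cong_sets[OF sets_lim refl], rule measurable_restrict_subset) auto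
    then show "emeasure (distr lim (PiM J (\<lambda>_. borel)) (\<lambda>\<omega>. restrict \<omega> J)) A = emeasure (ou_law J) A"
      using emeasure_lim_emb[OF _ J A] A by (subst emeasure_distr) (auto simp: prod_emb_def space_PiM PiE_def)
  qed (simp add: sets_ou_law)
  then have "ou_process lim"
    by (intro ou_process.intro P.prob_space_axioms ou_process_axioms.intro) auto
  then show ?thesis ..
qed

context ou_process
begin

lemma space_M [simp]: "space M = UNIV"
  using sets_eq_imp_space_eq[OF sets_M] by (simp add: space_PiM)

lemma coordinate_measurable [measurable]: "(\<lambda>\<omega>. \<omega> t) \<in> borel_measurable M"
  by (subst measurable_cong_sets[OF sets_M refl], rule measurable_component_singleton) simp

lemma restrict_measurable [measurable]: "(\<lambda>\<omega>. restrict \<omega> J) \<in> measurable M (PiM J (\<lambda>_. borel))"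
  by (subst measurable_cong_sets[OF sets_M refl], rule measurable_restrict_subset) auto

lemma nn_integral_coordinates:
  assumes "finite J" "f \<in> borel_measurable (PiM J (\<lambda>_. borel))"
  shows "(\<integral>\<^sup>+\<omega>. f (restrict \<omega> J) \<partial>M) = (\<integral>\<^sup>+x. f x \<partial>ou_law J)"
  unfolding law[OF assms(1), symmetric] using assms(2) by (subst nn_integral_distr) auto

lemma nn_integral_coordinate:
  assumes [measurable]: "g \<in> borel_measurable borel"
  shows "(\<integral>\<^sup>+\<omega>. g (\<omega> t) \<partial>M) = (\<integral>\<^sup>+y. g y \<partial>gauss)"
proof -
  have [measurable]: "(\<lambda>x. x t) \<in> borel_measurable (PiM {t} (\<lambda>_. borel :: real measure))"
    by (rule measurable_component_singleton) simp
  have "(\<integral>\<^sup>+\<omega>. g (\<omega> t) \<partial>M) = (\<integral>\<^sup>+x. g (x t) \<partial>ou_law {t})"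
    using nn_integral_coordinates[of "{t}" "\<lambda>x. g (x t)"] by simp
  also have "\<dots> = (\<integral>\<^sup>+x. g (x t) \<partial>PiM {t} (\<lambda>_. gauss))"
    by (subst nn_integral_ou_law) auto
  also have "\<dots> = (\<integral>\<^sup>+y. g y \<partial>gauss)"
    by (rule gauss_product.product_nn_integral_singleton) simp
  finally show ?thesis .
qed

lemma distributed_coordinate: "distributed M lborel (\<lambda>\<omega>. \<omega> t) (\<lambda>x. ennreal (std_normal_density x))"
proof -
  have "distr M lborel (\<lambda>\<omega>. \<omega> t) = gauss"
  proof (rule measure_eqI)
    fix A assume "A \<in> sets (distr M lborel (\<lambda>\<omega>. \<omega> t))"
    then have [measurable]: "A \<in> sets borel" by simp
    have "emeasure (distr M lborel (\<lambda>\<omega>. \<omega> t)) A = (\<integral>\<^sup>+x. indicator A x \<partial>distr M lborel (\<lambda>\<omega>. \<omega> t))" by simp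
    also have "\<dots> = (\<integral>\<^sup>+\<omega>. indicator A (\<omega> t) \<partial>M)" by (rule nn_integral_distr) auto
    also have "\<dots> = (\<integral>\<^sup>+y. indicator A y \<partial>gauss)" by (rule nn_integral_coordinate) measurable
    finally show "emeasure (distr M lborel (\<lambda>\<omega>. \<omega> t)) A = emeasure gauss A" by simp
  qed simp
  then show ?thesis by (simp add: distributed_def)
qed

lemma expectation_coordinate: "expectation (\<lambda>\<omega>. \<omega> t) = 0"
  by (rule standard_normal_distributed_expectation[OF distributed_coordinate])

lemma expectation_coordinate_square: "expectation (\<lambda>\<omega>. (\<omega> t)\<^sup>2) = 1"
  using standard_normal_distributed_variance[OF distributed_coordinate, of t] by (simp add: expectation_coordinate)

lemma integrable_coordinate_square: "integrable M (\<lambda>\<omega>. (\<omega> t)\<^sup>2)"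
  using expectation_coordinate_square[of t] not_integrable_integral_eq by fastforce

lemma integrable_coordinate_mult: "integrable M (\<lambda>\<omega>. \<omega> s * \<omega> t)"
proof (rule Bochner_Integration.integrable_bound)
  show "integrable M (\<lambda>\<omega>. (\<omega> s)\<^sup>2 + (\<omega> t)\<^sup>2)" by (intro Bochner_Integration.integrable_add integrable_coordinate_square)
  show "AE \<omega> in M. norm (\<omega> s * \<omega> t) \<le> norm ((\<omega> s)\<^sup>2 + (\<omega> t)\<^sup>2)"
  proof (rule AE_I2)
    fix \<omega> :: "real \<Rightarrow> real"
    have "2 * (\<bar>\<omega> s\<bar> * \<bar>\<omega> t\<bar>) \<le> (\<omega> s)\<^sup>2 + (\<omega> t)\<^sup>2"
      using sum_squares_bound[of "\<bar>\<omega> s\<bar>" "\<bar>\<omega> t\<bar>"] by simp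
    moreover have "0 \<le> \<bar>\<omega> s\<bar> * \<bar>\<omega> t\<bar>" by simp
    moreover have "norm (\<omega> s * \<omega> t) = \<bar>\<omega> s\<bar> * \<bar>\<omega> t\<bar>" "norm ((\<omega> s)\<^sup>2 + (\<omega> t)\<^sup>2) = (\<omega> s)\<^sup>2 + (\<omega> t)\<^sup>2"
      by (simp_all add: abs_mult)
    ultimately show "norm (\<omega> s * \<omega> t) \<le> norm ((\<omega> s)\<^sup>2 + (\<omega> t)\<^sup>2)" by linarith
  qed
qed measurable

lemma integrable_coordinate: "integrable M (\<lambda>\<omega>. \<omega> t)"
  by (rule square_integrable_imp_integrable[OF coordinate_measurable integrable_coordinate_square])

text \<open>The square of a sum is nonnegative, so its mean is accessible to the nonnegative
  integral before any integrability is discussed; \<open>expectation_mult\<close> then extracts the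
  covariance by polarization.\<close>

lemma nn_integral_sum_square:
  assumes st: "s < t"
  shows "(\<integral>\<^sup>+\<omega>. ennreal ((\<omega> t + \<omega> s)\<^sup>2) \<partial>M) = ennreal (2 + 2 * exp (s - t))"
proof -
  define r where "r = exp (s - t)"
  have r: "\<bar>r\<bar> < 1" "0 < 1 - r\<^sup>2" using st by (auto simp: r_def abs_square_less_1)
  have l: "sorted_list_of_set {s, t} = [s, t]" using st by (intro sorted_list_of_setI) auto
  have [measurable]: "(\<lambda>x. x s) \<in> borel_measurable (PiM {s, t} (\<lambda>_. borel :: real measure))" "(\<lambda>x. x t) \<in> borel_measurable (PiM {s, t} (\<lambda>_. borel :: real measure))"
     by (auto intro!: measurable_component_singleton)
  have m: "(\<lambda>x. ennreal ((x t + x s)\<^sup>2) * ennreal (path_density x [s, t])) \<in> borel_measurable (PiM {t, s} (\<lambda>_. gauss))"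
    by (subst measurable_cong_sets[OF sets_PiM_gauss refl], subst insert_commute) simp
  have "(\<integral>\<^sup>+\<omega>. ennreal ((\<omega> t + \<omega> s)\<^sup>2) \<partial>M) = (\<integral>\<^sup>+x. ennreal ((x t + x s)\<^sup>2) \<partial>ou_law {s, t})"
    using nn_integral_coordinates[of "{s, t}" "\<lambda>x. ennreal ((x t + x s)\<^sup>2)"] by simp
  also have "\<dots> = (\<integral>\<^sup>+x. ennreal ((x t + x s)\<^sup>2) * ennreal (path_density x [s, t]) \<partial>PiM {t, s} (\<lambda>_. gauss))"
    by (subst nn_integral_ou_law) (simp_all add: l insert_commute)
  also have "\<dots> = (\<integral>\<^sup>+x. \<integral>\<^sup>+y. ennreal (((x(t := y)) t + (x(t := y)) s)\<^sup>2) * ennreal (path_density (x(t := y)) [s, t]) \<partial>gauss \<partial>PiM {s} (\<lambda>_. gauss))"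
    using st by (intro gauss_product.product_nn_integral_insert m) auto
  also have "\<dots> = (\<integral>\<^sup>+x. ennreal ((1 + r)\<^sup>2 * (x s)\<^sup>2 + (1 - r\<^sup>2)) \<partial>PiM {s} (\<lambda>_. gauss))"
  proof (rule nn_integral_cong)
    fix x :: "real \<Rightarrow> real"
    have "(\<integral>\<^sup>+y. ennreal (((x(t := y)) t + (x(t := y)) s)\<^sup>2) * ennreal (path_density (x(t := y)) [s, t]) \<partial>gauss)
      = (\<integral>\<^sup>+y. ennreal ((y + x s)\<^sup>2) * ennreal (mehler r (x s) y) \<partial>gauss)"
      using st by (simp add: r_def)
    also have "\<dots> = ennreal ((r * x s + x s)\<^sup>2 + (1 - r\<^sup>2))"
      using r(2) by (subst nn_integral_mehler[OF r(1)], measurable, subst nn_integral_normal_square) auto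
    also have "(r * x s + x s)\<^sup>2 = (1 + r)\<^sup>2 * (x s)\<^sup>2" by (simp add: power2_eq_square algebra_simps)
    finally show "(\<integral>\<^sup>+y. ennreal (((x(t := y)) t + (x(t := y)) s)\<^sup>2) * ennreal (path_density (x(t := y)) [s, t]) \<partial>gauss)
      = ennreal ((1 + r)\<^sup>2 * (x s)\<^sup>2 + (1 - r\<^sup>2))" .
  qed
  also have "\<dots> = (\<integral>\<^sup>+y. ennreal ((1 + r)\<^sup>2 * y\<^sup>2 + (1 - r\<^sup>2)) \<partial>gauss)"
    by (rule gauss_product.product_nn_integral_singleton) simp
  also have "\<dots> = (\<integral>\<^sup>+\<omega>. ennreal ((1 + r)\<^sup>2 * (\<omega> s)\<^sup>2 + (1 - r\<^sup>2)) \<partial>M)"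
    by (rule nn_integral_coordinate[symmetric]) measurable
  also have "\<dots> = ennreal (expectation (\<lambda>\<omega>. (1 + r)\<^sup>2 * (\<omega> s)\<^sup>2 + (1 - r\<^sup>2)))"
    using r(2) integrable_coordinate_square by (intro nn_integral_eq_integral) auto
  also have "expectation (\<lambda>\<omega>. (1 + r)\<^sup>2 * (\<omega> s)\<^sup>2 + (1 - r\<^sup>2)) = (1 + r)\<^sup>2 + (1 - r\<^sup>2)"
    using integrable_coordinate_square by (simp add: expectation_coordinate_square prob_space[unfolded space_M])
  also have "\<dots> = 2 + 2 * r" by (simp add: power2_eq_square algebra_simps)
  finally show ?thesis by (simp add: r_def)
qed

lemma expectation_mult: "expectation (\<lambda>\<omega>. \<omega> s * \<omega> t) = exp (- \<bar>s - t\<bar>)"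
proof -
  have less: "expectation (\<lambda>\<omega>. \<omega> s * \<omega> t) = exp (s - t)" if st: "s < t" for s t
  proof -
    have e: "(\<lambda>\<omega> :: real \<Rightarrow> real. (\<omega> t + \<omega> s)\<^sup>2) = (\<lambda>\<omega>. (\<omega> t)\<^sup>2 + (\<omega> s)\<^sup>2 + 2 * (\<omega> s * \<omega> t))"
      by (auto simp: fun_eq_iff power2_eq_square algebra_simps)
    have i: "integrable M (\<lambda>\<omega>. (\<omega> t + \<omega> s)\<^sup>2)"
      unfolding e by (intro Bochner_Integration.integrable_add integrable_mult_right integrable_coordinate_square integrable_coordinate_mult)
    have "ennreal (expectation (\<lambda>\<omega>. (\<omega> t + \<omega> s)\<^sup>2)) = ennreal (2 + 2 * exp (s - t))"
      using nn_integral_eq_integral[OF i] nn_integral_sum_square[OF st] by simp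
    moreover have "0 \<le> expectation (\<lambda>\<omega>. (\<omega> t + \<omega> s)\<^sup>2)" by (rule integral_nonneg_AE) simp
    ultimately have "expectation (\<lambda>\<omega>. (\<omega> t + \<omega> s)\<^sup>2) = 2 + 2 * exp (s - t)"
      by (subst (asm) ennreal_inj) (auto intro: add_nonneg_nonneg)
    moreover have "expectation (\<lambda>\<omega>. (\<omega> t + \<omega> s)\<^sup>2) = 2 + 2 * expectation (\<lambda>\<omega>. \<omega> s * \<omega> t)"
      unfolding e using integrable_coordinate_square integrable_coordinate_mult
      by (simp add: expectation_coordinate_square)
    ultimately show ?thesis by simp
  qed
  consider "s < t" | "s = t" | "t < s" by linarith
  then show ?thesis
  proof cases
    case 1 then show ?thesis by (simp add: less)
  next
    case 2 then show ?thesis using expectation_coordinate_square[of t] by (simp add: power2_eq_square)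
  next
    case 3 then show ?thesis using less[of t s] by (simp add: mult.commute)
  qed
qed

lemma covariance_coordinates: "covariance M (\<lambda>\<omega>. \<omega> s) (\<lambda>\<omega>. \<omega> t) = exp (- \<bar>s - t\<bar>)"
  by (simp add: covariance_def expectation_coordinate expectation_mult)

lemma L2_continuous_coordinates: "L2_continuous M (\<lambda>t \<omega>. \<omega> t)"
  unfolding L2_continuous_def
proof (intro conjI allI)
  fix t
  show "square_integrable M (\<lambda>\<omega>. \<omega> t)" by (simp add: square_integrable_def integrable_coordinate_square)
  have "expectation (\<lambda>\<omega>. (\<omega> s - \<omega> t)\<^sup>2) = 2 - 2 * exp (- \<bar>s - t\<bar>)" for s
  proof -
    have e: "(\<lambda>\<omega> :: real \<Rightarrow> real. (\<omega> s - \<omega> t)\<^sup>2) = (\<lambda>\<omega>. (\<omega> s)\<^sup>2 + (\<omega> t)\<^sup>2 - 2 * (\<omega> s * \<omega> t))"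
      by (auto simp: fun_eq_iff power2_eq_square algebra_simps)
    show ?thesis unfolding e using integrable_coordinate_square integrable_coordinate_mult
      by (simp add: expectation_coordinate_square expectation_mult)
  qed
  moreover have "((\<lambda>s. 2 - 2 * exp (- \<bar>s - t\<bar>)) \<longlongrightarrow> 2 - 2 * exp (- \<bar>t - t\<bar>)) (at t)"
    by (intro tendsto_intros)
  ultimately show "((\<lambda>s. expectation (\<lambda>\<omega>. (\<omega> s - \<omega> t)\<^sup>2)) \<longlongrightarrow> 0) (at t)" by simp
qed

text \<open>The reference measure is a product of identical factors, hence invariant under
  reindexing by a shift, and the path density depends on the times only through their
  differences.\<close>

lemma stationary_coordinates: "stationary M (\<lambda>t \<omega>. \<omega> t)"
  unfolding stationary_def
proof (intro allI impI)
  fix J :: "real set" and h :: real assume J: "finite J"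
  define K where "K = (\<lambda>t. t + h) ` J"
  define S where "S = (\<lambda>\<omega> :: real \<Rightarrow> real. \<lambda>t\<in>J. \<omega> (t + h))"
  have K: "finite K" using J by (simp add: K_def)
  have Sm [measurable]: "S \<in> measurable (PiM K (\<lambda>_. borel)) (PiM J (\<lambda>_. borel :: real measure))"
    unfolding S_def by (intro measurable_restrict measurable_component_singleton) (simp add: K_def)
  have Sg: "S \<in> measurable (PiM K (\<lambda>_. gauss)) (PiM J (\<lambda>_. gauss))"
    using Sm by (subst measurable_cong_sets[OF sets_PiM_gauss sets_PiM_gauss])
  have reindex: "distr (PiM K (\<lambda>_. gauss)) (PiM J (\<lambda>_. gauss)) S = PiM J (\<lambda>_. gauss)"
    unfolding S_def by (rule distr_PiM_reindex) (auto simp: K_def inj_on_def gauss_space(1))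
  have l: "sorted_list_of_set K = map (\<lambda>t. t + h) (sorted_list_of_set J)"
    using J by (intro sorted_list_of_setI) (auto simp: K_def sorted_wrt_map)
  have "distr M (PiM J (\<lambda>_. borel)) S = ou_law J"
  proof (rule measure_eqI)
    fix A assume "A \<in> sets (distr M (PiM J (\<lambda>_. borel)) S)"
    then have A [measurable]: "A \<in> sets (PiM J (\<lambda>_. borel))" by simp
    define F where "F x = indicator A x * ennreal (path_density x (sorted_list_of_set J))" for x
    have Fm: "F \<in> borel_measurable (PiM J (\<lambda>_. gauss))"
      unfolding F_def using J by (subst measurable_cong_sets[OF sets_PiM_gauss refl]) simp
    have S_K: "S \<omega> = S (restrict \<omega> K)" for \<omega> by (auto simp: S_def K_def restrict_def fun_eq_iff)
    have Sd: "S \<in> measurable M (PiM J (\<lambda>_. borel))"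
      using measurable_compose[OF restrict_measurable[of K] Sm] by (simp add: S_K[symmetric])
    have "emeasure (distr M (PiM J (\<lambda>_. borel)) S) A = (\<integral>\<^sup>+\<omega>. indicator A (S (restrict \<omega> K)) \<partial>M)"
      using Sd by (subst nn_integral_indicator[symmetric], simp, subst nn_integral_distr) (auto simp: S_K[symmetric])
    also have "\<dots> = (\<integral>\<^sup>+x. indicator A (S x) \<partial>ou_law K)"
      by (rule nn_integral_coordinates[OF K]) measurable
    also have "\<dots> = (\<integral>\<^sup>+x. indicator A (S x) * ennreal (path_density x (sorted_list_of_set K)) \<partial>PiM K (\<lambda>_. gauss))"
      by (rule nn_integral_ou_law[OF K]) measurable
    also have "\<dots> = (\<integral>\<^sup>+x. F (S x) \<partial>PiM K (\<lambda>_. gauss))"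
    proof (rule nn_integral_cong)
      fix x
      have "path_density x (sorted_list_of_set K) = path_density (S x) (sorted_list_of_set J)"
        unfolding l path_density_shift using J by (intro path_density_cong) (simp add: S_def)
      then show "indicator A (S x) * ennreal (path_density x (sorted_list_of_set K)) = F (S x)" by (simp add: F_def)
    qed
    also have "\<dots> = (\<integral>\<^sup>+x. F x \<partial>distr (PiM K (\<lambda>_. gauss)) (PiM J (\<lambda>_. gauss)) S)"
      by (rule nn_integral_distr[symmetric, OF Sg]) (use Fm in simp)
    also have "\<dots> = (\<integral>\<^sup>+x. indicator A x \<partial>ou_law J)"
      unfolding reindex F_def by (rule nn_integral_ou_law[symmetric, OF J]) measurable
    also have "\<dots> = emeasure (ou_law J) A" by (simp add: sets_ou_law)
    finally show "emeasure (distr M (PiM J (\<lambda>_. borel)) S) A = emeasure (ou_law J) A" .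
  qed (simp add: sets_ou_law)
  then show "distr M (PiM J (\<lambda>_. borel)) (\<lambda>\<omega>. \<lambda>t\<in>J. \<omega> (t + h)) = distr M (PiM J (\<lambda>_. borel)) (\<lambda>\<omega>. \<lambda>t\<in>J. \<omega> t)"
    using law[OF J] by (simp add: S_def)
qed

end

text \<open>Induction on the largest point \<open>b\<close>. If \<open>p\<close> is the next
  largest, the row of \<open>b\<close> restricted to \<open>A\<close> is \<open>exp (p - b)\<close>
  times the row of \<open>p\<close>, because distances along the line add. Combining both rows gives
  \<open>c b = exp (2 * (p - b)) * c b\<close>, so \<open>c b = 0\<close> and \<open>b\<close> can
  be removed.\<close>

lemma exponential_kernel_nonsingular:
  fixes c :: "real \<Rightarrow> real"
  assumes "finite T" "\<And>l. l \<in> T \<Longrightarrow> (\<Sum>t\<in>T. exp (- \<bar>l - t\<bar>) * c t) = 0" "t \<in> T"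
  shows "c t = 0"
  using assms
proof (induction T arbitrary: t rule: finite_linorder_max_induct)
  case (insert b A)
  have b: "b \<notin> A" using insert by auto
  have "c b = 0"
  proof (cases "A = {}")
    case True
    then show ?thesis using insert.prems(1)[of b] by simp
  next
    case False
    define p where "p = Max A"
    have p: "p \<in> A" "\<And>t. t \<in> A \<Longrightarrow> t \<le> p" using False insert.hyps by (auto simp: p_def)
    have pb: "p < b" using p(1) insert.hyps by auto
    have "(\<Sum>t\<in>A. exp (- \<bar>b - t\<bar>) * c t) = exp (p - b) * (\<Sum>t\<in>A. exp (- \<bar>p - t\<bar>) * c t)"
      unfolding sum_distrib_left
    proof (rule sum.cong)
      fix t assume t: "t \<in> A"
      then have "exp (- \<bar>b - t\<bar>) = exp (p - b) * exp (- \<bar>p - t\<bar>)"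
        using p(2)[OF t] insert.hyps by (auto simp: exp_add[symmetric])
      then show "exp (- \<bar>b - t\<bar>) * c t = exp (p - b) * (exp (- \<bar>p - t\<bar>) * c t)" by simp
    qed simp
    moreover have "c b + (\<Sum>t\<in>A. exp (- \<bar>b - t\<bar>) * c t) = 0"
      using insert.prems(1)[of b] insert.hyps b by simp
    moreover have "exp (p - b) * c b + (\<Sum>t\<in>A. exp (- \<bar>p - t\<bar>) * c t) = 0"
      using insert.prems(1)[of p] insert.hyps b p(1) pb by simp
    ultimately have "c b = (exp (p - b) * exp (p - b)) * c b" by (simp add: algebra_simps add_eq_0_iff2)
    moreover have "exp (p - b) * exp (p - b) \<noteq> 1" using pb by (simp add: exp_add[symmetric])
    ultimately show ?thesis by simp
  qed
  then show ?case using insert b by auto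
qed simp

lemma invertible_mat_of_det:
  fixes A :: "'a :: field mat"
  assumes A: "A \<in> carrier_mat n n" and "det A \<noteq> 0"
  shows "invertible_mat A"
proof -
  have "A \<in> Units (ring_mat TYPE('a) n ())" by (rule det_non_zero_imp_unit[OF assms])
  then obtain B where "B \<in> carrier_mat n n" "B * A = 1\<^sub>m n" "A * B = 1\<^sub>m n"
    unfolding Units_def ring_mat_def by auto
  then show ?thesis using A unfolding invertible_mat_def inverts_mat_def by auto
qed

section \<open>The grid sequences are regular 1TSPs\<close>

context ou_process
begin

lemma invertible_covariance:
  assumes \<delta>: "0 < \<delta>" and d: "distinct ns"
  shows "invertible_mat (covariance_matrix M (\<lambda>n \<omega>. \<omega> (of_int n * \<delta>)) ns)" (is "invertible_mat ?A")
proof -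
  define n where "n = length ns"
  define \<tau> where "\<tau> k = of_int (ns ! k) * \<delta>" for k
  have A: "?A = mat n n (\<lambda>(j, k). exp (- \<bar>\<tau> j - \<tau> k\<bar>))"
    unfolding covariance_matrix_def covariance_coordinates by (simp add: n_def \<tau>_def)
  then have cA: "?A \<in> carrier_mat n n" by simp
  have inj: "inj_on \<tau> {..<n}"
    using \<delta> d by (auto simp: inj_on_def \<tau>_def n_def nth_eq_iff_index_eq)
  have "det ?A \<noteq> 0"
  proof
    assume "det ?A = 0"
    then obtain v where v: "v \<in> carrier_vec n" "v \<noteq> 0\<^sub>v n" "?A *\<^sub>v v = 0\<^sub>v n"
      using det_0_iff_vec_prod_zero[OF cA] by auto
    \<comment> \<open>A null vector of the matrix, reindexed by the times themselves, which are
      distinct because the indices are; this is the form required by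
      \<open>exponential_kernel_nonsingular\<close>.\<close>
    define c where "c t = v $ the_inv_into {..<n} \<tau> t" for t
    have c: "c (\<tau> k) = v $ k" if "k < n" for k using that inj by (simp add: c_def the_inv_into_f_f)
    have z: "(\<Sum>t\<in>\<tau> ` {..<n}. exp (- \<bar>l - t\<bar>) * c t) = 0" if "l \<in> \<tau> ` {..<n}" for l
    proof -
      from that obtain j where j: "j < n" "l = \<tau> j" by auto
      have "(\<Sum>t\<in>\<tau> ` {..<n}. exp (- \<bar>l - t\<bar>) * c t) = (\<Sum>k<n. exp (- \<bar>\<tau> j - \<tau> k\<bar>) * v $ k)"
        by (simp add: sum.reindex[OF inj] c j)
      also have "\<dots> = (?A *\<^sub>v v) $ j"
        unfolding A using j v(1) by (simp add: scalar_prod_def lessThan_atLeast0)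
      finally show ?thesis using v(3) j by simp
    qed
    have "v $ k = 0" if "k < n" for k
      using exponential_kernel_nonsingular[OF _ z, of "\<tau> k"] that by (simp add: c)
    then have "v = 0\<^sub>v n" using v(1) by (intro eq_vecI) auto
    with v(2) show False ..
  qed
  with cA show ?thesis by (rule invertible_mat_of_det)
qed

text \<open>Given all coordinates in \<open>H\<close>, the one at \<open>s\<close> depends only on
  its two neighbours \<open>p\<close> and \<open>z\<close>. The weight \<open>f\<close> is an
  arbitrary function of the coordinates in \<open>H\<close>, so this is a conditional expectation in
  integrated form.\<close>

lemma nn_integral_bridge:
  assumes H: "finite H" "p \<in> H" "z \<in> H" "s \<notin> H" "p < s" "s < z" "\<And>h. h \<in> H \<Longrightarrow> h \<le> p \<or> z \<le> h"
    and f: "f \<in> borel_measurable (PiM H (\<lambda>_. borel))"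
  shows "(\<integral>\<^sup>+\<omega>. f (restrict \<omega> H) * ennreal ((\<omega> s + u)\<^sup>2) \<partial>M)
    = (\<integral>\<^sup>+\<omega>. f (restrict \<omega> H) * ennreal ((bridge_mean (exp (p - s)) (exp (s - z)) (\<omega> p) (\<omega> z) + u)\<^sup>2 + bridge_var (exp (p - s)) (exp (s - z))) \<partial>M)"
    (is "_ = (\<integral>\<^sup>+\<omega>. _ * ennreal (?V \<omega>) \<partial>M)")
proof -
  note [measurable] = f
  define us vs where "us = sorted_list_of_set {h \<in> H. h < p}" and "vs = sorted_list_of_set {h \<in> H. z < h}"
  have srt: "sorted_wrt (<) (us @ p # s # z # vs)" using H by (auto simp: us_def vs_def sorted_wrt_append)
  then have "sorted_wrt (<) (us @ p # z # vs)" by (auto simp: sorted_wrt_append)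
  moreover have "set (us @ p # s # z # vs) = insert s H" "set (us @ p # z # vs) = H"
    using H(1-6) H(7) by (auto simp: us_def vs_def order.order_iff_strict)
  ultimately have l: "sorted_list_of_set (insert s H) = us @ p # s # z # vs" "sorted_list_of_set H = us @ p # z # vs"
    using sorted_list_of_setI srt by blast+
  have "0 < bridge_var (exp (p - s)) (exp (s - z))" using H by (intro bridge_var_pos) auto
  then have bv: "0 < sqrt (bridge_var (exp (p - s)) (exp (s - z)))" "(sqrt (bridge_var (exp (p - s)) (exp (s - z))))\<^sup>2 = bridge_var (exp (p - s)) (exp (s - z))" by auto
  have [measurable]: "(\<lambda>x. x s) \<in> borel_measurable (PiM (insert s H) (\<lambda>_. borel :: real measure))"
    "(\<lambda>x. restrict x H) \<in> measurable (PiM (insert s H) (\<lambda>_. borel)) (PiM H (\<lambda>_. borel :: real measure))"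
    "(\<lambda>x. x p) \<in> borel_measurable (PiM H (\<lambda>_. borel :: real measure))"
    "(\<lambda>x. x z) \<in> borel_measurable (PiM H (\<lambda>_. borel :: real measure))"
    using H by (auto intro!: measurable_component_singleton measurable_restrict_subset)
  have "(\<integral>\<^sup>+\<omega>. f (restrict \<omega> H) * ennreal ((\<omega> s + u)\<^sup>2) \<partial>M)
      = (\<integral>\<^sup>+\<omega>. f (restrict (restrict \<omega> (insert s H)) H) * ennreal ((restrict \<omega> (insert s H) s + u)\<^sup>2) \<partial>M)"
    by (simp add: Int_absorb1 subset_insertI)
  also have "\<dots> = (\<integral>\<^sup>+x. f (restrict x H) * ennreal ((x s + u)\<^sup>2) \<partial>ou_law (insert s H))"
  proof (rule nn_integral_coordinates)
    show "finite (insert s H)" using H(1) by simp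
  qed measurable
  also have "\<dots> = (\<integral>\<^sup>+x. f x * (\<integral>\<^sup>+y. ennreal ((y + u)\<^sup>2) * ennreal (path_density (x(s := y)) (us @ p # s # z # vs)) \<partial>gauss) \<partial>PiM H (\<lambda>_. gauss))"
    using nn_integral_ou_law_insert[OF H(1,4) f, of "\<lambda>y. ennreal ((y + u)\<^sup>2)"] by (simp add: l)
  also have "\<dots> = (\<integral>\<^sup>+x. f x * ennreal (?V x) * ennreal (path_density x (sorted_list_of_set H)) \<partial>PiM H (\<lambda>_. gauss))"
    by (subst nn_integral_path_density_bridge[OF srt], measurable, subst nn_integral_normal_square[OF bv(1)]) (simp add: bv(2) l mult_ac)
  also have "\<dots> = (\<integral>\<^sup>+x. f x * ennreal (?V x) \<partial>ou_law H)"
    by (rule nn_integral_ou_law[symmetric, OF H(1)]) (unfold bridge_mean_def, measurable)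
  also have "\<dots> = (\<integral>\<^sup>+\<omega>. f (restrict \<omega> H) * ennreal (?V (restrict \<omega> H)) \<partial>M)"
    by (rule nn_integral_coordinates[symmetric, OF H(1)]) (unfold bridge_mean_def, measurable)
  finally show ?thesis using H(2,3) by simp
qed

lemma bridge_grid:
  assumes \<delta>: "0 < \<delta>" and J: "finite J" "J \<subseteq> - {n}"
  defines "r \<equiv> exp (- \<delta>)"
  shows "expectation (\<lambda>\<omega>. indicator {\<omega> \<in> space M. \<forall>i\<in>J. \<omega> (of_int i * \<delta>) \<le> c i} \<omega> * (\<omega> (of_int n * \<delta>) + u)\<^sup>2)
    = expectation (\<lambda>\<omega>. indicator {\<omega> \<in> space M. \<forall>i\<in>J. \<omega> (of_int i * \<delta>) \<le> c i} \<omega> *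
        ((r / (1 + r\<^sup>2) * (\<omega> (of_int (n - 1) * \<delta>) + \<omega> (of_int (n + 1) * \<delta>)) + u)\<^sup>2 + (1 - r\<^sup>2) / (1 + r\<^sup>2)))"
proof -
  define \<tau> where "\<tau> i = of_int i * \<delta>" for i :: int
  have \<tau>_less: "\<tau> i < \<tau> j \<longleftrightarrow> i < j" and \<tau>_le: "\<tau> i \<le> \<tau> j \<longleftrightarrow> i \<le> j" and \<tau>_eq: "\<tau> i = \<tau> j \<longleftrightarrow> i = j" for i j
    using \<delta> by (auto simp: \<tau>_def)
  \<comment> \<open>The neighbours \<open>n - 1\<close> and \<open>n + 1\<close> are adjoined even
    if the event does not involve them: they must be the end points of the bridge around
    \<open>n\<close>.\<close>
  define H where "H = \<tau> ` (J \<union> {n - 1, n + 1})"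
  define B where "B = {x \<in> space (PiM H (\<lambda>_. borel :: real measure)). \<forall>i\<in>J. x (\<tau> i) \<le> c i}"
  have H: "finite H" "\<tau> (n - 1) \<in> H" "\<tau> (n + 1) \<in> H" "\<tau> n \<notin> H" "\<tau> (n - 1) < \<tau> n" "\<tau> n < \<tau> (n + 1)"
    using J by (auto simp: H_def \<tau>_less \<tau>_eq)
  have gap: "h \<le> \<tau> (n - 1) \<or> \<tau> (n + 1) \<le> h" if "h \<in> H" for h
  proof -
    from that obtain i where i: "i \<in> J \<union> {n - 1, n + 1}" "h = \<tau> i" unfolding H_def by blast
    then have "i \<noteq> n" using J(2) by auto
    then show ?thesis using i(2) by (auto simp: \<tau>_le)
  qed
  have Bm [measurable]: "B \<in> sets (PiM H (\<lambda>_. borel))"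
  proof -
    have "(\<lambda>x. x (\<tau> i)) \<in> borel_measurable (PiM H (\<lambda>_. borel :: real measure))" if "i \<in> J" for i
      using that by (intro measurable_component_singleton) (auto simp: H_def)
    then show ?thesis unfolding B_def
      by (intro sets.sets_Collect_finite_All borel_measurable_le borel_measurable_const J(1)) auto
  qed
  have ind: "indicator {\<omega> \<in> space M. \<forall>i\<in>J. \<omega> (\<tau> i) \<le> c i} \<omega> = (indicator B (restrict \<omega> H) :: 'b :: zero_neq_one)" for \<omega>
  proof -
    have "\<tau> i \<in> H" if "i \<in> J" for i using that by (auto simp: H_def)
    then show ?thesis by (auto simp: B_def space_PiM indicator_def)
  qed
  have dr: "exp (\<tau> (n - 1) - \<tau> n) = r" "exp (\<tau> n - \<tau> (n + 1)) = r" by (simp_all add: r_def \<tau>_def algebra_simps)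
  have r: "0 < r" "r < 1" using \<delta> by (auto simp: r_def)
  then have r2: "0 < 1 - r\<^sup>2" "0 < 1 + r\<^sup>2" by (auto simp: abs_square_less_1 add_pos_nonneg)
  have fac: "1 - r\<^sup>2 * r\<^sup>2 = (1 - r\<^sup>2) * (1 + r\<^sup>2)" by (simp add: algebra_simps)
  have bm: "bridge_mean r r x z = r / (1 + r\<^sup>2) * (x + z)" for x z
  proof -
    have "bridge_mean r r x z = ((1 - r\<^sup>2) * (r * (x + z))) / ((1 - r\<^sup>2) * (1 + r\<^sup>2))"
      unfolding bridge_mean_def fac by (simp add: algebra_simps)
    then show ?thesis using r2 by simp
  qed
  have bv: "bridge_var r r = (1 - r\<^sup>2) / (1 + r\<^sup>2)"
    unfolding bridge_var_def fac using r2 by simp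
  have nn: "(\<integral>\<^sup>+\<omega>. indicator B (restrict \<omega> H) * ennreal ((\<omega> (\<tau> n) + u)\<^sup>2) \<partial>M)
    = (\<integral>\<^sup>+\<omega>. indicator B (restrict \<omega> H) * ennreal ((r / (1 + r\<^sup>2) * (\<omega> (\<tau> (n - 1)) + \<omega> (\<tau> (n + 1))) + u)\<^sup>2 + (1 - r\<^sup>2) / (1 + r\<^sup>2)) \<partial>M)"
    using nn_integral_bridge[OF H gap, of "indicator B" u] unfolding dr bm bv by simp
  \<comment> \<open>For nonnegative integrands the real integral is the real part of the extended
    one, whether finite or not, since the default value 0 corresponds to \<open>enn2real\<close> of
    infinity.\<close>
  have toE: "expectation (\<lambda>\<omega>. indicator B (restrict \<omega> H) * g \<omega>) = enn2real (\<integral>\<^sup>+\<omega>. indicator B (restrict \<omega> H) * ennreal (g \<omega>) \<partial>M)"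
    if [measurable]: "g \<in> borel_measurable M" and "\<And>\<omega>. 0 \<le> g \<omega>" for g
    using that(2) by (subst integral_eq_nn_integral) (auto intro!: arg_cong[where f = enn2real] nn_integral_cong simp: indicator_def)
  have 1: "expectation (\<lambda>\<omega>. indicator B (restrict \<omega> H) * (\<omega> (\<tau> n) + u)\<^sup>2)
      = enn2real (\<integral>\<^sup>+\<omega>. indicator B (restrict \<omega> H) * ennreal ((\<omega> (\<tau> n) + u)\<^sup>2) \<partial>M)"
    by (rule toE) auto
  have 2: "expectation (\<lambda>\<omega>. indicator B (restrict \<omega> H) * ((r / (1 + r\<^sup>2) * (\<omega> (\<tau> (n - 1)) + \<omega> (\<tau> (n + 1))) + u)\<^sup>2 + (1 - r\<^sup>2) / (1 + r\<^sup>2)))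
      = enn2real (\<integral>\<^sup>+\<omega>. indicator B (restrict \<omega> H) * ennreal ((r / (1 + r\<^sup>2) * (\<omega> (\<tau> (n - 1)) + \<omega> (\<tau> (n + 1))) + u)\<^sup>2 + (1 - r\<^sup>2) / (1 + r\<^sup>2)) \<partial>M)"
    by (rule toE) (use r2 in auto)
  show ?thesis unfolding \<tau>_def[symmetric] ind 1 2 nn ..
qed

lemma regular_one_TSP_grid:
  assumes \<delta>: "0 < \<delta>"
  shows "regular_one_TSP M (\<lambda>n \<omega>. \<omega> (of_int n * \<delta>))"
proof -
  define X where "X = (\<lambda>(n :: int) (\<omega> :: real \<Rightarrow> real). \<omega> (of_int n * \<delta>))"
  define r where "r = exp (- \<delta>)"
  define a where "a = r / (1 + r\<^sup>2)"
  define v where "v = (1 - r\<^sup>2) / (1 + r\<^sup>2)"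
  have r: "0 < r" "r < 1" using \<delta> by (auto simp: r_def)
  have Xm [measurable]: "X n \<in> borel_measurable M" for n by (simp add: X_def)
  have iX: "integrable M (X n)" "integrable M (\<lambda>\<omega>. (X n \<omega>)\<^sup>2)" "integrable M (\<lambda>\<omega>. X n \<omega> * X m \<omega>)" for n m
    by (auto simp: X_def integrable_coordinate integrable_coordinate_square integrable_coordinate_mult)
  have corr: "correlation M (X 0) (X 1) = r"
    using \<delta> by (simp add: correlation_def X_def covariance_coordinates r_def)
  have sub: "subalgebra M (generated_algebra M (- {n}) X)" for n
    by (rule subalgebra_generated_algebra) measurable
  have adj [measurable]: "X (n - 1) \<in> borel_measurable (generated_algebra M (- {n}) X)"
    "X (n + 1) \<in> borel_measurable (generated_algebra M (- {n}) X)" for n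
    by (auto intro!: measurable_generated_algebra)
  have eW: "(a * (X (n - 1) \<omega> + X (n + 1) \<omega>) + u)\<^sup>2 + v
     = a\<^sup>2 * ((X (n - 1) \<omega>)\<^sup>2 + (X (n + 1) \<omega>)\<^sup>2 + 2 * (X (n - 1) \<omega> * X (n + 1) \<omega>)) + 2 * u * (a * (X (n - 1) \<omega> + X (n + 1) \<omega>)) + u\<^sup>2 + v" for n \<omega> u
    by (simp add: power2_eq_square algebra_simps)
  have iW: "integrable M (\<lambda>\<omega>. (a * (X (n - 1) \<omega> + X (n + 1) \<omega>) + u)\<^sup>2 + v)" for n u
    unfolding eW using iX by auto
  have eU: "(X n \<omega> + u)\<^sup>2 = (X n \<omega>)\<^sup>2 + 2 * u * X n \<omega> + u\<^sup>2" for n \<omega> u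
    by (simp add: power2_eq_square algebra_simps)
  have iU: "integrable M (\<lambda>\<omega>. (X n \<omega> + u)\<^sup>2)" for n u unfolding eU using iX by auto
  \<comment> \<open>The regressions of all shifted squares at once. \<open>u = 0\<close> is the
    quadratic regression; \<open>u = 1\<close> and \<open>u = - 1\<close> together yield the linear
    one.\<close>
  have ce: "AE \<omega> in M. real_cond_exp M (generated_algebra M (- {n}) X) (\<lambda>\<omega>. (X n \<omega> + u)\<^sup>2) \<omega> = (a * (X (n - 1) \<omega> + X (n + 1) \<omega>) + u)\<^sup>2 + v" for n u
  proof (rule cond_exp_eqI[OF sub iU iW])
    show "(\<lambda>\<omega>. (a * (X (n - 1) \<omega> + X (n + 1) \<omega>) + u)\<^sup>2 + v) \<in> borel_measurable (generated_algebra M (- {n}) X)" by measurable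
    fix F assume F: "F \<in> sets (generated_algebra M (- {n}) X)"
    show "expectation (\<lambda>\<omega>. indicator F \<omega> * (X n \<omega> + u)\<^sup>2) = expectation (\<lambda>\<omega>. indicator F \<omega> * ((a * (X (n - 1) \<omega> + X (n + 1) \<omega>) + u)\<^sup>2 + v))"
    proof (rule generated_algebra_integral_eqI[OF _ iU iW _ F])
      show "X i \<in> borel_measurable M" for i by measurable
      show "expectation (\<lambda>\<omega>. indicator {\<omega> \<in> space M. \<forall>i\<in>J. X i \<omega> \<le> c i} \<omega> * (X n \<omega> + u)\<^sup>2)
        = expectation (\<lambda>\<omega>. indicator {\<omega> \<in> space M. \<forall>i\<in>J. X i \<omega> \<le> c i} \<omega> * ((a * (X (n - 1) \<omega> + X (n + 1) \<omega>) + u)\<^sup>2 + v))"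
        if "finite J" "J \<subseteq> - {n}" for J c
        using bridge_grid[OF \<delta> that, of c u] unfolding X_def a_def v_def r_def .
    qed
  qed
  have ce2: "AE \<omega> in M. real_cond_exp M (generated_algebra M (- {n}) X) (\<lambda>\<omega>. (X n \<omega>)\<^sup>2) \<omega>
      = a\<^sup>2 * ((X (n - 1) \<omega>)\<^sup>2 + (X (n + 1) \<omega>)\<^sup>2) + 2 * a\<^sup>2 * X (n - 1) \<omega> * X (n + 1) \<omega> + 0 * (X (n - 1) \<omega> + X (n + 1) \<omega>) + v" for n
    using ce[of n 0] by eventually_elim (simp add: power2_eq_square algebra_simps)
  have ce1: "AE \<omega> in M. real_cond_exp M (generated_algebra M (- {n}) X) (X n) \<omega> = a * (X (n - 1) \<omega> + X (n + 1) \<omega>)" for n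
  proof -
    interpret G: sigma_finite_subalgebra M "generated_algebra M (- {n}) X" by (rule sigma_finite_subalgebraI[OF sub])
    have e: "(\<lambda>\<omega>. (X n \<omega> + 1)\<^sup>2 - (X n \<omega> + (- 1))\<^sup>2) = (\<lambda>\<omega>. 4 * X n \<omega>)"
      by (simp add: fun_eq_iff power2_eq_square algebra_simps)
    have "AE \<omega> in M. real_cond_exp M (generated_algebra M (- {n}) X) (\<lambda>\<omega>. 4 * X n \<omega>) \<omega>
        = real_cond_exp M (generated_algebra M (- {n}) X) (\<lambda>\<omega>. (X n \<omega> + 1)\<^sup>2) \<omega> - real_cond_exp M (generated_algebra M (- {n}) X) (\<lambda>\<omega>. (X n \<omega> + (- 1))\<^sup>2) \<omega>"
      unfolding e[symmetric] by (rule G.real_cond_exp_diff[OF iU iU])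
    moreover have "AE \<omega> in M. real_cond_exp M (generated_algebra M (- {n}) X) (\<lambda>\<omega>. 4 * X n \<omega>) \<omega> = 4 * real_cond_exp M (generated_algebra M (- {n}) X) (X n) \<omega>"
      by (rule G.real_cond_exp_cmult[OF iX(1)])
    ultimately show ?thesis
      using ce[of n 1] ce[of n "- 1"]
    proof eventually_elim
      case (elim \<omega>)
      then have "4 * real_cond_exp M (generated_algebra M (- {n}) X) (X n) \<omega> = 4 * (a * (X (n - 1) \<omega> + X (n + 1) \<omega>))"
        by (simp add: power2_eq_square algebra_simps)
      then show ?case by simp
    qed
  qed
  have inv: "invertible_mat (covariance_matrix M X ns)" if "distinct ns" for ns
    using invertible_covariance[OF \<delta> that] by (simp add: X_def)
  have "expectation (X n) = 0" "expectation (\<lambda>\<omega>. (X n \<omega>)\<^sup>2) = 1" for n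
    by (simp_all add: X_def expectation_coordinate expectation_coordinate_square)
  then have tsp: "one_TSP_with M X a (a\<^sup>2) (2 * a\<^sup>2) v 0"
    unfolding one_TSP_with_def
    by (intro conjI allI impI prob_space_axioms ce1 ce2 inv) (use iX r in \<open>auto simp: corr square_integrable_def\<close>)
  \<comment> \<open>With the bridge coefficients \<open>B * (r + 1 / r)\<^sup>2\<close> equals 2, so
    the numerator and the denominator of the second parameter are both \<open>1 + r ^ 4\<close> and
    the parameter is 1.\<close>
  have B: "2 * a\<^sup>2 * (r + 1 / r)\<^sup>2 = 2"
  proof -
    have "r + 1 / r = (1 + r\<^sup>2) / r" using r by (simp add: field_simps power2_eq_square)
    moreover have "1 + r\<^sup>2 \<noteq> 0" using zero_le_power2[of r] by linarith
    ultimately have "a * (r + 1 / r) = 1" using r by (simp add: a_def)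
    then have "(a * (r + 1 / r))\<^sup>2 = 1" by simp
    then show ?thesis by (simp add: power_mult_distrib)
  qed
  have "second_parameter_denom r (2 * a\<^sup>2) = 1 + r ^ 4" by (simp add: second_parameter_denom_def B)
  moreover have "1 + r ^ 4 \<noteq> 0" using r by (smt (verit) zero_less_power)
  ultimately have par: "second_parameter_denom r (2 * a\<^sup>2) \<noteq> 0" "second_parameter r (2 * a\<^sup>2) = 1"
    by (simp_all add: second_parameter_def B add.commute)
  have "regular_one_TSP M X" unfolding regular_one_TSP_def
  proof (intro exI conjI)
    show "one_TSP_with M X a (a\<^sup>2) (2 * a\<^sup>2) v 0" by (rule tsp)
    show "let \<rho> = correlation M (X 0) (X 1) in 0 < \<bar>\<rho>\<bar> \<and> \<bar>\<rho>\<bar> < 1 \<and>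
        second_parameter_denom \<rho> (2 * a\<^sup>2) \<noteq> 0 \<and> second_parameter \<rho> (2 * a\<^sup>2) \<in> {-1<..1}"
      using par r by (simp add: corr Let_def)
  qed
  then show ?thesis by (simp add: X_def)
qed

lemma continuous_time_regular_TSP_coordinates: "continuous_time_regular_TSP M (\<lambda>t \<omega>. \<omega> t)"
  using prob_space_axioms L2_continuous_coordinates stationary_coordinates regular_one_TSP_grid
  by (simp add: continuous_time_regular_TSP_def stochastic_process_def)

end

theorem theorem1:
  shows "(\<exists>(M :: (real \<Rightarrow> real) measure) Y. continuous_time_regular_TSP M Y) \<and>
    (\<forall>(M :: 'a measure) Y. continuous_time_regular_TSP M Y \<longrightarrow>
       (\<exists>q \<alpha>. -1 < q \<and> q \<le> 1 \<and> 0 < \<alpha> \<and>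
          markov_process M Y \<and>
          (\<forall>t. distributed M lborel (Y t) (\<lambda>x. ennreal (f_N x q))) \<and>
          (\<forall>t s. t < s \<longrightarrow>
             has_conditional_density M (Y s) (Y t)
               (\<lambda>x y. f_CN x y (exp (- \<alpha> * \<bar>s - t\<bar>)) q))))"
proof (intro conjI allI impI)
  obtain M where "ou_process M" using ou_process_exists by blast
  then show "\<exists>(M :: (real \<Rightarrow> real) measure) Y. continuous_time_regular_TSP M Y"
    using ou_process.continuous_time_regular_TSP_coordinates by blast
next
  fix M :: "'a measure" and Y
  assume "continuous_time_regular_TSP M Y"
  then interpret ctsp M Y by (rule ctsp.intro)
  show "\<exists>q \<alpha>. -1 < q \<and> q \<le> 1 \<and> 0 < \<alpha> \<and>
          markov_process M Y \<and>
          (\<forall>t. distributed M lborel (Y t) (\<lambda>x. ennreal (f_N x q))) \<and>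
          (\<forall>t s. t < s \<longrightarrow>
             has_conditional_density M (Y s) (Y t)
               (\<lambda>x y. f_CN x y (exp (- \<alpha> * \<bar>s - t\<bar>)) q))"
    by (rule characterization)
qed

end
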